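(* Let $SG$ be the Sierpinski gasket, and for $n\in\mathbb{N}_0=\{0,1,2,\dots\}$ and $i\in\{1,\dots,3^n\}$ let $ST_{n,i}(SG)=(C(SG),H_{n,i},D_{n,i})$ be the unbounded Fredholm module over $C(SG)$ associated with the triangle $\Delta_{n,i}$, as defined in the context. The direct sum $$ST(SG)=(C(SG),H_{SG},D_{SG}):=\bigoplus_{n\in\mathbb{N}_0}\bigoplus_{i=1}^{3^n}ST_{n,i}(SG)$$ is a spectral triple for $C(SG)$. It is $s$-summable if and only if $s>\log 3/\log 2$. Hence its metric dimension is equal to $\log 3/\log 2$, which is also the Minkowski dimension (as well as the Hausdorff dimension) of the Sierpinski gasket.
   Context: An unbounded Fredholm module $(H,D)$ over a unital C*-algebra $A$ consists of a Hilbert space $H$ carrying a unital representation $\pi$ of $A$ and an unbounded self-adjoint operator $D$ on $H$ such that (i) the set of $a\in A$ for which $[D,\pi(a)]$ is densely defined and extends to a bounded operator on $H$ is dense in $A$, and (ii) $(I+D^2)^{-1}$ is compact. If $\pi$ is faithful, $(A,H,D)$ is called a spectral triple. It is $s$-summable (for $s>0$) if $\mathrm{tr}((I+D^2)^{-s/2})<\infty$; its metric dimension is $\inf\{s>0 : \mathrm{tr}((I+D^2)^{-s/2})<\infty\}$. The Sierpinski gasket: let $SG_0\subset\mathbb{R}^2$ be the boundary (three sides) of an equilateral triangle with side length $2\pi/3$, vertices $v_1,v_2,v_3$, and horizontal bottom edge. Let $F_j(x)=(x+v_j)/2$, $j=1,2,3$. Let $SG_n$ be the union of the $3^n$ triangles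 $F_{j_1}\circ\cdots\circ F_{j_n}(SG_0)$, each an equilateral triangle (boundary only) of side length $2^{1-n}\pi/3$ and perimeter $2^{1-n}\pi$; number these triangles $\Delta_{n,i}$, $1\le i\le 3^n$. Then $SG$ is the closure of $\bigcup_n SG_n$. For each $n,i$ let $r_{n,i}:[-2^{-n}\pi,2^{-n}\pi]\to\Delta_{n,i}$ be the parameterization by arclength (modulo $2^{1-n}\pi$), counterclockwise, with $r_{n,i}(0)$ the lower right-hand corner of $\Delta_{n,i}$. Let $H_{n,i}=L^2([-2^{-n}\pi,2^{-n}\pi])$ with respect to normalized Lebesgue measure, let $\pi_{n,i}(f)$, for $f\in C(SG)$, be multiplication by $f\circ r_{n,i}$, and let $D_{n,i}$ be the self-adjoint operator on $H_{n,i}$ with $D_{n,i}\phi_k=2^n(k+\tfrac12)\phi_k$ for $k\in\mathbb{Z}$, where $\phi_k(t)=\exp(i2^nkt)$ is an orthonormal basis of $H_{n,i}$ (so $D_{n,i}$ is $\frac1i\frac{d}{dt}$ with periodic boundary conditions, translated by $2^{n-1}I$). The direct sum means $H_{SG}=\bigoplus H_{n,i}$, $\pi_{SG}=\bigoplus\pi_{n,i}$, $D_{SG}=\bigoplus D_{n,i}$. *)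

theory Defs
  imports
    "HOL-Analysis.Analysis"
    "HOL-Algebra.Module"
    "HOL-Library.Real_Mod"
begin

section \<open>Complex Hilbert spaces\<close>

definition complex_field :: "complex ring"
  where "complex_field =
    \<lparr>carrier = UNIV, monoid.mult = (*), one = 1, ring.zero = 0, add = (+)\<rparr>"

text \<open>
  A complex vector space is a module (in the sense of HOL-Algebra) over the field of complex
  numbers. The fields for multiplication and unit that the module record inherits from rings
  are not used for Hilbert spaces. The inner product is linear in its first argument.
\<close>

record 'h hspace = "(complex, 'h) module" +
  ip :: "'h \<Rightarrow> 'h \<Rightarrow> complex"

definition hnorm :: "('h, 'm) hspace_scheme \<Rightarrow> 'h \<Rightarrow> real"
  where "hnorm H x = sqrt (Re (ip H x x))"

text \<open>The value outside the carrier is 0 because \<^locale>\<open>Metric_space\<close> requires a distance function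
  that is symmetric and nonnegative on the whole type.\<close>

definition hdist :: "('h, 'm) hspace_scheme \<Rightarrow> 'h \<Rightarrow> 'h \<Rightarrow> real"
  where "hdist H x y =
    (if x \<in> carrier H \<and> y \<in> carrier H then hnorm H (x \<ominus>\<^bsub>H\<^esub> y) else 0)"

definition htop :: "('h, 'm) hspace_scheme \<Rightarrow> 'h topology"
  where "htop H = Metric_space.mtopology (carrier H) (hdist H)"

locale hilbert_space = module complex_field H for H :: "('h, 'm) hspace_scheme" (structure) +
  assumes ip_add_left: "\<lbrakk>x \<in> carrier H; y \<in> carrier H; z \<in> carrier H\<rbrakk>
      \<Longrightarrow> ip H (x \<oplus> y) z = ip H x z + ip H y z"
    and ip_smult_left: "\<lbrakk>x \<in> carrier H; y \<in> carrier H\<rbrakk>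
      \<Longrightarrow> ip H (c \<odot> x) y = c * ip H x y"
    and ip_commute: "\<lbrakk>x \<in> carrier H; y \<in> carrier H\<rbrakk> \<Longrightarrow> ip H y x = cnj (ip H x y)"
    and ip_pos: "\<lbrakk>x \<in> carrier H; x \<noteq> \<zero>\<rbrakk> \<Longrightarrow> 0 < Re (ip H x x)"
    and complete: "Metric_space.mcomplete (carrier H) (hdist H)"

definition is_onb :: "('h, 'm) hspace_scheme \<Rightarrow> 'h set \<Rightarrow> bool"
  where "is_onb H B \<longleftrightarrow> B \<subseteq> carrier H \<and>
    (\<forall>x\<in>B. \<forall>y\<in>B. ip H x y = (if x = y then 1 else 0)) \<and>
    (\<forall>x\<in>carrier H. (\<forall>b\<in>B. ip H x b = 0) \<longrightarrow> x = \<zero>\<^bsub>H\<^esub>)"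

section \<open>Operators\<close>

subsection \<open>Bounded and compact operators\<close>

definition bounded_op :: "('h, 'm) hspace_scheme \<Rightarrow> ('h \<Rightarrow> 'h) \<Rightarrow> bool"
  where "bounded_op H T \<longleftrightarrow> T \<in> carrier H \<rightarrow> carrier H \<and>
    (\<forall>x\<in>carrier H. \<forall>y\<in>carrier H. T (x \<oplus>\<^bsub>H\<^esub> y) = T x \<oplus>\<^bsub>H\<^esub> T y) \<and>
    (\<forall>c. \<forall>x\<in>carrier H. T (c \<odot>\<^bsub>H\<^esub> x) = c \<odot>\<^bsub>H\<^esub> T x) \<and>
    (\<exists>C. \<forall>x\<in>carrier H. hnorm H (T x) \<le> C * hnorm H x)"

definition compact_op :: "('h, 'm) hspace_scheme \<Rightarrow> ('h \<Rightarrow> 'h) \<Rightarrow> bool"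
  where "compact_op H T \<longleftrightarrow> bounded_op H T \<and>
    compactin (htop H) (htop H closure_of (T ` {x \<in> carrier H. hnorm H x \<le> 1}))"

text \<open>
  The power \<open>K\<^sup>p\<close> of a compact positive operator \<open>K\<close>, for \<open>p > 0\<close>: the bounded operator that acts on
  each eigenspace of \<open>K\<close> as multiplication by the \<open>p\<close>-th power of the eigenvalue. It is unique since
  the eigenvectors of \<open>K\<close> span a dense subspace.
\<close>

definition op_powr :: "('h, 'm) hspace_scheme \<Rightarrow> ('h \<Rightarrow> 'h) \<Rightarrow> real \<Rightarrow> 'h \<Rightarrow> 'h"
  where "op_powr H K p = (THE T. bounded_op H T \<and> T \<in> extensional (carrier H) \<and>
    (\<forall>x\<in>carrier H. \<forall>r::real. r \<ge> 0 \<longrightarrow> K x = complex_of_real r \<odot>\<^bsub>H\<^esub> x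
        \<longrightarrow> T x = complex_of_real (r powr p) \<odot>\<^bsub>H\<^esub> x))"

text \<open>The trace of a positive operator, in \<open>[0,\<infinity>]\<close>; it does not depend on the orthonormal basis.\<close>

definition op_trace :: "('h, 'm) hspace_scheme \<Rightarrow> ('h \<Rightarrow> 'h) \<Rightarrow> ennreal"
  where "op_trace H T = (\<Sum>\<^sub>\<infinity>e\<in>(SOME B. is_onb H B). ennreal (Re (ip H (T e) e)))"

subsection \<open>Unbounded operators\<close>

text \<open>An unbounded operator is a partial map whose domain is its domain of definition.\<close>

definition linear_op :: "('h, 'm) hspace_scheme \<Rightarrow> ('h \<rightharpoonup> 'h) \<Rightarrow> bool"
  where "linear_op H T \<longleftrightarrow> dom T \<subseteq> carrier H \<and> ran T \<subseteq> carrier H \<and> \<zero>\<^bsub>H\<^esub> \<in> dom T \<and>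
    (\<forall>x\<in>dom T. \<forall>y\<in>dom T. T (x \<oplus>\<^bsub>H\<^esub> y) = Some (the (T x) \<oplus>\<^bsub>H\<^esub> the (T y))) \<and>
    (\<forall>c. \<forall>x\<in>dom T. T (c \<odot>\<^bsub>H\<^esub> x) = Some (c \<odot>\<^bsub>H\<^esub> the (T x)))"

definition densely_defined :: "('h, 'm) hspace_scheme \<Rightarrow> ('h \<rightharpoonup> 'h) \<Rightarrow> bool"
  where "densely_defined H T \<longleftrightarrow> htop H closure_of (dom T) = carrier H"

definition adjoint_op :: "('h, 'm) hspace_scheme \<Rightarrow> ('h \<rightharpoonup> 'h) \<Rightarrow> ('h \<rightharpoonup> 'h)"
  where "adjoint_op H T y =
    (if y \<in> carrier H \<and> (\<exists>z\<in>carrier H. \<forall>x\<in>dom T. ip H (the (T x)) y = ip H x z)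
     then Some (THE z. z \<in> carrier H \<and> (\<forall>x\<in>dom T. ip H (the (T x)) y = ip H x z))
     else None)"

definition self_adjoint :: "('h, 'm) hspace_scheme \<Rightarrow> ('h \<rightharpoonup> 'h) \<Rightarrow> bool"
  where "self_adjoint H T \<longleftrightarrow> linear_op H T \<and> densely_defined H T \<and> adjoint_op H T = T"

text \<open>The commutator \<open>[D,T]\<close> of an unbounded operator with a bounded one, on its natural domain.\<close>

definition commutator_op ::
    "('h, 'm) hspace_scheme \<Rightarrow> ('h \<rightharpoonup> 'h) \<Rightarrow> ('h \<Rightarrow> 'h) \<Rightarrow> ('h \<rightharpoonup> 'h)"
  where "commutator_op H D T x =
    (if x \<in> dom D \<and> T x \<in> dom D then Some (the (D (T x)) \<ominus>\<^bsub>H\<^esub> T (the (D x))) else None)"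

definition extends_to_bounded :: "('h, 'm) hspace_scheme \<Rightarrow> ('h \<rightharpoonup> 'h) \<Rightarrow> bool"
  where "extends_to_bounded H T \<longleftrightarrow> (\<exists>B. bounded_op H B \<and> (\<forall>x\<in>dom T. T x = Some (B x)))"

definition id_plus_square :: "('h, 'm) hspace_scheme \<Rightarrow> ('h \<rightharpoonup> 'h) \<Rightarrow> ('h \<rightharpoonup> 'h)"
  where "id_plus_square H D = (\<lambda>x. map_option (\<lambda>z. x \<oplus>\<^bsub>H\<^esub> z) ((D \<circ>\<^sub>m D) x))"

text \<open>The operator \<open>(I + D\<^sup>2)\<^sup>-\<^sup>1\<close>. For self-adjoint \<open>D\<close>, the operator \<open>I + D\<^sup>2\<close> is a bijection from its
  domain onto the whole space, so that this is a map defined everywhere.\<close>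

definition resolvent_op :: "('h, 'm) hspace_scheme \<Rightarrow> ('h \<rightharpoonup> 'h) \<Rightarrow> 'h \<Rightarrow> 'h"
  where "resolvent_op H D =
    inv_into (dom (id_plus_square H D)) (the \<circ> id_plus_square H D)"

text \<open>
  For an orthonormal basis \<open>(e k)\<close> and real numbers \<open>\<mu> k\<close>, the self-adjoint operator that maps \<open>e k\<close> to
  \<open>\<mu> k e k\<close>. It is defined on all \<open>x\<close> for which the series \<open>\<Sum>k. \<mu> k \<langle>x, e k\<rangle> e k\<close> converges, that is,
  whose coefficients are square summable, and its value is the sum of that series.
\<close>

definition diagonal_op ::
    "('h, 'm) hspace_scheme \<Rightarrow> ('k \<Rightarrow> 'h) \<Rightarrow> ('k \<Rightarrow> real) \<Rightarrow> ('h \<rightharpoonup> 'h)"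
  where "diagonal_op H e \<mu> x =
    (if x \<in> carrier H \<and> (\<lambda>k. (cmod (\<mu> k * ip H x (e k)))\<^sup>2) summable_on UNIV
     then Some (THE y. y \<in> carrier H \<and> (\<forall>k. ip H y (e k) = \<mu> k * ip H x (e k)))
     else None)"

section \<open>Unital C*-algebras\<close>

record 'a cstar = "(complex, 'a) module" +
  star :: "'a \<Rightarrow> 'a"
  anorm :: "'a \<Rightarrow> real"

definition adist :: "('a, 'm) cstar_scheme \<Rightarrow> 'a \<Rightarrow> 'a \<Rightarrow> real"
  where "adist A x y =
    (if x \<in> carrier A \<and> y \<in> carrier A then anorm A (x \<ominus>\<^bsub>A\<^esub> y) else 0)"

definition atop :: "('a, 'm) cstar_scheme \<Rightarrow> 'a topology"
  where "atop A = Metric_space.mtopology (carrier A) (adist A)"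

locale unital_cstar_algebra =
  module complex_field A + ring A for A :: "('a, 'm) cstar_scheme" (structure) +
  assumes smult_mult_left: "\<lbrakk>x \<in> carrier A; y \<in> carrier A\<rbrakk> \<Longrightarrow> (c \<odot> x) \<otimes> y = c \<odot> (x \<otimes> y)"
    and smult_mult_right: "\<lbrakk>x \<in> carrier A; y \<in> carrier A\<rbrakk> \<Longrightarrow> x \<otimes> (c \<odot> y) = c \<odot> (x \<otimes> y)"
    and star_closed: "x \<in> carrier A \<Longrightarrow> star A x \<in> carrier A"
    and star_add: "\<lbrakk>x \<in> carrier A; y \<in> carrier A\<rbrakk> \<Longrightarrow> star A (x \<oplus> y) = star A x \<oplus> star A y"
    and star_smult: "x \<in> carrier A \<Longrightarrow> star A (c \<odot> x) = cnj c \<odot> star A x"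
    and star_mult: "\<lbrakk>x \<in> carrier A; y \<in> carrier A\<rbrakk> \<Longrightarrow> star A (x \<otimes> y) = star A y \<otimes> star A x"
    and star_star: "x \<in> carrier A \<Longrightarrow> star A (star A x) = x"
    and anorm_nonneg: "x \<in> carrier A \<Longrightarrow> 0 \<le> anorm A x"
    and anorm_eq_0: "x \<in> carrier A \<Longrightarrow> anorm A x = 0 \<longleftrightarrow> x = \<zero>"
    and anorm_triangle: "\<lbrakk>x \<in> carrier A; y \<in> carrier A\<rbrakk>
      \<Longrightarrow> anorm A (x \<oplus> y) \<le> anorm A x + anorm A y"
    and anorm_smult: "x \<in> carrier A \<Longrightarrow> anorm A (c \<odot> x) = cmod c * anorm A x"
    and anorm_mult: "\<lbrakk>x \<in> carrier A; y \<in> carrier A\<rbrakk>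
      \<Longrightarrow> anorm A (x \<otimes> y) \<le> anorm A x * anorm A y"
    and cstar_identity: "x \<in> carrier A \<Longrightarrow> anorm A (star A x \<otimes> x) = (anorm A x)\<^sup>2"
    and complete: "Metric_space.mcomplete (carrier A) (adist A)"

text \<open>The algebra \<open>C(X)\<close>. Its elements are functions on \<open>X\<close> only, hence extensional.\<close>

definition C_alg :: "'p::topological_space set \<Rightarrow> ('p \<Rightarrow> complex) cstar"
  where "C_alg X = \<lparr>
    carrier = {f. continuous_on X f \<and> f \<in> extensional X},
    monoid.mult = (\<lambda>f g. \<lambda>x\<in>X. f x * g x),
    one = (\<lambda>x\<in>X. 1),
    ring.zero = (\<lambda>x\<in>X. 0),
    add = (\<lambda>f g. \<lambda>x\<in>X. f x + g x),
    smult = (\<lambda>c f. \<lambda>x\<in>X. c * f x),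
    star = (\<lambda>f. \<lambda>x\<in>X. cnj (f x)),
    anorm = (\<lambda>f. SUP x\<in>X. cmod (f x)) \<rparr>"

section \<open>Unbounded Fredholm modules\<close>

definition unital_representation ::
    "('a, 'm) cstar_scheme \<Rightarrow> ('h, 'n) hspace_scheme \<Rightarrow> ('a \<Rightarrow> 'h \<Rightarrow> 'h) \<Rightarrow> bool"
  where "unital_representation A H \<pi> \<longleftrightarrow>
    (\<forall>a\<in>carrier A. bounded_op H (\<pi> a)) \<and>
    (\<forall>a\<in>carrier A. \<forall>b\<in>carrier A. \<forall>x\<in>carrier H.
       \<pi> (a \<oplus>\<^bsub>A\<^esub> b) x = \<pi> a x \<oplus>\<^bsub>H\<^esub> \<pi> b x \<and> \<pi> (a \<otimes>\<^bsub>A\<^esub> b) x = \<pi> a (\<pi> b x)) \<and>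
    (\<forall>c. \<forall>a\<in>carrier A. \<forall>x\<in>carrier H. \<pi> (c \<odot>\<^bsub>A\<^esub> a) x = c \<odot>\<^bsub>H\<^esub> \<pi> a x) \<and>
    (\<forall>a\<in>carrier A. \<forall>x\<in>carrier H. \<forall>y\<in>carrier H. ip H (\<pi> a x) y = ip H x (\<pi> (star A a) y)) \<and>
    (\<forall>x\<in>carrier H. \<pi> \<one>\<^bsub>A\<^esub> x = x)"

record ('a, 'h) fredholm =
  fspace :: "'h hspace"
  frep :: "'a \<Rightarrow> 'h \<Rightarrow> 'h"
  fdirac :: "'h \<rightharpoonup> 'h"

definition unbounded_fredholm_module ::
    "('a, 'm) cstar_scheme \<Rightarrow> ('a, 'h) fredholm \<Rightarrow> bool"
  where "unbounded_fredholm_module A M \<longleftrightarrow>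
    (let H = fspace M; \<pi> = frep M; D = fdirac M in
      unital_cstar_algebra A \<and> hilbert_space H \<and> unital_representation A H \<pi> \<and>
      self_adjoint H D \<and>
      atop A closure_of {a \<in> carrier A. densely_defined H (commutator_op H D (\<pi> a)) \<and>
                           extends_to_bounded H (commutator_op H D (\<pi> a))} = carrier A \<and>
      compact_op H (resolvent_op H D))"

definition spectral_triple :: "('a, 'm) cstar_scheme \<Rightarrow> ('a, 'h) fredholm \<Rightarrow> bool"
  where "spectral_triple A M \<longleftrightarrow> unbounded_fredholm_module A M \<and>
    (\<forall>a\<in>carrier A. (\<forall>x\<in>carrier (fspace M). frep M a x = \<zero>\<^bsub>fspace M\<^esub>) \<longrightarrow> a = \<zero>\<^bsub>A\<^esub>)"

text \<open>The operator \<open>(I + D\<^sup>2)\<^bsup>-s/2\<^esup>\<close> is the power \<open>s/2\<close> of the compact positive operator \<open>(I + D\<^sup>2)\<^sup>-\<^sup>1\<close>.\<close>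

definition summable_module :: "('a, 'h) fredholm \<Rightarrow> real \<Rightarrow> bool"
  where "summable_module M s \<longleftrightarrow>
    op_trace (fspace M) (op_powr (fspace M) (resolvent_op (fspace M) (fdirac M)) (s / 2)) < \<infinity>"

definition metric_dimension :: "('a, 'h) fredholm \<Rightarrow> ereal"
  where "metric_dimension M = (INF s\<in>{s. s > 0 \<and> summable_module M s}. ereal s)"

section \<open>Direct sums\<close>

definition direct_sum_space :: "'i set \<Rightarrow> ('i \<Rightarrow> 'h hspace) \<Rightarrow> ('i \<Rightarrow> 'h) hspace"
  where "direct_sum_space I H = \<lparr>
    carrier = {x \<in> (\<Pi>\<^sub>E i\<in>I. carrier (H i)). (\<lambda>i. (hnorm (H i) (x i))\<^sup>2) summable_on I},
    monoid.mult = undefined,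
    one = undefined,
    ring.zero = (\<lambda>i\<in>I. \<zero>\<^bsub>H i\<^esub>),
    add = (\<lambda>x y. \<lambda>i\<in>I. x i \<oplus>\<^bsub>H i\<^esub> y i),
    smult = (\<lambda>c x. \<lambda>i\<in>I. c \<odot>\<^bsub>H i\<^esub> x i),
    ip = (\<lambda>x y. \<Sum>\<^sub>\<infinity>i\<in>I. ip (H i) (x i) (y i)) \<rparr>"

definition direct_sum_op ::
    "'i set \<Rightarrow> ('i \<Rightarrow> 'h hspace) \<Rightarrow> ('i \<Rightarrow> ('h \<rightharpoonup> 'h)) \<Rightarrow> (('i \<Rightarrow> 'h) \<rightharpoonup> ('i \<Rightarrow> 'h))"
  where "direct_sum_op I H D x =
    (if x \<in> carrier (direct_sum_space I H) \<and> (\<forall>i\<in>I. x i \<in> dom (D i)) \<and>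
        (\<lambda>i\<in>I. the (D i (x i))) \<in> carrier (direct_sum_space I H)
     then Some (\<lambda>i\<in>I. the (D i (x i))) else None)"

definition direct_sum :: "'i set \<Rightarrow> ('i \<Rightarrow> ('a, 'h) fredholm) \<Rightarrow> ('a, 'i \<Rightarrow> 'h) fredholm"
  where "direct_sum I M = \<lparr>
    fspace = direct_sum_space I (\<lambda>i. fspace (M i)),
    frep = (\<lambda>a x. \<lambda>i\<in>I. frep (M i) a (x i)),
    fdirac = direct_sum_op I (\<lambda>i. fspace (M i)) (\<lambda>i. fdirac (M i)) \<rparr>"

section \<open>The Hilbert space of square integrable functions\<close>

definition sq_integrable :: "'t measure \<Rightarrow> ('t \<Rightarrow> complex) set"
  where "sq_integrable M =
    {f \<in> borel_measurable M. integrable M (\<lambda>t. (cmod (f t))\<^sup>2)}"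

definition L2_class :: "'t measure \<Rightarrow> ('t \<Rightarrow> complex) \<Rightarrow> ('t \<Rightarrow> complex) set"
  where "L2_class M f = {g \<in> sq_integrable M. AE t in M. g t = f t}"

definition L2_fun :: "('t \<Rightarrow> complex) set \<Rightarrow> 't \<Rightarrow> complex"
  where "L2_fun X = (SOME f. f \<in> X)"

definition L2 :: "'t measure \<Rightarrow> ('t \<Rightarrow> complex) set hspace"
  where "L2 M = \<lparr>
    carrier = L2_class M ` sq_integrable M,
    monoid.mult = undefined,
    one = undefined,
    ring.zero = L2_class M (\<lambda>t. 0),
    add = (\<lambda>X Y. L2_class M (\<lambda>t. L2_fun X t + L2_fun Y t)),
    smult = (\<lambda>c X. L2_class M (\<lambda>t. c * L2_fun X t)),
    ip = (\<lambda>X Y. LINT t|M. L2_fun X t * cnj (L2_fun Y t)) \<rparr>"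

section \<open>The Sierpinski gasket\<close>

text \<open>The vertices are labelled counterclockwise, beginning with the lower left one.\<close>

definition gasket_vertices :: "(nat \<Rightarrow> real^2) \<Rightarrow> bool"
  where "gasket_vertices v \<longleftrightarrow>
    dist (v 1) (v 2) = 2 * pi / 3 \<and> dist (v 2) (v 3) = 2 * pi / 3 \<and> dist (v 3) (v 1) = 2 * pi / 3 \<and>
    v 1 $ 2 = v 2 $ 2 \<and> v 1 $ 1 < v 2 $ 1 \<and> v 1 $ 2 < v 3 $ 2"

definition SG0 :: "(nat \<Rightarrow> real^2) \<Rightarrow> (real^2) set"
  where "SG0 v = closed_segment (v 1) (v 2) \<union> closed_segment (v 2) (v 3) \<union> closed_segment (v 3) (v 1)"

definition gasket_map :: "(nat \<Rightarrow> real^2) \<Rightarrow> nat \<Rightarrow> real^2 \<Rightarrow> real^2"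
  where "gasket_map v j x = (1 / 2) *\<^sub>R (x + v j)"

text \<open>A word \<open>[j\<^sub>1, \<dots>, j\<^sub>n]\<close> stands for the map \<open>F\<^sub>j\<^sub>1 \<circ> \<dots> \<circ> F\<^sub>j\<^sub>n\<close> and for the image of the initial
  triangle under this map.\<close>

definition words :: "nat \<Rightarrow> nat list set"
  where "words n = {w. length w = n \<and> set w \<subseteq> {1, 2, 3}}"

definition word_map :: "(nat \<Rightarrow> real^2) \<Rightarrow> nat list \<Rightarrow> real^2 \<Rightarrow> real^2"
  where "word_map v w = foldr (gasket_map v) w"

definition triangle :: "(nat \<Rightarrow> real^2) \<Rightarrow> nat list \<Rightarrow> (real^2) set"
  where "triangle v w = word_map v w ` SG0 v"

definition SG_level :: "(nat \<Rightarrow> real^2) \<Rightarrow> nat \<Rightarrow> (real^2) set"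
  where "SG_level v n = (\<Union>w\<in>words n. triangle v w)"

definition SG :: "(nat \<Rightarrow> real^2) \<Rightarrow> (real^2) set"
  where "SG v = closure (\<Union>n. SG_level v n)"

text \<open>A numbering of the \<open>3\<^sup>n\<close> triangles of each level \<open>n\<close>.\<close>

definition triangle_numbering :: "(nat \<Rightarrow> nat \<Rightarrow> nat list) \<Rightarrow> bool"
  where "triangle_numbering \<nu> \<longleftrightarrow> (\<forall>n. bij_betw (\<nu> n) {1..3 ^ n} (words n))"

text \<open>
  The parameterization by arclength of the triangle given by the word \<open>w\<close>, as a function on the real
  line whose period is the perimeter. It starts at the lower right corner and passes through the
  top corner and the lower left corner, in this order.
\<close>

definition triangle_param :: "(nat \<Rightarrow> real^2) \<Rightarrow> nat list \<Rightarrow> real \<Rightarrow> real^2"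
  where "triangle_param v w t =
    (let L = 2 * pi / (3 * 2 ^ length w); u = t rmod (3 * L); P = (\<lambda>j. word_map v w (v j)) in
      if u \<le> L then linepath (P 2) (P 3) (u / L)
      else if u \<le> 2 * L then linepath (P 3) (P 1) (u / L - 1)
      else linepath (P 1) (P 2) (u / L - 2))"

section \<open>The spectral triple of the Sierpinski gasket\<close>

definition circle_measure :: "nat \<Rightarrow> real measure"
  where "circle_measure n = uniform_measure lborel {- (pi / 2 ^ n) .. pi / 2 ^ n}"

definition circle_basis :: "nat \<Rightarrow> int \<Rightarrow> (real \<Rightarrow> complex) set"
  where "circle_basis n k = L2_class (circle_measure n) (\<lambda>t. exp (\<i> * 2 ^ n * of_int k * of_real t))"

definition ST_triangle ::
    "(nat \<Rightarrow> real^2) \<Rightarrow> nat list \<Rightarrow> (real^2 \<Rightarrow> complex, (real \<Rightarrow> complex) set) fredholm"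
  where "ST_triangle v w = (let n = length w; M = circle_measure n in \<lparr>
    fspace = L2 M,
    frep = (\<lambda>f X. L2_class M (\<lambda>t. f (triangle_param v w t) * L2_fun X t)),
    fdirac = diagonal_op (L2 M) (circle_basis n) (\<lambda>k. 2 ^ n * (of_int k + 1 / 2)) \<rparr>)"

definition ST_SG ::
    "(nat \<Rightarrow> real^2) \<Rightarrow> (nat \<Rightarrow> nat \<Rightarrow> nat list)
      \<Rightarrow> (real^2 \<Rightarrow> complex, nat \<times> nat \<Rightarrow> (real \<Rightarrow> complex) set) fredholm"
  where "ST_SG v \<nu> = direct_sum (SIGMA n:UNIV. {1..3 ^ n}) (\<lambda>(n, i). ST_triangle v (\<nu> n i))"

section \<open>Minkowski and Hausdorff dimension\<close>

definition covering_number :: "'a::metric_space set \<Rightarrow> real \<Rightarrow> nat"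
  where "covering_number S \<epsilon> =
    (LEAST m. \<exists>C. finite C \<and> card C = m \<and> S \<subseteq> (\<Union>c\<in>C. cball c \<epsilon>))"

text \<open>The Minkowski (box-counting) dimension of a totally bounded set: this predicate includes
  the existence of the limit, that is, the equality of the upper and the lower dimension.\<close>

definition has_minkowski_dimension :: "'a::metric_space set \<Rightarrow> real \<Rightarrow> bool"
  where "has_minkowski_dimension S d \<longleftrightarrow>
    ((\<lambda>\<epsilon>. ln (real (covering_number S \<epsilon>)) / ln (1 / \<epsilon>)) \<longlongrightarrow> d) (at_right 0)"

text \<open>Boundedness is required explicitly since \<^const>\<open>diameter\<close> is 0 for unbounded sets.\<close>

definition hausdorff_premeasure :: "real \<Rightarrow> real \<Rightarrow> 'a::metric_space set \<Rightarrow> ennreal"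
  where "hausdorff_premeasure s \<delta> S =
    (INF U\<in>{U :: nat \<Rightarrow> 'a set. S \<subseteq> (\<Union>i. U i) \<and> (\<forall>i. bounded (U i) \<and> diameter (U i) \<le> \<delta>)}.
      \<Sum>i. ennreal (diameter (U i) powr s))"

definition hausdorff_measure :: "real \<Rightarrow> 'a::metric_space set \<Rightarrow> ennreal"
  where "hausdorff_measure s S = (SUP \<delta>\<in>{0<..}. hausdorff_premeasure s \<delta> S)"

definition hausdorff_dimension :: "'a::metric_space set \<Rightarrow> ereal"
  where "hausdorff_dimension S = (INF s\<in>{s. s > 0 \<and> hausdorff_measure s S = 0}. ereal s)"

end

theory Submission
  imports Defs "HOL-Real_Asymp.Real_Asymp"
begin

text \<open>
  The operators \<open>D\<^bsub>n,i\<^esub>\<close> are diagonal in the Fourier bases, so their direct sum is diagonal in the union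
  of these bases, with eigenvalues \<open>2\<^sup>n (k + 1/2)\<close>, each occurring for the \<open>3\<^sup>n\<close> triangles of level \<open>n\<close>.
  Self-adjointness and compactness of the resolvent are properties of diagonal operators, and the trace
  of \<open>(I + D\<^sup>2)\<^bsub>-s/2\<^esub>\<close> converges together with the geometric series of \<open>(3 / 2\<^sup>s)\<^sup>n\<close>, since \<open>ln 3 / ln 2 > 1\<close>
  makes the sum over \<open>k\<close> finite. On the periodic absolutely continuous functions the commutator of
  \<open>D\<^bsub>n,i\<^esub>\<close> with a function \<open>g\<close> is multiplication by \<open>-i g'\<close>. For the restriction of a polynomial to the
  gasket, \<open>g'\<close> is a derivative in one of three unit directions, hence bounded independently of the
  triangle; polynomials are dense by the Stone-Weierstrass theorem. The representation is faithful since
  a continuous function in its kernel has a zero on each of the triangles, and arbitrarily small triangles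
  lie near every point of the gasket. Both dimensions come from counting: the \<open>3\<^sup>n\<close> corners of level \<open>n\<close> lie in a triangular lattice of mesh proportional
  to \<open>2\<^sup>-\<^sup>n\<close>, so they are separated, and the balls of this radius around them cover the gasket.
\<close>

section \<open>Hilbert spaces and orthonormal bases\<close>

text \<open>Resolvent, power and trace are given by descriptions: some preimage under
  \<open>inv_into\<close>, the unique operator prescribed on the eigenspaces, a sum over an
  arbitrarily chosen basis. None of them can be unfolded to a formula. Each is therefore evaluated
  through its action on coefficients in one orthonormal basis, so that all questions about operators
  become questions about families of numbers. The delicate point of the commutator estimate is the
  domain: multiplication by \<open>g\<close> must map the whole domain of \<open>D\<close> into
  itself, and it is not enough to verify the Leibniz rule on smooth functions. Since membership in
  the domain is square summability of coefficients, it suffices to exhibit a vector with the right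
  coefficients, and integration by parts is needed only against single exponentials. For the
  Hausdorff dimension no limit measure on the gasket is constructed: compactness reduces a cover to
  finitely many sets, and one sufficiently fine level of corners then decides.\<close>

lemma complex_field_simps [simp]:
  "carrier complex_field = UNIV" "x \<otimes>\<^bsub>complex_field\<^esub> y = x * y" "\<one>\<^bsub>complex_field\<^esub> = 1"
  "\<zero>\<^bsub>complex_field\<^esub> = 0" "x \<oplus>\<^bsub>complex_field\<^esub> y = x + y"
  by (simp_all add: complex_field_def)

lemma cring_complex_field: "cring complex_field"
  by (rule cringI; (rule abelian_groupI comm_monoidI)?)
     (auto simp: algebra_simps intro: exI[of _ "- x" for x :: complex])

text \<open>Completeness is left out because norm, Cauchy-Schwarz inequality and metric must be
  available for direct sums and for \<open>L2 M\<close> before their completeness can be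
  proved.\<close>

locale pre_hilbert_space = module complex_field H for H :: "('h, 'm) hspace_scheme" (structure) +
  assumes ip_add_left: "\<lbrakk>x \<in> carrier H; y \<in> carrier H; z \<in> carrier H\<rbrakk>
      \<Longrightarrow> ip H (x \<oplus> y) z = ip H x z + ip H y z"
    and ip_smult_left: "\<lbrakk>x \<in> carrier H; y \<in> carrier H\<rbrakk>
      \<Longrightarrow> ip H (c \<odot> x) y = c * ip H x y"
    and ip_commute: "\<lbrakk>x \<in> carrier H; y \<in> carrier H\<rbrakk> \<Longrightarrow> ip H y x = cnj (ip H x y)"
    and ip_pos: "\<lbrakk>x \<in> carrier H; x \<noteq> \<zero>\<rbrakk> \<Longrightarrow> 0 < Re (ip H x x)"
begin

lemma smult_in [simp, intro]: "x \<in> carrier H \<Longrightarrow> c \<odot> x \<in> carrier H"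
  using smult_closed[of c x] by simp

lemma ip_add_right:
  "\<lbrakk>x \<in> carrier H; y \<in> carrier H; z \<in> carrier H\<rbrakk> \<Longrightarrow> ip H z (x \<oplus> y) = ip H z x + ip H z y"
  by (metis M.a_closed complex_cnj_add ip_add_left ip_commute)

lemma ip_smult_right:
  "\<lbrakk>x \<in> carrier H; y \<in> carrier H\<rbrakk> \<Longrightarrow> ip H x (c \<odot> y) = cnj c * ip H x y"
  by (metis complex_cnj_mult ip_commute ip_smult_left smult_in)

lemma ip_zero_left [simp]: "x \<in> carrier H \<Longrightarrow> ip H \<zero> x = 0"
  using ip_add_left[of \<zero> \<zero> x] by simp

lemma ip_zero_right [simp]: "x \<in> carrier H \<Longrightarrow> ip H x \<zero> = 0"
  using ip_add_right[of \<zero> \<zero> x] by simp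

lemma minus_in [simp, intro]: "\<lbrakk>x \<in> carrier H; y \<in> carrier H\<rbrakk> \<Longrightarrow> x \<ominus> y \<in> carrier H"
  by (rule M.minus_closed)

lemma ip_minus_left:
  "\<lbrakk>x \<in> carrier H; y \<in> carrier H; z \<in> carrier H\<rbrakk> \<Longrightarrow> ip H (x \<ominus> y) z = ip H x z - ip H y z"
  using ip_add_left[of y "\<ominus> y" z] ip_add_left[of x "\<ominus> y" z]
  by (simp add: M.minus_eq M.r_neg eq_neg_iff_add_eq_0 add.commute)

lemma ip_minus_right:
  "\<lbrakk>x \<in> carrier H; y \<in> carrier H; z \<in> carrier H\<rbrakk> \<Longrightarrow> ip H z (x \<ominus> y) = ip H z x - ip H z y"
  by (metis complex_cnj_diff ip_commute ip_minus_left minus_in)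

lemma ip_nonneg: "x \<in> carrier H \<Longrightarrow> 0 \<le> Re (ip H x x)"
  by (cases "x = \<zero>") (auto dest: ip_pos)

lemma hnorm_nonneg [simp]: "x \<in> carrier H \<Longrightarrow> 0 \<le> hnorm H x"
  by (simp add: hnorm_def ip_nonneg)

lemma hnorm_sq: "x \<in> carrier H \<Longrightarrow> (hnorm H x)\<^sup>2 = Re (ip H x x)"
  by (simp add: hnorm_def ip_nonneg)

lemma ip_self: "x \<in> carrier H \<Longrightarrow> ip H x x = complex_of_real ((hnorm H x)\<^sup>2)"
  using ip_commute[of x x] by (simp add: hnorm_sq complex_eq_iff)

lemma hnorm_eq_0: "x \<in> carrier H \<Longrightarrow> hnorm H x = 0 \<longleftrightarrow> x = \<zero>"
  by (cases "x = \<zero>") (auto simp: hnorm_def dest: ip_pos)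

lemma hnorm_zero [simp]: "hnorm H \<zero> = 0"
  by (simp add: hnorm_eq_0)

lemma minus_zero [simp]: "x \<in> carrier H \<Longrightarrow> x \<ominus> \<zero> = x"
  by (simp add: M.minus_eq)

lemma minus_eq_zero_iff: "\<lbrakk>x \<in> carrier H; y \<in> carrier H\<rbrakk> \<Longrightarrow> x \<ominus> y = \<zero> \<longleftrightarrow> x = y"
  by (metis M.add.inv_closed M.minus_eq M.minus_minus M.minus_equality M.r_neg)

lemma hnorm_minus_sq:
  assumes "x \<in> carrier H" "y \<in> carrier H"
  shows "(hnorm H (x \<ominus> y))\<^sup>2 = (hnorm H x)\<^sup>2 + (hnorm H y)\<^sup>2 - 2 * Re (ip H x y)"
  using assms ip_commute[of x y] by (simp add: hnorm_sq ip_minus_left ip_minus_right)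

lemma hnorm_add_sq:
  assumes "x \<in> carrier H" "y \<in> carrier H"
  shows "(hnorm H (x \<oplus> y))\<^sup>2 = (hnorm H x)\<^sup>2 + (hnorm H y)\<^sup>2 + 2 * Re (ip H x y)"
  using assms ip_commute[of x y] by (simp add: hnorm_sq ip_add_left ip_add_right)

lemma hnorm_smult:
  assumes "x \<in> carrier H"
  shows "hnorm H (c \<odot> x) = cmod c * hnorm H x"
proof -
  have "(hnorm H (c \<odot> x))\<^sup>2 = Re ((c * cnj c) * ip H x x)"
    using assms by (simp add: hnorm_sq ip_smult_left ip_smult_right mult_ac)
  also have "\<dots> = (cmod c * hnorm H x)\<^sup>2"
    using assms by (simp add: complex_norm_square[symmetric] ip_self power_mult_distrib del: of_real_power flip: of_real_power of_real_mult)
  finally show ?thesis using assms by (simp add: power2_eq_iff_nonneg)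
qed

lemma Cauchy_Schwarz:
  assumes x: "x \<in> carrier H" and y: "y \<in> carrier H"
  shows "cmod (ip H x y) \<le> hnorm H x * hnorm H y"
proof (cases "y = \<zero>")
  case False
  define N where "N = (hnorm H y)\<^sup>2"
  have N: "N > 0" using False y hnorm_eq_0 by (simp add: N_def)
  \<comment> \<open>\<open>c \<odot> y\<close> is the orthogonal projection of \<open>x\<close> to
    the line spanned by \<open>y\<close>; with this \<open>c\<close> the square below is as small as
    possible, and its nonnegativity is the inequality.\<close>
  define c where "c = ip H x y / N"
  have "0 \<le> (hnorm H (x \<ominus> c \<odot> y))\<^sup>2" by simp
  also have "\<dots> = (hnorm H x)\<^sup>2 + (cmod c)\<^sup>2 * N - 2 * Re (cnj c * ip H x y)"
    using x y by (simp add: hnorm_minus_sq hnorm_smult ip_smult_right power_mult_distrib N_def)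
  also have "cnj c * ip H x y = complex_of_real ((cmod (ip H x y))\<^sup>2 / N)"
    using complex_norm_square[of "ip H x y"] by (simp add: c_def mult.commute)
  also have "(cmod c)\<^sup>2 * N = (cmod (ip H x y))\<^sup>2 / N"
    using N by (simp add: c_def norm_divide power2_eq_square field_simps)
  finally have "(cmod (ip H x y))\<^sup>2 / N \<le> (hnorm H x)\<^sup>2" by simp
  hence "(cmod (ip H x y))\<^sup>2 \<le> (hnorm H x * hnorm H y)\<^sup>2"
    using N by (simp add: field_simps N_def)
  thus ?thesis using x y by (simp add: power2_le_iff_abs_le)
qed (use x in auto)

lemma hnorm_triangle:
  assumes x: "x \<in> carrier H" and y: "y \<in> carrier H"
  shows "hnorm H (x \<oplus> y) \<le> hnorm H x + hnorm H y"
proof -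
  have "Re (ip H x y) \<le> hnorm H x * hnorm H y"
    using Cauchy_Schwarz[OF x y] complex_Re_le_cmod[of "ip H x y"] by linarith
  hence "(hnorm H (x \<oplus> y))\<^sup>2 \<le> (hnorm H x + hnorm H y)\<^sup>2"
    using x y by (simp add: hnorm_add_sq power2_sum)
  thus ?thesis using x y by (simp add: power2_le_iff_abs_le)
qed

lemma hnorm_minus_commute:
  assumes "x \<in> carrier H" "y \<in> carrier H"
  shows "hnorm H (x \<ominus> y) = hnorm H (y \<ominus> x)"
  by (rule power2_eq_imp_eq) (use assms ip_commute[of x y] in \<open>auto simp: hnorm_minus_sq\<close>)

lemma hnorm_triangle_minus:
  assumes "x \<in> carrier H" "y \<in> carrier H" "z \<in> carrier H"
  shows "hnorm H (x \<ominus> z) \<le> hnorm H (x \<ominus> y) + hnorm H (y \<ominus> z)"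
proof -
  have "x \<ominus> z = (x \<ominus> y) \<oplus> (y \<ominus> z)"
    using assms by (simp add: M.minus_eq M.a_assoc M.l_neg M.r_neg1)
  thus ?thesis using hnorm_triangle assms by simp
qed

sublocale hmetric: Metric_space "carrier H" "hdist H"
proof
  fix x y z assume xyz: "x \<in> carrier H" "y \<in> carrier H" "z \<in> carrier H"
  show "hdist H x z \<le> hdist H x y + hdist H y z"
    using xyz hnorm_triangle_minus by (simp add: hdist_def)
qed (auto simp: hdist_def hnorm_minus_commute hnorm_eq_0 minus_eq_zero_iff)

lemma htop_eq: "htop H = hmetric.mtopology"
  by (simp add: htop_def)

text \<open>Translates the abstract notion of completeness into Cauchy sequences for the norm; on
  the carrier \<open>hdist\<close> is the norm of the difference.\<close>

lemma mcompleteI: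
  assumes "\<And>s. \<lbrakk>\<And>n. s n \<in> carrier H;
      \<And>\<epsilon>. \<epsilon> > 0 \<Longrightarrow> \<exists>N. \<forall>m\<ge>N. \<forall>n\<ge>N. hnorm H (s m \<ominus> s n) < \<epsilon>\<rbrakk>
      \<Longrightarrow> \<exists>x\<in>carrier H. (\<lambda>n. hnorm H (s n \<ominus> x)) \<longlonglongrightarrow> 0"
  shows "hmetric.mcomplete"
  unfolding hmetric.mcomplete_def
proof (intro allI impI)
  fix s assume s: "hmetric.MCauchy s"
  have c: "s n \<in> carrier H" for n using s by (auto simp: hmetric.MCauchy_def)
  have "\<exists>N. \<forall>m\<ge>N. \<forall>n\<ge>N. hnorm H (s m \<ominus> s n) < \<epsilon>" if "\<epsilon> > 0" for \<epsilon>
    using s that c by (auto simp: hmetric.MCauchy_def hdist_def)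
  then obtain x where x: "x \<in> carrier H" "(\<lambda>n. hnorm H (s n \<ominus> x)) \<longlonglongrightarrow> 0"
    using assms[of s] c by blast
  have "\<forall>\<^sub>F n in sequentially. s n \<in> carrier H \<and> hdist H (s n) x < \<epsilon>" if "\<epsilon> > 0" for \<epsilon>
    using order_tendstoD(2)[OF x(2) that] c x by (simp add: hdist_def)
  thus "\<exists>x. limitin hmetric.mtopology s x sequentially"
    using x(1) by (auto simp: hmetric.limitin_metric)
qed

lemma tendsto_ip:
  assumes s: "\<And>n. s n \<in> carrier H" and x: "x \<in> carrier H" and y: "y \<in> carrier H"
    and lim: "(\<lambda>n. hnorm H (s n \<ominus> x)) \<longlonglongrightarrow> 0"
  shows "(\<lambda>n. ip H (s n) y) \<longlonglongrightarrow> ip H x y"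
proof (rule LIM_zero_cancel, rule Lim_transform_bound)
  show "\<forall>\<^sub>F n in sequentially. norm (ip H (s n) y - ip H x y) \<le> norm (hnorm H (s n \<ominus> x) * hnorm H y)"
    using s x y Cauchy_Schwarz by (auto intro!: always_eventually simp flip: ip_minus_left)
  show "(\<lambda>n. hnorm H (s n \<ominus> x) * hnorm H y) \<longlonglongrightarrow> 0"
    using tendsto_mult_left_zero[OF lim] .
qed

lemma tendsto_hnorm:
  assumes s: "\<And>n. s n \<in> carrier H" and x: "x \<in> carrier H"
    and lim: "(\<lambda>n. hnorm H (s n \<ominus> x)) \<longlonglongrightarrow> 0"
  shows "(\<lambda>n. hnorm H (s n)) \<longlonglongrightarrow> hnorm H x"
proof (rule LIM_zero_cancel, rule Lim_transform_bound[OF _ lim])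
  have "\<bar>hnorm H (s n) - hnorm H x\<bar> \<le> hnorm H (s n \<ominus> x)" for n
    using hnorm_triangle_minus[of "s n" x \<zero>] hnorm_triangle_minus[of x "s n" \<zero>]
      hnorm_minus_commute[of x "s n"] s[of n] x by simp
  thus "\<forall>\<^sub>F n in sequentially. norm (hnorm H (s n) - hnorm H x) \<le> norm (hnorm H (s n \<ominus> x))"
    using s x by auto
qed

end

sublocale hilbert_space \<subseteq> pre_hilbert_space
  by unfold_locales (auto simp: ip_add_left ip_smult_left ip_pos intro: ip_commute)

context hilbert_space
begin

lemma Cauchy_converges:
  assumes c: "\<And>n. s n \<in> carrier H"
    and s: "\<And>\<epsilon>. \<epsilon> > 0 \<Longrightarrow> \<exists>N. \<forall>m\<ge>N. \<forall>n\<ge>N. hnorm H (s m \<ominus> s n) < \<epsilon>"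
  obtains x where "x \<in> carrier H" "(\<lambda>n. hnorm H (s n \<ominus> x)) \<longlonglongrightarrow> 0"
proof -
  have "hmetric.MCauchy s" using c s by (auto simp: hmetric.MCauchy_def hdist_def)
  then obtain x where x: "limitin hmetric.mtopology s x sequentially"
    using complete by (auto simp: hmetric.mcomplete_def)
  hence xc: "x \<in> carrier H" by (simp add: hmetric.limitin_metric)
  have "\<forall>\<^sub>F n in sequentially. \<bar>hnorm H (s n \<ominus> x) - 0\<bar> < e" if "e > 0" for e
    using x that c xc by (simp add: hmetric.limitin_metric hdist_def)
  thus ?thesis using that[OF xc] by (simp add: tendsto_iff dist_real_def)
qed

end

text \<open>The index set is a set and not a type because the basis of a direct sum is indexed by a
  dependent sum of sets.\<close>

locale orthonormal_basis = hilbert_space H for H :: "('h, 'm) hspace_scheme" (structure) +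
  fixes K :: "'k set" and e :: "'k \<Rightarrow> 'h"
  assumes e_in [simp, intro]: "k \<in> K \<Longrightarrow> e k \<in> carrier H"
    and ip_e: "\<lbrakk>j \<in> K; k \<in> K\<rbrakk> \<Longrightarrow> ip H (e j) (e k) = (if j = k then 1 else 0)"
    and total: "\<lbrakk>x \<in> carrier H; \<And>k. k \<in> K \<Longrightarrow> ip H x (e k) = 0\<rbrakk> \<Longrightarrow> x = \<zero>"
begin

lemma coef_eqI:
  assumes "x \<in> carrier H" "y \<in> carrier H" "\<And>k. k \<in> K \<Longrightarrow> ip H x (e k) = ip H y (e k)"
  shows "x = y"
proof -
  have "x \<ominus> y = \<zero>" using assms by (intro total) (auto simp: ip_minus_left)
  thus ?thesis using assms by (simp add: minus_eq_zero_iff)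
qed

section \<open>Orthonormal expansions: Bessel, Riesz-Fischer, Parseval\<close>

lemma finite_combination:
  assumes "finite F" "F \<subseteq> K"
  shows "\<exists>y\<in>carrier H. \<forall>z\<in>carrier H. ip H z y = (\<Sum>k\<in>F. ip H z (e k) * cnj (c k))"
  using assms
proof (induction F rule: finite_induct)
  case empty
  show ?case by (intro bexI[of _ \<zero>]) auto
next
  case (insert k F)
  then obtain y where "y \<in> carrier H" "\<forall>z\<in>carrier H. ip H z y = (\<Sum>k\<in>F. ip H z (e k) * cnj (c k))"
    by auto
  thus ?case using insert
    by (intro bexI[of _ "c k \<odot> e k \<oplus> y"]) (auto simp: ip_add_right ip_smult_right)
qed

text \<open>The linear combination of the \<open>e k\<close> for \<open>k\<close> in
  \<open>F\<close> with coefficients \<open>c k\<close>. Since it is specified by its inner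
  products, no finite sum in the module has to be evaluated; the conjugate appears because
  \<open>ip\<close> is conjugate linear in its second argument.\<close>

definition comb :: "('k \<Rightarrow> complex) \<Rightarrow> 'k set \<Rightarrow> 'h" where
  "comb c F = (SOME y. y \<in> carrier H \<and> (\<forall>z\<in>carrier H. ip H z y = (\<Sum>k\<in>F. ip H z (e k) * cnj (c k))))"

context
  fixes F assumes F: "finite F" "F \<subseteq> K"
begin

lemma comb_in [simp, intro]: "comb c F \<in> carrier H"
  and ip_comb: "z \<in> carrier H \<Longrightarrow> ip H z (comb c F) = (\<Sum>k\<in>F. ip H z (e k) * cnj (c k))"
  using someI_ex[OF finite_combination[OF F, of c, unfolded Bex_def]] by (auto simp: comb_def)

lemma ip_comb_left:
  "z \<in> carrier H \<Longrightarrow> ip H (comb c F) z = (\<Sum>k\<in>F. c k * ip H (e k) z)"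
  using ip_commute[of z "comb c F"] ip_commute[of z] F by (auto simp: ip_comb subset_iff intro!: sum.cong)

lemma coef_comb:
  assumes "k \<in> K"
  shows "ip H (comb c F) (e k) = (if k \<in> F then c k else 0)"
proof -
  have "ip H (comb c F) (e k) = (\<Sum>j\<in>F. if k = j then c j else 0)"
    unfolding ip_comb_left[OF e_in[OF assms]] using F assms by (intro sum.cong) (auto simp: subset_iff ip_e)
  thus ?thesis using F by simp
qed

lemma hnorm_comb: "(hnorm H (comb c F))\<^sup>2 = (\<Sum>k\<in>F. (cmod (c k))\<^sup>2)"
proof -
  have "ip H (comb c F) (comb c F) = (\<Sum>k\<in>F. complex_of_real ((cmod (c k))\<^sup>2))"
    using F by (auto simp: ip_comb coef_comb subset_iff complex_norm_square[symmetric] intro!: sum.cong)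
  thus ?thesis by (simp add: hnorm_sq)
qed

text \<open>Pythagoras: the truncated expansion is the orthogonal projection of \<open>x\<close> to
  the span of finitely many basis vectors. Nonnegativity of the left side is Bessel's inequality;
  together with Parseval the identity shows how well truncations approximate.\<close>

lemma hnorm_minus_comb:
  assumes x: "x \<in> carrier H"
  shows "(hnorm H (x \<ominus> comb (\<lambda>k. ip H x (e k)) F))\<^sup>2
    = (hnorm H x)\<^sup>2 - (\<Sum>k\<in>F. (cmod (ip H x (e k)))\<^sup>2)"
proof -
  have "ip H x (comb (\<lambda>k. ip H x (e k)) F) = (\<Sum>k\<in>F. complex_of_real ((cmod (ip H x (e k)))\<^sup>2))"
    using x by (auto simp: ip_comb complex_norm_square[symmetric] intro!: sum.cong)
  thus ?thesis using x by (simp add: hnorm_minus_sq hnorm_comb)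
qed

lemma Bessel:
  "x \<in> carrier H \<Longrightarrow> (\<Sum>k\<in>F. (cmod (ip H x (e k)))\<^sup>2) \<le> (hnorm H x)\<^sup>2"
  using hnorm_minus_comb[of x] zero_le_power2[of "hnorm H (x \<ominus> comb (\<lambda>k. ip H x (e k)) F)"] by linarith

end

lemma coef_summable: "x \<in> carrier H \<Longrightarrow> (\<lambda>k. (cmod (ip H x (e k)))\<^sup>2) summable_on K"
  using Bessel by (intro nonneg_bdd_above_summable_on) (auto intro!: bdd_aboveI)

lemma Riesz_Fischer:
  assumes c: "(\<lambda>k. (cmod (c k))\<^sup>2) summable_on K"
  obtains y where "y \<in> carrier H" "\<And>k. k \<in> K \<Longrightarrow> ip H y (e k) = c k"
    "((\<lambda>k. (cmod (c k))\<^sup>2) has_sum (hnorm H y)\<^sup>2) K"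
proof -
  define S where "S = (\<Sum>\<^sub>\<infinity>k\<in>K. (cmod (c k))\<^sup>2)"
  have S: "((\<lambda>k. (cmod (c k))\<^sup>2) has_sum S) K" using c by (simp add: S_def)
  have le: "(\<Sum>k\<in>F. (cmod (c k))\<^sup>2) \<le> S" if "finite F" "F \<subseteq> K" for F
    using finite_sum_le_has_sum[OF S] that by auto
  have "\<exists>F. finite F \<and> F \<subseteq> K \<and> dist (\<Sum>k\<in>F. (cmod (c k))\<^sup>2) S \<le> inverse (real (Suc n))" for n
    using has_sum_finite_approximation[OF S, of "inverse (real (Suc n))"] by auto
  then obtain F where F: "\<And>n. finite (F n)" "\<And>n. F n \<subseteq> K"
    "\<And>n. dist (\<Sum>k\<in>F n. (cmod (c k))\<^sup>2) S \<le> inverse (real (Suc n))"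
    by metis
  have near: "S - (\<Sum>k\<in>F n. (cmod (c k))\<^sup>2) \<le> inverse (real (Suc n))" for n
    using F(3)[of n] by (simp add: dist_real_def)
  have lim0: "(\<lambda>n. inverse (real (Suc n))) \<longlonglongrightarrow> 0" by (rule LIMSEQ_inverse_real_of_nat)
  define s where "s n = comb c (F n)" for n
  have s: "s n \<in> carrier H" for n using F by (simp add: s_def comb_in)
  \<comment> \<open>The sets \<open>F n\<close> need not be nested. The squared distance of
    \<open>s m\<close> and \<open>s n\<close> is the sum over the symmetric difference of
    \<open>F m\<close> and \<open>F n\<close>, that is, twice the sum over the union minus the two
    separate sums, and the sum over the union is at most \<open>S\<close>.\<close>
  have cauchy: "(hnorm H (s m \<ominus> s n))\<^sup>2 \<le> inverse (real (Suc m)) + inverse (real (Suc n))" for m n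
  proof -
    have "ip H (s m) (s n) = (\<Sum>k\<in>F n. if k \<in> F m then complex_of_real ((cmod (c k))\<^sup>2) else 0)"
      unfolding s_def using F[of n] F[of m]
      by (auto simp: ip_comb comb_in coef_comb subset_iff complex_norm_square[symmetric] intro!: sum.cong)
    also have "\<dots> = (\<Sum>k\<in>F m \<inter> F n. complex_of_real ((cmod (c k))\<^sup>2))"
      using F(1) by (simp add: sum.inter_restrict[symmetric] Int_commute)
    finally have ip: "Re (ip H (s m) (s n)) = (\<Sum>k\<in>F m \<inter> F n. (cmod (c k))\<^sup>2)" by simp
    have "(\<Sum>k\<in>F m \<union> F n. (cmod (c k))\<^sup>2) \<le> S" using F by (intro le) auto
    moreover have "(\<Sum>k\<in>F m \<union> F n. (cmod (c k))\<^sup>2) + (\<Sum>k\<in>F m \<inter> F n. (cmod (c k))\<^sup>2)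
      = (\<Sum>k\<in>F m. (cmod (c k))\<^sup>2) + (\<Sum>k\<in>F n. (cmod (c k))\<^sup>2)"
      using F by (simp add: sum.union_inter)
    ultimately show ?thesis
      using near[of m] near[of n] s F ip by (simp add: hnorm_minus_sq) (simp add: s_def hnorm_comb)
  qed
  obtain y where y: "y \<in> carrier H" "(\<lambda>n. hnorm H (s n \<ominus> y)) \<longlonglongrightarrow> 0"
  proof (rule Cauchy_converges[of s])
    fix \<epsilon> :: real assume \<epsilon>: "\<epsilon> > 0"
    obtain N where N: "\<And>n. n \<ge> N \<Longrightarrow> inverse (real (Suc n)) < \<epsilon>\<^sup>2 / 2"
      using order_tendstoD(2)[OF lim0, of "\<epsilon>\<^sup>2 / 2"] \<epsilon> by (auto simp: eventually_sequentially)
    have "hnorm H (s m \<ominus> s n) < \<epsilon>" if "m \<ge> N" "n \<ge> N" for m n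
    proof -
      have "(hnorm H (s m \<ominus> s n))\<^sup>2 < \<epsilon>\<^sup>2" using cauchy[of m n] N[OF that(1)] N[OF that(2)] by linarith
      thus ?thesis using \<epsilon> s by (simp add: power_less_imp_less_base)
    qed
    thus "\<exists>N. \<forall>m\<ge>N. \<forall>n\<ge>N. hnorm H (s m \<ominus> s n) < \<epsilon>" by blast
  qed (use s in auto)
  show ?thesis
  proof
    show "y \<in> carrier H" by (rule y)
    show "ip H y (e k) = c k" if k: "k \<in> K" for k
    proof (rule LIMSEQ_unique)
      show "(\<lambda>n. ip H (s n) (e k)) \<longlonglongrightarrow> ip H y (e k)" using tendsto_ip[OF s y(1) _ y(2)] k by blast
      have *: "(cmod (ip H (s n) (e k) - c k))\<^sup>2 \<le> inverse (real (Suc n))" for n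
      proof (cases "k \<in> F n")
        case False
        \<comment> \<open>A coefficient not yet covered by \<open>F n\<close> is part of the mass
          that \<open>F n\<close> misses, which is at most 1/(n+1).\<close>
        have "(\<Sum>k\<in>insert k (F n). (cmod (c k))\<^sup>2) \<le> S" using F k by (intro le) auto
        thus ?thesis using False near[of n] F[of n] k by (simp add: s_def coef_comb)
      qed (use F[of n] k in \<open>simp add: s_def coef_comb\<close>)
      have "(\<lambda>n. (cmod (ip H (s n) (e k) - c k))\<^sup>2) \<longlonglongrightarrow> 0"
        by (rule tendsto_sandwich[OF _ _ tendsto_const lim0]) (use * in auto)
      hence "(\<lambda>n. sqrt ((cmod (ip H (s n) (e k) - c k))\<^sup>2)) \<longlonglongrightarrow> sqrt 0" by (rule tendsto_real_sqrt)
      hence "(\<lambda>n. cmod (ip H (s n) (e k) - c k)) \<longlonglongrightarrow> 0" by simp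
      thus "(\<lambda>n. ip H (s n) (e k)) \<longlonglongrightarrow> c k"
        by (rule LIM_zero_cancel[OF tendsto_norm_zero_cancel])
    qed
    have "(\<lambda>n. (hnorm H (s n))\<^sup>2) \<longlonglongrightarrow> (hnorm H y)\<^sup>2"
      using tendsto_hnorm[OF s y] by (rule tendsto_power)
    moreover have "(\<lambda>n. (hnorm H (s n))\<^sup>2) \<longlonglongrightarrow> S"
    proof (rule tendsto_sandwich)
      show "(\<lambda>n. S - inverse (real (Suc n))) \<longlonglongrightarrow> S" using tendsto_diff[OF tendsto_const lim0] by simp
    qed (use near le F in \<open>auto simp: s_def hnorm_comb algebra_simps\<close>)
    ultimately show "((\<lambda>k. (cmod (c k))\<^sup>2) has_sum (hnorm H y)\<^sup>2) K"
      using S LIMSEQ_unique by metis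
  qed
qed

text \<open>Riesz-Fischer applied to the coefficients of \<open>x\<close> produces a vector whose
  norm is given by the series; totality identifies this vector with \<open>x\<close>.\<close>

lemma Parseval:
  assumes x: "x \<in> carrier H"
  shows "((\<lambda>k. (cmod (ip H x (e k)))\<^sup>2) has_sum (hnorm H x)\<^sup>2) K"
proof -
  obtain y where y: "y \<in> carrier H" "\<And>k. k \<in> K \<Longrightarrow> ip H y (e k) = ip H x (e k)"
    "((\<lambda>k. (cmod (ip H x (e k)))\<^sup>2) has_sum (hnorm H y)\<^sup>2) K"
    using Riesz_Fischer[OF coef_summable[OF x]] by blast
  have "y = x" using coef_eqI x y by blast
  thus ?thesis using y by simp
qed

text \<open>The estimate is claimed for every finite \<open>G\<close> above \<open>F\<close>,
  because \<open>Parseval_ip\<close> needs convergence along the net of all finite sets.\<close>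

lemma comb_approx:
  assumes x: "x \<in> carrier H" and \<epsilon>: "\<epsilon> > 0"
  obtains F where "finite F" "F \<subseteq> K"
    "\<And>G. \<lbrakk>finite G; F \<subseteq> G; G \<subseteq> K\<rbrakk> \<Longrightarrow> hnorm H (x \<ominus> comb (\<lambda>k. ip H x (e k)) G) < \<epsilon>"
proof -
  have "\<forall>\<^sub>F F in finite_subsets_at_top K. (\<Sum>k\<in>F. (cmod (ip H x (e k)))\<^sup>2) > (hnorm H x)\<^sup>2 - \<epsilon>\<^sup>2"
    using Parseval[OF x] \<epsilon> unfolding has_sum_def by (intro order_tendstoD(1)) auto
  then obtain F where F: "finite F" "F \<subseteq> K"
    "\<And>G. \<lbrakk>finite G; F \<subseteq> G; G \<subseteq> K\<rbrakk> \<Longrightarrow> (\<Sum>k\<in>G. (cmod (ip H x (e k)))\<^sup>2) > (hnorm H x)\<^sup>2 - \<epsilon>\<^sup>2"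
    by (auto simp: eventually_finite_subsets_at_top)
  show ?thesis
  proof (rule that[OF F(1,2)])
    fix G assume G: "finite G" "F \<subseteq> G" "G \<subseteq> K"
    have "(hnorm H (x \<ominus> comb (\<lambda>k. ip H x (e k)) G))\<^sup>2 < \<epsilon>\<^sup>2"
      using hnorm_minus_comb[OF G(1,3) x] F(3)[OF G] by simp
    thus "hnorm H (x \<ominus> comb (\<lambda>k. ip H x (e k)) G) < \<epsilon>"
      using \<epsilon> by (simp add: power_less_imp_less_base)
  qed
qed

lemma Parseval_ip:
  assumes x: "x \<in> carrier H" and y: "y \<in> carrier H"
  shows "((\<lambda>k. ip H x (e k) * cnj (ip H y (e k))) has_sum ip H x y) K"
  unfolding has_sum_def tendsto_iff
proof (intro allI impI)
  fix \<epsilon> :: real assume \<epsilon>: "\<epsilon> > 0"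
  define \<delta> where "\<delta> = \<epsilon> / (hnorm H x + 1)"
  have \<delta>: "\<delta> > 0" unfolding \<delta>_def using \<epsilon> hnorm_nonneg[OF x] by (intro divide_pos_pos add_nonneg_pos) auto
  obtain F where F: "finite F" "F \<subseteq> K"
    "\<And>G. \<lbrakk>finite G; F \<subseteq> G; G \<subseteq> K\<rbrakk> \<Longrightarrow> hnorm H (y \<ominus> comb (\<lambda>k. ip H y (e k)) G) < \<delta>"
    using comb_approx[OF y \<delta>] by blast
  have "dist (\<Sum>k\<in>G. ip H x (e k) * cnj (ip H y (e k))) (ip H x y) < \<epsilon>"
    if G: "finite G" "F \<subseteq> G" "G \<subseteq> K" for G
  proof -
    let ?g = "comb (\<lambda>k. ip H y (e k)) G"
    have "dist (\<Sum>k\<in>G. ip H x (e k) * cnj (ip H y (e k))) (ip H x y) = cmod (ip H x (y \<ominus> ?g))"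
      using G x y by (simp add: ip_minus_right comb_in ip_comb dist_norm norm_minus_commute)
    also have "\<dots> \<le> hnorm H x * hnorm H (y \<ominus> ?g)" using G x y by (intro Cauchy_Schwarz) auto
    also have "\<dots> \<le> hnorm H x * \<delta>" using F(3)[OF G] x by (intro mult_left_mono) auto
    also have "\<dots> < \<epsilon>" using \<epsilon> hnorm_nonneg[OF x] by (simp add: \<delta>_def field_simps)
    finally show ?thesis .
  qed
  thus "\<forall>\<^sub>F G in finite_subsets_at_top K. dist (\<Sum>k\<in>G. ip H x (e k) * cnj (ip H y (e k))) (ip H x y) < \<epsilon>"
    using F(1,2) by (auto simp: eventually_finite_subsets_at_top)
qed

end

section \<open>Diagonal operators\<close>

lemma has_sum_ennreal:
  fixes f :: "'a \<Rightarrow> real"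
  assumes "(f has_sum a) A" "\<And>x. x \<in> A \<Longrightarrow> 0 \<le> f x"
  shows "(\<Sum>\<^sub>\<infinity>x\<in>A. ennreal (f x)) = ennreal a"
proof -
  have "ennreal a = (SUP F\<in>{F. finite F \<and> F \<subseteq> A}. ennreal (sum f F))"
    using infsum_nonneg_is_SUPREMUM_ennreal[of f A] assms infsumI[OF assms(1)]
    by (auto simp: summable_on_def)
  also have "\<dots> = (SUP F\<in>{F. finite F \<and> F \<subseteq> A}. (\<Sum>x\<in>F. ennreal (f x)))"
    using assms(2) by (intro SUP_cong) (auto simp: subset_iff)
  also have "\<dots> = (\<Sum>\<^sub>\<infinity>x\<in>A. ennreal (f x))"
    by (rule nonneg_infsum_complete[symmetric]) auto
  finally show ?thesis by simp
qed

lemma summable_on_iff_infsum_ennreal: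
  fixes f :: "'a \<Rightarrow> real"
  assumes nonneg: "\<And>x. x \<in> A \<Longrightarrow> 0 \<le> f x"
  shows "f summable_on A \<longleftrightarrow> (\<Sum>\<^sub>\<infinity>x\<in>A. ennreal (f x)) < \<infinity>"
proof
  assume "f summable_on A"
  thus "(\<Sum>\<^sub>\<infinity>x\<in>A. ennreal (f x)) < \<infinity>"
    using has_sum_ennreal[OF has_sum_infsum[of f A] nonneg] by simp
next
  assume fin: "(\<Sum>\<^sub>\<infinity>x\<in>A. ennreal (f x)) < \<infinity>"
  have "sum f F \<le> enn2real (\<Sum>\<^sub>\<infinity>x\<in>A. ennreal (f x))" if "finite F" "F \<subseteq> A" for F
  proof -
    have "ennreal (sum f F) = (\<Sum>x\<in>F. ennreal (f x))" using nonneg that by (auto simp: subset_iff)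
    also have "\<dots> \<le> (\<Sum>\<^sub>\<infinity>x\<in>A. ennreal (f x))"
      unfolding nonneg_infsum_complete[of A "\<lambda>x. ennreal (f x)", OF zero_le] using that by (intro SUP_upper) auto
    finally have "enn2real (ennreal (sum f F)) \<le> enn2real (\<Sum>\<^sub>\<infinity>x\<in>A. ennreal (f x))"
      using fin by (intro enn2real_mono) auto
    thus ?thesis using nonneg that by (simp add: sum_nonneg subset_iff)
  qed
  thus "f summable_on A"
    using nonneg by (intro nonneg_bdd_above_summable_on) (auto intro!: bdd_aboveI)
qed

lemma infsum_ennreal_finite_sum:
  fixes f :: "'a \<Rightarrow> 'b \<Rightarrow> ennreal"
  assumes "finite F"
  shows "(\<Sum>x\<in>F. \<Sum>\<^sub>\<infinity>y\<in>B. f x y) = (\<Sum>\<^sub>\<infinity>y\<in>B. \<Sum>x\<in>F. f x y)"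
  using assms
proof (induction F rule: finite_induct)
  case (insert x F)
  have "(\<Sum>\<^sub>\<infinity>y\<in>B. f x y + (\<Sum>x\<in>F. f x y)) = (\<Sum>\<^sub>\<infinity>y\<in>B. f x y) + (\<Sum>\<^sub>\<infinity>y\<in>B. \<Sum>x\<in>F. f x y)"
    by (rule infsum_add) (auto intro: nonneg_summable_on_complete)
  thus ?case using insert by simp
qed simp

text \<open>The outer sum on the left is a supremum of finite sums, and a finite sum may be moved
  inside. Exchanging the roles of the two index sets gives the reverse inequality, so the order of
  summation is free without any summability assumption.\<close>

lemma infsum_swap_ennreal_le:
  fixes f :: "'a \<Rightarrow> 'b \<Rightarrow> ennreal"
  shows "(\<Sum>\<^sub>\<infinity>x\<in>A. \<Sum>\<^sub>\<infinity>y\<in>B. f x y) \<le> (\<Sum>\<^sub>\<infinity>y\<in>B. \<Sum>\<^sub>\<infinity>x\<in>A. f x y)"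
  unfolding nonneg_infsum_complete[of A "\<lambda>x. \<Sum>\<^sub>\<infinity>y\<in>B. f x y", OF zero_le]
proof (rule SUP_least)
  fix F assume F: "F \<in> {F. finite F \<and> F \<subseteq> A}"
  have "(\<Sum>x\<in>F. f x y) \<le> (\<Sum>\<^sub>\<infinity>x\<in>A. f x y)" for y
    unfolding nonneg_infsum_complete[of A "\<lambda>x. f x y", OF zero_le] using F by (intro SUP_upper) auto
  hence "(\<Sum>\<^sub>\<infinity>y\<in>B. \<Sum>x\<in>F. f x y) \<le> (\<Sum>\<^sub>\<infinity>y\<in>B. \<Sum>\<^sub>\<infinity>x\<in>A. f x y)"
    by (intro infsum_mono) (auto intro: nonneg_summable_on_complete)
  thus "(\<Sum>x\<in>F. \<Sum>\<^sub>\<infinity>y\<in>B. f x y) \<le> (\<Sum>\<^sub>\<infinity>y\<in>B. \<Sum>\<^sub>\<infinity>x\<in>A. f x y)"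
    using F by (simp add: infsum_ennreal_finite_sum)
qed

lemma infsum_swap_ennreal:
  fixes f :: "'a \<Rightarrow> 'b \<Rightarrow> ennreal"
  shows "(\<Sum>\<^sub>\<infinity>x\<in>A. \<Sum>\<^sub>\<infinity>y\<in>B. f x y) = (\<Sum>\<^sub>\<infinity>y\<in>B. \<Sum>\<^sub>\<infinity>x\<in>A. f x y)"
  by (intro antisym infsum_swap_ennreal_le)

lemma square_summable_bound:
  fixes f :: "'a \<Rightarrow> 'b::real_normed_vector" and g :: "'a \<Rightarrow> 'c::real_normed_vector"
  assumes "(\<lambda>k. (norm (g k))\<^sup>2) summable_on K" "\<And>k. k \<in> K \<Longrightarrow> norm (f k) \<le> C * norm (g k)"
  shows "(\<lambda>k. (norm (f k))\<^sup>2) summable_on K"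
proof (rule summable_on_comparison_test)
  show "(\<lambda>k. C\<^sup>2 * (norm (g k))\<^sup>2) summable_on K"
    using assms(1) by (rule summable_on_cmult_right)
  show "(norm (f k))\<^sup>2 \<le> C\<^sup>2 * (norm (g k))\<^sup>2" if "k \<in> K" for k
    using power_mono[OF assms(2)[OF that], of 2] by (simp add: power_mult_distrib)
qed auto

section \<open>Bounded operators that are diagonal in a basis: uniqueness, trace,
  compactness\<close>

context orthonormal_basis
begin

lemma hnorm_e [simp]: "k \<in> K \<Longrightarrow> hnorm H (e k) = 1"
  by (simp add: hnorm_def ip_e)

lemma inj_e: "inj_on e K"
  using ip_e by (intro inj_onI) (metis zero_neq_one)

lemma is_onb_image: "is_onb H (e ` K)"
  using inj_onD[OF inj_e] total by (auto simp: is_onb_def ip_e)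

lemma is_onb_some: "is_onb H (SOME B. is_onb H B)"
  using is_onb_image by (rule someI)

lemma hnorm_le_of_coef_le:
  assumes x: "x \<in> carrier H" and y: "y \<in> carrier H" and C: "C \<ge> 0"
    and le: "\<And>k. k \<in> K \<Longrightarrow> cmod (ip H x (e k)) \<le> C * cmod (ip H y (e k))"
  shows "hnorm H x \<le> C * hnorm H y"
proof -
  have "(hnorm H x)\<^sup>2 \<le> C\<^sup>2 * (hnorm H y)\<^sup>2"
    by (rule has_sum_mono[OF Parseval[OF x] has_sum_cmult_right[OF Parseval[OF y]]])
       (use power_mono[OF le, of _ 2] in \<open>auto simp: power_mult_distrib\<close>)
  hence "(hnorm H x)\<^sup>2 \<le> (C * hnorm H y)\<^sup>2" by (simp add: power_mult_distrib)
  thus ?thesis using C y by (rule_tac power2_le_imp_le) auto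
qed

text \<open>A relation and not an operator, since it is to be established for
  \<open>resolvent_op\<close> and \<open>op_powr\<close>, which are given by choice and description.
  Everything later needed about them follows from it.\<close>

definition acts_diagonally :: "('h \<Rightarrow> 'h) \<Rightarrow> ('k \<Rightarrow> real) \<Rightarrow> bool" where
  "acts_diagonally T l \<longleftrightarrow>
    (\<forall>x\<in>carrier H. T x \<in> carrier H \<and> (\<forall>k\<in>K. ip H (T x) (e k) = l k * ip H x (e k)))"

lemma acts_diagonally_ex:
  assumes "\<And>k. k \<in> K \<Longrightarrow> \<bar>l k\<bar> \<le> C"
  obtains T where "acts_diagonally T l" "T \<in> extensional (carrier H)"
proof -
  have "\<exists>y. y \<in> carrier H \<and> (\<forall>k\<in>K. ip H y (e k) = l k * ip H x (e k))" if x: "x \<in> carrier H" for x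
  proof -
    have "(\<lambda>k. (cmod (l k * ip H x (e k)))\<^sup>2) summable_on K"
      by (rule square_summable_bound[OF coef_summable[OF x], of _ C])
         (use assms in \<open>auto simp: norm_mult intro!: mult_right_mono\<close>)
    thus ?thesis using Riesz_Fischer[of "\<lambda>k. l k * ip H x (e k)"] by metis
  qed
  then obtain T where "\<And>x. x \<in> carrier H \<Longrightarrow> T x \<in> carrier H \<and> (\<forall>k\<in>K. ip H (T x) (e k) = l k * ip H x (e k))"
    by metis
  thus ?thesis by (intro that[of "restrict T (carrier H)"]) (auto simp: acts_diagonally_def)
qed

lemma bounded_op_acts_diagonally:
  assumes T: "acts_diagonally T l" and l: "\<And>k. k \<in> K \<Longrightarrow> \<bar>l k\<bar> \<le> C"
  shows "bounded_op H T"
proof -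
  have [simp]: "T x \<in> carrier H" "k \<in> K \<Longrightarrow> ip H (T x) (e k) = l k * ip H x (e k)"
    if "x \<in> carrier H" for x k using T that by (auto simp: acts_diagonally_def)
  have "T (x \<oplus> y) = T x \<oplus> T y" if "x \<in> carrier H" "y \<in> carrier H" for x y
    by (rule coef_eqI) (use that in \<open>auto simp: ip_add_left algebra_simps\<close>)
  moreover have "T (c \<odot> x) = c \<odot> T x" if "x \<in> carrier H" for x c
    by (rule coef_eqI) (use that in \<open>auto simp: ip_smult_left algebra_simps\<close>)
  moreover have "hnorm H (T x) \<le> \<bar>C\<bar> * hnorm H x" if "x \<in> carrier H" for x
    using that l by (intro hnorm_le_of_coef_le) (auto simp: norm_mult intro!: mult_right_mono order.trans[OF l])
  ultimately show ?thesis unfolding bounded_op_def by (intro conjI exI[of _ "\<bar>C\<bar>"]) auto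
qed

lemma bounded_opE:
  assumes "bounded_op H T"
  obtains C where "C \<ge> 0" "\<And>x. x \<in> carrier H \<Longrightarrow> hnorm H (T x) \<le> C * hnorm H x"
proof -
  obtain C where C: "\<forall>x\<in>carrier H. hnorm H (T x) \<le> C * hnorm H x"
    using assms unfolding bounded_op_def by blast
  show ?thesis
  proof (rule that[of "\<bar>C\<bar>"])
    fix x assume x: "x \<in> carrier H"
    have "C * hnorm H x \<le> \<bar>C\<bar> * hnorm H x" using x by (intro mult_right_mono) auto
    thus "hnorm H (T x) \<le> \<bar>C\<bar> * hnorm H x" using C x by fastforce
  qed simp
qed

lemma bounded_op_zero:
  assumes "bounded_op H S"
  shows "S \<zero> = \<zero>"
proof -
  have S: "S \<zero> \<in> carrier H" using assms by (auto simp: bounded_op_def)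
  obtain C where "\<And>x. x \<in> carrier H \<Longrightarrow> hnorm H (S x) \<le> C * hnorm H x"
    using assms by (rule bounded_opE) blast
  from this[of \<zero>] show ?thesis using S hnorm_nonneg[OF S] by (simp add: hnorm_eq_0)
qed

lemma comb_insert:
  assumes "finite F" "insert k F \<subseteq> K" "k \<notin> F"
  shows "comb c (insert k F) = c k \<odot> e k \<oplus> comb c F"
  using assms by (intro coef_eqI) (auto simp: comb_in coef_comb ip_add_left ip_smult_left ip_e)

text \<open>Agreement passes from the basis to finite combinations by linearity and from there to
  all vectors by continuity. This yields the uniqueness that the description in
  \<open>op_powr\<close> requires.\<close>

lemma bounded_op_eqI:
  assumes S: "bounded_op H S" and T: "bounded_op H T" and eq: "\<And>k. k \<in> K \<Longrightarrow> S (e k) = T (e k)"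
    and x: "x \<in> carrier H"
  shows "S x = T x"
proof -
  have comb_eq: "S (comb c F) = T (comb c F)" if "finite F" "F \<subseteq> K" for c F
    using that
  proof (induction F rule: finite_induct)
    case empty
    have "comb c {} = \<zero>" by (rule total) (auto simp: comb_in coef_comb)
    thus ?case using S T by (simp add: bounded_op_zero)
  next
    case (insert k F)
    thus ?case using S T eq by (simp add: comb_insert bounded_op_def comb_in)
  qed
  have ST: "S y \<in> carrier H" "T y \<in> carrier H" if "y \<in> carrier H" for y
    using S T that by (auto simp: bounded_op_def)
  obtain C1 where C1: "C1 \<ge> 0" "\<And>y. y \<in> carrier H \<Longrightarrow> hnorm H (S y) \<le> C1 * hnorm H y"
    using S by (rule bounded_opE) (rule that)
  obtain C2 where C2: "C2 \<ge> 0" "\<And>y. y \<in> carrier H \<Longrightarrow> hnorm H (T y) \<le> C2 * hnorm H y"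
    using T by (rule bounded_opE) (rule that)
  define C where "C = C1 + C2 + 1"
  have C: "C > 0" using C1(1) C2(1) by (simp add: C_def)
  have "hnorm H (S x \<ominus> T x) \<le> 0 + \<epsilon>" if \<epsilon>: "\<epsilon> > 0" for \<epsilon>
  proof -
    have \<epsilon>C: "\<epsilon> / C > 0" using \<epsilon> C by simp
    then obtain F where F: "finite F" "F \<subseteq> K" "hnorm H (x \<ominus> comb (\<lambda>k. ip H x (e k)) F) < \<epsilon> / C"
      using comb_approx[OF x \<epsilon>C] by (metis order_refl)
    define y where "y = comb (\<lambda>k. ip H x (e k)) F"
    define z where "z = x \<ominus> y"
    have y: "y \<in> carrier H" and z: "z \<in> carrier H" using F x by (auto simp: y_def z_def comb_in)
    have "x = z \<oplus> y" using x y by (simp add: z_def M.minus_eq M.a_assoc M.l_neg)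
    hence "S x = S z \<oplus> S y" "T x = T z \<oplus> T y" using S T y z by (auto simp: bounded_op_def)
    hence "S x \<ominus> T x = S z \<ominus> T z"
      using comb_eq[OF F(1,2)] y z ST by (intro coef_eqI) (auto simp: y_def ip_minus_left ip_add_left)
    hence "hnorm H (S x \<ominus> T x) \<le> hnorm H (S z) + hnorm H (T z)"
      using hnorm_triangle_minus[of "S z" \<zero> "T z"] hnorm_minus_commute[of \<zero> "T z"] ST[OF z] by simp
    also have "\<dots> \<le> C1 * hnorm H z + C2 * hnorm H z" using C1 C2 z by (intro add_mono) auto
    also have "\<dots> \<le> C * hnorm H z"
      using z by (simp add: C_def algebra_simps)
    also have "\<dots> \<le> C * (\<epsilon> / C)"
      using F(3) C by (intro mult_left_mono) (auto simp: z_def y_def)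
    also have "\<dots> = \<epsilon>" using C by simp
    finally show ?thesis by simp
  qed
  hence "hnorm H (S x \<ominus> T x) = 0"
    using ST x hnorm_nonneg[of "S x \<ominus> T x"] by (rule_tac antisym[OF field_le_epsilon]) auto
  thus ?thesis using ST x by (simp add: hnorm_eq_0 minus_eq_zero_iff)
qed

text \<open>The basis \<open>B\<close> picked by the trace is unrelated to \<open>e\<close>. Each
  diagonal entry with respect to \<open>B\<close> is expanded in the basis \<open>e\<close>; after
  the order of summation is exchanged, Parseval with respect to \<open>B\<close> turns the inner sum
  into the squared norm of \<open>e k\<close>, which is 1.\<close>

lemma op_trace_acts_diagonally:
  assumes T: "acts_diagonally T l" and l: "\<And>k. k \<in> K \<Longrightarrow> 0 \<le> l k"
  shows "op_trace H T = (\<Sum>\<^sub>\<infinity>k\<in>K. ennreal (l k))"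
proof -
  define B where "B = (SOME B. is_onb H B)"
  have B: "is_onb H B" unfolding B_def by (rule is_onb_some)
  interpret B: orthonormal_basis H B "\<lambda>b. b"
    by unfold_locales (use B in \<open>auto simp: is_onb_def\<close>)
  have "ennreal (Re (ip H (T b) b)) = (\<Sum>\<^sub>\<infinity>k\<in>K. ennreal (l k * (cmod (ip H b (e k)))\<^sup>2))" if b: "b \<in> B" for b
  proof -
    have bH: "b \<in> carrier H" "T b \<in> carrier H" using b B T by (auto simp: acts_diagonally_def)
    have "((\<lambda>k. l k * ip H b (e k) * cnj (ip H b (e k))) has_sum ip H (T b) b) K"
      using Parseval_ip[OF bH(2,1)] T bH by (simp add: acts_diagonally_def cong: has_sum_cong)
    hence "((\<lambda>k. Re (l k * ip H b (e k) * cnj (ip H b (e k)))) has_sum Re (ip H (T b) b)) K"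
      by (rule has_sum_Re)
    moreover have "Re (l k * ip H b (e k) * cnj (ip H b (e k))) = l k * (cmod (ip H b (e k)))\<^sup>2" for k
      by (simp add: mult.assoc complex_norm_square[symmetric])
    ultimately have "((\<lambda>k. l k * (cmod (ip H b (e k)))\<^sup>2) has_sum Re (ip H (T b) b)) K" by simp
    thus ?thesis using l by (intro has_sum_ennreal[symmetric]) auto
  qed
  hence "op_trace H T = (\<Sum>\<^sub>\<infinity>b\<in>B. \<Sum>\<^sub>\<infinity>k\<in>K. ennreal (l k * (cmod (ip H b (e k)))\<^sup>2))"
    unfolding op_trace_def B_def[symmetric] by (rule infsum_cong)
  also have "\<dots> = (\<Sum>\<^sub>\<infinity>k\<in>K. \<Sum>\<^sub>\<infinity>b\<in>B. ennreal (l k * (cmod (ip H b (e k)))\<^sup>2))"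
    by (rule infsum_swap_ennreal)
  also have "\<dots> = (\<Sum>\<^sub>\<infinity>k\<in>K. ennreal (l k))"
  proof (rule infsum_cong)
    fix k assume k: "k \<in> K"
    have "((\<lambda>b. l k * (cmod (ip H (e k) b))\<^sup>2) has_sum l k * (hnorm H (e k))\<^sup>2) B"
      using k by (intro has_sum_cmult_right B.Parseval) auto
    moreover have "cmod (ip H (e k) b) = cmod (ip H b (e k))" if "b \<in> B" for b
      using ip_commute[of b "e k"] k that by simp
    ultimately have "((\<lambda>b. l k * (cmod (ip H b (e k)))\<^sup>2) has_sum l k) B"
      using k has_sum_cong[of B "\<lambda>b. l k * (cmod (ip H (e k) b))\<^sup>2" "\<lambda>b. l k * (cmod (ip H b (e k)))\<^sup>2"] by simp
    thus "(\<Sum>\<^sub>\<infinity>b\<in>B. ennreal (l k * (cmod (ip H b (e k)))\<^sup>2)) = ennreal (l k)"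
      using l[OF k] by (intro has_sum_ennreal) auto
  qed
  finally show ?thesis .
qed

lemma image_unit_ballE:
  assumes "y \<in> T ` {x \<in> carrier H. hnorm H x \<le> 1}"
  obtains x where "x \<in> carrier H" "hnorm H x \<le> 1" "y = T x"
  using assms by auto

text \<open>Only finitely many coordinates have a large factor \<open>l k\<close>. On those the
  image of the unit ball is bounded in finitely many dimensions and has a finite net; the other
  coordinates of the image are uniformly small. Total boundedness yields a compact closure because
  the space is complete.\<close>

lemma compact_op_acts_diagonally:
  assumes T: "acts_diagonally T l" and fin: "\<And>\<epsilon>. \<epsilon> > 0 \<Longrightarrow> finite {k\<in>K. \<bar>l k\<bar> > \<epsilon>}"
    and l: "\<And>k. k \<in> K \<Longrightarrow> \<bar>l k\<bar> \<le> C"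
  shows "compact_op H T"
proof -
  have [simp]: "T x \<in> carrier H" "k \<in> K \<Longrightarrow> ip H (T x) (e k) = l k * ip H x (e k)"
    if "x \<in> carrier H" for x k using T that by (auto simp: acts_diagonally_def)
  let ?S = "T ` {x \<in> carrier H. hnorm H x \<le> 1}"
  have "hmetric.mtotally_bounded ?S"
    unfolding hmetric.mtotally_bounded_def
  proof (intro allI impI)
    fix \<epsilon> :: real assume \<epsilon>: "\<epsilon> > 0"
    \<comment> \<open>Two points of the unit ball differ by a vector of norm at most 2, so the
      coordinates outside \<open>F\<close> contribute at most (\<epsilon>/4)^2 * 2^2 =
      (\<epsilon>/2)^2 to the squared distance of their images. The value of \<open>\<delta>\<close>
      is chosen to achieve the same bound for the coordinates in \<open>F\<close>; the sum is below
      \<epsilon>^2.\<close>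
    define F where "F = {k\<in>K. \<bar>l k\<bar> > \<epsilon> / 4}"
    have F: "finite F" "F \<subseteq> K" using fin[of "\<epsilon> / 4"] \<epsilon> by (auto simp: F_def)
    define \<delta> where "\<delta> = \<epsilon> / (4 * (real (card F) + 1))"
    have \<delta>: "\<delta> > 0" unfolding \<delta>_def using \<epsilon> by (intro divide_pos_pos) auto
    obtain N :: "complex set" where N: "finite N" "cball 0 \<bar>C\<bar> \<subseteq> (\<Union>z\<in>N. ball z \<delta>)"
    proof (rule compactE_image[OF compact_cball, of "cball 0 \<bar>C\<bar>" "\<lambda>z::complex. ball z \<delta>" 0 "\<bar>C\<bar>"])
      show "cball 0 \<bar>C\<bar> \<subseteq> (\<Union>z\<in>cball 0 \<bar>C\<bar>. ball z \<delta>)" using \<delta> by force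
    qed auto
    \<comment> \<open>Points of the image whose coordinates in \<open>F\<close> have the same neighbours in the net \<open>N\<close> are close to
      each other.\<close>
    define n where "n y k = (SOME z. z \<in> N \<and> dist z (ip H y (e k)) < \<delta>)" for y k
    have n: "n y k \<in> N \<and> dist (n y k) (ip H y (e k)) < \<delta>" if yS: "y \<in> ?S" and kF: "k \<in> F" for y k
    proof -
      obtain x where x: "x \<in> carrier H" "hnorm H x \<le> 1" "y = T x" using yS by (rule image_unit_ballE)
      have k: "k \<in> K" using kF F by auto
      have "cmod (ip H x (e k)) \<le> 1" using Cauchy_Schwarz[of x "e k"] x k by simp
      hence "cmod (ip H y (e k)) \<le> \<bar>C\<bar> * 1"
        using x k l[OF k] mult_mono[of "\<bar>l k\<bar>" "\<bar>C\<bar>" "cmod (ip H x (e k))" 1] by (simp add: norm_mult)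
      hence "ip H y (e k) \<in> cball 0 \<bar>C\<bar>" by simp
      hence "\<exists>z. z \<in> N \<and> dist z (ip H y (e k)) < \<delta>" using N(2) by (auto simp: subset_iff)
      thus ?thesis unfolding n_def by (rule someI_ex)
    qed
    define g where "g y = restrict (n y) F" for y
    have "g ` ?S \<subseteq> F \<rightarrow>\<^sub>E N" using n by (auto simp: g_def)
    hence fing: "finite (g ` ?S)" using F N by (meson finite_PiE finite_subset)
    obtain P where P: "P \<subseteq> ?S" "finite P" "g ` P = g ` ?S"
      using finite_subset_image[OF fing order_refl] by metis
    have "?S \<subseteq> (\<Union>x\<in>P. hmetric.mball x \<epsilon>)"
    proof
      fix y assume y: "y \<in> ?S"
      hence "g y \<in> g ` P" unfolding P(3) by (rule imageI)
      then obtain p where p: "g y = g p" "p \<in> P" by (rule imageE)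
      have pS: "p \<in> ?S" using p(2) P(1) by (rule subsetD[rotated])
      obtain x where x: "x \<in> carrier H" "hnorm H x \<le> 1" "y = T x" using y by (rule image_unit_ballE)
      obtain x' where x': "x' \<in> carrier H" "hnorm H x' \<le> 1" "p = T x'" using pS by (rule image_unit_ballE)
      have c: "p \<in> carrier H" "y \<in> carrier H" using x x' by auto
      have near: "(cmod (ip H (p \<ominus> y) (e k)))\<^sup>2 \<le> (2 * \<delta>)\<^sup>2" if k: "k \<in> F" for k
      proof -
        have "n y k = n p k" using fun_cong[OF p(1), of k] k by (simp add: g_def)
        hence "dist (ip H p (e k)) (ip H y (e k)) \<le> 2 * \<delta>"
          using n[OF y k] n[OF pS k] dist_triangle3[of "ip H p (e k)" "ip H y (e k)" "n y k"] by simp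
        thus ?thesis using c k F by (intro power_mono) (auto simp: ip_minus_left dist_norm subset_iff)
      qed
      define w where "w = x' \<ominus> x"
      have w: "w \<in> carrier H" using x x' by (simp add: w_def)
      have "hnorm H w \<le> 2"
        using hnorm_triangle_minus[of x' \<zero> x] hnorm_minus_commute[of \<zero> x] x x' by (simp add: w_def)
      have "(hnorm H (p \<ominus> y))\<^sup>2 \<le> real (card F) * (2 * \<delta>)\<^sup>2 + (\<epsilon> / 4)\<^sup>2 * (hnorm H w)\<^sup>2"
      proof (rule has_sum_le_finite_sums[OF Parseval])
        fix G assume G: "finite G" "G \<subseteq> K"
        have "(\<Sum>k\<in>G. (cmod (ip H (p \<ominus> y) (e k)))\<^sup>2)
          = (\<Sum>k\<in>G \<inter> F. (cmod (ip H (p \<ominus> y) (e k)))\<^sup>2) + (\<Sum>k\<in>G - F. (cmod (ip H (p \<ominus> y) (e k)))\<^sup>2)"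
          using G by (simp add: sum.Int_Diff)
        also have "(\<Sum>k\<in>G \<inter> F. (cmod (ip H (p \<ominus> y) (e k)))\<^sup>2) \<le> real (card (G \<inter> F)) * (2 * \<delta>)\<^sup>2"
          using near by (intro sum_bounded_above) auto
        also have "\<dots> \<le> real (card F) * (2 * \<delta>)\<^sup>2"
          using F by (intro mult_right_mono) (auto intro: card_mono)
        also have "(\<Sum>k\<in>G - F. (cmod (ip H (p \<ominus> y) (e k)))\<^sup>2) \<le> (\<Sum>k\<in>G - F. (\<epsilon> / 4)\<^sup>2 * (cmod (ip H w (e k)))\<^sup>2)"
        proof (rule sum_mono)
          fix k assume k: "k \<in> G - F"
          hence kK: "k \<in> K" using G by auto
          have "ip H (p \<ominus> y) (e k) = l k * ip H w (e k)"
            using x x' c kK by (simp add: ip_minus_left w_def algebra_simps)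
          moreover have "\<bar>l k\<bar> \<le> \<epsilon> / 4" using k kK by (auto simp: F_def)
          ultimately have "cmod (ip H (p \<ominus> y) (e k)) \<le> \<epsilon> / 4 * cmod (ip H w (e k))"
            using mult_right_mono[of "\<bar>l k\<bar>" "\<epsilon> / 4" "cmod (ip H w (e k))"] by (simp add: norm_mult)
          thus "(cmod (ip H (p \<ominus> y) (e k)))\<^sup>2 \<le> (\<epsilon> / 4)\<^sup>2 * (cmod (ip H w (e k)))\<^sup>2"
            unfolding power_mult_distrib[symmetric] by (rule power_mono) simp
        qed
        also have "\<dots> \<le> (\<epsilon> / 4)\<^sup>2 * (hnorm H w)\<^sup>2"
          unfolding sum_distrib_left[symmetric] using G w by (intro mult_left_mono Bessel) auto
        finally show "(\<Sum>k\<in>G. (cmod (ip H (p \<ominus> y) (e k)))\<^sup>2)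
          \<le> real (card F) * (2 * \<delta>)\<^sup>2 + (\<epsilon> / 4)\<^sup>2 * (hnorm H w)\<^sup>2" by simp
      qed (use c in auto)
      also have "(\<epsilon> / 4)\<^sup>2 * (hnorm H w)\<^sup>2 \<le> (\<epsilon> / 4)\<^sup>2 * 2\<^sup>2"
        using \<open>hnorm H w \<le> 2\<close> w by (intro mult_left_mono power_mono) auto
      also have "real (card F) * (2 * \<delta>)\<^sup>2 \<le> (real (card F) + 1)\<^sup>2 * (2 * \<delta>)\<^sup>2"
        by (intro mult_right_mono) (auto simp: power2_eq_square algebra_simps)
      also have "\<dots> = (\<epsilon> / 2)\<^sup>2"
      proof -
        have "(real (card F) + 1) * (2 * \<delta>) = \<epsilon> / 2"
          unfolding \<delta>_def by (simp add: divide_simps)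
        thus ?thesis by (simp only: power_mult_distrib[symmetric])
      qed
      finally have "(hnorm H (p \<ominus> y))\<^sup>2 \<le> (\<epsilon> / 2)\<^sup>2 + (\<epsilon> / 4)\<^sup>2 * 2\<^sup>2" by simp
      also have "\<dots> < \<epsilon>\<^sup>2" using \<epsilon> by (simp add: power2_eq_square field_simps)
      finally have "hnorm H (p \<ominus> y) < \<epsilon>" using \<epsilon> c by (simp add: power_less_imp_less_base)
      thus "y \<in> (\<Union>x\<in>P. hmetric.mball x \<epsilon>)" using p(2) c by (intro UN_I[of p]) (simp_all add: hdist_def)
    qed
    thus "\<exists>K. finite K \<and> K \<subseteq> ?S \<and> ?S \<subseteq> (\<Union>x\<in>K. hmetric.mball x \<epsilon>)"
      using P(1,2) by (intro exI[of _ P] conjI)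
  qed
  hence "compactin (htop H) (htop H closure_of ?S)"
    using hmetric.mtotally_bounded_eq_compact_closure_of[OF complete, of ?S] by (simp add: htop_eq)
  thus ?thesis using bounded_op_acts_diagonally[OF T l] by (simp add: compact_op_def)
qed

end

text \<open>Axiomatized by domain and coefficients instead of through \<open>diagonal_op\<close>, so
  that it also covers the Dirac operator of the direct sum, which is a \<open>direct_sum_op\<close>
  with a basis indexed by a dependent sum.\<close>

locale diagonal_operator = orthonormal_basis +
  fixes D :: "'a \<rightharpoonup> 'a" and \<mu> :: "'c \<Rightarrow> real"
  assumes dom_D: "dom D = {x \<in> carrier H. (\<lambda>k. (cmod (\<mu> k * ip H x (e k)))\<^sup>2) summable_on K}"
    and D_in: "x \<in> dom D \<Longrightarrow> the (D x) \<in> carrier H"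
    and coef_D: "\<lbrakk>x \<in> dom D; k \<in> K\<rbrakk> \<Longrightarrow> ip H (the (D x)) (e k) = \<mu> k * ip H x (e k)"
begin

lemma dom_in: "x \<in> dom D \<Longrightarrow> x \<in> carrier H"
  by (simp add: dom_D)

lemma D_Some_iff: "D x = Some y \<longleftrightarrow> x \<in> dom D \<and> y = the (D x)"
  by auto

lemma comb_in_dom:
  assumes F: "finite F" "F \<subseteq> K"
  shows "comb c F \<in> dom D"
proof -
  have "(\<lambda>k. (cmod (\<mu> k * ip H (comb c F) (e k)))\<^sup>2) summable_on K \<longleftrightarrow>
    (\<lambda>k. (cmod (\<mu> k * ip H (comb c F) (e k)))\<^sup>2) summable_on F"
    using F by (intro summable_on_cong_neutral) (auto simp: coef_comb)
  thus ?thesis using F by (simp add: dom_D comb_in)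
qed

lemma e_in_dom: "k \<in> K \<Longrightarrow> e k \<in> dom D"
proof -
  assume k: "k \<in> K"
  have "e k = comb (\<lambda>_. 1) {k}" using k by (intro coef_eqI) (auto simp: ip_e coef_comb comb_in)
  thus ?thesis using comb_in_dom[of "{k}"] k by simp
qed

lemma D_e: "k \<in> K \<Longrightarrow> the (D (e k)) = complex_of_real (\<mu> k) \<odot> e k"
  using e_in_dom by (intro coef_eqI) (auto simp: D_in coef_D ip_smult_left ip_e)

lemma densely_defined_D: "densely_defined H D"
proof -
  have "\<exists>y\<in>dom D. y \<in> hmetric.mball x r" if x: "x \<in> carrier H" and r: "r > 0" for x r
  proof -
    obtain F where "finite F" "F \<subseteq> K" "hnorm H (x \<ominus> comb (\<lambda>k. ip H x (e k)) F) < r"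
      using comb_approx[OF x r] by (metis order_refl)
    thus ?thesis using x comb_in_dom by (intro bexI[of _ "comb (\<lambda>k. ip H x (e k)) F"]) (auto simp: hdist_def comb_in)
  qed
  thus ?thesis by (auto simp: densely_defined_def htop_eq hmetric.metric_closure_of)
qed

lemma linear_op_D: "linear_op H D"
proof -
  have add: "x \<oplus> y \<in> dom D" if "x \<in> dom D" "y \<in> dom D" for x y
  proof -
    have "(\<lambda>k. (cmod (ip H (the (D x) \<oplus> the (D y)) (e k)))\<^sup>2) summable_on K"
      using that by (intro coef_summable) (auto simp: D_in)
    thus ?thesis using that
      by (simp add: dom_in ip_add_left D_in coef_D dom_D[THEN eqset_imp_iff, of "x \<oplus> y"] distrib_left cong: summable_on_cong)
  qed
  have smult: "c \<odot> x \<in> dom D" if "x \<in> dom D" for x c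
  proof -
    have "(\<lambda>k. (cmod (ip H (c \<odot> the (D x)) (e k)))\<^sup>2) summable_on K"
      using that by (intro coef_summable) (auto simp: D_in)
    thus ?thesis using that
      by (simp add: dom_in ip_smult_left D_in coef_D dom_D[THEN eqset_imp_iff, of "c \<odot> x"] mult_ac cong: summable_on_cong)
  qed
  have "D (x \<oplus> y) = Some (the (D x) \<oplus> the (D y))" if "x \<in> dom D" "y \<in> dom D" for x y
  proof -
    have "the (D x) \<oplus> the (D y) = the (D (x \<oplus> y))"
      using that add by (intro coef_eqI) (auto simp: D_in coef_D ip_add_left dom_in distrib_left)
    thus ?thesis using add that by (simp add: D_Some_iff)
  qed
  moreover have "D (c \<odot> x) = Some (c \<odot> the (D x))" if "x \<in> dom D" for x c
  proof -
    have "c \<odot> the (D x) = the (D (c \<odot> x))"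
      using that smult by (intro coef_eqI) (auto simp: D_in coef_D ip_smult_left dom_in)
    thus ?thesis using smult that by (simp add: D_Some_iff)
  qed
  moreover have "ran D \<subseteq> carrier H" using D_in by (force simp: ran_def)
  moreover have "\<zero> \<in> dom D" by (simp add: dom_D cong: summable_on_cong)
  ultimately show ?thesis using dom_in unfolding linear_op_def by blast
qed

lemma symmetric_D:
  assumes "x \<in> dom D" "y \<in> dom D"
  shows "ip H (the (D x)) y = ip H x (the (D y))"
proof -
  have "((\<lambda>k. \<mu> k * ip H x (e k) * cnj (ip H y (e k))) has_sum ip H (the (D x)) y) K"
    using Parseval_ip[of "the (D x)" y] assms by (simp add: D_in dom_in coef_D cong: has_sum_cong)
  moreover have "((\<lambda>k. \<mu> k * ip H x (e k) * cnj (ip H y (e k))) has_sum ip H x (the (D y))) K"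
    using Parseval_ip[of x "the (D y)"] assms by (simp add: D_in dom_in coef_D mult_ac cong: has_sum_cong)
  ultimately show ?thesis using has_sum_unique by blast
qed

text \<open>Testing the adjoint relation on the basis vectors, which lie in the domain, forces the
  coefficients of \<open>z\<close> to be \<open>\<mu> k\<close> times those of \<open>y\<close>. As
  the coefficients of \<open>z\<close> are square summable, \<open>y\<close> belongs to the domain
  of \<open>D\<close>. The converse is symmetry.\<close>

lemma self_adjoint_D: "self_adjoint H D"
proof -
  have "adjoint_op H D y = D y" for y
  proof (cases "y \<in> carrier H \<and> (\<exists>z\<in>carrier H. \<forall>x\<in>dom D. ip H (the (D x)) y = ip H x z)")
    case True
    then obtain z where y: "y \<in> carrier H" and z: "z \<in> carrier H"
      "\<And>x. x \<in> dom D \<Longrightarrow> ip H (the (D x)) y = ip H x z" by auto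
    have coef: "ip H w (e k) = \<mu> k * ip H y (e k)" if k: "k \<in> K" and w: "w \<in> carrier H"
      "\<forall>x\<in>dom D. ip H (the (D x)) y = ip H x w" for k w
    proof -
      have "ip H (e k) w = \<mu> k * ip H (e k) y"
        using w e_in_dom[OF k] k y by (simp add: D_e ip_smult_left flip: w(2)[rule_format])
      thus ?thesis using k y w ip_commute[of "e k" w] ip_commute[of "e k" y] by simp
    qed
    have ydom: "y \<in> dom D"
      using coef_summable[OF z(1)] coef[OF _ z(1)] z(2) y by (simp add: dom_D cong: summable_on_cong)
    have "(THE z. z \<in> carrier H \<and> (\<forall>x\<in>dom D. ip H (the (D x)) y = ip H x z)) = the (D y)"
    proof (rule the_equality, intro conjI ballI)
      show "the (D y) \<in> carrier H" using D_in[OF ydom] .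
      show "ip H (the (D x)) y = ip H x (the (D y))" if "x \<in> dom D" for x
        using symmetric_D[OF that ydom] .
      fix w assume w: "w \<in> carrier H \<and> (\<forall>x\<in>dom D. ip H (the (D x)) y = ip H x w)"
      show "w = the (D y)"
        by (rule coef_eqI) (use w coef[of _ w] ydom in \<open>simp_all add: D_in coef_D del: domIff\<close>)
    qed
    thus ?thesis using True ydom by (auto simp: adjoint_op_def)
  next
    case False
    hence "y \<notin> dom D" using symmetric_D D_in dom_in by blast
    thus ?thesis using False by (auto simp: adjoint_op_def domIff)
  qed
  thus ?thesis using linear_op_D densely_defined_D by (auto simp: self_adjoint_def)
qed

text \<open>\<open>inv_into\<close> yields a meaningful value only where a preimage exists, and then
  an arbitrary one. Dividing coefficients by \<open>1 + (\<mu> k)\<^sup>2\<close> gives a preimage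
  \<open>y\<close> of \<open>x\<close>; whichever preimage \<open>z\<close> is chosen, its
  coefficients are forced by the equation \<open>z \<oplus> D (D z) = x\<close>.\<close>

lemma resolvent_acts_diagonally: "acts_diagonally (resolvent_op H D) (\<lambda>k. 1 / (1 + (\<mu> k)\<^sup>2))"
  unfolding acts_diagonally_def
proof (intro ballI)
  fix x assume x: "x \<in> carrier H"
  let ?Q = "id_plus_square H D"
  have Q: "?Q y = (if y \<in> dom D \<and> the (D y) \<in> dom D then Some (y \<oplus> the (D (the (D y)))) else None)" for y
    by (auto simp: id_plus_square_def map_comp_def split: option.splits)
  have pos: "1 + (\<mu> k)\<^sup>2 > 0" for k by (simp add: add_pos_nonneg)
  have pos': "1 + (complex_of_real (\<mu> k))\<^sup>2 \<noteq> 0" for k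
    using pos[of k] by (metis less_irrefl of_real_0 of_real_1 of_real_add of_real_eq_iff of_real_power)
  \<comment> \<open>These three bounds dominate the coefficients of \<open>y\<close>, of
    \<open>D y\<close> and of \<open>D (D y)\<close> by those of \<open>x\<close>, so that
    \<open>y\<close> and \<open>D y\<close> are both in the domain.\<close>
  have sq: "a / (1 + m\<^sup>2) \<le> a" "\<bar>m\<bar> * a / (1 + m\<^sup>2) \<le> a" "m\<^sup>2 * a / (1 + m\<^sup>2) \<le> a" if "a \<ge> 0" for a m :: real
  proof -
    have p: "1 + m\<^sup>2 > 0" by (simp add: add_pos_nonneg)
    have "0 \<le> (\<bar>m\<bar> - 1)\<^sup>2" by simp
    hence "2 * \<bar>m\<bar> \<le> 1 + m\<^sup>2" by (simp add: power2_diff)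
    moreover have "\<bar>m\<bar> \<ge> 0" by simp
    ultimately have "\<bar>m\<bar> \<le> 1 + m\<^sup>2" by linarith
    thus "\<bar>m\<bar> * a / (1 + m\<^sup>2) \<le> a"
      using mult_right_mono[of "\<bar>m\<bar>" "1 + m\<^sup>2" a] that p by (simp add: divide_le_eq mult.commute)
    show "a / (1 + m\<^sup>2) \<le> a" "m\<^sup>2 * a / (1 + m\<^sup>2) \<le> a"
      using that p by (simp_all add: divide_le_eq algebra_simps)
  qed
  let ?c = "\<lambda>k. ip H x (e k) / (1 + (\<mu> k)\<^sup>2)"
  have ncm: "cmod (1 + (complex_of_real (\<mu> k))\<^sup>2) = 1 + (\<mu> k)\<^sup>2" for k
    using norm_of_real[of "1 + (\<mu> k)\<^sup>2", where 'a = complex] pos[of k] by simp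
  have "(\<lambda>k. (cmod (?c k))\<^sup>2) summable_on K"
    by (rule square_summable_bound[OF coef_summable[OF x], of _ 1]) (auto simp: norm_divide ncm sq)
  then obtain y where y: "y \<in> carrier H" "\<And>k. k \<in> K \<Longrightarrow> ip H y (e k) = ?c k"
    using Riesz_Fischer[of ?c] by metis
  have "(\<lambda>k. (cmod (\<mu> k * ?c k))\<^sup>2) summable_on K"
    by (rule square_summable_bound[OF coef_summable[OF x], of _ 1]) (auto simp: norm_divide norm_mult ncm sq)
  hence ydom: "y \<in> dom D" using y by (simp add: dom_D cong: summable_on_cong)
  have "(\<lambda>k. (cmod (\<mu> k * (\<mu> k * ?c k)))\<^sup>2) summable_on K"
    by (rule square_summable_bound[OF coef_summable[OF x], of _ 1])
       (auto simp: norm_divide norm_mult norm_power ncm sq[simplified] mult.assoc[symmetric] power2_eq_square[symmetric])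
  hence Dydom: "the (D y) \<in> dom D"
    using y ydom by (simp add: dom_D[THEN eqset_imp_iff, of "the (D y)"] D_in coef_D cong: summable_on_cong)
  have "y \<oplus> the (D (the (D y))) = x"
    using x y ydom Dydom pos'
    by (intro coef_eqI) (auto simp: D_in coef_D ip_add_left power2_eq_square field_simps)
  hence "x \<in> (the \<circ> ?Q) ` dom ?Q" using ydom Dydom by (force simp: Q)
  hence R: "resolvent_op H D x \<in> dom ?Q" "(the \<circ> ?Q) (resolvent_op H D x) = x"
    unfolding resolvent_op_def by (rule inv_into_into, rule f_inv_into_f)
  define z where "z = resolvent_op H D x"
  have z: "z \<in> dom D" "the (D z) \<in> dom D" "z \<oplus> the (D (the (D z))) = x"
    using R by (auto simp: Q z_def[symmetric] domIff split: if_splits)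
  have "ip H z (e k) = complex_of_real (1 / (1 + (\<mu> k)\<^sup>2)) * ip H x (e k)" if k: "k \<in> K" for k
  proof -
    have "ip H x (e k) = (1 + (\<mu> k)\<^sup>2) * ip H z (e k)"
      using z k by (simp add: D_in coef_D ip_add_left dom_in power2_eq_square algebra_simps flip: z(3))
    thus ?thesis using pos'[of k] by simp
  qed
  thus "resolvent_op H D x \<in> carrier H \<and>
    (\<forall>k\<in>K. ip H (resolvent_op H D x) (e k) = complex_of_real (1 / (1 + (\<mu> k)\<^sup>2)) * ip H x (e k))"
    using z dom_in by (simp add: z_def)
qed

lemma resolvent_eigenvalue_le_1: "\<bar>1 / (1 + (\<mu> k)\<^sup>2)\<bar> \<le> 1"
  by (simp add: add_pos_nonneg divide_le_eq)

lemma compact_resolvent: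
  assumes fin: "\<And>R. finite {k\<in>K. \<bar>\<mu> k\<bar> \<le> R}"
  shows "compact_op H (resolvent_op H D)"
proof (rule compact_op_acts_diagonally[OF resolvent_acts_diagonally])
  fix \<epsilon> :: real assume \<epsilon>: "\<epsilon> > 0"
  have "\<bar>\<mu> k\<bar> \<le> sqrt (1 / \<epsilon>)" if "\<bar>1 / (1 + (\<mu> k)\<^sup>2)\<bar> > \<epsilon>" for k
  proof -
    have "0 < 1 + (\<mu> k)\<^sup>2" by (simp add: add_pos_nonneg)
    hence "1 + (\<mu> k)\<^sup>2 < 1 / \<epsilon>" using that \<epsilon> by (simp add: field_simps)
    hence "(\<mu> k)\<^sup>2 \<le> 1 / \<epsilon>" by simp
    thus ?thesis by (metis real_sqrt_abs real_sqrt_le_mono)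
  qed
  thus "finite {k\<in>K. \<bar>1 / (1 + (\<mu> k)\<^sup>2)\<bar> > \<epsilon>}"
    by (intro finite_subset[OF _ fin[of "sqrt (1 / \<epsilon>)"]]) auto
qed (rule resolvent_eigenvalue_le_1)

text \<open>The diagonal operator \<open>T\<close> satisfies the description, since an eigenvector
  for \<open>r\<close> has nonzero coefficients only where the eigenvalue of the resolvent equals
  \<open>r\<close>. Any competitor agrees with \<open>T\<close> on every \<open>e k\<close>, which
  is itself an eigenvector, and hence everywhere on the carrier; outside both are fixed by
  extensionality.\<close>

lemma op_powr_resolvent:
  assumes p: "p > 0"
  shows "acts_diagonally (op_powr H (resolvent_op H D) p) (\<lambda>k. (1 / (1 + (\<mu> k)\<^sup>2)) powr p)"
proof -
  let ?l = "\<lambda>k. 1 / (1 + (\<mu> k)\<^sup>2)"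
  let ?R = "resolvent_op H D"
  have l: "?l k > 0" for k by (simp add: add_pos_nonneg)
  have b: "\<bar>?l k powr p\<bar> \<le> 1" for k
    using powr_mono2[of p "?l k" 1] p l[of k] resolvent_eigenvalue_le_1[of k] by simp
  have R: "?R x \<in> carrier H" "k \<in> K \<Longrightarrow> ip H (?R x) (e k) = ?l k * ip H x (e k)"
    if "x \<in> carrier H" for x k using resolvent_acts_diagonally that by (auto simp: acts_diagonally_def)
  obtain T where T: "acts_diagonally T (\<lambda>k. ?l k powr p)" "T \<in> extensional (carrier H)"
    using acts_diagonally_ex[of "\<lambda>k. ?l k powr p" 1] b by blast
  have Tx: "T x \<in> carrier H" "k \<in> K \<Longrightarrow> ip H (T x) (e k) = ?l k powr p * ip H x (e k)"
    if "x \<in> carrier H" for x k using T that by (auto simp: acts_diagonally_def)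
  have bT: "bounded_op H T" using T b by (rule_tac bounded_op_acts_diagonally)
  have "op_powr H ?R p = T"
    unfolding op_powr_def
  proof (rule the_equality, intro conjI ballI allI impI)
    fix x and r :: real assume x: "x \<in> carrier H" and r: "r \<ge> 0" and eig: "?R x = complex_of_real r \<odot> x"
    show "T x = complex_of_real (r powr p) \<odot> x"
    proof (rule coef_eqI)
      fix k assume k: "k \<in> K"
      have "complex_of_real (?l k) * ip H x (e k) = complex_of_real r * ip H x (e k)"
        using R(2)[OF x k] x k unfolding eig by (simp add: ip_smult_left)
      hence "ip H x (e k) = 0 \<or> ?l k = r" using of_real_eq_iff mult_right_cancel by blast
      thus "ip H (T x) (e k) = ip H (complex_of_real (r powr p) \<odot> x) (e k)"
        using Tx(2)[OF x k] x k by (auto simp: ip_smult_left)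
    qed (use x Tx in auto)
  next
    fix S assume S: "bounded_op H S \<and> S \<in> extensional (carrier H) \<and>
      (\<forall>x\<in>carrier H. \<forall>r\<ge>0. ?R x = complex_of_real r \<odot> x \<longrightarrow> S x = complex_of_real (r powr p) \<odot> x)"
    have "S (e k) = T (e k)" if k: "k \<in> K" for k
    proof -
      have "?R (e k) = complex_of_real (?l k) \<odot> e k"
        using k R by (intro coef_eqI) (auto simp: ip_smult_left ip_e)
      hence "S (e k) = complex_of_real (?l k powr p) \<odot> e k" using S k l[of k] by (metis e_in less_imp_le)
      also have "\<dots> = T (e k)" using k Tx by (intro coef_eqI) (auto simp: ip_smult_left ip_e)
      finally show ?thesis .
    qed
    hence "S x = T x" if "x \<in> carrier H" for x using bounded_op_eqI S bT that by blast
    thus "S = T" using S T(2) extensionalityI by metis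
  qed (use bT T in auto)
  thus ?thesis using T by simp
qed

end

text \<open>The trace is a sum in [0,\<infinity>] whose finiteness is summability of the same
  nonnegative reals. The exponent is negative because the resolvent has reciprocal
  eigenvalues.\<close>

lemma (in diagonal_operator) trace_power_resolvent_finite_iff:
  assumes s: "s > 0"
  shows "op_trace H (op_powr H (resolvent_op H D) (s / 2)) < \<infinity> \<longleftrightarrow>
    (\<lambda>k. (1 + (\<mu> k)\<^sup>2) powr (- s / 2)) summable_on K"
proof -
  have "op_trace H (op_powr H (resolvent_op H D) (s / 2)) = (\<Sum>\<^sub>\<infinity>k\<in>K. ennreal ((1 / (1 + (\<mu> k)\<^sup>2)) powr (s / 2)))"
    using op_powr_resolvent[of "s / 2"] s by (intro op_trace_acts_diagonally) auto
  also have "(\<lambda>k. (1 / (1 + (\<mu> k)\<^sup>2)) powr (s / 2)) = (\<lambda>k. (1 + (\<mu> k)\<^sup>2) powr (- s / 2))"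
    by (simp add: powr_divide powr_minus_divide add_nonneg_nonneg fun_eq_iff)
  finally show ?thesis using summable_on_iff_infsum_ennreal[of K "\<lambda>k. (1 + (\<mu> k)\<^sup>2) powr (- s / 2)"] by simp
qed

section \<open>Direct sums\<close>

lemma (in hilbert_space) pre_hilbert: "pre_hilbert_space H"
  by unfold_locales

context pre_hilbert_space
begin

lemma minus_add_cancel: "\<lbrakk>x \<in> carrier H; y \<in> carrier H\<rbrakk> \<Longrightarrow> (x \<ominus> y) \<oplus> y = x"
  by (simp add: M.minus_eq M.a_assoc M.l_neg)

lemma add_minus_cancel: "\<lbrakk>x \<in> carrier H; y \<in> carrier H\<rbrakk> \<Longrightarrow> (x \<oplus> y) \<ominus> y = x"
  by (simp add: M.minus_eq M.a_assoc M.r_neg)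

lemma minus_minus_cancel:
  assumes "x \<in> carrier H" "y \<in> carrier H"
  shows "x \<ominus> (x \<ominus> y) = y"
proof -
  have "x \<ominus> (x \<ominus> y) = (y \<oplus> (x \<ominus> y)) \<ominus> (x \<ominus> y)"
    using assms minus_add_cancel[of x y] M.a_comm[of y "x \<ominus> y"] by simp
  also have "\<dots> = y" using assms by (intro add_minus_cancel) auto
  finally show ?thesis .
qed

end

locale direct_sum_of_hilbert_spaces =
  fixes I :: "'i set" and H :: "'i \<Rightarrow> 'h hspace"
  assumes hilbert: "i \<in> I \<Longrightarrow> hilbert_space (H i)"
begin

abbreviation "S \<equiv> direct_sum_space I H"

lemma pre: "i \<in> I \<Longrightarrow> pre_hilbert_space (H i)"
  using hilbert by (rule hilbert_space.pre_hilbert)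

lemma carrier_iff:
  "x \<in> carrier S \<longleftrightarrow> x \<in> (\<Pi>\<^sub>E i\<in>I. carrier (H i)) \<and> (\<lambda>i. (hnorm (H i) (x i))\<^sup>2) summable_on I"
  by (simp add: direct_sum_space_def)

lemma comp_in: "\<lbrakk>x \<in> carrier S; i \<in> I\<rbrakk> \<Longrightarrow> x i \<in> carrier (H i)"
  by (auto simp: carrier_iff)

lemma comp_undefined: "\<lbrakk>x \<in> carrier S; i \<notin> I\<rbrakk> \<Longrightarrow> x i = undefined"
  unfolding carrier_iff by (blast intro: PiE_arb)

lemma zero_comp_in: "i \<in> I \<Longrightarrow> \<zero>\<^bsub>H i\<^esub> \<in> carrier (H i)"
  and hnorm_zero_comp: "i \<in> I \<Longrightarrow> hnorm (H i) \<zero>\<^bsub>H i\<^esub> = 0"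
proof -
  assume "i \<in> I"
  then interpret pre_hilbert_space "H i" by (rule pre)
  show "\<zero>\<^bsub>H i\<^esub> \<in> carrier (H i)" "hnorm (H i) \<zero>\<^bsub>H i\<^esub> = 0" by simp_all
qed

lemma norms_summable: "x \<in> carrier S \<Longrightarrow> (\<lambda>i. (hnorm (H i) (x i))\<^sup>2) summable_on I"
  by (simp add: carrier_iff)

lemma ops:
  "x \<oplus>\<^bsub>S\<^esub> y = (\<lambda>i\<in>I. x i \<oplus>\<^bsub>H i\<^esub> y i)" "c \<odot>\<^bsub>S\<^esub> x = (\<lambda>i\<in>I. c \<odot>\<^bsub>H i\<^esub> x i)"
  "\<zero>\<^bsub>S\<^esub> = (\<lambda>i\<in>I. \<zero>\<^bsub>H i\<^esub>)" "ip S x y = (\<Sum>\<^sub>\<infinity>i\<in>I. ip (H i) (x i) (y i))"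
  by (simp_all add: direct_sum_space_def)

lemma carrier_ext: "\<lbrakk>x \<in> carrier S; y \<in> carrier S; \<And>i. i \<in> I \<Longrightarrow> x i = y i\<rbrakk> \<Longrightarrow> x = y"
  by (auto simp: carrier_iff intro: PiE_ext)

lemma restrict_in_carrierI:
  assumes "\<And>i. i \<in> I \<Longrightarrow> x i \<in> carrier (H i)" "(\<lambda>i. (hnorm (H i) (x i))\<^sup>2) summable_on I"
  shows "restrict x I \<in> carrier S"
  using assms by (auto simp: carrier_iff cong: summable_on_cong)

lemma add_in: "x \<oplus>\<^bsub>S\<^esub> y \<in> carrier S" if x: "x \<in> carrier S" and y: "y \<in> carrier S"
  unfolding ops
proof (rule restrict_in_carrierI)
  fix i assume i: "i \<in> I"
  interpret pre_hilbert_space "H i" by (rule pre[OF i])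
  show "x i \<oplus>\<^bsub>H i\<^esub> y i \<in> carrier (H i)" using comp_in x y i by auto
next
  show "(\<lambda>i. (hnorm (H i) (x i \<oplus>\<^bsub>H i\<^esub> y i))\<^sup>2) summable_on I"
  proof (rule summable_on_comparison_test)
    show "(\<lambda>i. 2 * (hnorm (H i) (x i))\<^sup>2 + 2 * (hnorm (H i) (y i))\<^sup>2) summable_on I"
      using x y by (intro summable_on_add summable_on_cmult_right norms_summable)
    fix i assume i: "i \<in> I"
    interpret pre_hilbert_space "H i" by (rule pre[OF i])
    have "(hnorm (H i) (x i \<oplus>\<^bsub>H i\<^esub> y i))\<^sup>2 \<le> (hnorm (H i) (x i) + hnorm (H i) (y i))\<^sup>2"
      using comp_in x y i hnorm_triangle by (intro power_mono) auto
    also have "\<dots> \<le> 2 * (hnorm (H i) (x i))\<^sup>2 + 2 * (hnorm (H i) (y i))\<^sup>2"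
      using sum_squares_bound[of "hnorm (H i) (x i)" "hnorm (H i) (y i)"] by (simp add: power2_sum)
    finally show "(hnorm (H i) (x i \<oplus>\<^bsub>H i\<^esub> y i))\<^sup>2 \<le> 2 * (hnorm (H i) (x i))\<^sup>2 + 2 * (hnorm (H i) (y i))\<^sup>2" .
  qed auto
qed

lemma bounded_image_in:
  assumes x: "x \<in> carrier S" and y: "\<And>i. i \<in> I \<Longrightarrow> y i \<in> carrier (H i)"
    and le: "\<And>i. i \<in> I \<Longrightarrow> hnorm (H i) (y i) \<le> C * hnorm (H i) (x i)"
  shows "restrict y I \<in> carrier S"
proof (rule restrict_in_carrierI[OF y])
  have "0 \<le> hnorm (H i) (y i)" if "i \<in> I" for i
    using pre_hilbert_space.hnorm_nonneg[OF pre] that y by blast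
  thus "(\<lambda>i. (hnorm (H i) (y i))\<^sup>2) summable_on I"
    by (intro summable_on_comparison_test[OF summable_on_cmult_right[OF norms_summable[OF x], of "C\<^sup>2"]])
       (use power_mono[OF le, of _ 2] in \<open>auto simp: power_mult_distrib\<close>)
qed

lemma smult_in: "c \<odot>\<^bsub>S\<^esub> x \<in> carrier S" if x: "x \<in> carrier S"
  unfolding ops
proof (rule bounded_image_in[OF x, of _ "cmod c"])
  fix i assume i: "i \<in> I"
  interpret pre_hilbert_space "H i" by (rule pre[OF i])
  show "c \<odot>\<^bsub>H i\<^esub> x i \<in> carrier (H i)" "hnorm (H i) (c \<odot>\<^bsub>H i\<^esub> x i) \<le> cmod c * hnorm (H i) (x i)"
    using comp_in[OF x i] by (auto simp: hnorm_smult)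
qed

lemma zero_in: "\<zero>\<^bsub>S\<^esub> \<in> carrier S"
  unfolding ops
  by (rule restrict_in_carrierI) (simp_all add: zero_comp_in hnorm_zero_comp cong: summable_on_cong)

lemma ip_abs_summable:
  assumes x: "x \<in> carrier S" and y: "y \<in> carrier S"
  shows "(\<lambda>i. norm (ip (H i) (x i) (y i))) summable_on I"
proof (rule Infinite_Sum.abs_summable_on_comparison_test')
  show "(\<lambda>i. (hnorm (H i) (x i))\<^sup>2 + (hnorm (H i) (y i))\<^sup>2) summable_on I"
    using x y by (intro summable_on_add norms_summable)
  fix i assume i: "i \<in> I"
  interpret pre_hilbert_space "H i" by (rule pre[OF i])
  have "cmod (ip (H i) (x i) (y i)) \<le> hnorm (H i) (x i) * hnorm (H i) (y i)"
    using comp_in x y i Cauchy_Schwarz by auto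
  also have "\<dots> \<le> (hnorm (H i) (x i))\<^sup>2 + (hnorm (H i) (y i))\<^sup>2"
  proof -
    have "0 \<le> hnorm (H i) (x i) * hnorm (H i) (y i)" using comp_in x y i by simp
    thus ?thesis using sum_squares_bound[of "hnorm (H i) (x i)" "hnorm (H i) (y i)"] by linarith
  qed
  finally show "cmod (ip (H i) (x i) (y i)) \<le> (hnorm (H i) (x i))\<^sup>2 + (hnorm (H i) (y i))\<^sup>2" .
qed

lemmas ip_summable = Infinite_Sum.abs_summable_summable[OF ip_abs_summable]

lemma ip_self_has_sum:
  assumes x: "x \<in> carrier S"
  shows "((\<lambda>i. (hnorm (H i) (x i))\<^sup>2) has_sum Re (ip S x x)) I"
proof -
  have "((\<lambda>i. ip (H i) (x i) (x i)) has_sum ip S x x) I"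
    unfolding ops using ip_summable[OF x x] by simp
  hence "((\<lambda>i. Re (ip (H i) (x i) (x i))) has_sum Re (ip S x x)) I" by (rule has_sum_Re)
  moreover have "Re (ip (H i) (x i) (x i)) = (hnorm (H i) (x i))\<^sup>2" if i: "i \<in> I" for i
    using pre_hilbert_space.hnorm_sq[OF pre[OF i] comp_in[OF x i]] by simp
  ultimately show ?thesis by (simp cong: has_sum_cong)
qed

lemma pre_hilbert_space_S: "pre_hilbert_space S"
proof -
  have ag: "abelian_group S"
  proof (rule abelian_groupI)
    fix x y z assume x: "x \<in> carrier S" and y: "y \<in> carrier S" and z: "z \<in> carrier S"
    show "x \<oplus>\<^bsub>S\<^esub> y \<in> carrier S" using x y by (rule add_in)
    show "x \<oplus>\<^bsub>S\<^esub> y = y \<oplus>\<^bsub>S\<^esub> x"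
    proof (rule carrier_ext)
      fix i assume i: "i \<in> I"
      interpret pre_hilbert_space "H i" by (rule pre[OF i])
      show "(x \<oplus>\<^bsub>S\<^esub> y) i = (y \<oplus>\<^bsub>S\<^esub> x) i" using comp_in x y i by (simp add: ops M.a_comm)
    qed (use x y add_in in auto)
    show "(x \<oplus>\<^bsub>S\<^esub> y) \<oplus>\<^bsub>S\<^esub> z = x \<oplus>\<^bsub>S\<^esub> (y \<oplus>\<^bsub>S\<^esub> z)"
    proof (rule carrier_ext)
      fix i assume i: "i \<in> I"
      interpret pre_hilbert_space "H i" by (rule pre[OF i])
      show "((x \<oplus>\<^bsub>S\<^esub> y) \<oplus>\<^bsub>S\<^esub> z) i = (x \<oplus>\<^bsub>S\<^esub> (y \<oplus>\<^bsub>S\<^esub> z)) i"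
        using comp_in x y z i by (simp add: ops M.a_assoc)
    qed (use x y z add_in in auto)
  next
    show "\<zero>\<^bsub>S\<^esub> \<in> carrier S" by (rule zero_in)
  next
    fix x assume x: "x \<in> carrier S"
    show "\<zero>\<^bsub>S\<^esub> \<oplus>\<^bsub>S\<^esub> x = x"
    proof (rule carrier_ext)
      fix i assume i: "i \<in> I"
      interpret pre_hilbert_space "H i" by (rule pre[OF i])
      show "(\<zero>\<^bsub>S\<^esub> \<oplus>\<^bsub>S\<^esub> x) i = x i" using comp_in x i by (simp add: ops)
    qed (use x zero_in add_in in auto)
    show "\<exists>y\<in>carrier S. y \<oplus>\<^bsub>S\<^esub> x = \<zero>\<^bsub>S\<^esub>"
    proof (intro bexI[of _ "(- 1) \<odot>\<^bsub>S\<^esub> x"] carrier_ext)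
      fix i assume i: "i \<in> I"
      interpret pre_hilbert_space "H i" by (rule pre[OF i])
      have "(- 1) \<odot>\<^bsub>H i\<^esub> x i \<oplus>\<^bsub>H i\<^esub> 1 \<odot>\<^bsub>H i\<^esub> x i = (- 1 + 1) \<odot>\<^bsub>H i\<^esub> x i"
        using smult_l_distr[of "- 1" 1 "x i"] comp_in x i by simp
      also have "\<dots> = \<zero>\<^bsub>H i\<^esub>" using smult_l_null[of "x i"] comp_in x i by simp
      finally show "((- 1) \<odot>\<^bsub>S\<^esub> x \<oplus>\<^bsub>S\<^esub> x) i = \<zero>\<^bsub>S\<^esub> i"
        using smult_one[of "x i"] comp_in[OF x i] i by (simp add: ops)
    qed (use x zero_in add_in smult_in in auto)
  qed
  have "module complex_field S"
  proof (rule moduleI[OF cring_complex_field ag])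
    fix a b :: complex and x y assume x: "x \<in> carrier S" and y: "y \<in> carrier S"
    show "a \<odot>\<^bsub>S\<^esub> x \<in> carrier S" using x by (rule smult_in)
    show "(a \<oplus>\<^bsub>complex_field\<^esub> b) \<odot>\<^bsub>S\<^esub> x = a \<odot>\<^bsub>S\<^esub> x \<oplus>\<^bsub>S\<^esub> b \<odot>\<^bsub>S\<^esub> x"
    proof (rule carrier_ext)
      fix i assume i: "i \<in> I"
      interpret pre_hilbert_space "H i" by (rule pre[OF i])
      show "((a \<oplus>\<^bsub>complex_field\<^esub> b) \<odot>\<^bsub>S\<^esub> x) i = (a \<odot>\<^bsub>S\<^esub> x \<oplus>\<^bsub>S\<^esub> b \<odot>\<^bsub>S\<^esub> x) i"
        using smult_l_distr[of a b "x i"] comp_in x i by (simp add: ops)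
    qed (use x add_in smult_in in auto)
    show "a \<odot>\<^bsub>S\<^esub> (x \<oplus>\<^bsub>S\<^esub> y) = a \<odot>\<^bsub>S\<^esub> x \<oplus>\<^bsub>S\<^esub> a \<odot>\<^bsub>S\<^esub> y"
    proof (rule carrier_ext)
      fix i assume i: "i \<in> I"
      interpret pre_hilbert_space "H i" by (rule pre[OF i])
      show "(a \<odot>\<^bsub>S\<^esub> (x \<oplus>\<^bsub>S\<^esub> y)) i = (a \<odot>\<^bsub>S\<^esub> x \<oplus>\<^bsub>S\<^esub> a \<odot>\<^bsub>S\<^esub> y) i"
        using smult_r_distr[of a "x i" "y i"] comp_in x y i by (simp add: ops)
    qed (use x y add_in smult_in in auto)
    show "(a \<otimes>\<^bsub>complex_field\<^esub> b) \<odot>\<^bsub>S\<^esub> x = a \<odot>\<^bsub>S\<^esub> (b \<odot>\<^bsub>S\<^esub> x)"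
    proof (rule carrier_ext)
      fix i assume i: "i \<in> I"
      interpret pre_hilbert_space "H i" by (rule pre[OF i])
      show "((a \<otimes>\<^bsub>complex_field\<^esub> b) \<odot>\<^bsub>S\<^esub> x) i = (a \<odot>\<^bsub>S\<^esub> (b \<odot>\<^bsub>S\<^esub> x)) i"
        using smult_assoc1[of a b "x i"] comp_in x i by (simp add: ops)
    qed (use x add_in smult_in in auto)
    show "\<one>\<^bsub>complex_field\<^esub> \<odot>\<^bsub>S\<^esub> x = x"
    proof (rule carrier_ext)
      fix i assume i: "i \<in> I"
      interpret pre_hilbert_space "H i" by (rule pre[OF i])
      show "(\<one>\<^bsub>complex_field\<^esub> \<odot>\<^bsub>S\<^esub> x) i = x i"
        using smult_one[of "x i"] comp_in x i by (simp add: ops)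
    qed (use x smult_in in auto)
  qed
  moreover have "pre_hilbert_space_axioms S"
  proof
    fix x y z :: "'i \<Rightarrow> 'h" and c :: complex
    assume x: "x \<in> carrier S" and y: "y \<in> carrier S"
    show "ip S (c \<odot>\<^bsub>S\<^esub> x) y = c * ip S x y"
    proof -
      have "ip (H i) ((c \<odot>\<^bsub>S\<^esub> x) i) (y i) = c * ip (H i) (x i) (y i)" if i: "i \<in> I" for i
        using pre_hilbert_space.ip_smult_left[OF pre[OF i]] comp_in x y i by (simp add: ops)
      thus ?thesis unfolding ops(4) by (simp add: infsum_cmult_right' cong: infsum_cong)
    qed
    show "ip S y x = cnj (ip S x y)"
    proof -
      have "ip (H i) (y i) (x i) = cnj (ip (H i) (x i) (y i))" if i: "i \<in> I" for i
        using pre_hilbert_space.ip_commute[OF pre[OF i]] comp_in x y i by blast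
      thus ?thesis unfolding ops(4) infsum_cnj[symmetric] by (rule infsum_cong)
    qed
    assume z: "z \<in> carrier S"
    show "ip S (x \<oplus>\<^bsub>S\<^esub> y) z = ip S x z + ip S y z"
    proof -
      have "ip (H i) ((x \<oplus>\<^bsub>S\<^esub> y) i) (z i) = ip (H i) (x i) (z i) + ip (H i) (y i) (z i)" if i: "i \<in> I" for i
        using pre_hilbert_space.ip_add_left[OF pre[OF i]] comp_in x y z i by (simp add: ops)
      thus ?thesis unfolding ops(4) using ip_summable x y z by (simp add: infsum_add cong: infsum_cong)
    qed
  next
    fix x assume x: "x \<in> carrier S" and nz: "x \<noteq> \<zero>\<^bsub>S\<^esub>"
    then obtain i where i: "i \<in> I" "x i \<noteq> \<zero>\<^bsub>S\<^esub> i" using carrier_ext zero_in by metis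
    interpret pre_hilbert_space "H i" by (rule pre[OF i(1)])
    have "0 < (hnorm (H i) (x i))\<^sup>2"
      using i hnorm_eq_0[OF comp_in[OF x i(1)]] by (simp add: ops)
    also have "\<dots> \<le> Re (ip S x x)"
      using finite_sum_le_has_sum[OF ip_self_has_sum[OF x], of "{i}"] i by simp
    finally show "0 < Re (ip S x x)" .
  qed
  ultimately show ?thesis by (simp add: pre_hilbert_space_def)
qed

sublocale pre: pre_hilbert_space S
  by (rule pre_hilbert_space_S)

lemma hnorm_has_sum: "x \<in> carrier S \<Longrightarrow> ((\<lambda>i. (hnorm (H i) (x i))\<^sup>2) has_sum (hnorm S x)\<^sup>2) I"
  using ip_self_has_sum by (simp add: pre.hnorm_sq)

lemma hnorm_comp_le:
  assumes x: "x \<in> carrier S" and i: "i \<in> I"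
  shows "hnorm (H i) (x i) \<le> hnorm S x"
proof (rule power2_le_imp_le)
  show "(hnorm (H i) (x i))\<^sup>2 \<le> (hnorm S x)\<^sup>2"
    using finite_sum_le_has_sum[OF hnorm_has_sum[OF x], of "{i}"] i by simp
qed (rule pre.hnorm_nonneg[OF x])

lemma hnorm_le_of_comp_le:
  assumes x: "x \<in> carrier S" and y: "y \<in> carrier S" and C: "C \<ge> 0"
    and le: "\<And>i. i \<in> I \<Longrightarrow> hnorm (H i) (y i) \<le> C * hnorm (H i) (x i)"
  shows "hnorm S y \<le> C * hnorm S x"
proof (rule power2_le_imp_le)
  have "0 \<le> hnorm (H i) (y i)" if "i \<in> I" for i
    using pre_hilbert_space.hnorm_nonneg[OF pre comp_in[OF y]] that by blast
  hence "(hnorm S y)\<^sup>2 \<le> C\<^sup>2 * (hnorm S x)\<^sup>2"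
    by (intro has_sum_mono[OF hnorm_has_sum[OF y] has_sum_cmult_right[OF hnorm_has_sum[OF x]]])
       (use power_mono[OF le, of _ 2] in \<open>auto simp: power_mult_distrib\<close>)
  thus "(hnorm S y)\<^sup>2 \<le> (C * hnorm S x)\<^sup>2" by (simp add: power_mult_distrib)
qed (use x C in simp)

text \<open>Subtraction in a module goes through an additive inverse obtained by description, so it
  is not componentwise by definition. Addition is, and cancelling in
  \<open>(x \<ominus> y) \<oplus> y = x\<close> transfers this.\<close>

lemma minus_comp: "\<lbrakk>x \<in> carrier S; y \<in> carrier S; i \<in> I\<rbrakk> \<Longrightarrow> (x \<ominus>\<^bsub>S\<^esub> y) i = x i \<ominus>\<^bsub>H i\<^esub> y i"
proof -
  assume x: "x \<in> carrier S" and y: "y \<in> carrier S" and i: "i \<in> I"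
  interpret pre_hilbert_space "H i" by (rule pre[OF i])
  have eq: "(x \<ominus>\<^bsub>S\<^esub> y) \<oplus>\<^bsub>S\<^esub> y = x"
    using x y by (rule pre.minus_add_cancel)
  define a where "a = (x \<ominus>\<^bsub>S\<^esub> y) i"
  have a: "a \<in> carrier (H i)" and yi: "y i \<in> carrier (H i)"
    using comp_in[OF pre.minus_in[OF x y] i] comp_in[OF y i] by (simp_all only: a_def)
  have "x i = a \<oplus>\<^bsub>H i\<^esub> y i"
    using fun_cong[OF eq, of i] i by (simp add: ops a_def)
  hence "x i \<ominus>\<^bsub>H i\<^esub> y i = (a \<oplus>\<^bsub>H i\<^esub> y i) \<ominus>\<^bsub>H i\<^esub> y i" by (rule arg_cong)
  also have "\<dots> = a" using a yi by (rule add_minus_cancel)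
  finally show ?thesis by (simp only: a_def)
qed

lemma hilbert_space_S: "hilbert_space S"
proof -
  have "pre.hmetric.mcomplete"
  proof (rule pre.mcompleteI)
    fix s :: "nat \<Rightarrow> 'i \<Rightarrow> 'h" assume s: "\<And>n. s n \<in> carrier S"
      and cau: "\<And>\<epsilon>. \<epsilon> > 0 \<Longrightarrow> \<exists>N. \<forall>m\<ge>N. \<forall>n\<ge>N. hnorm S (s m \<ominus>\<^bsub>S\<^esub> s n) < \<epsilon>"
    have "\<exists>y\<in>carrier (H i). (\<lambda>n. hnorm (H i) (s n i \<ominus>\<^bsub>H i\<^esub> y)) \<longlonglongrightarrow> 0" if i: "i \<in> I" for i
    proof -
      interpret hilbert_space "H i" by (rule hilbert[OF i])
      have le: "hnorm (H i) (s m i \<ominus>\<^bsub>H i\<^esub> s n i) \<le> hnorm S (s m \<ominus>\<^bsub>S\<^esub> s n)" for m n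
        using hnorm_comp_le[OF pre.minus_in[OF s[of m] s[of n]] i] unfolding minus_comp[OF s s i] .
      have "\<exists>N. \<forall>m\<ge>N. \<forall>n\<ge>N. hnorm (H i) (s m i \<ominus>\<^bsub>H i\<^esub> s n i) < \<epsilon>" if "\<epsilon> > 0" for \<epsilon>
        using cau[OF that] le_less_trans[OF le] by blast
      then obtain z where "z \<in> carrier (H i)" "(\<lambda>n. hnorm (H i) (s n i \<ominus>\<^bsub>H i\<^esub> z)) \<longlonglongrightarrow> 0"
        by (rule Cauchy_converges[of "\<lambda>n. s n i", OF comp_in[OF s i]])
      thus ?thesis by (rule bexI[rotated])
    qed
    hence "\<exists>y. \<forall>i\<in>I. y i \<in> carrier (H i) \<and> (\<lambda>n. hnorm (H i) (s n i \<ominus>\<^bsub>H i\<^esub> y i)) \<longlonglongrightarrow> 0"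
      by (intro bchoice) (simp add: Bex_def)
    then obtain y where y: "\<And>i. i \<in> I \<Longrightarrow> y i \<in> carrier (H i)"
        "\<And>i. i \<in> I \<Longrightarrow> (\<lambda>n. hnorm (H i) (s n i \<ominus>\<^bsub>H i\<^esub> y i)) \<longlonglongrightarrow> 0" by auto
    \<comment> \<open>Over a finite set \<open>F\<close> the second index of the Cauchy estimate can
      be sent to infinity in each component; the resulting bound does not depend on
      \<open>F\<close>.\<close>
    have tail: "(\<Sum>i\<in>F. (hnorm (H i) (s m i \<ominus>\<^bsub>H i\<^esub> y i))\<^sup>2) \<le> \<epsilon>\<^sup>2"
      if F: "finite F" "F \<subseteq> I" and \<epsilon>: "\<epsilon> > 0" and N: "\<forall>m\<ge>N. \<forall>n\<ge>N. hnorm S (s m \<ominus>\<^bsub>S\<^esub> s n) < \<epsilon>" and m: "m \<ge> N"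
      for F \<epsilon> N m
    proof (rule LIMSEQ_le_const2)
      show "(\<lambda>n. \<Sum>i\<in>F. (hnorm (H i) (s m i \<ominus>\<^bsub>H i\<^esub> s n i))\<^sup>2)
        \<longlonglongrightarrow> (\<Sum>i\<in>F. (hnorm (H i) (s m i \<ominus>\<^bsub>H i\<^esub> y i))\<^sup>2)"
      proof (intro tendsto_sum tendsto_power)
        fix i assume "i \<in> F"
        hence i: "i \<in> I" using F by auto
        interpret hilbert_space "H i" by (rule hilbert[OF i])
        have c: "s n i \<in> carrier (H i)" for n by (rule comp_in[OF s i])
        show "(\<lambda>n. hnorm (H i) (s m i \<ominus>\<^bsub>H i\<^esub> s n i)) \<longlonglongrightarrow> hnorm (H i) (s m i \<ominus>\<^bsub>H i\<^esub> y i)"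
        proof (rule tendsto_hnorm)
          have "hnorm (H i) ((s m i \<ominus>\<^bsub>H i\<^esub> s n i) \<ominus>\<^bsub>H i\<^esub> (s m i \<ominus>\<^bsub>H i\<^esub> y i)) = hnorm (H i) (s n i \<ominus>\<^bsub>H i\<^esub> y i)" for n
          proof -
            have "ip (H i) ((s m i \<ominus>\<^bsub>H i\<^esub> s n i) \<ominus>\<^bsub>H i\<^esub> (s m i \<ominus>\<^bsub>H i\<^esub> y i)) ((s m i \<ominus>\<^bsub>H i\<^esub> s n i) \<ominus>\<^bsub>H i\<^esub> (s m i \<ominus>\<^bsub>H i\<^esub> y i))
              = ip (H i) (s n i \<ominus>\<^bsub>H i\<^esub> y i) (s n i \<ominus>\<^bsub>H i\<^esub> y i)"
              using c y(1)[OF i] by (simp add: ip_minus_left ip_minus_right)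
            thus ?thesis by (simp add: hnorm_def)
          qed
          thus "(\<lambda>n. hnorm (H i) ((s m i \<ominus>\<^bsub>H i\<^esub> s n i) \<ominus>\<^bsub>H i\<^esub> (s m i \<ominus>\<^bsub>H i\<^esub> y i))) \<longlonglongrightarrow> 0"
            using y(2)[OF i] by simp
        qed (use c y(1)[OF i] in auto)
      qed
      have "(\<Sum>i\<in>F. (hnorm (H i) (s m i \<ominus>\<^bsub>H i\<^esub> s n i))\<^sup>2) \<le> \<epsilon>\<^sup>2" if n: "n \<ge> N" for n
      proof -
        have "(\<Sum>i\<in>F. (hnorm (H i) (s m i \<ominus>\<^bsub>H i\<^esub> s n i))\<^sup>2) = (\<Sum>i\<in>F. (hnorm (H i) ((s m \<ominus>\<^bsub>S\<^esub> s n) i))\<^sup>2)"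
          using F s by (intro sum.cong) (auto simp: minus_comp subset_iff)
        also have "\<dots> \<le> (hnorm S (s m \<ominus>\<^bsub>S\<^esub> s n))\<^sup>2"
          using F s by (intro finite_sum_le_has_sum[OF hnorm_has_sum]) auto
        also have "\<dots> \<le> \<epsilon>\<^sup>2" using N m n s by (intro power_mono) (auto intro: less_imp_le)
        finally show ?thesis .
      qed
      thus "\<exists>N. \<forall>n\<ge>N. (\<Sum>i\<in>F. (hnorm (H i) (s m i \<ominus>\<^bsub>H i\<^esub> s n i))\<^sup>2) \<le> \<epsilon>\<^sup>2" by blast
    qed
    \<comment> \<open>Square summability is first obtained for the differences
      \<open>s m - y\<close>, from the bounds on finite sums. The limit \<open>z\<close> is then
      recovered as \<open>s N1 - r N1\<close>, which lies in the direct sum as a difference of two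
      of its elements.\<close>
    define r where "r m = (\<lambda>i\<in>I. s m i \<ominus>\<^bsub>H i\<^esub> y i)" for m
    have r_in: "r m \<in> carrier S" if \<epsilon>: "\<epsilon> > 0" and N: "\<forall>m\<ge>N. \<forall>n\<ge>N. hnorm S (s m \<ominus>\<^bsub>S\<^esub> s n) < \<epsilon>" and m: "m \<ge> N" for \<epsilon> N m
      unfolding r_def
    proof (rule restrict_in_carrierI)
      show "s m i \<ominus>\<^bsub>H i\<^esub> y i \<in> carrier (H i)" if "i \<in> I" for i
        using pre_hilbert_space.minus_in[OF pre[OF that]] comp_in[OF s that] y(1)[OF that] by blast
      show "(\<lambda>i. (hnorm (H i) (s m i \<ominus>\<^bsub>H i\<^esub> y i))\<^sup>2) summable_on I"
        using tail[OF _ _ \<epsilon> N m] by (intro nonneg_bdd_above_summable_on) (auto intro!: bdd_aboveI)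
    qed
    have r_le: "hnorm S (r m) \<le> \<epsilon>" if \<epsilon>: "\<epsilon> > 0" and N: "\<forall>m\<ge>N. \<forall>n\<ge>N. hnorm S (s m \<ominus>\<^bsub>S\<^esub> s n) < \<epsilon>" and m: "m \<ge> N" for \<epsilon> N m
    proof (rule power2_le_imp_le)
      have eq: "(\<Sum>i\<in>F. (hnorm (H i) (r m i))\<^sup>2) = (\<Sum>i\<in>F. (hnorm (H i) (s m i \<ominus>\<^bsub>H i\<^esub> y i))\<^sup>2)" if "F \<subseteq> I" for F
        using subsetD[OF that] by (intro sum.cong refl) (simp add: r_def)
      show "(hnorm S (r m))\<^sup>2 \<le> \<epsilon>\<^sup>2"
      proof (rule has_sum_le_finite_sums[OF hnorm_has_sum[OF r_in[OF \<epsilon> N m]]])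
        fix F assume F: "finite F" "F \<subseteq> I"
        show "(\<Sum>i\<in>F. (hnorm (H i) (r m i))\<^sup>2) \<le> \<epsilon>\<^sup>2"
          unfolding eq[OF F(2)] by (rule tail[OF F \<epsilon> N m])
      qed
    qed (use \<epsilon> in simp)
    obtain N1 where N1: "\<forall>m\<ge>N1. \<forall>n\<ge>N1. hnorm S (s m \<ominus>\<^bsub>S\<^esub> s n) < 1"
      using cau[OF zero_less_one] by (rule exE)
    have r1: "r N1 \<in> carrier S" by (rule r_in[OF zero_less_one N1 order_refl])
    define z where "z = s N1 \<ominus>\<^bsub>S\<^esub> r N1"
    have z: "z \<in> carrier S" using s r1 by (simp add: z_def)
    have zi: "z i = y i" if i: "i \<in> I" for i
    proof -
      interpret pre_hilbert_space "H i" by (rule pre[OF i])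
      have c: "s N1 i \<in> carrier (H i)" "y i \<in> carrier (H i)" using comp_in[OF s i] y(1)[OF i] by auto
      have "z i = s N1 i \<ominus>\<^bsub>H i\<^esub> (s N1 i \<ominus>\<^bsub>H i\<^esub> y i)"
        using minus_comp[OF s r1 i] i by (simp add: z_def r_def)
      also have "\<dots> = y i"
        using c by (rule minus_minus_cancel)
      finally show ?thesis .
    qed
    have rz: "r m = s m \<ominus>\<^bsub>S\<^esub> z" for m
    proof
      fix i show "r m i = (s m \<ominus>\<^bsub>S\<^esub> z) i"
      proof (cases "i \<in> I")
        case False
        thus ?thesis using comp_undefined[OF pre.minus_in[OF s[of m] z]] by (simp add: r_def)
      qed (use minus_comp[OF s z] zi in \<open>simp add: r_def\<close>)
    qed
    have "(\<lambda>n. hnorm S (s n \<ominus>\<^bsub>S\<^esub> z)) \<longlonglongrightarrow> 0"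
    proof (rule LIMSEQ_I)
      fix \<epsilon> :: real assume \<epsilon>: "\<epsilon> > 0"
      obtain N where N: "\<forall>m\<ge>N. \<forall>n\<ge>N. hnorm S (s m \<ominus>\<^bsub>S\<^esub> s n) < \<epsilon> / 2"
        using cau[OF half_gt_zero[OF \<epsilon>]] by (rule exE)
      have "norm (hnorm S (s n \<ominus>\<^bsub>S\<^esub> z) - 0) < \<epsilon>" if "n \<ge> N" for n
        using r_le[OF half_gt_zero[OF \<epsilon>] N that] \<epsilon> pre.hnorm_nonneg[OF pre.minus_in[OF s[of n] z]]
        unfolding rz by simp
      thus "\<exists>N. \<forall>n\<ge>N. norm (hnorm S (s n \<ominus>\<^bsub>S\<^esub> z) - 0) < \<epsilon>" by blast
    qed
    thus "\<exists>x\<in>carrier S. (\<lambda>n. hnorm S (s n \<ominus>\<^bsub>S\<^esub> x)) \<longlonglongrightarrow> 0" using z by (rule bexI)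
  qed
  thus ?thesis
    by unfold_locales (auto simp: pre.ip_add_left pre.ip_smult_left pre.ip_pos intro: pre.ip_commute)
qed

section \<open>Embedded summands and the basis of the direct sum\<close>

definition single :: "'i \<Rightarrow> 'h \<Rightarrow> 'i \<Rightarrow> 'h" where
  "single i x = (\<lambda>j\<in>I. if j = i then x else \<zero>\<^bsub>H j\<^esub>)"

lemma single_in:
  assumes i: "i \<in> I" and x: "x \<in> carrier (H i)"
  shows "single i x \<in> carrier S"
  unfolding single_def
proof (rule restrict_in_carrierI)
  show "(if j = i then x else \<zero>\<^bsub>H j\<^esub>) \<in> carrier (H j)" if "j \<in> I" for j
    using x zero_comp_in[OF that] by (cases "j = i") simp_all
next
  have "(\<lambda>j. (hnorm (H j) (if j = i then x else \<zero>\<^bsub>H j\<^esub>))\<^sup>2) summable_on I \<longleftrightarrow>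
     (\<lambda>j. (hnorm (H j) (if j = i then x else \<zero>\<^bsub>H j\<^esub>))\<^sup>2) summable_on {i}"
    using i by (intro summable_on_cong_neutral) (auto simp: hnorm_zero_comp)
  thus "(\<lambda>j. (hnorm (H j) (if j = i then x else \<zero>\<^bsub>H j\<^esub>))\<^sup>2) summable_on I" by simp
qed

lemma ip_single:
  assumes i: "i \<in> I" and x: "x \<in> carrier (H i)" and y: "y \<in> carrier S"
  shows "ip S y (single i x) = ip (H i) (y i) x"
proof -
  have "ip (H j) (y j) (single i x j) = 0" if "j \<in> I" "j \<noteq> i" for j
    using pre_hilbert_space.ip_zero_right[OF pre[OF that(1)] comp_in[OF y that(1)]] that by (simp add: single_def)
  hence "ip S y (single i x) = (\<Sum>\<^sub>\<infinity>j\<in>{i}. ip (H j) (y j) (single i x j))"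
    unfolding ops(4) using i by (intro infsum_cong_neutral) auto
  thus ?thesis using i by (simp add: single_def)
qed

end

locale direct_sum_of_diagonal_operators =
  fixes I :: "'i set" and H :: "'i \<Rightarrow> 'h hspace" and K :: "'i \<Rightarrow> 'k set" and e :: "'i \<Rightarrow> 'k \<Rightarrow> 'h"
    and D :: "'i \<Rightarrow> ('h \<rightharpoonup> 'h)" and \<mu> :: "'i \<Rightarrow> 'k \<Rightarrow> real"
  assumes diag: "i \<in> I \<Longrightarrow> diagonal_operator (H i) (K i) (e i) (D i) (\<mu> i)"
begin

sublocale direct_sum_of_hilbert_spaces I H
  by (rule direct_sum_of_hilbert_spaces.intro)
     (metis diag diagonal_operator.axioms(1) orthonormal_basis.axioms(1))

definition sum_basis :: "'i \<times> 'k \<Rightarrow> 'i \<Rightarrow> 'h" where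
  "sum_basis = (\<lambda>(i, k). single i (e i k))"

lemma onb: "i \<in> I \<Longrightarrow> orthonormal_basis (H i) (K i) (e i)"
  using diag diagonal_operator.axioms(1) by blast

lemma ip_sum_basis: "\<lbrakk>x \<in> carrier S; i \<in> I; k \<in> K i\<rbrakk> \<Longrightarrow> ip S x (sum_basis (i, k)) = ip (H i) (x i) (e i k)"
  using orthonormal_basis.e_in[OF onb] by (simp add: sum_basis_def ip_single)

lemma orthonormal_basis_S: "orthonormal_basis S (Sigma I K) sum_basis"
proof -
  interpret hilbert_space S by (rule hilbert_space_S)
  have b_in: "sum_basis p \<in> carrier S" if "p \<in> Sigma I K" for p
    using that orthonormal_basis.e_in[OF onb] by (auto simp: sum_basis_def single_in)
  show ?thesis
  proof
    fix p q assume p: "p \<in> Sigma I K" and q: "q \<in> Sigma I K"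
    obtain i k j l where ij: "p = (i, k)" "q = (j, l)" by (metis surj_pair)
    have *: "i \<in> I" "j \<in> I" "k \<in> K i" "l \<in> K j" using p q ij by auto
    have "ip S (sum_basis p) (sum_basis q) = ip (H j) (single i (e i k) j) (e j l)"
      using ip_sum_basis[OF b_in[OF p], of j l] * by (simp add: ij sum_basis_def)
    also have "\<dots> = (if p = q then 1 else 0)"
    proof -
      interpret J: orthonormal_basis "H j" "K j" "e j" by (rule onb[OF *(2)])
      show ?thesis
      proof (cases "j = i")
        case True
        thus ?thesis using * J.ip_e[of k l] by (auto simp: ij single_def)
      qed (use * J.ip_zero_left[OF J.e_in[OF *(4)]] in \<open>auto simp: ij single_def\<close>)
    qed
    finally show "ip S (sum_basis p) (sum_basis q) = (if p = q then 1 else 0)" .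
  next
    fix x assume x: "x \<in> carrier S" and z: "\<And>p. p \<in> Sigma I K \<Longrightarrow> ip S x (sum_basis p) = 0"
    show "x = \<zero>\<^bsub>S\<^esub>"
    proof (rule carrier_ext[OF x zero_in])
      fix i assume i: "i \<in> I"
      interpret J: orthonormal_basis "H i" "K i" "e i" by (rule onb[OF i])
      have "x i = \<zero>\<^bsub>H i\<^esub>"
      proof (rule J.total[OF comp_in[OF x i]])
        fix k assume "k \<in> K i"
        thus "ip (H i) (x i) (e i k) = 0" using z[of "(i, k)"] ip_sum_basis[OF x i] i by auto
      qed
      thus "x i = \<zero>\<^bsub>S\<^esub> i" using i by (simp add: ops)
    qed
  qed (rule b_in)
qed

text \<open>Both domains are conditions on the same double family of numbers. Summability over pairs
  splits into summability in each component, which says that \<open>x i\<close> is in the domain of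
  \<open>D i\<close>, and summability of the inner sums, which by Parseval are the squared norms of
  \<open>D i (x i)\<close>.\<close>

lemma diagonal_operator_S:
  "diagonal_operator S (Sigma I K) sum_basis (direct_sum_op I H D) (\<lambda>(i, k). \<mu> i k)"
proof -
  let ?D = "direct_sum_op I H D" and ?\<mu> = "\<lambda>(i, k). \<mu> i k"
  let ?f = "\<lambda>x. \<lambda>i. (\<lambda>k. (cmod (complex_of_real (\<mu> i k) * ip (H i) (x i) (e i k)))\<^sup>2)"
  have D_in: "the (D i y) \<in> carrier (H i)" if "i \<in> I" "y \<in> dom (D i)" for i y
    using diagonal_operator.D_in[OF diag[OF that(1)] that(2)] .
  have D_sum: "(?f x i has_sum (hnorm (H i) (the (D i (x i))))\<^sup>2) (K i)"
    if i: "i \<in> I" and x: "x i \<in> dom (D i)" for x i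
  proof -
    note P = orthonormal_basis.Parseval[OF onb[OF i] D_in[OF i x]]
    have eq: "(cmod (ip (H i) (the (D i (x i))) (e i k)))\<^sup>2 = ?f x i k" if "k \<in> K i" for k
      by (simp only: diagonal_operator.coef_D[OF diag[OF i] x that])
    show ?thesis by (rule has_sum_cong[THEN iffD1, OF eq P])
  qed
  have dom_iff: "x \<in> dom ?D \<longleftrightarrow> (\<lambda>p. (cmod (complex_of_real (?\<mu> p) * ip S x (sum_basis p)))\<^sup>2) summable_on Sigma I K"
    if x: "x \<in> carrier S" for x
  proof -
    have *: "(\<lambda>p. (cmod (complex_of_real (?\<mu> p) * ip S x (sum_basis p)))\<^sup>2) summable_on Sigma I K \<longleftrightarrow>
      (\<lambda>(i, k). ?f x i k) summable_on Sigma I K"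
      using ip_sum_basis[OF x] by (intro summable_on_cong) auto
    \<comment> \<open>The terms are nonnegative; the norms are inserted to reach the criterion for
      absolute summability over a dependent sum, which allows iterating the two sums.\<close>
    also have "\<dots> \<longleftrightarrow> (\<lambda>p. norm ((\<lambda>(i, k). ?f x i k) p)) summable_on Sigma I K"
      by (simp add: case_prod_unfold)
    also have "\<dots> \<longleftrightarrow> (\<forall>i\<in>I. (\<lambda>k. norm ((\<lambda>(i, k). ?f x i k) (i, k))) summable_on K i) \<and>
        (\<lambda>i. norm (\<Sum>\<^sub>\<infinity>k\<in>K i. norm ((\<lambda>(i, k). ?f x i k) (i, k)))) summable_on I"
      by (rule Infinite_Sum.abs_summable_on_Sigma_iff)
    also have "\<dots> \<longleftrightarrow> (\<forall>i\<in>I. ?f x i summable_on K i) \<and> (\<lambda>i. \<Sum>\<^sub>\<infinity>k\<in>K i. ?f x i k) summable_on I"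
      by (simp add: infsum_nonneg)
    also have "(\<forall>i\<in>I. ?f x i summable_on K i) \<longleftrightarrow> (\<forall>i\<in>I. x i \<in> dom (D i))"
      using diagonal_operator.dom_D[OF diag] comp_in[OF x] by blast
    also have "(\<forall>i\<in>I. x i \<in> dom (D i)) \<and> (\<lambda>i. \<Sum>\<^sub>\<infinity>k\<in>K i. ?f x i k) summable_on I \<longleftrightarrow>
      (\<forall>i\<in>I. x i \<in> dom (D i)) \<and> (\<lambda>i. (hnorm (H i) (the (D i (x i))))\<^sup>2) summable_on I"
      using infsumI[OF D_sum] by (auto cong: summable_on_cong)
    also have "\<dots> \<longleftrightarrow> (\<forall>i\<in>I. x i \<in> dom (D i)) \<and> (\<lambda>i\<in>I. the (D i (x i))) \<in> carrier S"
      using D_in by (auto simp: carrier_iff cong: summable_on_cong)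
    finally show ?thesis using x by (auto simp: direct_sum_op_def domIff)
  qed
  have dom_in: "x \<in> carrier S" "\<And>i. i \<in> I \<Longrightarrow> x i \<in> dom (D i)" "?D x = Some (\<lambda>i\<in>I. the (D i (x i)))"
    "(\<lambda>i\<in>I. the (D i (x i))) \<in> carrier S" if "x \<in> dom ?D" for x
    using that by (auto simp: direct_sum_op_def domIff split: if_splits)
  show ?thesis
  proof (rule diagonal_operator.intro[OF orthonormal_basis_S diagonal_operator_axioms.intro])
    show "dom ?D = {x \<in> carrier S. (\<lambda>p. (cmod (complex_of_real (?\<mu> p) * ip S x (sum_basis p)))\<^sup>2) summable_on Sigma I K}"
      using dom_iff dom_in(1) by blast
    fix x assume x: "x \<in> dom ?D"
    show "the (?D x) \<in> carrier S" using dom_in[OF x] by simp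
    fix p assume p: "p \<in> Sigma I K"
    then obtain i k where ik: "p = (i, k)" "i \<in> I" "k \<in> K i" by auto
    show "ip S (the (?D x)) (sum_basis p) = complex_of_real (?\<mu> p) * ip S x (sum_basis p)"
      using dom_in[OF x] ik diagonal_operator.coef_D[OF diag[OF ik(2)] dom_in(2)[OF x ik(2)] ik(3)]
      by (simp add: ip_sum_basis)
  qed
qed

end

section \<open>The space of square integrable functions\<close>

lemma borel_measurable_cnj [measurable (raw)]:
  "f \<in> borel_measurable M \<Longrightarrow> (\<lambda>x. cnj (f x)) \<in> borel_measurable M"
  by (rule borel_measurable_continuous_on[of cnj]) (auto intro: continuous_intros)

lemma sq_integrableI:
  assumes [measurable]: "f \<in> borel_measurable M" and g: "integrable M g" "\<And>t. (cmod (f t))\<^sup>2 \<le> g t"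
  shows "f \<in> sq_integrable M"
  unfolding sq_integrable_def
  using Bochner_Integration.integrable_bound[OF g(1), of "\<lambda>t. (cmod (f t))\<^sup>2"] g(2)
  by (auto intro: order_trans[OF _ abs_ge_self])

lemma sq_integrable_measurable [measurable_dest]: "f \<in> sq_integrable M \<Longrightarrow> f \<in> borel_measurable M"
  by (simp add: sq_integrable_def)

lemma sq_integrable_norm: "f \<in> sq_integrable M \<Longrightarrow> integrable M (\<lambda>t. (cmod (f t))\<^sup>2)"
  by (simp add: sq_integrable_def)

lemma sq_integrable_0 [simp]: "(\<lambda>t. 0) \<in> sq_integrable M"
  by (simp add: sq_integrable_def)

lemma sq_integrable_add:
  assumes f: "f \<in> sq_integrable M" and g: "g \<in> sq_integrable M"
  shows "(\<lambda>t. f t + g t) \<in> sq_integrable M"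
proof (rule sq_integrableI)
  show "integrable M (\<lambda>t. 2 * (cmod (f t))\<^sup>2 + 2 * (cmod (g t))\<^sup>2)"
    using f g by (intro Bochner_Integration.integrable_add integrable_mult_right sq_integrable_norm)
  fix t
  have "(cmod (f t + g t))\<^sup>2 \<le> (cmod (f t) + cmod (g t))\<^sup>2" by (intro power_mono norm_triangle_ineq) simp
  also have "\<dots> \<le> 2 * (cmod (f t))\<^sup>2 + 2 * (cmod (g t))\<^sup>2"
    using sum_squares_bound[of "cmod (f t)" "cmod (g t)"] by (simp add: power2_sum)
  finally show "(cmod (f t + g t))\<^sup>2 \<le> 2 * (cmod (f t))\<^sup>2 + 2 * (cmod (g t))\<^sup>2" .
qed (use f g in measurable)

lemma sq_integrable_mult:
  assumes f: "f \<in> sq_integrable M" and [measurable]: "g \<in> borel_measurable M" and C: "\<And>t. cmod (g t) \<le> C"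
  shows "(\<lambda>t. g t * f t) \<in> sq_integrable M"
proof (rule sq_integrableI)
  show "integrable M (\<lambda>t. C\<^sup>2 * (cmod (f t))\<^sup>2)" using f by (intro integrable_mult_right sq_integrable_norm)
  fix t
  have "(cmod (g t))\<^sup>2 \<le> C\<^sup>2" by (intro power_mono C) simp
  thus "(cmod (g t * f t))\<^sup>2 \<le> C\<^sup>2 * (cmod (f t))\<^sup>2"
    by (simp add: norm_mult power_mult_distrib mult_right_mono)
qed (use f in measurable)

lemma sq_integrable_cmult: "f \<in> sq_integrable M \<Longrightarrow> (\<lambda>t. c * f t) \<in> sq_integrable M"
  by (rule sq_integrable_mult[where C = "cmod c"]) auto

lemma sq_integrable_diff:
  assumes "f \<in> sq_integrable M" "g \<in> sq_integrable M"
  shows "(\<lambda>t. f t - g t) \<in> sq_integrable M"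
  using sq_integrable_add[OF assms(1) sq_integrable_cmult[OF assms(2), of "-1"]] by simp

lemma sq_integrable_product:
  assumes f: "f \<in> sq_integrable M" and g: "g \<in> sq_integrable M"
  shows "integrable M (\<lambda>t. f t * cnj (g t))"
proof (rule Bochner_Integration.integrable_bound)
  show "integrable M (\<lambda>t. (cmod (f t))\<^sup>2 + (cmod (g t))\<^sup>2)"
    using f g by (intro Bochner_Integration.integrable_add sq_integrable_norm)
  have "cmod (f t * cnj (g t)) \<le> (cmod (f t))\<^sup>2 + (cmod (g t))\<^sup>2" for t
  proof -
    have "0 \<le> cmod (f t) * cmod (g t)" by simp
    thus ?thesis using sum_squares_bound[of "cmod (f t)" "cmod (g t)"] unfolding norm_mult complex_mod_cnj
      by linarith
  qed
  thus "AE t in M. norm (f t * cnj (g t)) \<le> norm ((cmod (f t))\<^sup>2 + (cmod (g t))\<^sup>2)" by auto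
qed (use f g in measurable)

lemma L2_class_self: "f \<in> sq_integrable M \<Longrightarrow> f \<in> L2_class M f"
  by (simp add: L2_class_def)

lemma L2_class_eqI: "(AE t in M. f t = g t) \<Longrightarrow> L2_class M f = L2_class M g"
  unfolding L2_class_def by (intro Collect_cong conj_cong refl eventually_subst) (auto elim: eventually_mono)

lemma L2_class_eq_iff:
  assumes "f \<in> sq_integrable M"
  shows "L2_class M f = L2_class M g \<longleftrightarrow> (AE t in M. f t = g t)"
  using L2_class_self[OF assms] L2_class_eqI[of f g M] by (auto simp: L2_class_def)

text \<open>The operations of \<open>L2\<close> are defined with an arbitrary representative of each
  class. That it differs from \<open>f\<close> only on a null set lets them be computed with any
  given representative.\<close>

lemma L2_fun_class:
  assumes "f \<in> sq_integrable M"
  shows "L2_fun (L2_class M f) \<in> sq_integrable M" "AE t in M. L2_fun (L2_class M f) t = f t"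
proof -
  have "L2_fun (L2_class M f) \<in> L2_class M f"
    unfolding L2_fun_def by (rule someI[of _ f]) (rule L2_class_self[OF assms])
  thus "L2_fun (L2_class M f) \<in> sq_integrable M" "AE t in M. L2_fun (L2_class M f) t = f t"
    by (simp_all add: L2_class_def)
qed

lemma L2_carrier: "carrier (L2 M) = L2_class M ` sq_integrable M"
  by (simp add: L2_def)

lemma L2_class_in [simp, intro]: "f \<in> sq_integrable M \<Longrightarrow> L2_class M f \<in> carrier (L2 M)"
  by (simp add: L2_carrier)

lemma L2_cases:
  assumes "X \<in> carrier (L2 M)"
  obtains f where "f \<in> sq_integrable M" "X = L2_class M f"
  using assms by (auto simp: L2_carrier)

lemma L2_fun_in: "X \<in> carrier (L2 M) \<Longrightarrow> L2_fun X \<in> sq_integrable M"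
  by (auto simp: L2_carrier L2_fun_class)

lemma L2_class_L2_fun: "X \<in> carrier (L2 M) \<Longrightarrow> L2_class M (L2_fun X) = X"
  using L2_class_eqI[OF L2_fun_class(2)] by (auto simp: L2_carrier)

lemma L2_zero: "\<zero>\<^bsub>L2 M\<^esub> = L2_class M (\<lambda>t. 0)"
  by (simp add: L2_def)

lemma L2_add:
  assumes "f \<in> sq_integrable M" "g \<in> sq_integrable M"
  shows "L2_class M f \<oplus>\<^bsub>L2 M\<^esub> L2_class M g = L2_class M (\<lambda>t. f t + g t)"
proof -
  have "AE t in M. L2_fun (L2_class M f) t + L2_fun (L2_class M g) t = f t + g t"
    using L2_fun_class(2)[OF assms(1)] L2_fun_class(2)[OF assms(2)] by eventually_elim simp
  thus ?thesis by (simp add: L2_def L2_class_eqI)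
qed

lemma L2_smult:
  assumes "f \<in> sq_integrable M"
  shows "c \<odot>\<^bsub>L2 M\<^esub> L2_class M f = L2_class M (\<lambda>t. c * f t)"
proof -
  have "AE t in M. c * L2_fun (L2_class M f) t = c * f t"
    using L2_fun_class(2)[OF assms] by eventually_elim simp
  thus ?thesis by (simp add: L2_def L2_class_eqI)
qed

lemma L2_ip:
  assumes "f \<in> sq_integrable M" "g \<in> sq_integrable M"
  shows "ip (L2 M) (L2_class M f) (L2_class M g) = (LINT t|M. f t * cnj (g t))"
proof -
  note [measurable_dest] = sq_integrable_measurable
  note [measurable] = assms L2_fun_class(1)[OF assms(1)] L2_fun_class(1)[OF assms(2)]
  have "AE t in M. L2_fun (L2_class M f) t * cnj (L2_fun (L2_class M g) t) = f t * cnj (g t)"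
    using L2_fun_class(2)[OF assms(1)] L2_fun_class(2)[OF assms(2)] by eventually_elim simp
  thus ?thesis unfolding L2_def hspace.simps by (intro integral_cong_AE) measurable
qed

lemma L2_ip_self:
  assumes "f \<in> sq_integrable M"
  shows "ip (L2 M) (L2_class M f) (L2_class M f) = complex_of_real (LINT t|M. (cmod (f t))\<^sup>2)"
  unfolding L2_ip[OF assms assms] complex_norm_square[symmetric] by (rule integral_complex_of_real)

lemma L2_hnorm:
  assumes "f \<in> sq_integrable M"
  shows "hnorm (L2 M) (L2_class M f) = sqrt (LINT t|M. (cmod (f t))\<^sup>2)"
  by (simp add: hnorm_def L2_ip_self[OF assms])

lemma pre_hilbert_space_L2: "pre_hilbert_space (L2 M)"
proof -
  have "abelian_group (L2 M)"
  proof (rule abelian_groupI)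
    fix X Y Z assume "X \<in> carrier (L2 M)" "Y \<in> carrier (L2 M)" "Z \<in> carrier (L2 M)"
    then obtain f g h where fgh: "f \<in> sq_integrable M" "X = L2_class M f"
      "g \<in> sq_integrable M" "Y = L2_class M g" "h \<in> sq_integrable M" "Z = L2_class M h" by (metis L2_cases)
    show "X \<oplus>\<^bsub>L2 M\<^esub> Y \<in> carrier (L2 M)" "X \<oplus>\<^bsub>L2 M\<^esub> Y = Y \<oplus>\<^bsub>L2 M\<^esub> X"
      "X \<oplus>\<^bsub>L2 M\<^esub> Y \<oplus>\<^bsub>L2 M\<^esub> Z = X \<oplus>\<^bsub>L2 M\<^esub> (Y \<oplus>\<^bsub>L2 M\<^esub> Z)"
      using fgh by (simp_all add: L2_add sq_integrable_add algebra_simps)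
  next
    fix X assume "X \<in> carrier (L2 M)"
    then obtain f where f: "f \<in> sq_integrable M" "X = L2_class M f" by (rule L2_cases)
    show "\<zero>\<^bsub>L2 M\<^esub> \<oplus>\<^bsub>L2 M\<^esub> X = X" using f by (simp add: L2_zero L2_add)
    show "\<exists>Y\<in>carrier (L2 M). Y \<oplus>\<^bsub>L2 M\<^esub> X = \<zero>\<^bsub>L2 M\<^esub>"
      by (intro bexI[of _ "L2_class M (\<lambda>t. (-1) * f t)"])
         (use f sq_integrable_cmult[OF f(1), of "-1"] in \<open>simp_all add: L2_zero L2_add\<close>)
  qed (simp add: L2_zero)
  hence "module complex_field (L2 M)"
  proof (rule moduleI[OF cring_complex_field])
    fix a b X Y assume "X \<in> carrier (L2 M)" "Y \<in> carrier (L2 M)"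
    then obtain f g where fg: "f \<in> sq_integrable M" "X = L2_class M f"
      "g \<in> sq_integrable M" "Y = L2_class M g" by (metis L2_cases)
    show "a \<odot>\<^bsub>L2 M\<^esub> X \<in> carrier (L2 M)" "a \<odot>\<^bsub>L2 M\<^esub> (X \<oplus>\<^bsub>L2 M\<^esub> Y) = a \<odot>\<^bsub>L2 M\<^esub> X \<oplus>\<^bsub>L2 M\<^esub> a \<odot>\<^bsub>L2 M\<^esub> Y"
      "(a \<oplus>\<^bsub>complex_field\<^esub> b) \<odot>\<^bsub>L2 M\<^esub> X = a \<odot>\<^bsub>L2 M\<^esub> X \<oplus>\<^bsub>L2 M\<^esub> b \<odot>\<^bsub>L2 M\<^esub> X"
      "(a \<otimes>\<^bsub>complex_field\<^esub> b) \<odot>\<^bsub>L2 M\<^esub> X = a \<odot>\<^bsub>L2 M\<^esub> (b \<odot>\<^bsub>L2 M\<^esub> X)"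
      "\<one>\<^bsub>complex_field\<^esub> \<odot>\<^bsub>L2 M\<^esub> X = X"
      using fg by (simp_all add: L2_add L2_smult sq_integrable_add sq_integrable_cmult algebra_simps)
  qed
  moreover have "pre_hilbert_space_axioms (L2 M)"
  proof
    fix X Y Z :: "('a \<Rightarrow> complex) set" and c :: complex
    assume "X \<in> carrier (L2 M)" "Y \<in> carrier (L2 M)"
    then obtain f g where fg: "f \<in> sq_integrable M" "X = L2_class M f"
      "g \<in> sq_integrable M" "Y = L2_class M g" by (metis L2_cases)
    show "ip (L2 M) (c \<odot>\<^bsub>L2 M\<^esub> X) Y = c * ip (L2 M) X Y"
      using fg by (simp add: L2_smult L2_ip sq_integrable_cmult mult.assoc)
    show "ip (L2 M) Y X = cnj (ip (L2 M) X Y)"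
      using fg Bochner_Integration.integral_cnj[of M "\<lambda>t. f t * cnj (g t)"] by (simp add: L2_ip mult.commute)
    assume "Z \<in> carrier (L2 M)"
    then obtain h where h: "h \<in> sq_integrable M" "Z = L2_class M h" by (rule L2_cases)
    show "ip (L2 M) (X \<oplus>\<^bsub>L2 M\<^esub> Y) Z = ip (L2 M) X Z + ip (L2 M) Y Z"
      using fg h by (simp add: L2_add L2_ip sq_integrable_add distrib_right sq_integrable_product)
  next
    fix X assume "X \<in> carrier (L2 M)" and nz: "X \<noteq> \<zero>\<^bsub>L2 M\<^esub>"
    then obtain f where f: "f \<in> sq_integrable M" "X = L2_class M f" by (metis L2_cases)
    have "\<not> (AE t in M. f t = 0)" using nz f L2_class_eq_iff[of f M "\<lambda>t. 0"] by (simp add: L2_zero)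
    hence "(LINT t|M. (cmod (f t))\<^sup>2) \<noteq> 0"
      using integral_nonneg_eq_0_iff_AE[OF sq_integrable_norm[OF f(1)]] by auto
    moreover have "(LINT t|M. (cmod (f t))\<^sup>2) \<ge> 0" by simp
    ultimately have "0 < (LINT t|M. (cmod (f t))\<^sup>2)" by linarith
    thus "0 < Re (ip (L2 M) X X)" by (simp add: f L2_ip_self)
  qed
  ultimately show ?thesis by (simp add: pre_hilbert_space_def)
qed

interpretation L2: pre_hilbert_space "L2 M" for M
  by (rule pre_hilbert_space_L2)

lemma L2_minus:
  assumes "f \<in> sq_integrable M" "g \<in> sq_integrable M"
  shows "L2_class M f \<ominus>\<^bsub>L2 M\<^esub> L2_class M g = L2_class M (\<lambda>t. f t - g t)"
proof -
  have "L2_class M (\<lambda>t. f t - g t) \<oplus>\<^bsub>L2 M\<^esub> L2_class M g = L2_class M f"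
    using assms by (simp add: L2_add sq_integrable_diff)
  moreover have "(L2_class M (\<lambda>t. f t - g t) \<oplus>\<^bsub>L2 M\<^esub> L2_class M g) \<ominus>\<^bsub>L2 M\<^esub> L2_class M g = L2_class M (\<lambda>t. f t - g t)"
    using assms sq_integrable_diff by (intro L2.add_minus_cancel) auto
  ultimately show ?thesis by simp
qed

text \<open>Cauchy-Schwarz for the modulus of \<open>f\<close> and the constant 1. It provides the
  mean convergence of order one from which almost everywhere convergence is extracted.\<close>

lemma (in finite_measure) integral_norm_le_L2_hnorm:
  assumes f: "f \<in> sq_integrable M"
  shows "integrable M f" "(LINT t|M. cmod (f t)) \<le> sqrt (measure M (space M)) * hnorm (L2 M) (L2_class M f)"
proof -
  note [measurable] = sq_integrable_measurable[OF f]
  have one: "(\<lambda>t. 1) \<in> sq_integrable M" by (simp add: sq_integrable_def)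
  have nf: "(\<lambda>t. complex_of_real (cmod (f t))) \<in> sq_integrable M"
    using sq_integrable_norm[OF f] by (auto simp: sq_integrable_def)
  show "integrable M f" using sq_integrable_product[OF f one] by simp
  have "(LINT t|M. cmod (f t)) = Re (ip (L2 M) (L2_class M (\<lambda>t. complex_of_real (cmod (f t)))) (L2_class M (\<lambda>t. 1)))"
    by (simp add: L2_ip[OF nf one])
  also have "\<dots> \<le> hnorm (L2 M) (L2_class M (\<lambda>t. complex_of_real (cmod (f t)))) * hnorm (L2 M) (L2_class M (\<lambda>t. 1))"
    by (rule order_trans[OF complex_Re_le_cmod L2.Cauchy_Schwarz]) (use nf one in auto)
  also have "\<dots> = sqrt (measure M (space M)) * hnorm (L2 M) (L2_class M f)"
    by (simp add: L2_hnorm[OF nf] L2_hnorm[OF one] L2_hnorm[OF f])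
  finally show "(LINT t|M. cmod (f t)) \<le> sqrt (measure M (space M)) * hnorm (L2 M) (L2_class M f)" .
qed

text \<open>A rapidly converging subsequence converges almost everywhere, and by Fatou's lemma its pointwise
  limit is also the limit in the mean.\<close>

lemma (in finite_measure) hilbert_space_L2: "hilbert_space (L2 M)"
proof -
  have "Metric_space.mcomplete (carrier (L2 M)) (hdist (L2 M))"
  proof (rule L2.mcompleteI)
    fix s :: "nat \<Rightarrow> ('a \<Rightarrow> complex) set" assume s: "\<And>n. s n \<in> carrier (L2 M)"
      and cau: "\<And>\<epsilon>. \<epsilon> > 0 \<Longrightarrow> \<exists>N. \<forall>m\<ge>N. \<forall>n\<ge>N. hnorm (L2 M) (s m \<ominus>\<^bsub>L2 M\<^esub> s n) < \<epsilon>"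
    define f where "f n = L2_fun (s n)" for n
    have f: "f n \<in> sq_integrable M" and sf: "s n = L2_class M (f n)" for n
      using L2_fun_in[OF s] L2_class_L2_fun[OF s] by (simp_all add: f_def)
    note [measurable] = sq_integrable_measurable[OF f]
    have diff: "(\<lambda>t. f m t - f n t) \<in> sq_integrable M" for m n using f by (intro sq_integrable_diff)
    have hn: "hnorm (L2 M) (s m \<ominus>\<^bsub>L2 M\<^esub> s n) = hnorm (L2 M) (L2_class M (\<lambda>t. f m t - f n t))" for m n
      by (simp add: sf L2_minus f)
    have "\<exists>N. \<forall>m\<ge>N. \<forall>n\<ge>N. hnorm (L2 M) (s m \<ominus>\<^bsub>L2 M\<^esub> s n) < (1 / 2) ^ k" for k :: nat
      by (rule cau) simp
    then obtain N :: "nat \<Rightarrow> nat" where N: "\<And>k m n. \<lbrakk>m \<ge> N k; n \<ge> N k\<rbrakk> \<Longrightarrow> hnorm (L2 M) (s m \<ominus>\<^bsub>L2 M\<^esub> s n) < (1 / 2) ^ k"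
      by metis
    \<comment> \<open>\<open>r k\<close> is at least \<open>N k\<close>, at least \<open>k\<close>,
      and nondecreasing in \<open>k\<close>: successive members of the subsequence are within
      (1/2)^k, and the subsequence goes to infinity.\<close>
    define r where "r k = k + Max (N ` {..k})" for k
    have rN: "r k \<ge> N k" for k
    proof -
      have "N k \<le> Max (N ` {..k})" by (intro Max_ge) auto
      thus ?thesis unfolding r_def by linarith
    qed
    have rk: "r k \<ge> k" for k by (simp add: r_def)
    have r_mono: "r k \<le> r (Suc k)" for k unfolding r_def by (intro add_mono Max_mono) auto
    have step: "hnorm (L2 M) (s (r (Suc k)) \<ominus>\<^bsub>L2 M\<^esub> s (r k)) < (1 / 2) ^ k" for k
      using N[of k "r (Suc k)" "r k"] rN[of k] r_mono[of k] by linarith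
    define h where "h k t = f (r (Suc k)) t - f (r k) t" for k t
    have h: "h k \<in> sq_integrable M" for k unfolding h_def by (rule diff)
    note [measurable] = sq_integrable_measurable[OF h]
    define c where "c = sqrt (measure M (space M))"
    have hi: "integrable M (\<lambda>t. cmod (h k t))" "(LINT t|M. cmod (h k t)) \<le> c * (1 / 2) ^ k" for k
    proof -
      show "integrable M (\<lambda>t. cmod (h k t))"
        using integral_norm_le_L2_hnorm(1)[OF h[of k]] by (rule integrable_norm)
      have "hnorm (L2 M) (L2_class M (h k)) \<le> (1 / 2) ^ k"
        using step[of k] unfolding hn h_def by simp
      hence "c * hnorm (L2 M) (L2_class M (h k)) \<le> c * (1 / 2) ^ k"
        by (intro mult_left_mono) (simp_all add: c_def)
      thus "(LINT t|M. cmod (h k t)) \<le> c * (1 / 2) ^ k"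
        using integral_norm_le_L2_hnorm(2)[OF h[of k]] by (simp add: c_def)
    qed
    \<comment> \<open>The increments have integrals bounded by a geometric series, so by monotone
      convergence the sum of their moduli is finite almost everywhere; there the telescoping series
      converges.\<close>
    have "(\<integral>\<^sup>+t. (\<Sum>k. ennreal (cmod (h k t))) \<partial>M) = (\<Sum>k. \<integral>\<^sup>+t. ennreal (cmod (h k t)) \<partial>M)"
      by (rule nn_integral_suminf) measurable
    also have "\<dots> = (\<Sum>k. ennreal (LINT t|M. cmod (h k t)))"
      using hi(1) by (intro suminf_cong nn_integral_eq_integral) auto
    also have "\<dots> \<le> (\<Sum>k. ennreal (c * (1 / 2) ^ k))"
      using hi(2) by (intro suminf_le ennreal_leI summableI) auto
    also have "\<dots> = ennreal (\<Sum>k. c * (1 / 2) ^ k)"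
      by (rule suminf_ennreal2) (auto simp: c_def intro!: summable_mult summable_geometric)
    finally have "(\<integral>\<^sup>+t. (\<Sum>k. ennreal (cmod (h k t))) \<partial>M) \<noteq> \<infinity>" by (auto simp: top_unique)
    hence "AE t in M. (\<Sum>k. ennreal (cmod (h k t))) \<noteq> \<infinity>" by (intro nn_integral_PInf_AE) measurable
    hence conv: "AE t in M. convergent (\<lambda>k. f (r k) t)"
    proof eventually_elim
      case (elim t)
      hence "summable (\<lambda>k. norm (h k t))" by (intro summable_suminf_not_top) auto
      hence "summable (\<lambda>k. h k t)" by (rule summable_norm_cancel)
      hence "convergent (\<lambda>n. \<Sum>k<n. h k t)" by (simp add: summable_iff_convergent)
      moreover have "(\<lambda>n. \<Sum>k<n. h k t) = (\<lambda>n. f (r n) t - f (r 0) t)"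
      proof
        fix n show "(\<Sum>k<n. h k t) = f (r n) t - f (r 0) t" by (induction n) (simp_all add: h_def)
      qed
      ultimately show ?case using convergent_add_const_iff[of "- f (r 0) t" "\<lambda>n. f (r n) t"] by simp
    qed
    define g where "g t = lim (\<lambda>k. f (r k) t)" for t
    have [measurable]: "g \<in> borel_measurable M" unfolding g_def by measurable
    have lim: "AE t in M. (\<lambda>k. f (r k) t) \<longlonglongrightarrow> g t"
      using conv by eventually_elim (simp add: g_def convergent_LIMSEQ_iff)
    have bound: "(\<integral>\<^sup>+t. ennreal ((cmod (f n t - g t))\<^sup>2) \<partial>M) \<le> ennreal (\<epsilon>\<^sup>2)"
      if \<epsilon>: "\<epsilon> > 0" and K: "\<forall>m\<ge>K. \<forall>n\<ge>K. hnorm (L2 M) (s m \<ominus>\<^bsub>L2 M\<^esub> s n) < \<epsilon>" and n: "n \<ge> K" for \<epsilon> K n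
    proof -
      have "(\<integral>\<^sup>+t. ennreal ((cmod (f n t - g t))\<^sup>2) \<partial>M)
        = (\<integral>\<^sup>+t. liminf (\<lambda>k. ennreal ((cmod (f n t - f (r k) t))\<^sup>2)) \<partial>M)"
      proof (rule nn_integral_cong_AE)
        show "AE t in M. ennreal ((cmod (f n t - g t))\<^sup>2) = liminf (\<lambda>k. ennreal ((cmod (f n t - f (r k) t))\<^sup>2))"
          using lim
        proof eventually_elim
          case (elim t)
          have "(\<lambda>k. ennreal ((cmod (f n t - f (r k) t))\<^sup>2)) \<longlonglongrightarrow> ennreal ((cmod (f n t - g t))\<^sup>2)"
            by (intro tendsto_ennrealI tendsto_power tendsto_norm tendsto_diff tendsto_const elim)
          thus ?case by (intro lim_imp_Liminf[symmetric]) auto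
        qed
      qed
      also have "\<dots> \<le> liminf (\<lambda>k. \<integral>\<^sup>+t. ennreal ((cmod (f n t - f (r k) t))\<^sup>2) \<partial>M)"
        by (rule nn_integral_liminf) measurable
      also have "\<dots> \<le> ennreal (\<epsilon>\<^sup>2)"
      proof (rule Liminf_le)
        have "(\<integral>\<^sup>+t. ennreal ((cmod (f n t - f (r k) t))\<^sup>2) \<partial>M) \<le> ennreal (\<epsilon>\<^sup>2)" if k: "k \<ge> K" for k
        proof -
          have "(\<integral>\<^sup>+t. ennreal ((cmod (f n t - f (r k) t))\<^sup>2) \<partial>M) = ennreal (LINT t|M. (cmod (f n t - f (r k) t))\<^sup>2)"
            using sq_integrable_norm[OF diff] by (intro nn_integral_eq_integral) auto
          also have "(LINT t|M. (cmod (f n t - f (r k) t))\<^sup>2) = (hnorm (L2 M) (s n \<ominus>\<^bsub>L2 M\<^esub> s (r k)))\<^sup>2"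
            by (simp add: hn L2_hnorm[OF diff])
          also have "\<dots> \<le> \<epsilon>\<^sup>2"
            using K n k rk[of k] s by (intro power_mono) (auto intro: less_imp_le)
          finally show ?thesis by (simp add: ennreal_leI)
        qed
        thus "\<forall>\<^sub>F k in sequentially. (\<integral>\<^sup>+t. ennreal ((cmod (f n t - f (r k) t))\<^sup>2) \<partial>M) \<le> ennreal (\<epsilon>\<^sup>2)"
          by (auto simp: eventually_sequentially)
      qed simp
      finally show ?thesis .
    qed
    have fg: "(\<lambda>t. f n t - g t) \<in> sq_integrable M" if "\<epsilon> > 0" "\<forall>m\<ge>K. \<forall>n\<ge>K. hnorm (L2 M) (s m \<ominus>\<^bsub>L2 M\<^esub> s n) < \<epsilon>" "n \<ge> K" for \<epsilon> K n
    proof -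
      have "integrable M (\<lambda>t. (cmod (f n t - g t))\<^sup>2)"
        using bound[OF that] by (intro integrableI_bounded) (auto simp: top_unique intro: le_less_trans)
      thus ?thesis unfolding sq_integrable_def by simp
    qed
    obtain K1 where K1: "\<forall>m\<ge>K1. \<forall>n\<ge>K1. hnorm (L2 M) (s m \<ominus>\<^bsub>L2 M\<^esub> s n) < 1" using cau[OF zero_less_one] by (rule exE)
    have g: "g \<in> sq_integrable M"
      using sq_integrable_diff[OF f fg[OF zero_less_one K1 order_refl], of K1] by simp
    have "(\<lambda>n. hnorm (L2 M) (s n \<ominus>\<^bsub>L2 M\<^esub> L2_class M g)) \<longlonglongrightarrow> 0"
    proof (rule LIMSEQ_I)
      fix \<epsilon> :: real assume "\<epsilon> > 0"
      hence \<epsilon>: "\<epsilon> / 2 > 0" by simp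
      obtain K where K: "\<forall>m\<ge>K. \<forall>n\<ge>K. hnorm (L2 M) (s m \<ominus>\<^bsub>L2 M\<^esub> s n) < \<epsilon> / 2" using cau[OF \<epsilon>] by (rule exE)
      have "norm (hnorm (L2 M) (s n \<ominus>\<^bsub>L2 M\<^esub> L2_class M g) - 0) < \<epsilon>" if n: "n \<ge> K" for n
      proof -
        have eq: "hnorm (L2 M) (s n \<ominus>\<^bsub>L2 M\<^esub> L2_class M g) = sqrt (LINT t|M. (cmod (f n t - g t))\<^sup>2)"
          by (simp add: sf L2_minus f g L2_hnorm[OF fg[OF \<epsilon> K n]])
        have "ennreal (LINT t|M. (cmod (f n t - g t))\<^sup>2) \<le> ennreal ((\<epsilon> / 2)\<^sup>2)"
          using bound[OF \<epsilon> K n] nn_integral_eq_integral[OF sq_integrable_norm[OF fg[OF \<epsilon> K n]]] by simp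
        hence "(LINT t|M. (cmod (f n t - g t))\<^sup>2) \<le> (\<epsilon> / 2)\<^sup>2" by (subst (asm) ennreal_le_iff) auto
        hence "sqrt (LINT t|M. (cmod (f n t - g t))\<^sup>2) \<le> \<epsilon> / 2" using \<epsilon> by (rule_tac real_le_lsqrt) auto
        thus ?thesis using \<epsilon> unfolding eq by (simp add: real_sqrt_ge_zero)
      qed
      thus "\<exists>K. \<forall>n\<ge>K. norm (hnorm (L2 M) (s n \<ominus>\<^bsub>L2 M\<^esub> L2_class M g) - 0) < \<epsilon>" by blast
    qed
    thus "\<exists>X\<in>carrier (L2 M). (\<lambda>n. hnorm (L2 M) (s n \<ominus>\<^bsub>L2 M\<^esub> X)) \<longlonglongrightarrow> 0" using g by blast
  qed
  thus ?thesis
    by unfold_locales (auto simp: L2.ip_add_left L2.ip_smult_left L2.ip_pos intro: L2.ip_commute)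
qed

section \<open>The Fourier basis on a circle\<close>

definition fourier :: "nat \<Rightarrow> int \<Rightarrow> real \<Rightarrow> complex" where
  "fourier n k t = exp (\<i> * 2 ^ n * of_int k * of_real t)"

lemma fourier_cis: "fourier n k t = cis (2 ^ n * of_int k * t)"
  by (simp add: fourier_def cis_conv_exp mult_ac)

lemma norm_fourier [simp]: "cmod (fourier n k t) = 1"
  by (simp add: fourier_cis)

lemma continuous_fourier [continuous_intros]: "continuous_on S (fourier n k)"
  unfolding fourier_def by (intro continuous_intros)

lemma fourier_measurable [measurable]: "fourier n k \<in> borel_measurable borel"
  by (rule borel_measurable_continuous_onI) (rule continuous_fourier)

lemma fourier_mult: "fourier n j t * fourier n k t = fourier n (j + k) t"
  by (simp add: fourier_def algebra_simps flip: exp_add)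

lemma cnj_fourier: "cnj (fourier n k t) = fourier n (- k) t"
  by (simp add: fourier_cis cis_cnj)

lemma fourier_0 [simp]: "fourier n 0 t = 1"
  by (simp add: fourier_def)

lemma fourier_deriv:
  "(fourier n k has_vector_derivative (\<i> * 2 ^ n * of_int k * fourier n k t)) (at t within S)"
proof -
  define c where "c = \<i> * 2 ^ n * of_int k"
  have "((\<lambda>z. exp (c * z)) has_field_derivative c * exp (c * of_real t)) (at (of_real t))"
    by (auto intro!: derivative_eq_intros)
  from has_vector_derivative_real_field[OF this] show ?thesis by (simp add: fourier_def[abs_def] c_def)
qed

lemma fourier_periodic: "fourier n k (- (pi / 2 ^ n)) = fourier n k (pi / 2 ^ n)"
proof -
  have "fourier n k (pi / 2 ^ n) = fourier n k (- (pi / 2 ^ n)) * cis (2 * pi * of_int k)"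
    unfolding fourier_cis cis_mult by (simp add: algebra_simps)
  also have "cis (2 * pi * of_int k) = 1" by (rule cis_multiple_2pi) simp
  finally show ?thesis by simp
qed

lemma prob_space_circle: "emeasure (circle_measure n) (space (circle_measure n)) = 1"
  unfolding circle_measure_def by (subst emeasure_uniform_measure) (auto simp: ennreal_divide_self)

lemma finite_measure_circle: "finite_measure (circle_measure n)"
  by (rule finite_measureI) (simp add: prob_space_circle)

lemma sets_circle [measurable_cong, simp]: "sets (circle_measure n) = sets borel"
  by (simp add: circle_measure_def)

lemma space_circle [simp]: "space (circle_measure n) = UNIV"
  by (simp add: circle_measure_def)

lemma measure_circle [simp]: "measure (circle_measure n) UNIV = 1"
  using prob_space_circle[of n] by (simp add: measure_def)

lemma measurable_circle [simp]: "borel_measurable (circle_measure n) = borel_measurable borel"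
  by (rule measurable_cong_sets) simp_all

lemma circle_measure_density:
  "circle_measure n = density lborel (\<lambda>t. ennreal (indicator {- (pi / 2 ^ n)..pi / 2 ^ n} t / (2 * pi / 2 ^ n)))"
  unfolding circle_measure_def uniform_measure_def
proof (rule density_cong)
  define c where "c = 2 * pi / 2 ^ n"
  have c: "c > 0" "emeasure lborel {- (pi / 2 ^ n)..pi / 2 ^ n} = ennreal c" by (simp_all add: c_def)
  have "indicator {- (pi / 2 ^ n)..pi / 2 ^ n} t / ennreal c = ennreal (indicator {- (pi / 2 ^ n)..pi / 2 ^ n} t / c)" for t
    using divide_ennreal[of 1 c] c(1) by (simp add: indicator_def)
  thus "AE t in lborel. indicator {- (pi / 2 ^ n)..pi / 2 ^ n} t / emeasure lborel {- (pi / 2 ^ n)..pi / 2 ^ n}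
      = ennreal (indicator {- (pi / 2 ^ n)..pi / 2 ^ n} t / (2 * pi / 2 ^ n))"
    unfolding c c_def[symmetric] by simp
qed auto

lemma circle_integral:
  fixes f :: "real \<Rightarrow> complex"
  assumes [measurable]: "f \<in> borel_measurable borel"
  shows "(LINT t|circle_measure n. f t) = (1 / (2 * pi / 2 ^ n)) *\<^sub>R (LINT t:{- (pi / 2 ^ n)..pi / 2 ^ n}|lborel. f t)"
proof -
  define c where "c = 2 * pi / 2 ^ n"
  have "(LINT t|circle_measure n. f t)
    = (LINT t|lborel. (indicator {- (pi / 2 ^ n)..pi / 2 ^ n} t / c) *\<^sub>R f t)"
    unfolding circle_measure_density c_def by (rule integral_density) auto
  also have "\<dots> = (LINT t|lborel. (1 / c) *\<^sub>R (indicator {- (pi / 2 ^ n)..pi / 2 ^ n} t *\<^sub>R f t))"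
    by simp
  also have "\<dots> = (1 / c) *\<^sub>R (LINT t:{- (pi / 2 ^ n)..pi / 2 ^ n}|lborel. f t)"
    unfolding set_lebesgue_integral_def by (rule integral_scaleR_right)
  finally show ?thesis by (simp only: c_def)
qed

lemma AE_circle_iff:
  assumes [measurable]: "Measurable.pred borel P"
  shows "(AE t in circle_measure n. P t) \<longleftrightarrow> (AE t in lborel. t \<in> {- (pi / 2 ^ n)..pi / 2 ^ n} \<longrightarrow> P t)"
proof -
  have "(AE t in circle_measure n. P t) \<longleftrightarrow>
    (AE t in lborel. 0 < ennreal (indicator {- (pi / 2 ^ n)..pi / 2 ^ n} t / (2 * pi / 2 ^ n)) \<longrightarrow> P t)"
    unfolding circle_measure_density by (rule AE_density) measurable
  also have "\<dots> \<longleftrightarrow> (AE t in lborel. t \<in> {- (pi / 2 ^ n)..pi / 2 ^ n} \<longrightarrow> P t)"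
    by (intro eventually_subst always_eventually) (auto simp: indicator_def)
  finally show ?thesis .
qed

lemma AE_circle_I:
  assumes "\<And>t. - (pi / 2 ^ n) < t \<Longrightarrow> t < pi / 2 ^ n \<Longrightarrow> t \<notin> F \<Longrightarrow> P t" "finite F"
  shows "AE t in circle_measure n. P t"
proof -
  let ?N = "insert (pi / 2 ^ n) (insert (- (pi / 2 ^ n)) F)"
  let ?A = "- {- (pi / 2 ^ n)..pi / 2 ^ n} \<union> ?N"
  have "AE t in circle_measure n. t \<notin> ?A"
  proof (subst AE_circle_iff)
    have [measurable]: "?N \<in> sets borel" using assms(2) by (intro borel_closed finite_imp_closed) auto
    show "Measurable.pred borel (\<lambda>t. t \<notin> ?A)" by measurable
    have "?N \<in> null_sets lborel" using assms(2) by (intro finite_imp_null_set_lborel) auto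
    hence "AE t in lborel. t \<notin> ?N" by (rule AE_not_in)
    thus "AE t in lborel. t \<in> {- (pi / 2 ^ n)..pi / 2 ^ n} \<longrightarrow> t \<notin> ?A" by eventually_elim auto
  qed
  thus ?thesis by eventually_elim (use assms(1) in auto)
qed

lemma integrable_circle_bounded:
  fixes f :: "real \<Rightarrow> complex"
  assumes "f \<in> borel_measurable borel" "\<And>t. cmod (f t) \<le> C"
  shows "integrable (circle_measure n) f"
  by (rule finite_measure.integrable_const_bound[OF finite_measure_circle, where B = C]) (use assms in auto)

lemma bounded_sq_integrable_circle:
  assumes [measurable]: "f \<in> borel_measurable borel" and C: "\<And>t. cmod (f t) \<le> C"
  shows "f \<in> sq_integrable (circle_measure n)"
proof -
  have "(\<lambda>t. 1) \<in> sq_integrable (circle_measure n)"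
    unfolding sq_integrable_def using finite_measure.integrable_const[OF finite_measure_circle] by simp
  from sq_integrable_mult[OF this, of f C] C show ?thesis by simp
qed

lemma fourier_sq_integrable: "fourier n k \<in> sq_integrable (circle_measure n)"
  by (rule bounded_sq_integrable_circle[of _ 1]) auto

lemma circle_basis_fourier: "circle_basis n k = L2_class (circle_measure n) (fourier n k)"
  by (simp add: circle_basis_def fourier_def[abs_def])

text \<open>The fundamental theorem of calculus over one period. The finite set \<open>F\<close>
  accommodates the kinks at the corners of a triangle. The bound on \<open>h'\<close> ensures
  Lebesgue integrability, which identifies the gauge integral of the fundamental theorem with the
  integral for the circle measure.\<close>

lemma circle_integral_derivative:
  assumes cont: "continuous_on {- (pi / 2 ^ n)..pi / 2 ^ n} h" and per: "h (- (pi / 2 ^ n)) = h (pi / 2 ^ n)"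
    and F: "finite F" and h': "\<And>t. t \<in> {- (pi / 2 ^ n)<..<pi / 2 ^ n} - F \<Longrightarrow> (h has_vector_derivative h' t) (at t)"
    and [measurable]: "h' \<in> borel_measurable borel" and C: "\<And>t. cmod (h' t) \<le> C"
  shows "(LINT t|circle_measure n. h' t) = 0"
proof -
  let ?I = "{- (pi / 2 ^ n)..pi / 2 ^ n}"
  have "(h' has_integral h (pi / 2 ^ n) - h (- (pi / 2 ^ n))) ?I"
    by (rule fundamental_theorem_of_calculus_interior_strong[OF F _ h' cont]) (auto simp: field_simps)
  hence "integral ?I h' = 0" using per by (simp add: integral_unique)
  moreover have "set_integrable lborel ?I h'"
    unfolding set_integrable_def
  proof (rule Bochner_Integration.integrable_bound)
    show "integrable lborel (\<lambda>t. C * indicator ?I t :: real)" by simp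
    show "AE t in lborel. norm (indicator ?I t *\<^sub>R h' t) \<le> norm (C * indicator ?I t)"
      using C order_trans[OF C abs_ge_self] by (auto simp: indicator_def)
  qed auto
  ultimately show ?thesis
    using set_borel_integral_eq_integral(2)[of ?I h'] by (simp add: circle_integral)
qed

lemma fourier_integral: "(LINT t|circle_measure n. fourier n k t) = (if k = 0 then 1 else 0)"
proof (cases "k = 0")
  case True
  have "fourier n k = (\<lambda>t. 1)" using True by (simp add: fun_eq_iff)
  thus ?thesis using True by simp
next
  case False
  have "(LINT t|circle_measure n. \<i> * 2 ^ n * of_int k * fourier n k t) = 0"
    by (rule circle_integral_derivative[of n "fourier n k" "{}" _ "2 ^ n * real_of_int \<bar>k\<bar>"])
       (auto intro: fourier_deriv fourier_periodic continuous_fourier simp: norm_mult norm_power)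
  thus ?thesis using False by simp
qed

lemma circle_basis_orthonormal: "ip (L2 (circle_measure n)) (circle_basis n j) (circle_basis n k) = (if j = k then 1 else 0)"
  unfolding circle_basis_fourier L2_ip[OF fourier_sq_integrable fourier_sq_integrable] cnj_fourier fourier_mult fourier_integral
  by simp

subsection \<open>Completeness of the basis\<close>

text \<open>The span of the exponentials as a predicate on functions. Its closure under products,
  \<open>trig_poly_mult\<close>, makes it an algebra, as is needed to compose polynomials with
  \<open>fourier n 1\<close>.\<close>

inductive trig_poly :: "nat \<Rightarrow> (real \<Rightarrow> complex) \<Rightarrow> bool" for n where
  monomial: "trig_poly n (\<lambda>t. c * fourier n k t)"
| sum: "\<lbrakk>trig_poly n f; trig_poly n g\<rbrakk> \<Longrightarrow> trig_poly n (\<lambda>t. f t + g t)"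

lemma trig_poly_mult:
  assumes "trig_poly n f" "trig_poly n g"
  shows "trig_poly n (\<lambda>t. f t * g t)"
  using assms
proof (induction arbitrary: g rule: trig_poly.induct)
  case (monomial c j)
  from monomial show ?case
  proof (induction rule: trig_poly.induct)
    case (monomial d k)
    have "(\<lambda>t. (c * fourier n j t) * (d * fourier n k t)) = (\<lambda>t. (c * d) * fourier n (j + k) t)"
      by (simp add: fourier_mult[symmetric] mult_ac)
    thus ?case by (simp only: trig_poly.monomial)
  next
    case (sum f g)
    thus ?case by (simp only: distrib_left trig_poly.sum)
  qed
next
  case (sum f g)
  thus ?case by (simp only: distrib_right trig_poly.sum)
qed

lemma trig_poly_const: "trig_poly n (\<lambda>t. c)"
  using trig_poly.monomial[of n c 0] by simp

text \<open>A real linear form on the complex plane is a combination of \<open>z\<close> and its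
  conjugate, and on the unit circle the conjugate of \<open>fourier n 1\<close> is
  \<open>fourier n (- 1)\<close>. Sums and products stay in the algebra.\<close>

lemma trig_poly_real_polynomial:
  fixes p :: "complex \<Rightarrow> real"
  assumes "real_polynomial_function p"
  shows "trig_poly n (\<lambda>t. complex_of_real (p (fourier n 1 t)))"
  using assms
proof (induction rule: real_polynomial_function.induct)
  case (linear p)
  interpret bounded_linear p by (rule linear)
  have "complex_of_real (p (fourier n 1 t))
     = (p 1 / 2 - \<i> * p \<i> / 2) * fourier n 1 t + (p 1 / 2 + \<i> * p \<i> / 2) * fourier n (- 1) t" for t
  proof -
    let ?z = "fourier n 1 t"
    have "?z = Re ?z *\<^sub>R 1 + Im ?z *\<^sub>R \<i>" by (simp add: complex_eq_iff)
    hence "p ?z = Re ?z * p 1 + Im ?z * p \<i>" by (metis add scaleR real_scaleR_def)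
    thus ?thesis unfolding cnj_fourier[of n 1, symmetric]
      by (simp add: complex_eq_iff field_simps)
  qed
  thus ?case by (simp only: trig_poly.intros)
next
  case (const c)
  show ?case by (rule trig_poly_const)
next
  case (add p q)
  thus ?case by (simp only: of_real_add trig_poly.sum)
next
  case (mult p q)
  thus ?case by (simp only: of_real_mult trig_poly_mult)
qed

lemma trig_poly_polynomial:
  fixes p :: "complex \<Rightarrow> complex"
  assumes "polynomial_function p"
  shows "trig_poly n (\<lambda>t. p (fourier n 1 t))"
proof -
  have "real_polynomial_function (Re \<circ> p)" "real_polynomial_function (Im \<circ> p)"
    using assms bounded_linear_Re bounded_linear_Im by (auto simp: polynomial_function_def)
  hence "trig_poly n (\<lambda>t. complex_of_real ((Re \<circ> p) (fourier n 1 t)) + \<i> * complex_of_real ((Im \<circ> p) (fourier n 1 t)))"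
    by (intro trig_poly.sum trig_poly_mult trig_poly_const trig_poly_real_polynomial)
  moreover have "complex_of_real ((Re \<circ> p) z) + \<i> * complex_of_real ((Im \<circ> p) z) = p z" for z
    by (simp add: complex_eq_iff)
  ultimately show ?thesis by simp
qed

lemma trig_poly_measurable [measurable_dest]: "trig_poly n f \<Longrightarrow> f \<in> borel_measurable borel"
  by (induction rule: trig_poly.induct) measurable

text \<open>A periodic function is a function \<open>G\<close> on the unit circle, a compact set in
  the plane, where Stone-Weierstrass supplies a polynomial; pulled back to the line it becomes
  trigonometric.\<close>

lemma periodic_continuous_approx:
  assumes g: "continuous_on {- (pi / 2 ^ n)..pi / 2 ^ n} g" and per: "g (- (pi / 2 ^ n)) = g (pi / 2 ^ n)"
    and \<epsilon>: "\<epsilon> > (0::real)"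
  obtains h where "trig_poly n h" "\<And>t. t \<in> {- (pi / 2 ^ n)..pi / 2 ^ n} \<Longrightarrow> cmod (g t - h t) < \<epsilon>"
proof -
  let ?I = "{- (pi / 2 ^ n)..pi / 2 ^ n}"
  let ?E = "fourier n 1"
  define G where "G z = g (Arg z / 2 ^ n)" for z
  have GE: "G (?E t) = g t" if t: "t \<in> ?I" for t
  proof (cases "t = - (pi / 2 ^ n)")
    case True
    \<comment> \<open>At the left end point \<open>Arg\<close> returns the value of the right one;
      here the periodicity of \<open>g\<close> enters.\<close>
    have "?E t = cis pi" unfolding True fourier_periodic by (simp add: fourier_cis)
    thus ?thesis using Arg_cis[of pi] per True by (simp add: G_def)
  next
    case False
    hence "2 ^ n * t \<in> {- pi<..pi}" using t by (auto simp: field_simps)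
    thus ?thesis using Arg_cis[of "2 ^ n * t"] by (simp add: G_def fourier_cis)
  qed
  have sph: "z \<in> ?E ` ?I" if "z \<in> sphere 0 1" for z
  proof (rule image_eqI)
    have "z \<noteq> 0" using that by auto
    from Arg_eq[OF this] have "z = cis (Arg z)" using that by (simp add: cis_conv_exp)
    thus "z = ?E (Arg z / 2 ^ n)" by (simp add: fourier_cis)
    show "Arg z / 2 ^ n \<in> ?I" using mpi_less_Arg[of z] Arg_le_pi[of z] by (auto simp: field_simps)
  qed
  \<comment> \<open>\<open>Arg\<close> jumps on the negative real axis, so continuity does not
    follow from that of \<open>Arg\<close>. Instead, preimages of closed sets under \<open>G\<close>
    are images of compact sets under the continuous map \<open>?E\<close>, hence closed.\<close>
  have "continuous_on (sphere 0 1) G"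
    unfolding continuous_on_closed_vimage[OF closed_sphere]
  proof (intro allI impI)
    fix B :: "complex set" assume B: "closed B"
    have "G -` B \<inter> sphere 0 1 = ?E ` (g -` B \<inter> ?I)"
    proof (intro equalityI subsetI)
      fix z assume z: "z \<in> G -` B \<inter> sphere 0 1"
      then obtain t where t: "z = ?E t" "t \<in> ?I" using sph[of z] by blast
      thus "z \<in> ?E ` (g -` B \<inter> ?I)" using z GE[OF t(2)] by (intro image_eqI[of _ _ t]) simp_all
    next
      fix z assume "z \<in> ?E ` (g -` B \<inter> ?I)"
      then obtain t where t: "z = ?E t" "g t \<in> B" "t \<in> ?I" by blast
      thus "z \<in> G -` B \<inter> sphere 0 1" using GE[OF t(3)] by simp
    qed
    moreover have "compact (g -` B \<inter> ?I)"
      using g B continuous_on_closed_vimage[of ?I g] by (auto simp: compact_eq_bounded_closed intro: bounded_subset[OF bounded_closed_interval])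
    ultimately show "closed (G -` B \<inter> sphere 0 1)"
      by (simp add: compact_imp_closed compact_continuous_image continuous_fourier)
  qed
  then obtain p where p: "polynomial_function p" "\<forall>z\<in>sphere 0 1. norm (G z - p z) < \<epsilon>"
    using Stone_Weierstrass_polynomial_function[OF compact_sphere _ \<epsilon>] by blast
  show ?thesis
  proof (rule that[OF trig_poly_polynomial[OF p(1)]])
    show "cmod (g t - p (?E t)) < \<epsilon>" if "t \<in> ?I" for t
      using p(2)[rule_format, of "?E t"] unfolding GE[OF that] by simp
  qed
qed

text \<open>Orthogonality is inherited by the trigonometric polynomials, by bounded periodic
  continuous functions as uniform limits, and by dominated convergence also by
  \<open>cnj (sgn f)\<close>; the product of \<open>f\<close> with the latter is the modulus of
  \<open>f\<close>, whose integral is therefore 0.\<close>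

lemma circle_basis_total:
  assumes f: "f \<in> sq_integrable (circle_measure n)"
    and ortho: "\<And>k. (LINT t|circle_measure n. f t * cnj (fourier n k t)) = 0"
  shows "AE t in circle_measure n. f t = 0"
proof -
  let ?M = "circle_measure n" and ?I = "{- (pi / 2 ^ n)..pi / 2 ^ n}"
  interpret finite_measure ?M by (rule finite_measure_circle)
  have [measurable]: "f \<in> borel_measurable borel"
    using sq_integrable_measurable[OF f] by simp
  have fi: "integrable ?M f" using integral_norm_le_L2_hnorm(1)[OF f] .
  have fb: "integrable ?M (\<lambda>t. f t * h t)" if [measurable]: "h \<in> borel_measurable borel" and "\<And>t. cmod (h t) \<le> C" for h C
  proof (rule Bochner_Integration.integrable_bound[OF integrable_mult_right[OF integrable_norm[OF fi], of C]])
    have "0 \<le> C" using order_trans[OF norm_ge_zero that(2)] .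
    thus "AE t in ?M. norm (f t * h t) \<le> norm (C * norm (f t))"
      using mult_right_mono[OF that(2) norm_ge_zero[of "f _"]]
      by (intro always_eventually allI) (simp add: norm_mult mult.commute)
  qed measurable
  have trig: "(\<exists>C. \<forall>t. cmod (h t) \<le> C) \<and> (LINT t|?M. f t * h t) = 0" if "trig_poly n h" for h
    using that
  proof (induction rule: trig_poly.induct)
    case (monomial c k)
    have "(LINT t|?M. f t * (c * fourier n k t)) = c * (LINT t|?M. f t * cnj (fourier n (- k) t))"
      by (simp add: cnj_fourier mult_ac)
    thus ?case using ortho by (auto simp: norm_mult)
  next
    case (sum g h)
    then obtain C D where C: "\<And>t. cmod (g t) \<le> C" and D: "\<And>t. cmod (h t) \<le> D" by blast
    have "cmod (g t + h t) \<le> C + D" for t by (rule norm_triangle_mono[OF C D])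
    moreover have "(LINT t|?M. f t * (g t + h t)) = 0"
      using sum.IH Bochner_Integration.integral_add[OF fb[OF trig_poly_measurable[OF sum.hyps(1)] C] fb[OF trig_poly_measurable[OF sum.hyps(2)] D]]
      by (simp add: distrib_left)
    ultimately show ?case by blast
  qed
  have periodic: "(LINT t|?M. f t * g t) = 0"
    if g: "continuous_on UNIV g" "\<And>t. cmod (g t) \<le> 1" "g (- (pi / 2 ^ n)) = g (pi / 2 ^ n)" for g
  proof -
    have [measurable]: "g \<in> borel_measurable borel" using g(1) by (rule borel_measurable_continuous_onI)
    have "cmod (LINT t|?M. f t * g t) \<le> 0 + \<epsilon>" if \<epsilon>: "\<epsilon> > 0" for \<epsilon>
    proof -
      define S where "S = (LINT t|?M. cmod (f t))"
      have S: "S \<ge> 0" by (simp add: S_def)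
      define \<delta> where "\<delta> = \<epsilon> / (S + 1)"
      have \<delta>: "\<delta> > 0" using \<epsilon> S by (simp add: \<delta>_def)
      obtain h where h: "trig_poly n h" "\<And>t. t \<in> ?I \<Longrightarrow> cmod (g t - h t) < \<delta>"
        using periodic_continuous_approx[OF continuous_on_subset[OF g(1)] g(3) \<delta>] by auto
      note [measurable] = trig_poly_measurable[OF h(1)]
      obtain C where C: "\<And>t. cmod (h t) \<le> C" using trig[OF h(1)] by blast
      have "(LINT t|?M. f t * g t) = (LINT t|?M. f t * g t) - (LINT t|?M. f t * h t)"
        using trig[OF h(1)] by simp
      also have "\<dots> = (LINT t|?M. f t * g t - f t * h t)"
        by (intro Bochner_Integration.integral_diff[symmetric] fb[of g 1] fb[of h C] g C) auto
      finally have "cmod (LINT t|?M. f t * g t) \<le> (LINT t|?M. cmod (f t * g t - f t * h t))"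
        using integral_norm_bound[of ?M "\<lambda>t. f t * g t - f t * h t"] by simp
      also have "\<dots> \<le> (LINT t|?M. \<delta> * cmod (f t))"
      proof (rule integral_mono_AE)
        show "integrable ?M (\<lambda>t. cmod (f t * g t - f t * h t))"
          by (intro integrable_norm Bochner_Integration.integrable_diff fb[of g 1] fb[of h C] g C) auto
        show "integrable ?M (\<lambda>t. \<delta> * cmod (f t))" by (intro integrable_mult_right integrable_norm fi)
        show "AE t in ?M. cmod (f t * g t - f t * h t) \<le> \<delta> * cmod (f t)"
        proof (rule AE_circle_I[of _ "{}"])
          fix t assume "- (pi / 2 ^ n) < t" "t < pi / 2 ^ n"
          hence "cmod (g t - h t) \<le> \<delta>" using h(2)[of t] by auto
          hence "cmod (f t) * cmod (g t - h t) \<le> cmod (f t) * \<delta>" by (intro mult_left_mono) auto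
          thus "cmod (f t * g t - f t * h t) \<le> \<delta> * cmod (f t)"
            by (simp add: norm_mult[symmetric] right_diff_distrib mult.commute)
        qed auto
      qed
      also have "\<dots> = \<delta> * S" by (simp add: S_def)
      also have "\<dots> \<le> \<epsilon>" using \<epsilon> S by (simp add: \<delta>_def field_simps)
      finally show ?thesis by simp
    qed
    hence "cmod (LINT t|?M. f t * g t) \<le> 0" by (rule field_le_epsilon)
    thus ?thesis by simp
  qed
  \<comment> \<open>The unimodular function \<open>cnj (sgn f)\<close> is a pointwise limit of continuous functions; those are made
    periodic by a cutoff and bounded by normalization.\<close>
  define s where "s t = cnj (sgn (f t))" for t
  have [measurable]: "s \<in> borel_measurable borel" unfolding s_def sgn_div_norm by measurable
  have s1: "cmod (s t) \<le> 1" for t by (simp add: s_def norm_sgn)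
  \<comment> \<open>The detour through Lebesgue measure and \<open>measurable_on\<close> supplies
    continuous functions that converge to \<open>s\<close> off a negligible set.\<close>
  have "s \<in> borel_measurable lborel" by simp
  hence "s \<in> borel_measurable (lebesgue_on UNIV)" unfolding lebesgue_on_UNIV_eq by (rule measurable_completion)
  hence "s measurable_on UNIV" by (simp add: lebesgue_measurable_imp_measurable_on)
  then obtain N g where N: "negligible N" and g: "\<And>m::nat. continuous_on UNIV (g m)"
      "\<And>t. t \<notin> N \<Longrightarrow> (\<lambda>m. g m t) \<longlonglongrightarrow> s t"
    unfolding measurable_on_def by auto
  define a where "a = pi / 2 ^ n"
  \<comment> \<open>For positive \<open>m\<close> this is 0 at both ends of the interval and 1 as
    soon as |t| \<le> a - 1/m, so at every interior point it is eventually 1.\<close>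
  define cut where "cut m t = max 0 (min 1 (real m * (a - \<bar>t\<bar>)))" for m :: nat and t
  have cut01: "0 \<le> cut m t" "cut m t \<le> 1" for m t by (auto simp: cut_def)
  define u where "u m t = complex_of_real (cut m t) * (g m t / complex_of_real (max 1 (cmod (g m t))))" for m t
  have u_cont: "continuous_on UNIV (u m)" for m
    unfolding u_def cut_def by (intro continuous_intros g) (auto simp: max_def)
  have u1: "cmod (u m t) \<le> 1" for m t
  proof -
    have "cmod (u m t) = cut m t * (cmod (g m t) / max 1 (cmod (g m t)))"
      using cut01[of m t] by (simp add: u_def norm_mult norm_divide)
    also have "\<dots> \<le> 1 * 1" using cut01[of m t] by (intro mult_mono) (auto simp: divide_le_eq_1)
    finally show ?thesis by simp
  qed
  have u_per: "u m (- (pi / 2 ^ n)) = u m (pi / 2 ^ n)" for m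
    by (simp add: u_def cut_def a_def)
  have [measurable]: "u m \<in> borel_measurable borel" for m by (rule borel_measurable_continuous_onI[OF u_cont])
  have u_lim: "(\<lambda>m. u m t) \<longlonglongrightarrow> s t" if t: "t \<notin> N" "- a < t" "t < a" for t
  proof -
    have "\<forall>\<^sub>F m in sequentially. cut m t = 1"
    proof -
      obtain m0 :: nat where "1 / (a - \<bar>t\<bar>) < real m0" using reals_Archimedean2 by blast
      hence "real m0 * (a - \<bar>t\<bar>) \<ge> 1" using t by (auto simp: field_simps)
      hence "real m * (a - \<bar>t\<bar>) \<ge> 1" if "m \<ge> m0" for m
        using t that by (intro order_trans[OF _ mult_right_mono[of "real m0" "real m"]]) auto
      thus ?thesis by (auto simp: eventually_sequentially cut_def intro!: exI[of _ m0])
    qed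
    hence "(\<lambda>m. complex_of_real (cut m t)) \<longlonglongrightarrow> 1" by (intro tendsto_eventually) (auto elim: eventually_mono)
    moreover have "(\<lambda>m. g m t / complex_of_real (max 1 (cmod (g m t)))) \<longlonglongrightarrow> s t / complex_of_real (max 1 (cmod (s t)))"
      by (intro tendsto_intros g(2) t) auto
    ultimately have "(\<lambda>m. u m t) \<longlonglongrightarrow> 1 * (s t / complex_of_real (max 1 (cmod (s t))))"
      unfolding u_def by (rule tendsto_mult)
    thus ?thesis using s1[of t] by (simp add: max_absorb1)
  qed
  have "(\<lambda>m. LINT t|?M. f t * u m t) \<longlonglongrightarrow> (LINT t|?M. f t * s t)"
  proof (rule integral_dominated_convergence)
    show "integrable ?M (\<lambda>t. cmod (f t))" using fi by (rule integrable_norm)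
    show "AE t in ?M. norm (f t * u m t) \<le> cmod (f t)" for m
      using u1 by (auto simp: norm_mult intro!: mult_left_le)
    have "AE t in lebesgue. t \<notin> N" using N by (simp add: negligible_iff_null_sets AE_not_in)
    hence "AE t in lborel. t \<notin> N" by (simp add: AE_completion_iff)
    hence "AE t in ?M. t \<notin> N"
      unfolding circle_measure_density by (subst AE_density) (auto elim: eventually_mono)
    moreover have "AE t in ?M. - a < t \<and> t < a"
      by (rule AE_circle_I[of _ "{}"]) (auto simp: a_def)
    ultimately show "AE t in ?M. (\<lambda>m. f t * u m t) \<longlonglongrightarrow> f t * s t"
      by eventually_elim (intro tendsto_mult tendsto_const u_lim, auto)
  qed measurable
  moreover have "(LINT t|?M. f t * u m t) = 0" for m by (rule periodic[OF u_cont u1 u_per])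
  ultimately have "(LINT t|?M. f t * s t) = 0" by (simp add: LIMSEQ_const_iff)
  moreover have "f t * s t = complex_of_real (cmod (f t))" for t
    by (simp add: s_def sgn_div_norm complex_norm_square[symmetric] scaleR_conv_of_real field_simps power2_eq_square)
  ultimately have "(LINT t|?M. cmod (f t)) = 0" by simp
  hence "AE t in ?M. cmod (f t) = 0"
    using integral_nonneg_eq_0_iff_AE[OF integrable_norm[OF fi]] by simp
  thus ?thesis by simp
qed

lemma orthonormal_basis_circle: "orthonormal_basis (L2 (circle_measure n)) UNIV (circle_basis n)"
proof -
  interpret hilbert_space "L2 (circle_measure n)"
    by (rule finite_measure.hilbert_space_L2[OF finite_measure_circle])
  show ?thesis
  proof
    fix j k :: int
    show "circle_basis n k \<in> carrier (L2 (circle_measure n))"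
      unfolding circle_basis_fourier by (rule L2_class_in[OF fourier_sq_integrable])
    show "ip (L2 (circle_measure n)) (circle_basis n j) (circle_basis n k) = (if j = k then 1 else 0)"
      by (rule circle_basis_orthonormal)
  next
    fix X assume "X \<in> carrier (L2 (circle_measure n))"
      and z: "\<And>k::int. k \<in> UNIV \<Longrightarrow> ip (L2 (circle_measure n)) X (circle_basis n k) = 0"
    then obtain f where f: "f \<in> sq_integrable (circle_measure n)" "X = L2_class (circle_measure n) f"
      by (metis L2_cases)
    have "AE t in circle_measure n. f t = 0"
      by (rule circle_basis_total[OF f(1)]) (use z f fourier_sq_integrable in \<open>simp add: circle_basis_fourier L2_ip\<close>)
    thus "X = \<zero>\<^bsub>L2 (circle_measure n)\<^esub>" unfolding f(2) L2_zero by (rule L2_class_eqI)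
  qed
qed

section \<open>The algebra of continuous functions\<close>

lemma C_alg_simps:
  "carrier (C_alg X) = {f. continuous_on X f \<and> f \<in> extensional X}"
  "f \<otimes>\<^bsub>C_alg X\<^esub> g = (\<lambda>x\<in>X. f x * g x)" "\<one>\<^bsub>C_alg X\<^esub> = (\<lambda>x\<in>X. 1)"
  "\<zero>\<^bsub>C_alg X\<^esub> = (\<lambda>x\<in>X. 0)" "f \<oplus>\<^bsub>C_alg X\<^esub> g = (\<lambda>x\<in>X. f x + g x)"
  "c \<odot>\<^bsub>C_alg X\<^esub> f = (\<lambda>x\<in>X. c * f x)" "star (C_alg X) f = (\<lambda>x\<in>X. cnj (f x))"
  "anorm (C_alg X) f = (SUP x\<in>X. cmod (f x))"
  by (simp_all add: C_alg_def)

lemma restrict_in_C_alg: "continuous_on X f \<Longrightarrow> restrict f X \<in> carrier (C_alg X)"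
  by (simp add: C_alg_simps cong: continuous_on_cong)

lemma C_alg_ext:
  "\<lbrakk>f \<in> carrier (C_alg X); g \<in> carrier (C_alg X); \<And>x. x \<in> X \<Longrightarrow> f x = g x\<rbrakk> \<Longrightarrow> f = g"
  by (auto simp: C_alg_simps intro: extensionalityI)

lemma abelian_group_C_alg: "abelian_group (C_alg X)"
proof (rule abelian_groupI)
  fix f assume f: "f \<in> carrier (C_alg X)"
  show "\<exists>g\<in>carrier (C_alg X). g \<oplus>\<^bsub>C_alg X\<^esub> f = \<zero>\<^bsub>C_alg X\<^esub>"
    using f by (intro bexI[of _ "\<lambda>x\<in>X. - f x"])
      (auto simp: C_alg_simps fun_eq_iff cong: continuous_on_cong intro!: continuous_intros)
next
  fix f assume "f \<in> carrier (C_alg X)"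
  thus "\<zero>\<^bsub>C_alg X\<^esub> \<oplus>\<^bsub>C_alg X\<^esub> f = f" by (auto simp: C_alg_simps fun_eq_iff extensional_def)
qed (auto simp: C_alg_simps fun_eq_iff algebra_simps cong: continuous_on_cong intro!: continuous_intros)

lemma monoid_C_alg: "monoid (C_alg X)"
  by (rule monoidI)
     (auto simp: C_alg_simps fun_eq_iff algebra_simps extensional_def cong: continuous_on_cong intro!: continuous_intros)

lemma ring_C_alg: "ring (C_alg X)"
  by (rule ringI[OF abelian_group_C_alg monoid_C_alg]) (auto simp: C_alg_simps fun_eq_iff algebra_simps)

lemma module_C_alg: "module complex_field (C_alg X)"
  by (rule moduleI[OF cring_complex_field abelian_group_C_alg])
     (auto simp: C_alg_simps fun_eq_iff algebra_simps extensional_def cong: continuous_on_cong intro!: continuous_intros)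

lemma C_alg_minus:
  assumes f: "f \<in> carrier (C_alg X)" and g: "g \<in> carrier (C_alg X)"
  shows "f \<ominus>\<^bsub>C_alg X\<^esub> g = (\<lambda>x\<in>X. f x - g x)"
proof -
  interpret ring "C_alg X" by (rule ring_C_alg)
  have h: "(\<lambda>x\<in>X. f x - g x) \<in> carrier (C_alg X)"
    using f g by (intro restrict_in_C_alg) (auto simp: C_alg_simps intro!: continuous_intros)
  have "(\<lambda>x\<in>X. f x - g x) \<oplus>\<^bsub>C_alg X\<^esub> g = f"
    using f by (auto simp: C_alg_simps fun_eq_iff extensional_def)
  hence "f \<ominus>\<^bsub>C_alg X\<^esub> g = ((\<lambda>x\<in>X. f x - g x) \<oplus>\<^bsub>C_alg X\<^esub> g) \<ominus>\<^bsub>C_alg X\<^esub> g" by simp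
  also have "\<dots> = (\<lambda>x\<in>X. f x - g x)" using h g by (simp add: minus_eq a_assoc r_neg)
  finally show ?thesis .
qed

context
  fixes X :: "'p::topological_space set"
  assumes X: "compact X" "X \<noteq> {}"
begin

lemma C_alg_bdd: "f \<in> carrier (C_alg X) \<Longrightarrow> bdd_above ((\<lambda>x. cmod (f x)) ` X)"
  using X(1) by (intro bounded_imp_bdd_above compact_imp_bounded compact_continuous_image)
     (auto simp: C_alg_simps intro!: continuous_intros)

lemma anorm_upper: "\<lbrakk>f \<in> carrier (C_alg X); x \<in> X\<rbrakk> \<Longrightarrow> cmod (f x) \<le> anorm (C_alg X) f"
  unfolding C_alg_simps by (rule cSUP_upper[OF _ C_alg_bdd]) (simp_all add: C_alg_simps)

lemma anorm_least: "(\<And>x. x \<in> X \<Longrightarrow> cmod (f x) \<le> C) \<Longrightarrow> anorm (C_alg X) f \<le> C"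
  unfolding C_alg_simps using X(2) by (rule cSUP_least)

lemma anorm_C_alg_nonneg: "f \<in> carrier (C_alg X) \<Longrightarrow> 0 \<le> anorm (C_alg X) f"
  using anorm_upper X(2) norm_ge_zero order_trans by (metis ex_in_conv)

text \<open>The supremum norm is the least uniform bound. The metric axioms, completeness and
  density are all derived from this equivalence, which avoids handling the supremum again.\<close>

lemma adist_le_iff:
  assumes f: "f \<in> carrier (C_alg X)" and g: "g \<in> carrier (C_alg X)"
  shows "(\<forall>x\<in>X. cmod (f x - g x) \<le> C) \<longleftrightarrow> adist (C_alg X) f g \<le> C"
proof -
  have h: "(\<lambda>x\<in>X. f x - g x) \<in> carrier (C_alg X)"
    using f g by (intro restrict_in_C_alg) (auto simp: C_alg_simps intro!: continuous_intros)
  show ?thesis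
    using f g anorm_upper[OF h] anorm_least[of "\<lambda>x\<in>X. f x - g x" C]
    by (auto simp: adist_def C_alg_minus intro: order_trans)
qed

lemma anorm_triangle_C_alg:
  assumes f: "f \<in> carrier (C_alg X)" and g: "g \<in> carrier (C_alg X)"
  shows "anorm (C_alg X) (f \<oplus>\<^bsub>C_alg X\<^esub> g) \<le> anorm (C_alg X) f + anorm (C_alg X) g"
  using norm_triangle_mono[OF anorm_upper[OF f] anorm_upper[OF g]]
  by (intro anorm_least) (simp add: C_alg_simps)

lemma Metric_space_C_alg: "Metric_space (carrier (C_alg X)) (adist (C_alg X))"
proof
  show "0 \<le> adist (C_alg X) f g" for f g
  proof (cases "f \<in> carrier (C_alg X) \<and> g \<in> carrier (C_alg X)")
    case True
    then obtain x where "x \<in> X" "cmod (f x - g x) \<le> adist (C_alg X) f g"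
      using adist_le_iff[of f g "adist (C_alg X) f g"] X(2) by blast
    thus ?thesis using norm_ge_zero order_trans by blast
  qed (auto simp: adist_def)
  show "adist (C_alg X) f g = adist (C_alg X) g f" for f g
  proof (cases "f \<in> carrier (C_alg X) \<and> g \<in> carrier (C_alg X)")
    case True
    thus ?thesis
      using adist_le_iff[of f g "adist (C_alg X) g f"] adist_le_iff[of g f "adist (C_alg X) f g"]
        adist_le_iff[of f g "adist (C_alg X) f g"] adist_le_iff[of g f "adist (C_alg X) g f"]
      by (simp add: norm_minus_commute)
  qed (auto simp: adist_def)
next
  fix f g assume f: "f \<in> carrier (C_alg X)" and g: "g \<in> carrier (C_alg X)"
  show "adist (C_alg X) f g = 0 \<longleftrightarrow> f = g"
  proof
    assume "adist (C_alg X) f g = 0"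
    thus "f = g" using adist_le_iff[OF f g, of 0] by (intro C_alg_ext[OF f g]) auto
  next
    assume "f = g"
    hence "adist (C_alg X) f g \<le> 0" using adist_le_iff[OF f g, of 0] by simp
    moreover obtain x where "x \<in> X" "cmod (f x - g x) \<le> adist (C_alg X) f g"
      using adist_le_iff[OF f g, of "adist (C_alg X) f g"] X(2) by blast
    ultimately show "adist (C_alg X) f g = 0" using norm_ge_zero[of "f x - g x"] by linarith
  qed
  fix h assume h: "h \<in> carrier (C_alg X)"
  have "cmod (f x - h x) \<le> adist (C_alg X) f g + adist (C_alg X) g h" if x: "x \<in> X" for x
  proof -
    have "cmod (f x - g x) \<le> adist (C_alg X) f g" "cmod (g x - h x) \<le> adist (C_alg X) g h"
      using adist_le_iff[OF f g, of "adist (C_alg X) f g"] adist_le_iff[OF g h, of "adist (C_alg X) g h"] x by auto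
    thus ?thesis using norm_triangle_ineq[of "f x - g x" "g x - h x"] by simp
  qed
  thus "adist (C_alg X) f h \<le> adist (C_alg X) f g + adist (C_alg X) g h"
    using adist_le_iff[OF f h] by blast
qed

lemma mcomplete_C_alg: "Metric_space.mcomplete (carrier (C_alg X)) (adist (C_alg X))"
proof -
  interpret Metric_space "carrier (C_alg X)" "adist (C_alg X)" by (rule Metric_space_C_alg)
  show ?thesis unfolding mcomplete_def
  proof (intro allI impI)
    fix s assume "MCauchy s"
    hence s: "s n \<in> carrier (C_alg X)" and cau: "\<And>\<epsilon>. \<epsilon> > 0 \<Longrightarrow> \<exists>N. \<forall>m n. N \<le> m \<longrightarrow> N \<le> n \<longrightarrow> adist (C_alg X) (s m) (s n) < \<epsilon>"
      for n by (auto simp: MCauchy_def)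
    have "uniformly_Cauchy_on X s"
      unfolding uniformly_Cauchy_on_def
    proof (intro allI impI)
      fix \<epsilon> :: real assume "\<epsilon> > 0"
      then obtain N where N: "\<And>m n. \<lbrakk>N \<le> m; N \<le> n\<rbrakk> \<Longrightarrow> adist (C_alg X) (s m) (s n) < \<epsilon>" using cau by meson
      have "dist (s m x) (s n x) < \<epsilon>" if "x \<in> X" "N \<le> m" "N \<le> n" for x m n
        using N[OF that(2,3)] adist_le_iff[OF s s, of m n "adist (C_alg X) (s m) (s n)"] that(1)
        by (auto simp: dist_norm)
      thus "\<exists>M. \<forall>x\<in>X. \<forall>m\<ge>M. \<forall>n\<ge>M. dist (s m x) (s n x) < \<epsilon>" by blast
    qed
    then obtain g where g: "uniform_limit X s g sequentially"
      using Cauchy_uniformly_convergent uniformly_convergent_on_def by blast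
    have "continuous_on X g"
      by (rule uniform_limit_theorem[OF _ g]) (use s in \<open>auto simp: C_alg_simps\<close>)
    hence G: "restrict g X \<in> carrier (C_alg X)" by (rule restrict_in_C_alg)
    have "\<forall>\<^sub>F n in sequentially. s n \<in> carrier (C_alg X) \<and> adist (C_alg X) (s n) (restrict g X) < \<epsilon>" if \<epsilon>: "\<epsilon> > 0" for \<epsilon>
    proof -
      have "\<forall>\<^sub>F n in sequentially. \<forall>x\<in>X. dist (s n x) (g x) < \<epsilon> / 2"
        using uniform_limitD[OF g, of "\<epsilon> / 2"] \<epsilon> by simp
      thus ?thesis
      proof eventually_elim
        case (elim n)
        hence "adist (C_alg X) (s n) (restrict g X) \<le> \<epsilon> / 2"
          by (subst adist_le_iff[OF s G, symmetric]) (auto simp: dist_norm less_imp_le)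
        thus ?case using s \<epsilon> by simp
      qed
    qed
    thus "\<exists>x. limitin mtopology s x sequentially" using G by (auto simp: limitin_metric)
  qed
qed

lemma unital_cstar_algebra_C_alg: "unital_cstar_algebra (C_alg X)"
proof -
  have "unital_cstar_algebra_axioms (C_alg X)"
  proof
    fix f g and c :: complex assume f: "f \<in> carrier (C_alg X)" and g: "g \<in> carrier (C_alg X)"
    show "anorm (C_alg X) (f \<otimes>\<^bsub>C_alg X\<^esub> g) \<le> anorm (C_alg X) f * anorm (C_alg X) g"
      using anorm_upper[OF f] anorm_upper[OF g] anorm_C_alg_nonneg[OF f]
      by (intro anorm_least) (auto simp: C_alg_simps(2) norm_mult intro!: mult_mono)
    show "anorm (C_alg X) (f \<oplus>\<^bsub>C_alg X\<^esub> g) \<le> anorm (C_alg X) f + anorm (C_alg X) g"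
      using f g by (rule anorm_triangle_C_alg)
  next
    fix f assume f: "f \<in> carrier (C_alg X)"
    show "0 \<le> anorm (C_alg X) f" using f by (rule anorm_C_alg_nonneg)
    have zero: "\<zero>\<^bsub>C_alg X\<^esub> \<in> carrier (C_alg X)" by (auto simp: C_alg_simps cong: continuous_on_cong)
    show "anorm (C_alg X) f = 0 \<longleftrightarrow> f = \<zero>\<^bsub>C_alg X\<^esub>"
    proof
      assume "anorm (C_alg X) f = 0"
      thus "f = \<zero>\<^bsub>C_alg X\<^esub>" using anorm_upper[OF f]
        by (intro C_alg_ext[OF f zero]) (auto simp: C_alg_simps(4))
    next
      assume "f = \<zero>\<^bsub>C_alg X\<^esub>"
      thus "anorm (C_alg X) f = 0" using X(2) by (simp add: C_alg_simps)
    qed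
    show "anorm (C_alg X) (c \<odot>\<^bsub>C_alg X\<^esub> f) = cmod c * anorm (C_alg X) f" for c
    proof (cases "c = 0")
      case True
      thus ?thesis using X(2) by (simp add: C_alg_simps)
    next
      case False
      show ?thesis
      proof (rule antisym)
        show "anorm (C_alg X) (c \<odot>\<^bsub>C_alg X\<^esub> f) \<le> cmod c * anorm (C_alg X) f"
          using anorm_upper[OF f] by (intro anorm_least) (auto simp: C_alg_simps(6) norm_mult intro!: mult_left_mono)
        have cf: "c \<odot>\<^bsub>C_alg X\<^esub> f \<in> carrier (C_alg X)"
          unfolding C_alg_simps(6) using f by (intro restrict_in_C_alg) (auto simp: C_alg_simps intro!: continuous_intros)
        have "anorm (C_alg X) f \<le> anorm (C_alg X) (c \<odot>\<^bsub>C_alg X\<^esub> f) / cmod c"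
          using anorm_upper[OF cf] False
          by (intro anorm_least) (simp add: C_alg_simps(6) norm_mult field_simps)
        thus "cmod c * anorm (C_alg X) f \<le> anorm (C_alg X) (c \<odot>\<^bsub>C_alg X\<^esub> f)" using False by (simp add: field_simps)
      qed
    qed
    show "anorm (C_alg X) (star (C_alg X) f \<otimes>\<^bsub>C_alg X\<^esub> f) = (anorm (C_alg X) f)\<^sup>2"
    proof (rule antisym)
      let ?g = "star (C_alg X) f \<otimes>\<^bsub>C_alg X\<^esub> f"
      have g: "?g = (\<lambda>x\<in>X. complex_of_real ((cmod (f x))\<^sup>2))"
        by (simp add: C_alg_simps mult.commute[of "cnj _"] complex_norm_square[symmetric] cong: restrict_cong)
      have gc: "?g \<in> carrier (C_alg X)"
        unfolding g using f by (intro restrict_in_C_alg) (auto simp: C_alg_simps intro!: continuous_intros)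
      have gx: "cmod (?g x) = (cmod (f x))\<^sup>2" if "x \<in> X" for x using that by (simp add: g norm_power)
      show "anorm (C_alg X) ?g \<le> (anorm (C_alg X) f)\<^sup>2"
        using anorm_upper[OF f] by (intro anorm_least) (simp add: gx power_mono)
      have "anorm (C_alg X) f \<le> sqrt (anorm (C_alg X) ?g)"
        using anorm_upper[OF gc] gx by (intro anorm_least real_le_rsqrt) auto
      thus "(anorm (C_alg X) f)\<^sup>2 \<le> anorm (C_alg X) ?g"
        using anorm_C_alg_nonneg[OF f] anorm_C_alg_nonneg[OF gc] power_mono[of "anorm (C_alg X) f" _ 2] by fastforce
    qed
  qed (rule mcomplete_C_alg | (auto simp: C_alg_simps fun_eq_iff algebra_simps extensional_def
      cong: continuous_on_cong intro!: continuous_intros)[1])+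
  thus ?thesis by (simp add: unital_cstar_algebra_def module_C_alg ring_C_alg)
qed

lemma atop_dense:
  assumes S: "S \<subseteq> carrier (C_alg X)"
    and approx: "\<And>f \<epsilon>. \<lbrakk>f \<in> carrier (C_alg X); \<epsilon> > 0\<rbrakk> \<Longrightarrow> \<exists>g\<in>S. \<forall>x\<in>X. cmod (f x - g x) \<le> \<epsilon>"
  shows "atop (C_alg X) closure_of S = carrier (C_alg X)"
proof -
  interpret Metric_space "carrier (C_alg X)" "adist (C_alg X)" by (rule Metric_space_C_alg)
  have "\<exists>g\<in>S. g \<in> mball f r" if f: "f \<in> carrier (C_alg X)" and r: "r > 0" for f r
  proof -
    obtain g where g: "g \<in> S" "\<forall>x\<in>X. cmod (f x - g x) \<le> r / 2" using approx[OF f, of "r / 2"] r by auto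
    have gc: "g \<in> carrier (C_alg X)" using g S by auto
    have "adist (C_alg X) f g \<le> r / 2" using g(2) adist_le_iff[OF f gc] by blast
    thus ?thesis using g f gc r by (intro bexI[of _ g]) auto
  qed
  thus ?thesis unfolding atop_def metric_closure_of by blast
qed

end

section \<open>Geometry of the Sierpinski gasket\<close>

lemma finite_words: "finite (words n)" and card_words: "card (words n) = 3 ^ n"
proof -
  have eq: "words n = {w. set w \<subseteq> {1, 2, 3} \<and> length w = n}" by (auto simp: words_def)
  show "finite (words n)" unfolding eq by (rule finite_lists_length_eq) simp
  show "card (words n) = 3 ^ n" unfolding eq by (subst card_lists_length_eq) (simp_all add: card_insert_if numeral_3_eq_3[symmetric])
qed

lemma words_append: "w \<in> words n \<Longrightarrow> m \<le> n \<Longrightarrow> take m w \<in> words m \<and> drop m w \<in> words (n - m)"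
  using set_take_subset[of m w] set_drop_subset[of m w] by (auto simp: words_def)

lemma word_map_Nil [simp]: "word_map v [] x = x"
  and word_map_Cons [simp]: "word_map v (j # w) x = gasket_map v j (word_map v w x)"
  and word_map_append: "word_map v (a @ b) x = word_map v a (word_map v b x)"
  by (simp_all add: word_map_def)

lemma word_map_diff: "word_map v w x - word_map v w y = (1 / 2 ^ length w) *\<^sub>R (x - y)"
proof (induction w)
  case (Cons j w)
  have "word_map v (j # w) x - word_map v (j # w) y = (1 / 2) *\<^sub>R (word_map v w x - word_map v w y)"
    by (simp add: gasket_map_def algebra_simps)
  also have "\<dots> = (1 / 2 ^ length (j # w)) *\<^sub>R (x - y)" by (simp add: Cons.IH)
  finally show ?case .
qed simp

lemma dist_word_map: "dist (word_map v w x) (word_map v w y) = dist x y / 2 ^ length w"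
  by (simp add: dist_norm word_map_diff)

text \<open>With respect to \<open>v 1\<close> and the edges \<open>v 2 - v 1\<close>, \<open>v 3 - v 1\<close>, scaled by \<open>2\<^sup>-\<^sup>n\<close>, the corner
  \<open>F\<^sub>w (v 1)\<close> for \<open>w\<close> of length \<open>n\<close> has integer coordinates; the binary digits of these two numbers are the
  positions of the letters 2 and 3 in \<open>w\<close>.\<close>

fun lattice_coord :: "nat \<Rightarrow> nat list \<Rightarrow> int" where
  "lattice_coord a [] = 0"
| "lattice_coord a (j # w) = lattice_coord a w + (if j = a then 2 ^ length w else 0)"

lemma lattice_coord_bounds: "0 \<le> lattice_coord a w \<and> lattice_coord a w < 2 ^ length w"
  by (induction w) auto

text \<open>The leading digit of value 2^(length w) exceeds everything that the remaining digits can
  sum to, so it can be read off: equal coordinates decide alike whether the first letter is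
  \<open>a\<close>, and the tails again have equal coordinates. A letter that is neither 2 nor 3
  must be 1.\<close>

lemma lattice_coord_inj:
  assumes "length w = length w'" "set w \<subseteq> {1, 2, 3}" "set w' \<subseteq> {1, 2, 3}"
    "lattice_coord 2 w = lattice_coord 2 w'" "lattice_coord 3 w = lattice_coord 3 w'"
  shows "w = w'"
  using assms
proof (induction w w' rule: list_induct2)
  case (Cons j w j' w')
  have digit: "(j = a) = (j' = a) \<and> lattice_coord a w = lattice_coord a w'"
    if "lattice_coord a (j # w) = lattice_coord a (j' # w')" for a
    using that lattice_coord_bounds[of a w] lattice_coord_bounds[of a w'] Cons.hyps by (auto split: if_splits)
  show ?case using digit[of 2] digit[of 3] Cons by auto
qed simp

text \<open>The squared length in the triangular lattice of mesh 1. Completing the square shows that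
  it is positive, and integrality raises positivity to the bound 1.\<close>

lemma int_quadratic_form_ge_1:
  fixes p q :: int
  assumes "p \<noteq> 0 \<or> q \<noteq> 0"
  shows "p\<^sup>2 + p * q + q\<^sup>2 \<ge> 1"
proof -
  have "4 * (p\<^sup>2 + p * q + q\<^sup>2) = (2 * p + q)\<^sup>2 + 3 * q\<^sup>2" by (simp add: power2_eq_square algebra_simps)
  moreover have "(2 * p + q)\<^sup>2 + 3 * q\<^sup>2 > 0"
  proof (cases "q = 0")
    case True
    thus ?thesis using assms by simp
  next
    case False
    hence "q\<^sup>2 > 0" by simp
    thus ?thesis using zero_le_power2[of "2 * p + q"] by linarith
  qed
  ultimately have "0 < 4 * (p\<^sup>2 + p * q + q\<^sup>2)" by (simp only:)
  thus ?thesis by (simp only: zero_less_mult_iff int_one_le_iff_zero_less) simp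
qed

locale gasket =
  fixes v :: "nat \<Rightarrow> real^2"
  assumes vertices: "gasket_vertices v"
begin

text \<open>Otherwise the simplifier would rewrite \<open>v 1\<close> to
  \<open>v (Suc 0)\<close>.\<close>

context
  notes One_nat_def [simp del]
begin

definition side :: real where "side = 2 * pi / 3"

lemma side_pos: "side > 0" by (simp add: side_def)

lemma dist_vertices:
  "dist (v 1) (v 2) = side" "dist (v 2) (v 3) = side" "dist (v 3) (v 1) = side"
  using vertices by (simp_all add: gasket_vertices_def side_def)

text \<open>Both edges have length \<open>side\<close>, and so does their difference, the third
  side; polarization gives the inner product side^2 / 2, which accounts for the mixed term.\<close>

lemma norm_lattice:
  "(norm (a *\<^sub>R (v 2 - v 1) + b *\<^sub>R (v 3 - v 1)))\<^sup>2 = side\<^sup>2 * (a\<^sup>2 + a * b + b\<^sup>2)"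
proof -
  define x y where "x = v 2 - v 1" and "y = v 3 - v 1"
  have n: "norm x = side" "norm y = side" "norm (x - y) = side"
    using dist_vertices by (simp_all add: x_def y_def dist_norm norm_minus_commute)
  have "(norm (x - y))\<^sup>2 = (norm x)\<^sup>2 + (norm y)\<^sup>2 - 2 * (x \<bullet> y)"
    by (simp add: power2_norm_eq_inner inner_diff_left inner_diff_right inner_commute)
  hence xy: "x \<bullet> y = side\<^sup>2 / 2" using n by simp
  have "(norm (a *\<^sub>R x + b *\<^sub>R y))\<^sup>2 = a\<^sup>2 * (norm x)\<^sup>2 + 2 * a * b * (x \<bullet> y) + b\<^sup>2 * (norm y)\<^sup>2"
    unfolding power2_norm_eq_inner
    by (simp add: inner_add_left inner_add_right inner_commute power2_eq_square algebra_simps)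
  also have "\<dots> = side\<^sup>2 * (a\<^sup>2 + a * b + b\<^sup>2)" using n xy by (simp add: algebra_simps)
  finally show ?thesis by (simp only: x_def y_def)
qed

definition corner :: "nat list \<Rightarrow> real^2" where "corner w = word_map v w (v 1)"

lemma corner_lattice:
  assumes "set w \<subseteq> {1, 2, 3}"
  shows "corner w = v 1 + (1 / 2 ^ length w) *\<^sub>R
    (of_int (lattice_coord 2 w) *\<^sub>R (v 2 - v 1) + of_int (lattice_coord 3 w) *\<^sub>R (v 3 - v 1))"
  using assms
proof (induction w)
  case (Cons j w)
  define X where "X = of_int (lattice_coord 2 w) *\<^sub>R (v 2 - v 1) + of_int (lattice_coord 3 w) *\<^sub>R (v 3 - v 1)"
  define N :: real where "N = 2 ^ length w"
  have N: "N > 0" by (simp add: N_def)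
  have IH: "word_map v w (v 1) = v 1 + (1 / N) *\<^sub>R X" using Cons by (simp add: X_def N_def corner_def)
  have eq: "of_int (lattice_coord 2 (j # w)) *\<^sub>R (v 2 - v 1) + of_int (lattice_coord 3 (j # w)) *\<^sub>R (v 3 - v 1)
     = X + N *\<^sub>R (v j - v 1)"
    using Cons.prems by (auto simp: X_def N_def algebra_simps)
  have "corner (j # w) = (1 / 2) *\<^sub>R (v 1 + (1 / N) *\<^sub>R X + v j)"
    by (simp add: corner_def gasket_map_def IH)
  also have "\<dots> = v 1 + (1 / (2 * N)) *\<^sub>R (X + N *\<^sub>R (v j - v 1))"
  proof -
    have "(1 / (2 * N)) *\<^sub>R (X + N *\<^sub>R (v j - v 1)) = (1 / (2 * N)) *\<^sub>R X + (1 / 2) *\<^sub>R (v j - v 1)"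
      using N by (simp add: scaleR_add_right)
    moreover have "v 1 = (1 / 2) *\<^sub>R v 1 + (1 / 2) *\<^sub>R v 1" by (simp flip: scaleR_add_left)
    ultimately show ?thesis using N by (simp add: algebra_simps)
  qed
  finally show ?case unfolding eq by (simp add: N_def)
qed (simp add: corner_def)

lemma dist_corner:
  assumes "w \<in> words n" "w' \<in> words n"
  defines "p \<equiv> lattice_coord 2 w - lattice_coord 2 w'" and "q \<equiv> lattice_coord 3 w - lattice_coord 3 w'"
  shows "(dist (corner w) (corner w'))\<^sup>2 = (side / 2 ^ n)\<^sup>2 * of_int (p\<^sup>2 + p * q + q\<^sup>2)"
proof -
  have w: "length w = n" "length w' = n" "set w \<subseteq> {1, 2, 3}" "set w' \<subseteq> {1, 2, 3}"
    using assms by (auto simp: words_def)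
  have "corner w - corner w' = (1 / 2 ^ n) *\<^sub>R (of_int p *\<^sub>R (v 2 - v 1) + of_int q *\<^sub>R (v 3 - v 1))"
    unfolding corner_lattice[OF w(3)] corner_lattice[OF w(4)] w(1,2) p_def q_def
    by (simp add: algebra_simps)
  hence "(dist (corner w) (corner w'))\<^sup>2 = (1 / 2 ^ n)\<^sup>2 * (norm (of_int p *\<^sub>R (v 2 - v 1) + of_int q *\<^sub>R (v 3 - v 1)))\<^sup>2"
    by (simp add: dist_norm power_mult_distrib power_divide)
  thus ?thesis unfolding norm_lattice by (simp add: power_divide)
qed

lemma corner_separated:
  assumes w: "w \<in> words n" "w' \<in> words n" "w \<noteq> w'"
  shows "dist (corner w) (corner w') \<ge> side / 2 ^ n"
proof (rule power2_le_imp_le)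
  let ?p = "lattice_coord 2 w - lattice_coord 2 w'" and ?q = "lattice_coord 3 w - lattice_coord 3 w'"
  have "?p \<noteq> 0 \<or> ?q \<noteq> 0" using lattice_coord_inj[of w w'] w by (auto simp: words_def)
  hence "?p\<^sup>2 + ?p * ?q + ?q\<^sup>2 \<ge> 1" by (rule int_quadratic_form_ge_1)
  hence "(1::real) \<le> of_int (?p\<^sup>2 + ?p * ?q + ?q\<^sup>2)" by linarith
  hence "(side / 2 ^ n)\<^sup>2 * 1 \<le> (side / 2 ^ n)\<^sup>2 * of_int (?p\<^sup>2 + ?p * ?q + ?q\<^sup>2)"
    by (intro mult_left_mono) auto
  thus "(side / 2 ^ n)\<^sup>2 \<le> (dist (corner w) (corner w'))\<^sup>2" unfolding dist_corner[OF w(1,2)] by simp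
qed simp

text \<open>Relative to one corner the lattice coordinates satisfy p^2 + p q + q^2 \<le> 9. Since
  four times this form is at least 3 p^2 and 3 * 16 > 36, both coordinates are at most 3 in absolute
  value, and 49 = 7 * 7 counts the possible pairs.\<close>

lemma card_corner_cluster:
  assumes A: "A \<subseteq> words m" and close: "\<And>w w'. \<lbrakk>w \<in> A; w' \<in> A\<rbrakk> \<Longrightarrow> dist (corner w) (corner w') \<le> 3 * (side / 2 ^ m)"
  shows "card A \<le> 49"
proof (cases "A = {}")
  case False
  then obtain a where a: "a \<in> A" by blast
  let ?c = "\<lambda>w. (lattice_coord 2 w, lattice_coord 3 w)"
  let ?R = "{lattice_coord 2 a - 3..lattice_coord 2 a + 3} \<times> {lattice_coord 3 a - 3..lattice_coord 3 a + 3}"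
  have inj: "inj_on ?c A"
    using A lattice_coord_inj by (intro inj_onI) (auto simp: words_def subset_iff)
  have "?c ` A \<subseteq> ?R"
  proof (rule image_subsetI)
    fix w assume w: "w \<in> A"
    define p q where "p = lattice_coord 2 w - lattice_coord 2 a" and "q = lattice_coord 3 w - lattice_coord 3 a"
    have "(side / 2 ^ m)\<^sup>2 * of_int (p\<^sup>2 + p * q + q\<^sup>2) = (dist (corner w) (corner a))\<^sup>2"
      using dist_corner[of w m a] A w a unfolding p_def q_def by (simp add: subsetD)
    also have "\<dots> \<le> (3 * (side / 2 ^ m))\<^sup>2" using close[OF w a] by (intro power_mono) auto
    also have "\<dots> = (side / 2 ^ m)\<^sup>2 * 9" by (simp only: power_mult_distrib) simp
    finally have "of_int (p\<^sup>2 + p * q + q\<^sup>2) \<le> (9 :: real)"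
      using side_pos by (simp add: mult_le_cancel_left_pos)
    hence 9: "p\<^sup>2 + p * q + q\<^sup>2 \<le> 9" by linarith
    have "\<bar>x\<bar> \<le> 3" if "x\<^sup>2 + x * y + y\<^sup>2 \<le> 9" for x y :: int
    proof (rule ccontr)
      assume "\<not> \<bar>x\<bar> \<le> 3"
      hence "4 \<le> \<bar>x\<bar>" by simp
      hence "16 \<le> x\<^sup>2" using power_mono[of 4 "\<bar>x\<bar>" 2] by simp
      moreover have "4 * (x\<^sup>2 + x * y + y\<^sup>2) = 3 * x\<^sup>2 + (x + 2 * y)\<^sup>2"
        by (simp add: power2_eq_square algebra_simps)
      moreover have "(x + 2 * y)\<^sup>2 \<ge> 0" by simp
      moreover have False if "16 \<le> a" "4 * t = 3 * a + b" "0 \<le> b" "t \<le> 9" for a b t :: int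
        using that by linarith
      ultimately show False using that by blast
    qed
    from this[OF 9] this[of q p] 9 have "\<bar>p\<bar> \<le> 3" "\<bar>q\<bar> \<le> 3" by (simp_all add: algebra_simps)
    thus "?c w \<in> ?R" by (auto simp: p_def q_def)
  qed
  hence "card (?c ` A) \<le> card ?R" by (intro card_mono) auto
  thus ?thesis by (simp add: card_image[OF inj] card_cartesian_product)
qed simp

section \<open>Levels of the gasket and covers by balls around corners\<close>

lemma vertex_in_ball: "j \<in> {1, 2, 3} \<Longrightarrow> v j \<in> cball (v 1) side"
  using dist_vertices less_imp_le[OF side_pos] dist_commute[of "v 1" "v 3"] by auto

lemma word_map_in_ball:
  assumes "x \<in> cball (v 1) side" "set w \<subseteq> {1, 2, 3}"
  shows "word_map v w x \<in> cball (v 1) side"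
  using assms(2)
proof (induction w)
  case (Cons j w)
  have "gasket_map v j y \<in> cball (v 1) side" if "y \<in> cball (v 1) side" for y
  proof -
    have "(1 / 2) *\<^sub>R y + (1 / 2) *\<^sub>R v j \<in> cball (v 1) side"
      using that vertex_in_ball[of j] Cons.prems by (intro convexD[OF convex_cball]) auto
    thus ?thesis by (simp add: gasket_map_def algebra_simps)
  qed
  thus ?case using Cons by auto
qed (use assms in simp)

lemma SG0_in_ball: "SG0 v \<subseteq> cball (v 1) side"
  unfolding SG0_def by (intro Un_least closed_segment_subset vertex_in_ball convex_cball) simp_all

text \<open>Each half of a side is the image of the whole side under the contraction that fixes its
  outer end point. This is why the levels \<open>SG_level\<close> increase.\<close>

lemma SG0_subset_maps: "SG0 v \<subseteq> (\<Union>j\<in>{1, 2, 3}. gasket_map v j ` SG0 v)"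
proof -
  have seg: "x \<in> gasket_map v i ` SG0 v \<union> gasket_map v j ` SG0 v"
    if sub: "closed_segment (v i) (v j) \<subseteq> SG0 v" and x: "x \<in> closed_segment (v i) (v j)" for x i j
  proof -
    obtain t where t: "0 \<le> t" "t \<le> 1" "x = (1 - t) *\<^sub>R v i + t *\<^sub>R v j" using x by (auto simp: in_segment)
    show ?thesis
    proof (cases "t \<le> 1 / 2")
      case True
      have "x = gasket_map v i ((1 - 2 * t) *\<^sub>R v i + (2 * t) *\<^sub>R v j)"
      proof -
        have "(1 - 2 * t) *\<^sub>R v i + (2 * t) *\<^sub>R v j + v i = 2 *\<^sub>R x"
          unfolding t(3) by (simp add: algebra_simps scaleR_2)
        thus ?thesis by (simp add: gasket_map_def)
      qed
      moreover have "(1 - 2 * t) *\<^sub>R v i + (2 * t) *\<^sub>R v j \<in> closed_segment (v i) (v j)"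
        using True t by (auto simp: in_segment intro!: exI[of _ "2 * t"])
      ultimately show ?thesis using sub by blast
    next
      case False
      have "x = gasket_map v j ((1 - (2 * t - 1)) *\<^sub>R v i + (2 * t - 1) *\<^sub>R v j)"
      proof -
        have "(1 - (2 * t - 1)) *\<^sub>R v i + (2 * t - 1) *\<^sub>R v j + v j = 2 *\<^sub>R x"
          unfolding t(3) by (simp add: algebra_simps scaleR_2)
        thus ?thesis by (simp add: gasket_map_def)
      qed
      moreover have "(1 - (2 * t - 1)) *\<^sub>R v i + (2 * t - 1) *\<^sub>R v j \<in> closed_segment (v i) (v j)"
        unfolding in_segment using False t by (intro exI[of _ "2 * t - 1"]) auto
      ultimately show ?thesis using sub by blast
    qed
  qed
  show ?thesis
  proof
    fix x assume "x \<in> SG0 v"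
    then consider "x \<in> closed_segment (v 1) (v 2)" | "x \<in> closed_segment (v 2) (v 3)" | "x \<in> closed_segment (v 3) (v 1)"
      by (auto simp: SG0_def)
    thus "x \<in> (\<Union>j\<in>{1, 2, 3}. gasket_map v j ` SG0 v)"
    proof cases
      case 1
      thus ?thesis using seg[of 1 2 x] by (auto simp: SG0_def)
    next
      case 2
      thus ?thesis using seg[of 2 3 x] by (auto simp: SG0_def)
    next
      case 3
      thus ?thesis using seg[of 3 1 x] by (auto simp: SG0_def)
    qed
  qed
qed

lemma SG_level_mono: "SG_level v m \<subseteq> SG_level v (m + k)"
proof (induction k)
  case (Suc k)
  have "SG_level v n \<subseteq> SG_level v (Suc n)" for n
  proof
    fix x assume "x \<in> SG_level v n"
    then obtain w y where w: "w \<in> words n" "y \<in> SG0 v" "x = word_map v w y"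
      by (auto simp: SG_level_def triangle_def)
    obtain j z where "j \<in> {1, 2, 3}" "z \<in> SG0 v" "y = gasket_map v j z" using SG0_subset_maps w(2) by blast
    hence "w @ [j] \<in> words (Suc n)" "x = word_map v (w @ [j]) z" "z \<in> SG0 v"
      using w by (auto simp: words_def word_map_append)
    thus "x \<in> SG_level v (Suc n)" by (auto simp: SG_level_def triangle_def)
  qed
  thus ?case using Suc by auto
qed simp

text \<open>On a deeper level the first \<open>n\<close> letters of a word determine the ball,
  because the rest of the word maps into the ball of radius \<open>side\<close> around
  \<open>v 1\<close>, which those letters contract by 2^(-n). A shallower level is contained in a
  deeper one.\<close>

lemma SG_level_subset_balls: "SG_level v m \<subseteq> (\<Union>w\<in>words n. cball (corner w) (side / 2 ^ n))"
proof -
  have "SG_level v (n + m) \<subseteq> (\<Union>w\<in>words n. cball (corner w) (side / 2 ^ n))"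
  proof
    fix x assume "x \<in> SG_level v (n + m)"
    then obtain w y where w: "w \<in> words (n + m)" "y \<in> SG0 v" "x = word_map v w y"
      by (auto simp: SG_level_def triangle_def)
    let ?a = "take n w" and ?b = "drop n w"
    have ab: "?a \<in> words n" "?b \<in> words m" using words_append[OF w(1), of n] by auto
    have x: "x = word_map v ?a (word_map v ?b y)" using w(3) by (simp flip: word_map_append)
    have "word_map v ?b y \<in> cball (v 1) side"
      using ab(2) w(2) SG0_in_ball by (intro word_map_in_ball) (auto simp: words_def)
    hence "x \<in> cball (corner ?a) (side / 2 ^ n)"
      using ab(1) unfolding x by (simp add: corner_def dist_word_map words_def divide_right_mono)
    thus "x \<in> (\<Union>w\<in>words n. cball (corner w) (side / 2 ^ n))" using ab(1) by blast
  qed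
  thus ?thesis using SG_level_mono[of m n] by (simp add: add.commute)
qed

lemma SG_subset_balls: "SG v \<subseteq> (\<Union>w\<in>words n. cball (corner w) (side / 2 ^ n))"
  unfolding SG_def
proof (rule closure_minimal)
  show "closed (\<Union>w\<in>words n. cball (corner w) (side / 2 ^ n))"
    by (rule closed_UN) (auto intro: finite_words)
qed (use SG_level_subset_balls in blast)

lemma triangle_subset_SG: "w \<in> words n \<Longrightarrow> triangle v w \<subseteq> SG v"
  unfolding SG_def SG_level_def by (rule order_trans[OF _ closure_subset]) blast

lemma corner_in_SG: "w \<in> words n \<Longrightarrow> corner w \<in> SG v"
  using triangle_subset_SG[of w n] by (auto simp: triangle_def corner_def SG0_def)

lemma compact_SG: "compact (SG v)"
proof -
  have "bounded (\<Union>w\<in>words 0. cball (corner w) (side / 2 ^ 0))" by (intro bounded_UN finite_words) auto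
  hence "bounded (SG v)" by (rule bounded_subset[OF _ SG_subset_balls])
  thus ?thesis by (simp add: compact_eq_bounded_closed SG_def)
qed

lemma SG_nonempty: "SG v \<noteq> {}"
  using corner_in_SG[of "[]" 0] by (auto simp: words_def)

subsection \<open>Minkowski dimension\<close>

lemma covering_number_le:
  assumes "side / 2 ^ n \<le> \<epsilon>"
  shows "covering_number (SG v) \<epsilon> \<le> 3 ^ n" and "\<exists>C. finite C \<and> SG v \<subseteq> (\<Union>c\<in>C. cball c \<epsilon>)"
proof -
  let ?C = "corner ` words n"
  have "(\<Union>w\<in>words n. cball (corner w) (side / 2 ^ n)) \<subseteq> (\<Union>w\<in>words n. cball (corner w) \<epsilon>)"
    using assms by (intro UN_mono order_refl subset_cball)
  hence "SG v \<subseteq> (\<Union>c\<in>?C. cball c \<epsilon>)"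
    using SG_subset_balls[of n] by (simp only: image_image UN_simps order_trans)
  with finite_words[of n] have C: "finite ?C" "SG v \<subseteq> (\<Union>c\<in>?C. cball c \<epsilon>)" by simp_all
  thus "\<exists>C. finite C \<and> SG v \<subseteq> (\<Union>c\<in>C. cball c \<epsilon>)" by blast
  have "covering_number (SG v) \<epsilon> \<le> card ?C" unfolding covering_number_def by (rule Least_le) (use C in blast)
  also have "\<dots> \<le> 3 ^ n" using card_image_le[OF finite_words, of corner n] by (simp add: card_words)
  finally show "covering_number (SG v) \<epsilon> \<le> 3 ^ n" .
qed

text \<open>Corners of level \<open>n\<close> are more than 2 \<epsilon> apart, so no ball of radius
  \<epsilon> contains two of them, and every cover needs one centre for each corner.\<close>

lemma covering_number_ge:
  assumes \<epsilon>: "\<epsilon> > 0" "2 * \<epsilon> < side / 2 ^ n"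
  shows "3 ^ n \<le> covering_number (SG v) \<epsilon>"
proof -
  \<comment> \<open>A least cardinality is attained only if some finite cover exists; a sufficiently
    deep level provides one.\<close>
  obtain k where "side / \<epsilon> < 2 ^ k" using real_arch_pow[of 2 "side / \<epsilon>"] by auto
  hence "side / 2 ^ k \<le> \<epsilon>" using \<epsilon> by (simp add: field_simps)
  then obtain C0 where "finite C0" "SG v \<subseteq> (\<Union>c\<in>C0. cball c \<epsilon>)" using covering_number_le(2) by blast
  hence "\<exists>C. finite C \<and> card C = covering_number (SG v) \<epsilon> \<and> SG v \<subseteq> (\<Union>c\<in>C. cball c \<epsilon>)"
    unfolding covering_number_def by (intro LeastI_ex[where P = "\<lambda>m. \<exists>C. finite C \<and> card C = m \<and> SG v \<subseteq> (\<Union>c\<in>C. cball c \<epsilon>)"]) blast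
  then obtain C where C: "finite C" "card C = covering_number (SG v) \<epsilon>" "SG v \<subseteq> (\<Union>c\<in>C. cball c \<epsilon>)" by blast
  have "\<forall>w\<in>words n. \<exists>c. c \<in> C \<and> corner w \<in> cball c \<epsilon>" using corner_in_SG C(3) by blast
  then obtain f where f: "\<forall>w\<in>words n. f w \<in> C \<and> corner w \<in> cball (f w) \<epsilon>" using bchoice by metis
  have "inj_on f (words n)"
  proof (rule inj_onI, rule ccontr)
    fix w w' assume w: "w \<in> words n" "w' \<in> words n" "f w = f w'" "w \<noteq> w'"
    have "dist (corner w) (corner w') \<le> dist (f w) (corner w) + dist (f w) (corner w')"
      by (metis dist_commute dist_triangle)
    also have "\<dots> \<le> 2 * \<epsilon>" using f w by (smt (verit) mem_cball)
    finally show False using corner_separated[OF w(1,2,4)] \<epsilon> by linarith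
  qed
  hence "card (words n) \<le> card C" using f C(1) by (intro card_inj_on_le[of f]) auto
  thus ?thesis using C by (simp add: card_words)
qed

lemma minkowski_dimension_SG: "has_minkowski_dimension (SG v) (ln 3 / ln 2)"
proof -
  let ?L = "\<lambda>\<epsilon>. log 2 (side / \<epsilon>)"
  \<comment> \<open>\<epsilon> < 1 makes \<open>ln (1 / \<epsilon>)\<close> positive, and 4
    \<epsilon> < side makes the level \<open>n\<close> below at least 2, so that
    \<open>n - 2\<close> is a genuine difference.\<close>
  have small: "\<forall>\<^sub>F \<epsilon> in at_right (0::real). 0 < \<epsilon> \<and> \<epsilon> < 1 \<and> 4 * \<epsilon> < side"
  proof -
    have "\<forall>\<^sub>F \<epsilon> in at_right 0. \<epsilon> \<in> {0<..<min 1 (side / 4)}"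
      by (rule eventually_at_right_real) (use side_pos in simp)
    thus ?thesis by eventually_elim auto
  qed
  have bounds: "(?L \<epsilon> - 2) * ln 3 \<le> ln (real (covering_number (SG v) \<epsilon>)) \<and>
      ln (real (covering_number (SG v) \<epsilon>)) \<le> (?L \<epsilon> + 1) * ln 3" if \<epsilon>: "0 < \<epsilon> \<and> \<epsilon> < 1 \<and> 4 * \<epsilon> < side" for \<epsilon>
  proof -
    \<comment> \<open>The first level whose mesh side / 2^n is at most \<epsilon>, so its balls
      cover. By the upper estimate for the ceiling, level \<open>n - 2\<close> has mesh above 2
      \<epsilon>, so its corners are separated. The offsets -2 and +1 reflect these two
      levels.\<close>
    define n where "n = nat \<lceil>?L \<epsilon>\<rceil>"
    have "4 \<le> side / \<epsilon>" using \<epsilon> by (simp add: field_simps)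
    hence "log 2 4 \<le> ?L \<epsilon>" by (subst log_le_cancel_iff) auto
    moreover have "log 2 4 = (2::real)" using log_powr_cancel[of 2 2] by simp
    ultimately have L2: "2 \<le> ?L \<epsilon>" by simp
    have n: "?L \<epsilon> \<le> real n" "real n < ?L \<epsilon> + 1" using L2 unfolding n_def by linarith+
    have n2: "n \<ge> 2" using n L2 by linarith
    have se: "side / \<epsilon> > 0" using side_pos \<epsilon> by simp
    have "side / \<epsilon> \<le> 2 powr real n" using n(1) se by (simp add: log_le_iff)
    hence up: "side / 2 ^ n \<le> \<epsilon>" using \<epsilon> by (simp add: powr_realpow field_simps)
    have "2 powr (real n - 1) < side / \<epsilon>" using n(2) se by (simp add: less_log_iff[symmetric])
    moreover have "2 powr (real n - 1) = 2 * 2 ^ (n - 2)"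
    proof -
      have "real n - 1 = real (Suc (n - 2))" using n2 by linarith
      hence "2 powr (real n - 1) = (2::real) ^ Suc (n - 2)" by (simp only: powr_realpow zero_less_numeral)
      thus ?thesis by simp
    qed
    ultimately have low: "2 * \<epsilon> < side / 2 ^ (n - 2)" using \<epsilon> by (simp add: field_simps)
    have N: "3 ^ (n - 2) \<le> covering_number (SG v) \<epsilon>" "covering_number (SG v) \<epsilon> \<le> 3 ^ n"
      using covering_number_ge[OF _ low] covering_number_le(1)[OF up] \<epsilon> by auto
    have N0: "0 < covering_number (SG v) \<epsilon>" using N(1) by (rule less_le_trans[rotated]) simp
    have "real (n - 2) * ln 3 \<le> ln (real (covering_number (SG v) \<epsilon>))"
    proof -
      have "real (3 ^ (n - 2)) \<le> real (covering_number (SG v) \<epsilon>)" using N(1) by (rule of_nat_mono)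
      hence "ln (3 ^ (n - 2)) \<le> ln (real (covering_number (SG v) \<epsilon>))" using N0 by (intro ln_mono) auto
      thus ?thesis by (simp add: ln_realpow)
    qed
    moreover have "(?L \<epsilon> - 2) * ln 3 \<le> real (n - 2) * ln 3"
      using n n2 by (intro mult_right_mono) auto
    moreover have "ln (real (covering_number (SG v) \<epsilon>)) \<le> real n * ln 3"
    proof -
      have "real (covering_number (SG v) \<epsilon>) \<le> real (3 ^ n)" using N(2) by (rule of_nat_mono)
      hence "ln (real (covering_number (SG v) \<epsilon>)) \<le> ln (3 ^ n)" using N0 by (intro ln_mono) auto
      thus ?thesis by (simp add: ln_realpow)
    qed
    moreover have "real n * ln 3 \<le> (?L \<epsilon> + 1) * ln 3" using n by (intro mult_right_mono) auto
    ultimately show ?thesis by linarith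
  qed
  have lim: "((\<lambda>\<epsilon>. (?L \<epsilon> + c) * ln 3 / ln (1 / \<epsilon>)) \<longlongrightarrow> ln 3 / ln 2) (at_right 0)" for c :: real
  proof -
    have "((\<lambda>\<epsilon>. (?L \<epsilon> + c) * ln 3 / ln (1 / \<epsilon>)) \<longlongrightarrow> inverse (ln 2) * ln 3) (at_right 0)"
      unfolding log_def using side_pos by real_asymp
    thus ?thesis by (simp add: divide_inverse mult.commute)
  qed
  show ?thesis unfolding has_minkowski_dimension_def
  proof (rule tendsto_sandwich[OF _ _ lim[of "-2"] lim[of 1]])
    show "\<forall>\<^sub>F \<epsilon> in at_right 0. (?L \<epsilon> + - 2) * ln 3 / ln (1 / \<epsilon>) \<le> ln (real (covering_number (SG v) \<epsilon>)) / ln (1 / \<epsilon>)"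
      using small by eventually_elim (use bounds in \<open>auto intro!: divide_right_mono\<close>)
    show "\<forall>\<^sub>F \<epsilon> in at_right 0. ln (real (covering_number (SG v) \<epsilon>)) / ln (1 / \<epsilon>) \<le> (?L \<epsilon> + 1) * ln 3 / ln (1 / \<epsilon>)"
      using small by eventually_elim (use bounds in \<open>auto intro!: divide_right_mono\<close>)
  qed
qed

subsection \<open>Hausdorff dimension\<close>

text \<open>The balls of level \<open>n\<close> give a covering sum of at most 3^n (2 side / 2^n)^s
  = (2 side)^s (3 / 2^s)^n, which tends to 0 because 2^s > 3.\<close>

lemma hausdorff_measure_SG_eq_0:
  assumes s: "s > ln 3 / ln 2"
  shows "hausdorff_measure s (SG v) = 0"
proof -
  have s0: "s > 0" using s by (rule less_trans[rotated]) simp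
  have "ln 3 < s * ln 2" using s by (simp add: field_simps)
  hence "exp (ln 3) < exp (s * ln 2)" by (rule exp_less_mono)
  hence q: "3 / 2 powr s < 1" by (simp add: powr_def field_simps)
  define b where "b n = 3 ^ n * (2 * (side / 2 ^ n)) powr s" for n :: nat
  have "b = (\<lambda>n. (2 * side) powr s * (3 / 2 powr s) ^ n)"
  proof
    fix n
    have "((2::real) ^ n) powr s = (2 powr s) ^ n"
      by (simp add: powr_realpow[symmetric] powr_powr powr_power mult.commute)
    thus "b n = (2 * side) powr s * (3 / 2 powr s) ^ n"
      using side_pos by (simp add: b_def powr_divide power_divide)
  qed
  hence lim: "b \<longlonglongrightarrow> 0" using q by (auto intro!: tendsto_mult_right_zero LIMSEQ_realpow_zero)
  have small: "hausdorff_premeasure s \<delta> (SG v) \<le> 0 + ennreal \<eta>" if \<delta>: "\<delta> > 0" and \<eta>: "\<eta> > 0" for \<delta> \<eta>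
  proof -
    have "(\<lambda>n. 2 * (side / 2 ^ n)) \<longlonglongrightarrow> 0" by real_asymp
    hence "\<forall>\<^sub>F n in sequentially. 2 * (side / 2 ^ n) < \<delta> \<and> b n < \<eta>"
      using order_tendstoD(2)[OF lim \<eta>] order_tendstoD(2)[of _ 0 sequentially \<delta>] \<delta>
      by (intro eventually_conj) auto
    then obtain n where n: "2 * (side / 2 ^ n) < \<delta>" "b n < \<eta>" by (auto simp: eventually_sequentially)
    obtain f where f: "bij_betw f {..<(3::nat) ^ n} (words n)"
      using ex_bij_betw_nat_finite[OF finite_words, of n] by (auto simp: card_words atLeast0LessThan)
    \<comment> \<open>Covers are sequences, so the finitely many balls are padded with empty sets,
      which contribute 0 to the sum.\<close>
    define U where "U i = (if i < 3 ^ n then cball (corner (f i)) (side / 2 ^ n) else {})" for i :: nat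
    have diam: "diameter (U i) \<le> 2 * (side / 2 ^ n)" for i
      using side_pos by (simp add: U_def diameter_cball)
    have cover: "SG v \<subseteq> (\<Union>i. U i)"
    proof
      fix x assume "x \<in> SG v"
      then obtain w where w: "w \<in> words n" "x \<in> cball (corner w) (side / 2 ^ n)"
        using SG_subset_balls[of n] by blast
      have "w \<in> f ` {..<(3::nat) ^ n}" using f w(1) by (simp add: bij_betw_def)
      then obtain i where "i < 3 ^ n" "f i = w" by auto
      thus "x \<in> (\<Union>i. U i)" using w by (auto simp: U_def)
    qed
    have "hausdorff_premeasure s \<delta> (SG v) \<le> (\<Sum>i. ennreal (diameter (U i) powr s))"
    proof -
      have "bounded (U i)" "diameter (U i) \<le> \<delta>" for i
        using order_trans[OF diam[of i] less_imp_le[OF n(1)]] by (simp_all add: U_def)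
      thus ?thesis unfolding hausdorff_premeasure_def using cover by (intro INF_lower) simp
    qed
    also have "\<dots> = (\<Sum>i<3 ^ n. ennreal (diameter (U i) powr s))"
      by (rule suminf_finite) (auto simp: U_def)
    also have "\<dots> \<le> (\<Sum>i<(3::nat) ^ n. ennreal ((2 * (side / 2 ^ n)) powr s))"
    proof (intro sum_mono ennreal_leI powr_mono2)
      show "0 \<le> diameter (U i)" for i by (rule diameter_ge_0) (simp add: U_def)
    qed (use diam s0 in auto)
    also have "\<dots> = ennreal (b n)" by (simp add: b_def ennreal_mult'' flip: ennreal_power)
    also have "\<dots> \<le> ennreal \<eta>" using n(2) by (intro ennreal_leI) simp
    finally show ?thesis by simp
  qed
  have "hausdorff_premeasure s \<delta> (SG v) \<le> 0" if "\<delta> > 0" for \<delta>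
    by (rule ennreal_le_epsilon) (rule small[OF that])
  hence "hausdorff_measure s (SG v) \<le> 0"
    unfolding hausdorff_measure_def by (intro SUP_least) simp
  thus ?thesis by simp
qed

text \<open>The prefixes of length \<open>m\<close> have corners within 3 mesh widths of each other:
  one for the extent of \<open>V\<close>, and one for each of the two passages from a word to its
  prefix. Hence there are at most 49 prefixes, and each has 3^(n - m) extensions.\<close>

lemma card_words_in_small_set:
  assumes m: "m \<le> n" and V: "\<And>x y. \<lbrakk>x \<in> V; y \<in> V\<rbrakk> \<Longrightarrow> dist x y \<le> side / 2 ^ m"
  shows "card {w \<in> words n. corner w \<in> V} \<le> 49 * 3 ^ (n - m)"
proof -
  let ?W = "{w \<in> words n. corner w \<in> V}"
  let ?A = "take m ` ?W"
  have near: "dist (corner (take m w)) (corner w) \<le> side / 2 ^ m" if w: "w \<in> words n" for w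
  proof -
    have ab: "take m w \<in> words m" "drop m w \<in> words (n - m)" using words_append[OF w m] by auto
    have "corner w = word_map v (take m w) (word_map v (drop m w) (v 1))"
      by (simp add: corner_def flip: word_map_append)
    moreover have "word_map v (drop m w) (v 1) \<in> cball (v 1) side"
      using ab side_pos by (intro word_map_in_ball) (auto simp: words_def)
    ultimately show ?thesis
      using ab(1) by (simp add: corner_def dist_word_map words_def divide_right_mono)
  qed
  have A: "card ?A \<le> 49"
  proof (rule card_corner_cluster[of _ m])
    show "?A \<subseteq> words m" using words_append m by auto
    fix a a' assume "a \<in> ?A" "a' \<in> ?A"
    then obtain w w' where w: "w \<in> ?W" "w' \<in> ?W" "a = take m w" "a' = take m w'" by auto
    have "dist (corner a) (corner a') \<le> dist (corner a) (corner w) + dist (corner w) (corner w') + dist (corner a') (corner w')"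
      using dist_triangle[of "corner a" "corner a'" "corner w"] dist_triangle[of "corner w" "corner a'" "corner w'"]
      by (simp add: dist_commute)
    also have "\<dots> \<le> 3 * (side / 2 ^ m)" using near[of w] near[of w'] V[of "corner w" "corner w'"] w by auto
    finally show "dist (corner a) (corner a') \<le> 3 * (side / 2 ^ m)" .
  qed
  have "?W \<subseteq> (\<lambda>(a, b). a @ b) ` (?A \<times> words (n - m))"
  proof
    fix w assume w: "w \<in> ?W"
    hence "w = (\<lambda>(a, b). a @ b) (take m w, drop m w)" by simp
    moreover have "(take m w, drop m w) \<in> ?A \<times> words (n - m)" using w words_append[of w n m] m by auto
    ultimately show "w \<in> (\<lambda>(a, b). a @ b) ` (?A \<times> words (n - m))" by (rule image_eqI)
  qed
  hence "card ?W \<le> card ((\<lambda>(a, b). a @ b) ` (?A \<times> words (n - m)))"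
    using finite_words by (intro card_mono) auto
  also have "\<dots> \<le> card (?A \<times> words (n - m))" using finite_words by (intro card_image_le) auto
  also have "\<dots> \<le> 49 * 3 ^ (n - m)" using A by (simp add: card_cartesian_product card_words)
  finally show ?thesis .
qed

lemma dyadic_scale:
  assumes "0 < \<rho>" "\<rho> \<le> side"
  obtains m where "side / 2 ^ Suc m < \<rho>" "\<rho> \<le> side / 2 ^ m"
proof -
  have "\<exists>m. side / 2 ^ Suc m < \<rho>"
  proof -
    obtain k where "side / \<rho> < 2 ^ k" using real_arch_pow[of 2 "side / \<rho>"] by auto
    hence "side / 2 ^ k < \<rho>" using assms by (simp add: field_simps)
    moreover have "side / 2 ^ Suc k \<le> side / 2 ^ k" using side_pos by (simp add: field_simps)
    ultimately show ?thesis by (meson le_less_trans)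
  qed
  define m where "m = (LEAST m. side / 2 ^ Suc m < \<rho>)"
  have 1: "side / 2 ^ Suc m < \<rho>" unfolding m_def by (rule LeastI_ex) fact
  have "\<rho> \<le> side / 2 ^ m"
  proof (cases m)
    case (Suc k)
    hence "\<not> side / 2 ^ Suc k < \<rho>" using not_less_Least[of k "\<lambda>m. side / 2 ^ Suc m < \<rho>"] by (simp add: m_def)
    thus ?thesis using Suc by simp
  qed (use assms in simp)
  thus ?thesis using that 1 by blast
qed

text \<open>Mass distribution principle with the counting measures on the corners of a level: the finitely many
  sets of a cover by open sets contain all \<open>3\<^sup>n\<close> corners of level \<open>n\<close>, but each of them only a proportion of
  the order \<open>\<rho>\<^sup>s\<close>, where \<open>\<rho>\<close> is its diameter.\<close>

lemma open_cover_bound: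
  assumes s: "0 < s" "s \<le> ln 3 / ln 2" and F: "finite F" and cover: "SG v \<subseteq> (\<Union>i\<in>F. V i)"
    and \<rho>: "\<And>i. i \<in> F \<Longrightarrow> 0 < \<rho> i \<and> \<rho> i \<le> side"
    and V: "\<And>i x y. \<lbrakk>i \<in> F; x \<in> V i; y \<in> V i\<rbrakk> \<Longrightarrow> dist x y \<le> \<rho> i"
  shows "1 \<le> 49 * (2 / side) powr s * (\<Sum>i\<in>F. \<rho> i powr s)"
proof -
  have "\<forall>i\<in>F. \<exists>m. side / 2 ^ Suc m < \<rho> i \<and> \<rho> i \<le> side / 2 ^ m" using dyadic_scale \<rho> by metis
  then obtain m where m: "\<And>i. i \<in> F \<Longrightarrow> side / 2 ^ Suc (m i) < \<rho> i \<and> \<rho> i \<le> side / 2 ^ m i"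
    using bchoice[of F "\<lambda>i m. side / 2 ^ Suc m < \<rho> i \<and> \<rho> i \<le> side / 2 ^ m"] by blast
  \<comment> \<open>One level that is at least as fine as the scale of every set of the
    cover.\<close>
  define n where "n = Max (insert 0 (m ` F))"
  have mn: "m i \<le> n" if "i \<in> F" for i using that F by (auto simp: n_def)
  have "words n \<subseteq> (\<Union>i\<in>F. {w \<in> words n. corner w \<in> V i})" using corner_in_SG cover by blast
  hence "card (words n) \<le> card (\<Union>i\<in>F. {w \<in> words n. corner w \<in> V i})"
    using F finite_words by (intro card_mono) auto
  also have "\<dots> \<le> (\<Sum>i\<in>F. card {w \<in> words n. corner w \<in> V i})" by (rule card_UN_le[OF F])
  also have "\<dots> \<le> (\<Sum>i\<in>F. 49 * 3 ^ (n - m i))"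
  proof (rule sum_mono)
    fix i assume i: "i \<in> F"
    show "card {w \<in> words n. corner w \<in> V i} \<le> 49 * 3 ^ (n - m i)"
      using V[OF i] m[OF i] by (intro card_words_in_small_set[OF mn[OF i]]) (meson order_trans)
  qed
  finally have "(3::nat) ^ n \<le> (\<Sum>i\<in>F. 49 * 3 ^ (n - m i))" by (simp add: card_words)
  hence "real (3 ^ n) \<le> real (\<Sum>i\<in>F. 49 * 3 ^ (n - m i))" by (rule of_nat_mono)
  hence le: "(3::real) ^ n \<le> (\<Sum>i\<in>F. 49 * (3::real) ^ (n - m i))" by simp
  \<comment> \<open>The assumption on \<open>s\<close> says 2^s \<le> 3, hence 3^(-m) \<le>
    (2^(-m))^s. Moreover 2^(-m) is 2 / side times side / 2^(m+1), which is below
    \<open>\<rho> i\<close>; this is the origin of the factor 2 / side.\<close>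
  have "(3::real) ^ (n - m i) \<le> 3 ^ n * ((2 / side) powr s * \<rho> i powr s)" if i: "i \<in> F" for i
  proof -
    have "(2::real) powr (real (m i) * s) \<le> 2 powr (real (m i) * (ln 3 / ln 2))"
      using s by (intro powr_mono mult_left_mono) auto
    also have "\<dots> = 3 ^ m i"
      by (simp add: powr_def exp_of_nat_mult)
    finally have "1 / 3 ^ m i \<le> 1 / 2 powr (real (m i) * s)" by (intro divide_left_mono) auto
    also have "\<dots> = (1 / 2 ^ m i) powr s"
      by (simp add: powr_divide powr_realpow[symmetric] powr_powr)
    also have "\<dots> = ((2 / side) * (side / 2 ^ Suc (m i))) powr s" using side_pos by simp
    also have "\<dots> \<le> ((2 / side) * \<rho> i) powr s"
      using m[OF i] side_pos s by (intro powr_mono2 mult_left_mono) auto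
    also have "\<dots> = (2 / side) powr s * \<rho> i powr s"
      by (rule powr_mult)
    finally have "3 ^ n * (1 / 3 ^ m i) \<le> 3 ^ n * ((2 / side) powr s * \<rho> i powr s)"
      by (intro mult_left_mono) auto
    thus ?thesis using mn[OF i] by (simp add: power_diff)
  qed
  hence "(\<Sum>i\<in>F. 49 * (3::real) ^ (n - m i)) \<le> (\<Sum>i\<in>F. 49 * (3 ^ n * ((2 / side) powr s * \<rho> i powr s)))"
    by (intro sum_mono mult_left_mono) auto
  also have "\<dots> = 3 ^ n * (49 * (2 / side) powr s * (\<Sum>i\<in>F. \<rho> i powr s))"
    unfolding sum_distrib_left by (rule sum.cong) (simp_all add: mult_ac)
  finally have "3 ^ n * 1 \<le> 3 ^ n * (49 * (2 / side) powr s * (\<Sum>i\<in>F. \<rho> i powr s))"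
    unfolding mult_1_right by (rule order_trans[OF le])
  thus ?thesis by (rule mult_left_le_imp_le) simp
qed

text \<open>A countable cover by arbitrary sets is exchanged for a finite one by open sets at the
  price \<eta> in the sum; \<open>open_cover_bound\<close> then gives a lower bound \<open>c\<close>
  independent of the cover. The critical exponent is included, so the positive exponents with
  measure 0 are exactly those above ln 3 / ln 2.\<close>

lemma hausdorff_measure_SG_pos:
  assumes s: "0 < s" "s \<le> ln 3 / ln 2"
  shows "hausdorff_measure s (SG v) > 0"
proof -
  define c where "c = 1 / (49 * (2 / side) powr s)"
  have c: "c > 0" using side_pos by (simp add: c_def)
  have "ennreal c \<le> (\<Sum>i. ennreal (diameter (U i) powr s))"
    if cov: "SG v \<subseteq> (\<Union>i. U i)" and U: "\<And>i. bounded (U i) \<and> diameter (U i) \<le> side / 4" for U :: "nat \<Rightarrow> (real^2) set"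
  proof (rule ennreal_le_epsilon)
    fix \<eta> :: real assume \<eta>: "\<eta> > 0"
    define x where "x i = diameter (U i)" for i
    have x: "0 \<le> x i" "x i \<le> side / 4" for i using U[of i] by (auto simp: x_def diameter_ge_0)
    \<comment> \<open>The room available for enlarging: diameters start at or below side / 4, and
      adding at most \<open>gap\<close> to the power keeps them at or below side / 2.\<close>
    define gap where "gap = (side / 2) powr s - (side / 4) powr s"
    have gap: "gap > 0" using side_pos s by (simp add: gap_def powr_less_mono2)
    define \<theta> where "\<theta> i = min (\<eta> * (1 / 2) ^ Suc i) gap" for i
    have \<theta>: "\<theta> i > 0" "\<theta> i \<le> \<eta> * (1 / 2) ^ Suc i" "\<theta> i \<le> gap" for i using \<eta> gap by (auto simp: \<theta>_def)
    \<comment> \<open>The enlarged diameter is defined through its \<open>s\<close>-th power, so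
      that the increase of the covering sum is bounded by a geometric series with sum \<eta>. It
      exceeds \<open>x i\<close> strictly, also for sets of diameter 0.\<close>
    define \<rho> where "\<rho> i = (x i powr s + \<theta> i) powr (1 / s)" for i
    have \<rho>s: "\<rho> i powr s = x i powr s + \<theta> i" for i
      using \<theta>[of i] s by (simp add: \<rho>_def powr_powr add_nonneg_nonneg)
    have x\<rho>: "x i < \<rho> i" for i
    proof -
      have "x i = (x i powr s) powr (1 / s)" using x[of i] s by (simp add: powr_powr)
      also have "\<dots> < (x i powr s + \<theta> i) powr (1 / s)" using \<theta>[of i] s by (intro powr_less_mono2) auto
      finally show ?thesis by (simp add: \<rho>_def)
    qed
    have \<rho>_le: "\<rho> i \<le> side" for i
    proof -
      have "x i powr s \<le> (side / 4) powr s" using x[of i] s by (intro powr_mono2) auto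
      hence "x i powr s + \<theta> i \<le> (side / 2) powr s" using \<theta>(3)[of i] by (simp add: gap_def)
      hence "\<rho> i \<le> ((side / 2) powr s) powr (1 / s)"
        unfolding \<rho>_def using \<theta>[of i] s by (intro powr_mono2) (auto intro: add_nonneg_nonneg)
      also have "\<dots> = side / 2" using s side_pos by (simp add: powr_powr)
      finally show ?thesis using side_pos by simp
    qed
    \<comment> \<open>Thickening by half of \<open>\<rho> i - x i\<close> makes the sets open and
      lets any distance grow by at most \<open>\<rho> i - x i\<close>; compactness can now select
      finitely many.\<close>
    define V where "V i = (\<Union>y\<in>U i. ball y ((\<rho> i - x i) / 2))" for i
    have "SG v \<subseteq> (\<Union>i. V i)"
    proof
      fix y assume "y \<in> SG v"
      then obtain i where "y \<in> U i" using cov by blast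
      thus "y \<in> (\<Union>i. V i)" using x\<rho>[of i] by (auto simp: V_def intro!: exI[of _ i] bexI[of _ y])
    qed
    moreover have "open (V i)" for i by (auto simp: V_def)
    ultimately obtain F where F: "finite F" "SG v \<subseteq> (\<Union>i\<in>F. V i)"
      using compactE_image[OF compact_SG, of UNIV V] by (metis UNIV_I)
    have "dist y z \<le> \<rho> i" if yz: "y \<in> V i" "z \<in> V i" for i y z
    proof -
      obtain y' z' where "y' \<in> U i" "z' \<in> U i" "dist y' y < (\<rho> i - x i) / 2" "dist z' z < (\<rho> i - x i) / 2"
        using yz by (auto simp: V_def)
      moreover from this have "dist y' z' \<le> x i"
        unfolding x_def using U[of i] by (intro diameter_bounded_bound) auto
      moreover have "dist y z \<le> dist y' y + dist y' z' + dist z' z"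
        using dist_triangle[of y z y'] dist_triangle[of y' z z'] by (simp add: dist_commute)
      ultimately show ?thesis by argo
    qed
    moreover have "0 < \<rho> i" for i using x(1)[of i] x\<rho>[of i] by linarith
    ultimately have "1 \<le> 49 * (2 / side) powr s * (\<Sum>i\<in>F. \<rho> i powr s)"
      using \<rho>_le by (intro open_cover_bound[OF s F]) auto
    hence "c \<le> (\<Sum>i\<in>F. \<rho> i powr s)" using side_pos by (simp add: c_def field_simps)
    also have "\<dots> = (\<Sum>i\<in>F. x i powr s) + (\<Sum>i\<in>F. \<theta> i)" by (simp add: \<rho>s sum.distrib)
    also have "(\<Sum>i\<in>F. \<theta> i) \<le> (\<Sum>i\<in>F. \<eta> * (1 / 2) ^ Suc i)" using \<theta> by (intro sum_mono) auto
    also have "\<dots> \<le> (\<Sum>i. \<eta> * (1 / 2) ^ Suc i)"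
      using \<eta> F by (intro sum_le_suminf summable_mult sums_summable[OF power_half_series]) auto
    also have "\<dots> = \<eta>" using suminf_mult[OF sums_summable[OF power_half_series], of \<eta>] sums_unique[OF power_half_series] by simp
    finally have "ennreal c \<le> ennreal ((\<Sum>i\<in>F. x i powr s) + \<eta>)" by (intro ennreal_leI) simp
    also have "\<dots> = (\<Sum>i\<in>F. ennreal (x i powr s)) + ennreal \<eta>" using \<eta> by (simp add: sum_nonneg)
    also have "\<dots> \<le> (\<Sum>i. ennreal (x i powr s)) + ennreal \<eta>" using F by (intro add_right_mono sum_le_suminf) auto
    finally show "ennreal c \<le> (\<Sum>i. ennreal (diameter (U i) powr s)) + ennreal \<eta>" by (simp add: x_def)
  qed
  hence "ennreal c \<le> hausdorff_premeasure s (side / 4) (SG v)"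
    unfolding hausdorff_premeasure_def by (intro INF_greatest) auto
  also have "\<dots> \<le> hausdorff_measure s (SG v)"
    unfolding hausdorff_measure_def using side_pos by (intro SUP_upper) auto
  finally show ?thesis using c by (meson ennreal_less_zero_iff less_le_trans)
qed

text \<open>Shared by metric and Hausdorff dimension, where the admissible exponents are in both
  cases those above ln 3 / ln 2.\<close>

lemma INF_ereal_greaterThan:
  assumes "a > 0"
  shows "(INF s\<in>{s. s > 0 \<and> s > a}. ereal s) = ereal a"
proof (rule antisym)
  show "ereal a \<le> (INF s\<in>{s. s > 0 \<and> s > a}. ereal s)" by (rule INF_greatest) auto
  show "(INF s\<in>{s. s > 0 \<and> s > a}. ereal s) \<le> ereal a"
  proof (rule ereal_le_epsilon2)
    fix e :: real assume "e > 0"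
    thus "(INF s\<in>{s. s > 0 \<and> s > a}. ereal s) \<le> ereal a + ereal e"
      using assms by (intro INF_lower2[of "a + e"]) auto
  qed
qed

lemma hausdorff_dimension_SG: "hausdorff_dimension (SG v) = ereal (ln 3 / ln 2)"
proof -
  have "hausdorff_measure s (SG v) = 0 \<longleftrightarrow> s > ln 3 / ln 2" if "s > 0" for s
    using hausdorff_measure_SG_eq_0[of s] hausdorff_measure_SG_pos[of s] that by (cases "s > ln 3 / ln 2") auto
  hence "{s. s > 0 \<and> hausdorff_measure s (SG v) = 0} = {s. s > 0 \<and> s > ln 3 / ln 2}" by auto
  thus ?thesis using INF_ereal_greaterThan[of "ln 3 / ln 2"] by (simp add: hausdorff_dimension_def)
qed

end

end

section \<open>Multiplication operators and commutators\<close>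

definition mult_op :: "'t measure \<Rightarrow> ('t \<Rightarrow> complex) \<Rightarrow> ('t \<Rightarrow> complex) set \<Rightarrow> ('t \<Rightarrow> complex) set" where
  "mult_op M g X = L2_class M (\<lambda>t. g t * L2_fun X t)"

lemma mult_op_class:
  assumes "f \<in> sq_integrable M"
  shows "mult_op M g (L2_class M f) = L2_class M (\<lambda>t. g t * f t)"
  unfolding mult_op_def by (rule L2_class_eqI) (use L2_fun_class(2)[OF assms] in eventually_elim, simp)

context
  fixes M :: "'t measure" and g :: "'t \<Rightarrow> complex" and C :: real
  assumes g: "g \<in> borel_measurable M" and C: "\<And>t. cmod (g t) \<le> C"
begin

lemma mult_op_in: "X \<in> carrier (L2 M) \<Longrightarrow> mult_op M g X \<in> carrier (L2 M)"
  unfolding mult_op_def by (intro L2_class_in sq_integrable_mult[OF L2_fun_in g C])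

lemma mult_op_add:
  assumes "X \<in> carrier (L2 M)" "Y \<in> carrier (L2 M)"
  shows "mult_op M g (X \<oplus>\<^bsub>L2 M\<^esub> Y) = mult_op M g X \<oplus>\<^bsub>L2 M\<^esub> mult_op M g Y"
proof -
  obtain f where f: "f \<in> sq_integrable M" "X = L2_class M f" using assms(1) by (rule L2_cases)
  obtain h where h: "h \<in> sq_integrable M" "Y = L2_class M h" using assms(2) by (rule L2_cases)
  note fh = f h
  show ?thesis
    using fh sq_integrable_mult[OF fh(1) g C] sq_integrable_mult[OF fh(3) g C]
    by (simp add: L2_add mult_op_class sq_integrable_add distrib_left)
qed

lemma mult_op_smult:
  assumes "X \<in> carrier (L2 M)"
  shows "mult_op M g (c \<odot>\<^bsub>L2 M\<^esub> X) = c \<odot>\<^bsub>L2 M\<^esub> mult_op M g X"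
proof -
  obtain f where f: "f \<in> sq_integrable M" "X = L2_class M f" using assms by (rule L2_cases)
  thus ?thesis
    using sq_integrable_mult[OF f(1) g C] by (simp add: L2_smult mult_op_class sq_integrable_cmult mult_ac)
qed

lemma hnorm_mult_op:
  assumes "X \<in> carrier (L2 M)"
  shows "hnorm (L2 M) (mult_op M g X) \<le> C * hnorm (L2 M) X"
proof -
  obtain f where f: "f \<in> sq_integrable M" "X = L2_class M f" using assms by (rule L2_cases)
  note gf = sq_integrable_mult[OF f(1) g C]
  have C0: "0 \<le> C" using order_trans[OF norm_ge_zero C] .
  have "(LINT t|M. (cmod (g t * f t))\<^sup>2) \<le> (LINT t|M. C\<^sup>2 * (cmod (f t))\<^sup>2)"
  proof (rule integral_mono)
    show "(cmod (g t * f t))\<^sup>2 \<le> C\<^sup>2 * (cmod (f t))\<^sup>2" for t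
      using power_mono[OF C norm_ge_zero, of t 2] by (simp add: norm_mult power_mult_distrib mult_right_mono)
  qed (use sq_integrable_norm[OF gf] sq_integrable_norm[OF f(1)] in auto)
  hence "sqrt (LINT t|M. (cmod (g t * f t))\<^sup>2) \<le> sqrt (C\<^sup>2 * (LINT t|M. (cmod (f t))\<^sup>2))" by simp
  thus ?thesis using C0 by (simp add: f mult_op_class L2_hnorm[OF gf] L2_hnorm[OF f(1)] real_sqrt_mult)
qed

lemma mult_op_adjoint:
  assumes "X \<in> carrier (L2 M)" "Y \<in> carrier (L2 M)"
  shows "ip (L2 M) (mult_op M g X) Y = ip (L2 M) X (mult_op M (\<lambda>t. cnj (g t)) Y)"
proof -
  obtain f where f: "f \<in> sq_integrable M" "X = L2_class M f" using assms(1) by (rule L2_cases)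
  obtain h where h: "h \<in> sq_integrable M" "Y = L2_class M h" using assms(2) by (rule L2_cases)
  note fh = f h
  have g': "(\<lambda>t. cnj (g t)) \<in> borel_measurable M" "\<And>t. cmod (cnj (g t)) \<le> C" using g C by auto
  show ?thesis
    using fh sq_integrable_mult[OF fh(1) g C] sq_integrable_mult[OF fh(3) g']
    by (simp add: mult_op_class L2_ip mult_ac)
qed

lemma bounded_op_mult_op: "bounded_op (L2 M) (mult_op M g)"
  unfolding bounded_op_def
  by (intro conjI ballI allI exI[of _ C] Pi_I mult_op_in mult_op_add mult_op_smult hnorm_mult_op)

end

lemma mult_op_cong: "(\<And>t. g t = h t) \<Longrightarrow> mult_op M g X = mult_op M h X"
  by (simp add: mult_op_def)

lemma mult_op_sum:
  assumes "g \<in> borel_measurable M" "\<And>t. cmod (g t) \<le> C" "h \<in> borel_measurable M" "\<And>t. cmod (h t) \<le> C'"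
    and X: "X \<in> carrier (L2 M)"
  shows "mult_op M (\<lambda>t. g t + h t) X = mult_op M g X \<oplus>\<^bsub>L2 M\<^esub> mult_op M h X"
  unfolding mult_op_def
  using L2_add[OF sq_integrable_mult[OF L2_fun_in[OF X] assms(1,2)] sq_integrable_mult[OF L2_fun_in[OF X] assms(3,4)]]
  by (simp add: distrib_right)

lemma mult_op_product:
  assumes "h \<in> borel_measurable M" "\<And>t. cmod (h t) \<le> C'" and X: "X \<in> carrier (L2 M)"
  shows "mult_op M (\<lambda>t. g t * h t) X = mult_op M g (mult_op M h X)"
proof -
  have "mult_op M g (L2_class M (\<lambda>t. h t * L2_fun X t)) = L2_class M (\<lambda>t. g t * (h t * L2_fun X t))"
    by (rule mult_op_class[OF sq_integrable_mult[OF L2_fun_in[OF X] assms(1,2)]])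
  thus ?thesis by (simp add: mult_op_def[of M h] mult_op_def[of M "\<lambda>t. g t * h t"] mult.assoc)
qed

lemma mult_op_cmult:
  assumes "g \<in> borel_measurable M" "\<And>t. cmod (g t) \<le> C" and X: "X \<in> carrier (L2 M)"
  shows "mult_op M (\<lambda>t. c * g t) X = c \<odot>\<^bsub>L2 M\<^esub> mult_op M g X"
  unfolding mult_op_def
  using L2_smult[OF sq_integrable_mult[OF L2_fun_in[OF X] assms(1,2)]] by (simp add: mult.assoc)

lemma mult_op_one: "X \<in> carrier (L2 M) \<Longrightarrow> mult_op M (\<lambda>t. 1) X = X"
  by (simp add: mult_op_def L2_class_L2_fun)

lemma diagonal_operator_diagonal_op:
  assumes "orthonormal_basis H UNIV e"
  shows "diagonal_operator H UNIV e (diagonal_op H e \<mu>) \<mu>"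
proof -
  interpret orthonormal_basis H UNIV e by (rule assms)
  let ?D = "diagonal_op H e \<mu>"
  have D: "the (?D x) \<in> carrier H \<and> (\<forall>k. ip H (the (?D x)) (e k) = \<mu> k * ip H x (e k))" if "x \<in> dom ?D" for x
  proof -
    have x: "x \<in> carrier H" "(\<lambda>k. (cmod (\<mu> k * ip H x (e k)))\<^sup>2) summable_on UNIV"
      using that by (auto simp: diagonal_op_def domIff split: if_splits)
    obtain y where y: "y \<in> carrier H" "\<forall>k. ip H y (e k) = \<mu> k * ip H x (e k)"
      using Riesz_Fischer[OF x(2)] by (metis UNIV_I)
    have "(THE y. y \<in> carrier H \<and> (\<forall>k. ip H y (e k) = \<mu> k * ip H x (e k))) = y"
      by (rule the_equality) (use y in \<open>auto intro: coef_eqI\<close>)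
    thus ?thesis using x y by (simp add: diagonal_op_def)
  qed
  show ?thesis
  proof
    show "dom ?D = {x \<in> carrier H. (\<lambda>k. (cmod (\<mu> k * ip H x (e k)))\<^sup>2) summable_on UNIV}"
      by (auto simp: diagonal_op_def domIff split: if_splits)
  qed (use D in auto)
qed

abbreviation circle_dirac :: "nat \<Rightarrow> (real \<Rightarrow> complex) set \<rightharpoonup> (real \<Rightarrow> complex) set" where
  "circle_dirac n \<equiv> diagonal_op (L2 (circle_measure n)) (circle_basis n) (\<lambda>k. 2 ^ n * (of_int k + 1 / 2))"

lemma diagonal_operator_circle_dirac:
  "diagonal_operator (L2 (circle_measure n)) UNIV (circle_basis n) (circle_dirac n) (\<lambda>k. 2 ^ n * (of_int k + 1 / 2))"
  by (rule diagonal_operator_diagonal_op[OF orthonormal_basis_circle])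

text \<open>Integration by parts shows that the coefficients of the expected value \<open>V\<close>
  are the eigenvalues times those of \<open>W\<close>. As \<open>V\<close> has square summable
  coefficients, \<open>W\<close> is in the domain, and by totality the operator takes it to
  \<open>V\<close>.\<close>

lemma circle_dirac_mult_basis:
  fixes c c' :: "real \<Rightarrow> complex" and k :: int
  assumes cont: "continuous_on {- (pi / 2 ^ n)..pi / 2 ^ n} c" and per: "c (- (pi / 2 ^ n)) = c (pi / 2 ^ n)"
    and F: "finite F" and c': "\<And>t. t \<in> {- (pi / 2 ^ n)<..<pi / 2 ^ n} - F \<Longrightarrow> (c has_vector_derivative c' t) (at t)"
    and meas: "c \<in> borel_measurable borel" "c' \<in> borel_measurable borel"
    and B: "\<And>t. cmod (c t) \<le> B" "\<And>t. cmod (c' t) \<le> B'"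
  defines "W \<equiv> mult_op (circle_measure n) c (circle_basis n k)"
  shows "W \<in> dom (circle_dirac n)"
    and "the (circle_dirac n W) = complex_of_real (2 ^ n * (of_int k + 1 / 2)) \<odot>\<^bsub>L2 (circle_measure n)\<^esub> W
      \<oplus>\<^bsub>L2 (circle_measure n)\<^esub> mult_op (circle_measure n) (\<lambda>t. - \<i> * c' t) (circle_basis n k)"
proof -
  let ?M = "circle_measure n"
  let ?H = "L2 ?M"
  interpret diagonal_operator ?H UNIV "circle_basis n" "circle_dirac n" "\<lambda>k. 2 ^ n * (of_int k + 1 / 2)"
    by (rule diagonal_operator_circle_dirac)
  note [measurable] = meas
  have ic': "(\<lambda>t. - \<i> * c' t) \<in> borel_measurable ?M" "\<And>t. cmod (- \<i> * c' t) \<le> B'"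
    using B(2) by (auto simp: norm_mult)
  have cM: "c \<in> borel_measurable ?M" using meas by simp
  define V where "V = complex_of_real (2 ^ n * (of_int k + 1 / 2)) \<odot>\<^bsub>?H\<^esub> W
    \<oplus>\<^bsub>?H\<^esub> mult_op ?M (\<lambda>t. - \<i> * c' t) (circle_basis n k)"
  have e: "circle_basis n j \<in> carrier ?H" for j by (rule e_in) simp
  have W: "W \<in> carrier ?H" unfolding W_def by (rule mult_op_in[OF cM B(1) e])
  have W': "mult_op ?M (\<lambda>t. - \<i> * c' t) (circle_basis n k) \<in> carrier ?H" by (rule mult_op_in[OF ic' e])
  have V: "V \<in> carrier ?H" unfolding V_def using W W' by auto
  have coef: "ip ?H (mult_op ?M f (circle_basis n k)) (circle_basis n j) = (LINT t|?M. f t * fourier n (k - j) t)"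
    if [measurable]: "f \<in> borel_measurable borel" and "\<And>t. cmod (f t) \<le> A" for f j A
  proof -
    have "ip ?H (mult_op ?M f (circle_basis n k)) (circle_basis n j) = (LINT t|?M. (f t * fourier n k t) * cnj (fourier n j t))"
      unfolding circle_basis_fourier mult_op_class[OF fourier_sq_integrable]
      by (rule L2_ip[OF sq_integrable_mult[OF fourier_sq_integrable _ that(2)] fourier_sq_integrable]) simp
    thus ?thesis by (simp add: cnj_fourier mult.assoc fourier_mult)
  qed
  have key: "ip ?H V (circle_basis n j) = complex_of_real (2 ^ n * (of_int j + 1 / 2)) * ip ?H W (circle_basis n j)" for j
  proof -
    define I1 where "I1 = (LINT t|?M. c t * fourier n (k - j) t)"
    define I2 where "I2 = (LINT t|?M. c' t * fourier n (k - j) t)"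
    have int: "integrable ?M (\<lambda>t. c t * fourier n (k - j) t)" "integrable ?M (\<lambda>t. c' t * fourier n (k - j) t)"
      by (rule integrable_circle_bounded[of _ B], use B in \<open>simp_all add: norm_mult\<close>)
        (rule integrable_circle_bounded[of _ B'], use B in \<open>simp_all add: norm_mult\<close>)
    \<comment> \<open>The integrand is the derivative of \<open>c\<close> times the exponential of
      index \<open>k - j\<close>, which arises from \<open>fourier n k\<close> and the conjugate of
      \<open>fourier n j\<close>; over a full period it integrates to 0.\<close>
    have "(LINT t|?M. c t * (\<i> * 2 ^ n * of_int (k - j) * fourier n (k - j) t) + c' t * fourier n (k - j) t) = 0"
    proof (rule circle_integral_derivative[of n "\<lambda>t. c t * fourier n (k - j) t" F])
      show "continuous_on {- (pi / 2 ^ n)..pi / 2 ^ n} (\<lambda>t. c t * fourier n (k - j) t)"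
        by (intro continuous_intros cont)
      show "((\<lambda>t. c t * fourier n (k - j) t) has_vector_derivative
          c t * (\<i> * 2 ^ n * of_int (k - j) * fourier n (k - j) t) + c' t * fourier n (k - j) t) (at t)"
        if "t \<in> {- (pi / 2 ^ n)<..<pi / 2 ^ n} - F" for t
        by (rule has_vector_derivative_mult[OF c'[OF that] fourier_deriv])
      fix t
      have "cmod (c t * (\<i> * 2 ^ n * of_int (k - j) * fourier n (k - j) t)) \<le> B * (2 ^ n * \<bar>of_int (k - j)\<bar>)"
        using mult_right_mono[OF B(1)[of t], of "2 ^ n * \<bar>real_of_int (k - j)\<bar>"]
        by (simp add: norm_mult norm_power del: of_int_diff)
      moreover have "cmod (c' t * fourier n (k - j) t) \<le> B'" using B(2)[of t] by (simp add: norm_mult)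
      ultimately show "cmod (c t * (\<i> * 2 ^ n * of_int (k - j) * fourier n (k - j) t) + c' t * fourier n (k - j) t)
          \<le> B * (2 ^ n * \<bar>of_int (k - j)\<bar>) + B'"
        by (rule norm_triangle_mono)
    next
      show "c (- (pi / 2 ^ n)) * fourier n (k - j) (- (pi / 2 ^ n)) = c (pi / 2 ^ n) * fourier n (k - j) (pi / 2 ^ n)"
        by (simp only: per fourier_periodic)
    qed (rule F, measurable)
    also have "(LINT t|?M. c t * (\<i> * 2 ^ n * of_int (k - j) * fourier n (k - j) t) + c' t * fourier n (k - j) t)
      = (LINT t|?M. (\<i> * 2 ^ n * of_int (k - j)) * (c t * fourier n (k - j) t) + c' t * fourier n (k - j) t)"
      by (simp add: mult_ac)
    also have "\<dots> = (\<i> * 2 ^ n * of_int (k - j)) * I1 + I2"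
      using int unfolding I1_def I2_def by (subst Bochner_Integration.integral_add) auto
    finally have parts: "I2 = - (\<i> * 2 ^ n * of_int (k - j)) * I1" by (simp add: eq_neg_iff_add_eq_0 add.commute)
    have "ip ?H W (circle_basis n j) = I1"
      unfolding W_def I1_def by (rule coef[OF meas(1) B(1)])
    moreover have "ip ?H (mult_op ?M (\<lambda>t. - \<i> * c' t) (circle_basis n k)) (circle_basis n j) = - \<i> * I2"
    proof -
      have "ip ?H (mult_op ?M (\<lambda>t. - \<i> * c' t) (circle_basis n k)) (circle_basis n j)
        = (LINT t|?M. - \<i> * c' t * fourier n (k - j) t)" by (rule coef[OF _ ic'(2)]) simp
      also have "\<dots> = (LINT t|?M. - \<i> * (c' t * fourier n (k - j) t))" by (simp add: mult.assoc)
      also have "\<dots> = - \<i> * I2" unfolding I2_def by (rule integral_mult_right_zero)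
      finally show ?thesis .
    qed
    ultimately have "ip ?H V (circle_basis n j) = complex_of_real (2 ^ n * (of_int k + 1 / 2)) * I1 + - \<i> * I2"
      unfolding V_def using W W' e by (simp add: L2.ip_add_left L2.ip_smult_left)
    \<comment> \<open>The second term equals -2^n (k - j) times \<open>I1\<close>, which turns the
      eigenvalue of index \<open>k\<close> into that of index \<open>j\<close>.\<close>
    also have "\<dots> = complex_of_real (2 ^ n * (of_int j + 1 / 2)) * I1"
    proof -
      have "- \<i> * I2 = - (2 ^ n * of_int (k - j) * I1)" unfolding parts by (simp add: mult.assoc del: of_int_diff)
      thus ?thesis by (simp only:) (simp add: algebra_simps)
    qed
    finally show ?thesis using \<open>ip ?H W (circle_basis n j) = I1\<close> by simp
  qed
  have Wdom: "W \<in> dom (circle_dirac n)"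
    using coef_summable[OF V] W key by (simp add: dom_D)
  show "W \<in> dom (circle_dirac n)" by (rule Wdom)
  have "the (circle_dirac n W) = V"
    by (rule coef_eqI[OF D_in[OF Wdom] V]) (simp only: coef_D[OF Wdom] key)
  thus "the (circle_dirac n W) = complex_of_real (2 ^ n * (of_int k + 1 / 2)) \<odot>\<^bsub>?H\<^esub> W
      \<oplus>\<^bsub>?H\<^esub> mult_op ?M (\<lambda>t. - \<i> * c' t) (circle_basis n k)"
    by (simp only: V_def)
qed

text \<open>The Leibniz rule \<open>D g - g D = -i g'\<close> holds on the domain of \<open>D\<close>: testing against the basis reduces it
  to the previous lemma for \<open>cnj g\<close>, by symmetry of \<open>D\<close>.\<close>

lemma circle_dirac_commutator:
  fixes g g' :: "real \<Rightarrow> complex"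
  assumes cont: "continuous_on {- (pi / 2 ^ n)..pi / 2 ^ n} g" and per: "g (- (pi / 2 ^ n)) = g (pi / 2 ^ n)"
    and F: "finite F" and g': "\<And>t. t \<in> {- (pi / 2 ^ n)<..<pi / 2 ^ n} - F \<Longrightarrow> (g has_vector_derivative g' t) (at t)"
    and meas: "g \<in> borel_measurable borel" "g' \<in> borel_measurable borel"
    and B: "\<And>t. cmod (g t) \<le> B" "\<And>t. cmod (g' t) \<le> B'"
    and X: "X \<in> dom (circle_dirac n)"
  shows "mult_op (circle_measure n) g X \<in> dom (circle_dirac n)"
    and "the (circle_dirac n (mult_op (circle_measure n) g X)) = mult_op (circle_measure n) g (the (circle_dirac n X))
      \<oplus>\<^bsub>L2 (circle_measure n)\<^esub> mult_op (circle_measure n) (\<lambda>t. - \<i> * g' t) X"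
proof -
  let ?M = "circle_measure n" and ?D = "circle_dirac n"
  let ?H = "L2 ?M"
  interpret diagonal_operator ?H UNIV "circle_basis n" ?D "\<lambda>k. 2 ^ n * (of_int k + 1 / 2)"
    by (rule diagonal_operator_circle_dirac)
  note [measurable] = meas
  define c c' where c_def: "c = (\<lambda>t. cnj (g t))" and c'_def: "c' = (\<lambda>t. cnj (g' t))"
  have e: "circle_basis n j \<in> carrier ?H" for j by (rule e_in) simp
  have Xc: "X \<in> carrier ?H" using X by (rule dom_in)
  have gM: "g \<in> borel_measurable ?M" using meas by simp
  have ig: "(\<lambda>t. - \<i> * g' t) \<in> borel_measurable ?M" "\<And>t. cmod (- \<i> * g' t) \<le> B'"
    using B(2) by (auto simp: norm_mult)
  let ?T = "mult_op ?M g"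
  define Y where "Y = ?T (the (?D X)) \<oplus>\<^bsub>?H\<^esub> mult_op ?M (\<lambda>t. - \<i> * g' t) X"
  have TX: "?T X \<in> carrier ?H" by (rule mult_op_in[OF gM B(1) Xc])
  have TDX: "?T (the (?D X)) \<in> carrier ?H" by (rule mult_op_in[OF gM B(1) D_in[OF X]])
  have BX: "mult_op ?M (\<lambda>t. - \<i> * g' t) X \<in> carrier ?H" by (rule mult_op_in[OF ig Xc])
  have Y: "Y \<in> carrier ?H" unfolding Y_def using TDX BX by auto
  have key: "ip ?H Y (circle_basis n k) = complex_of_real (2 ^ n * (of_int k + 1 / 2)) * ip ?H (?T X) (circle_basis n k)" for k
  proof -
    let ?W = "mult_op ?M c (circle_basis n k)" and ?\<mu> = "2 ^ n * (of_int k + 1 / 2) :: real"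
    have c: "c \<in> borel_measurable borel" "c' \<in> borel_measurable borel" "\<And>t. cmod (c t) \<le> B" "\<And>t. cmod (c' t) \<le> B'"
      using B by (auto simp: c_def c'_def)
    have W: "?W \<in> dom ?D" "the (?D ?W) = complex_of_real ?\<mu> \<odot>\<^bsub>?H\<^esub> ?W
        \<oplus>\<^bsub>?H\<^esub> mult_op ?M (\<lambda>t. - \<i> * c' t) (circle_basis n k)"
    proof (rule_tac [!] circle_dirac_mult_basis[OF _ _ F _ c])
      show "continuous_on {- (pi / 2 ^ n)..pi / 2 ^ n} c" unfolding c_def by (intro continuous_intros cont)
      show "c (- (pi / 2 ^ n)) = c (pi / 2 ^ n)" by (simp add: c_def per)
      show "(c has_vector_derivative c' t) (at t)" if "t \<in> {- (pi / 2 ^ n)<..<pi / 2 ^ n} - F" for t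
        unfolding c_def c'_def by (rule has_vector_derivative_cnj[OF g'[OF that]])
      thus "(c has_vector_derivative c' t) (at t)" if "t \<in> {- (pi / 2 ^ n)<..<pi / 2 ^ n} - F" for t using that .
      show "continuous_on {- (pi / 2 ^ n)..pi / 2 ^ n} c" unfolding c_def by (intro continuous_intros cont)
      show "c (- (pi / 2 ^ n)) = c (pi / 2 ^ n)" by (simp add: c_def per)
    qed
    have Wc: "?W \<in> carrier ?H" "mult_op ?M (\<lambda>t. - \<i> * c' t) (circle_basis n k) \<in> carrier ?H"
      using dom_in[OF W(1)] mult_op_in[of "\<lambda>t. - \<i> * c' t" ?M B' "circle_basis n k"] c e by (auto simp: norm_mult)
    have 1: "ip ?H (the (?D X)) ?W = ip ?H (?T (the (?D X))) (circle_basis n k)"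
      using mult_op_adjoint[OF gM B(1) D_in[OF X] e] by (simp add: c_def)
    have 2: "ip ?H X ?W = ip ?H (?T X) (circle_basis n k)"
      using mult_op_adjoint[OF gM B(1) Xc e] by (simp add: c_def)
    \<comment> \<open>Passing to the adjoint conjugates the factor -i, so this term acquires the
      opposite sign and cancels the multiplication by -i g' that is part of
      \<open>Y\<close>.\<close>
    have 3: "ip ?H X (mult_op ?M (\<lambda>t. - \<i> * c' t) (circle_basis n k)) = - ip ?H (mult_op ?M (\<lambda>t. - \<i> * g' t) X) (circle_basis n k)"
    proof -
      have "mult_op ?M (\<lambda>t. cnj (- \<i> * g' t)) (circle_basis n k) = mult_op ?M (\<lambda>t. (- 1) * (- \<i> * c' t)) (circle_basis n k)"
        by (rule mult_op_cong) (simp add: c'_def)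
      also have "\<dots> = (- 1) \<odot>\<^bsub>?H\<^esub> mult_op ?M (\<lambda>t. - \<i> * c' t) (circle_basis n k)"
        using c e by (intro mult_op_cmult[of _ _ B']) (auto simp: norm_mult)
      finally show ?thesis
        using mult_op_adjoint[OF ig Xc e] Wc Xc by (simp add: L2.ip_smult_right)
    qed
    have "ip ?H (?T (the (?D X))) (circle_basis n k) = ip ?H X (the (?D ?W))"
      unfolding 1[symmetric] by (rule symmetric_D[OF X W(1)])
    also have "\<dots> = complex_of_real ?\<mu> * ip ?H (?T X) (circle_basis n k) - ip ?H (mult_op ?M (\<lambda>t. - \<i> * g' t) X) (circle_basis n k)"
    proof -
      have "ip ?H X (complex_of_real r \<odot>\<^bsub>?H\<^esub> A \<oplus>\<^bsub>?H\<^esub> A') = complex_of_real r * ip ?H X A + ip ?H X A'"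
        if "A \<in> carrier ?H" "A' \<in> carrier ?H" for r A A'
        using that Xc by (simp add: L2.ip_add_right L2.ip_smult_right)
      from this[OF Wc, of ?\<mu>] show ?thesis unfolding W(2) 2 3 by simp
    qed
    finally show ?thesis unfolding Y_def using TDX BX e by (simp add: L2.ip_add_left)
  qed
  have dom: "?T X \<in> dom ?D"
    using coef_summable[OF Y] TX key by (simp add: dom_D)
  show "?T X \<in> dom ?D" by (rule dom)
  have "the (?D (?T X)) = Y"
    by (rule coef_eqI[OF D_in[OF dom] Y]) (simp only: coef_D[OF dom] key)
  thus "the (?D (?T X)) = ?T (the (?D X)) \<oplus>\<^bsub>?H\<^esub> mult_op ?M (\<lambda>t. - \<i> * g' t) X"
    by (simp only: Y_def)
qed

section \<open>Parameterization of the triangles\<close>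

context gasket
begin

context
  notes One_nat_def [simp del]
begin

text \<open>The unit tangent vector of \<open>triangle_param\<close>; at a corner, where there is
  none, it is one of the two adjacent directions.\<close>

definition edge_direction :: "nat list \<Rightarrow> real \<Rightarrow> real^2" where
  "edge_direction w t = (let L = side / 2 ^ length w; u = t rmod (3 * L) in
    if u \<le> L then (1 / side) *\<^sub>R (v 3 - v 2)
    else if u \<le> 2 * L then (1 / side) *\<^sub>R (v 1 - v 3)
    else (1 / side) *\<^sub>R (v 2 - v 1))"

lemma triangle_param_side:
  "triangle_param v w t = (let L = side / 2 ^ length w; u = t rmod (3 * L); P = (\<lambda>j. word_map v w (v j)) in
      if u \<le> L then linepath (P 2) (P 3) (u / L)
      else if u \<le> 2 * L then linepath (P 3) (P 1) (u / L - 1)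
      else linepath (P 1) (P 2) (u / L - 2))"
  by (simp add: triangle_param_def side_def Let_def)

lemma word_map_linepath: "linepath (word_map v w a) (word_map v w b) s = word_map v w (linepath a b s)"
proof -
  have "word_map v w (linepath a b s) = word_map v w a + (1 / 2 ^ length w) *\<^sub>R (linepath a b s - a)"
    using word_map_diff[of v w "linepath a b s" a] by (simp add: algebra_simps)
  also have "\<dots> = word_map v w a + s *\<^sub>R (word_map v w b - word_map v w a)"
    unfolding word_map_diff by (simp add: linepath_def algebra_simps)
  finally show ?thesis by (simp add: linepath_def algebra_simps)
qed

lemma triangle_param_in: "triangle_param v w t \<in> triangle v w"
proof -
  define L where "L = side / 2 ^ length w"
  have L: "L > 0" using side_pos by (simp add: L_def)
  define u where "u = t rmod (3 * L)"
  have u: "0 \<le> u" "u < 3 * L" using rmod_nonneg[of "3 * L" t] rmod_less[of "3 * L" t] L by (auto simp: u_def)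
  have lp: "linepath (v i) (v j) s \<in> closed_segment (v i) (v j)" if "0 \<le> s" "s \<le> 1" for s i j
    using that by (simp add: linepath_in_path)
  have "\<exists>x\<in>SG0 v. triangle_param v w t = word_map v w x"
  proof (cases "u \<le> L")
    case True
    hence "linepath (v 2) (v 3) (u / L) \<in> SG0 v" using lp[of "u / L" 2 3] u L by (simp add: SG0_def)
    thus ?thesis using True
      by (intro bexI[of _ "linepath (v 2) (v 3) (u / L)"])
         (simp_all add: triangle_param_side L_def[symmetric] u_def[symmetric] word_map_linepath)
  next
    case F1: False
    show ?thesis
    proof (cases "u \<le> 2 * L")
      case True
      hence "linepath (v 3) (v 1) (u / L - 1) \<in> SG0 v"
        using lp[of "u / L - 1" 3 1] F1 L by (simp add: SG0_def field_simps)
      thus ?thesis using True F1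
        by (intro bexI[of _ "linepath (v 3) (v 1) (u / L - 1)"])
           (simp_all add: triangle_param_side L_def[symmetric] u_def[symmetric] word_map_linepath)
    next
      case False
      hence "linepath (v 1) (v 2) (u / L - 2) \<in> SG0 v"
        using lp[of "u / L - 2" 1 2] u L by (simp add: SG0_def field_simps)
      thus ?thesis using False F1
        by (intro bexI[of _ "linepath (v 1) (v 2) (u / L - 2)"])
           (simp_all add: triangle_param_side L_def[symmetric] u_def[symmetric] word_map_linepath)
    qed
  qed
  thus ?thesis by (auto simp: triangle_def)
qed

lemma triangle_param_in_SG: "w \<in> words n \<Longrightarrow> triangle_param v w t \<in> SG v"
  using triangle_param_in triangle_subset_SG by blast

lemma rmod_measurable [measurable]: "(\<lambda>t::real. t rmod m) \<in> borel_measurable borel"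
  unfolding rmod_def by measurable

lemma triangle_param_measurable [measurable]: "triangle_param v w \<in> borel_measurable borel"
proof -
  have lp: "(\<lambda>t. linepath a b (f t)) \<in> borel_measurable borel" if [measurable]: "f \<in> borel_measurable borel"
    for a b :: "real^2" and f :: "real \<Rightarrow> real"
    unfolding linepath_def by measurable
  have "(\<lambda>t. triangle_param v w t) \<in> borel_measurable borel"
    unfolding triangle_param_side Let_def by (intro measurable_If lp) measurable
  thus ?thesis .
qed

text \<open>On a period around 0 the parameterization is affine on the four intervals cut out by \<open>-L\<close>, \<open>0\<close>, \<open>L\<close>,
  where \<open>L\<close> is the side length; the points \<open>-3L/2\<close> and \<open>3L/2\<close> are the same midpoint of a side.\<close>

context
  fixes w :: "nat list" and L a :: real
  defines "L \<equiv> side / 2 ^ length w" and "a \<equiv> pi / 2 ^ length w"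
begin

lemma a_eq: "a = 3 * L / 2"
  by (simp add: a_def L_def side_def)

lemma L_pos: "L > 0"
  using side_pos by (simp add: L_def)

lemma rmod_period:
  "\<lbrakk>0 \<le> t; t < 3 * L\<rbrakk> \<Longrightarrow> t rmod (3 * L) = t" "\<lbrakk>- (3 * L) \<le> t; t < 0\<rbrakk> \<Longrightarrow> t rmod (3 * L) = t + 3 * L"
proof -
  show "\<lbrakk>0 \<le> t; t < 3 * L\<rbrakk> \<Longrightarrow> t rmod (3 * L) = t" using L_pos by (intro rmod_idem) auto
  assume t: "- (3 * L) \<le> t" "t < 0"
  have "\<lfloor>t / (3 * L)\<rfloor> = -1" using t L_pos by (intro floor_unique) (auto simp: field_simps)
  thus "t rmod (3 * L) = t + 3 * L" using L_pos by (simp add: rmod_def)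
qed

text \<open>The intervals are closed and overlap in their end points, where two formulas hold at
  once; this is what gluing on closed sets needs for continuity. At \<open>t = 0\<close> and
  \<open>t = \<plusminus>L\<close> the definition selects only one of the adjacent branches, hence
  the separate cases.\<close>

lemma triangle_param_pieces:
  "t \<in> {-a..-L} \<Longrightarrow> triangle_param v w t = linepath (word_map v w (v 3)) (word_map v w (v 1)) (t / L + 2)"
  "t \<in> {-L..0} \<Longrightarrow> triangle_param v w t = linepath (word_map v w (v 1)) (word_map v w (v 2)) (t / L + 1)"
  "t \<in> {0..L} \<Longrightarrow> triangle_param v w t = linepath (word_map v w (v 2)) (word_map v w (v 3)) (t / L)"
  "t \<in> {L..a} \<Longrightarrow> triangle_param v w t = linepath (word_map v w (v 3)) (word_map v w (v 1)) (t / L - 1)"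
proof -
  have e: "(t + 3 * L) / L = t / L + 3" using L_pos by (simp add: add_divide_distrib)
  show "triangle_param v w t = linepath (word_map v w (v 3)) (word_map v w (v 1)) (t / L + 2)" if "t \<in> {-a..-L}"
  proof -
    have "t rmod (3 * L) = t + 3 * L" using that a_eq L_pos by (intro rmod_period) auto
    thus ?thesis using that a_eq L_pos e by (simp add: triangle_param_side L_def[symmetric] add.commute)
  qed
  show "triangle_param v w t = linepath (word_map v w (v 1)) (word_map v w (v 2)) (t / L + 1)" if "t \<in> {-L..0}"
  proof (cases "t = 0")
    case True
    thus ?thesis using rmod_period(1)[of 0] L_pos
      by (simp add: triangle_param_side L_def[symmetric] linepath_def)
  next
    case False
    hence u: "t rmod (3 * L) = t + 3 * L" using that L_pos by (intro rmod_period) auto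
    show ?thesis
    proof (cases "t = - L")
      case True
      thus ?thesis using u L_pos by (simp add: triangle_param_side L_def[symmetric] linepath_def)
    qed (use that u e L_pos in \<open>simp add: triangle_param_side L_def[symmetric] add.commute\<close>)
  qed
  show "triangle_param v w t = linepath (word_map v w (v 2)) (word_map v w (v 3)) (t / L)" if "t \<in> {0..L}"
  proof -
    have u: "t rmod (3 * L) = t" using that L_pos by (intro rmod_period) auto
    show ?thesis unfolding triangle_param_side L_def[symmetric] Let_def u using that by simp
  qed
  show "triangle_param v w t = linepath (word_map v w (v 3)) (word_map v w (v 1)) (t / L - 1)" if "t \<in> {L..a}"
  proof -
    have u: "t rmod (3 * L) = t" using that a_eq L_pos by (intro rmod_period) auto
    have le: "t \<le> 2 * L" "L \<le> t" using that a_eq L_pos by auto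
    show ?thesis
    proof (cases "t = L")
      case True
      have "L \<noteq> 0" using L_pos by simp
      thus ?thesis unfolding triangle_param_side L_def[symmetric] Let_def u using True by (simp add: linepath_def)
    next
      case False
      hence "\<not> t \<le> L" using le by linarith
      thus ?thesis unfolding triangle_param_side L_def[symmetric] Let_def u using le by simp
    qed
  qed
qed

lemma continuous_triangle_param: "continuous_on {-a..a} (triangle_param v w)"
proof -
  have lp: "continuous_on S (\<lambda>t. linepath p q (f t))" if "continuous_on S f" for p q :: "real^2" and f :: "real \<Rightarrow> real" and S
    unfolding linepath_def by (intro continuous_intros that)
  have 1: "continuous_on {-a..-L} (triangle_param v w)"
    by (subst continuous_on_cong[OF refl triangle_param_pieces(1)]) (assumption, intro lp continuous_intros, use L_pos in simp)
  have 2: "continuous_on {-L..0} (triangle_param v w)"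
    by (subst continuous_on_cong[OF refl triangle_param_pieces(2)]) (assumption, intro lp continuous_intros, use L_pos in simp)
  have 3: "continuous_on {0..L} (triangle_param v w)"
    by (subst continuous_on_cong[OF refl triangle_param_pieces(3)]) (assumption, intro lp continuous_intros, use L_pos in simp)
  have 4: "continuous_on {L..a} (triangle_param v w)"
    by (subst continuous_on_cong[OF refl triangle_param_pieces(4)]) (assumption, intro lp continuous_intros, use L_pos in simp)
  have eq: "{-a..a} = (({-a..-L} \<union> {-L..0}) \<union> {0..L}) \<union> {L..a}" using a_eq L_pos by auto
  show ?thesis unfolding eq
    by (intro continuous_on_closed_Un closed_Un closed_atLeastAtMost 1 2 3 4)
qed

lemma triangle_param_ends: "triangle_param v w (-a) = triangle_param v w a"
proof -
  have eq: "(-a) / L + 2 = a / L - 1" using a_eq L_pos by (simp add: field_simps)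
  have 1: "triangle_param v w (-a) = linepath (word_map v w (v 3)) (word_map v w (v 1)) ((-a) / L + 2)"
    by (rule triangle_param_pieces) (use a_eq L_pos in auto)
  have 2: "triangle_param v w a = linepath (word_map v w (v 3)) (word_map v w (v 1)) (a / L - 1)"
    by (rule triangle_param_pieces) (use a_eq L_pos in auto)
  show ?thesis unfolding 1 2 eq ..
qed

text \<open>The word map contracts by 2^(-length w), and a side is traversed in time L = side /
  2^(length w); the two factors cancel. The velocity is the same at every level, which makes the
  commutator bound uniform over all triangles.\<close>

lemma linepath_word_map_derivative:
  "((\<lambda>t. linepath (word_map v w p) (word_map v w q) (t / L + b)) has_vector_derivative (1 / side) *\<^sub>R (q - p)) (at t)"
proof -
  have "(\<lambda>t. linepath (word_map v w p) (word_map v w q) (t / L + b))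
    = (\<lambda>t. word_map v w p + (t / L + b) *\<^sub>R (word_map v w q - word_map v w p))"
    by (auto simp: linepath_def algebra_simps)
  moreover have "((\<lambda>t. word_map v w p + (t / L + b) *\<^sub>R (word_map v w q - word_map v w p)) has_vector_derivative
      (1 / L) *\<^sub>R (word_map v w q - word_map v w p)) (at t)"
  proof -
    have d: "((\<lambda>t. t / L + b) has_real_derivative 1 / L) (at t)"
      using L_pos by (auto intro!: derivative_eq_intros)
    have "((\<lambda>t. (t / L + b) *\<^sub>R (word_map v w q - word_map v w p)) has_vector_derivative
        (t / L + b) *\<^sub>R 0 + (1 / L) *\<^sub>R (word_map v w q - word_map v w p)) (at t)"
      by (rule has_vector_derivative_scaleR[OF d has_vector_derivative_const])
    from has_vector_derivative_add[OF has_vector_derivative_const this]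
    show ?thesis by simp
  qed
  moreover have "(1 / L) *\<^sub>R (word_map v w q - word_map v w p) = (1 / side) *\<^sub>R (q - p)"
    using side_pos by (simp add: word_map_diff L_def)
  ultimately show ?thesis by simp
qed

lemma triangle_param_derivative:
  assumes t: "t \<in> {-a<..<a} - {-L, 0, L}"
  shows "(triangle_param v w has_vector_derivative edge_direction w t) (at t)"
proof -
  have piece: "(triangle_param v w has_vector_derivative (1 / side) *\<^sub>R (q - p)) (at t)"
    if "t \<in> {c<..<d}" "\<And>s. s \<in> {c..d} \<Longrightarrow> triangle_param v w s = linepath (word_map v w p) (word_map v w q) (s / L + b)"
    for c d p q b
    by (rule has_vector_derivative_transform_within_open[OF linepath_word_map_derivative[of p q b], where S = "{c<..<d}"])
       (use that in auto)
  consider "t \<in> {-a<..<-L}" | "t \<in> {-L<..<0}" | "t \<in> {0<..<L}" | "t \<in> {L<..<a}"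
    using t by (auto simp: greaterThanLessThan_iff) linarith+
  thus ?thesis
  proof cases
    case 1
    hence u: "t rmod (3 * L) = t + 3 * L" using a_eq L_pos by (intro rmod_period) auto
    hence "edge_direction w t = (1 / side) *\<^sub>R (v 1 - v 3)" using 1 a_eq L_pos
      by (simp add: edge_direction_def L_def[symmetric])
    thus ?thesis using piece[OF 1 triangle_param_pieces(1)] by simp
  next
    case 2
    hence u: "t rmod (3 * L) = t + 3 * L" using L_pos by (intro rmod_period) auto
    hence "edge_direction w t = (1 / side) *\<^sub>R (v 2 - v 1)" using 2 L_pos
      by (simp add: edge_direction_def L_def[symmetric])
    thus ?thesis using piece[OF 2 triangle_param_pieces(2)] by simp
  next
    case 3
    hence u: "t rmod (3 * L) = t" using L_pos by (intro rmod_period) auto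
    hence "edge_direction w t = (1 / side) *\<^sub>R (v 3 - v 2)" using 3 L_pos
      by (simp add: edge_direction_def L_def[symmetric])
    thus ?thesis using piece[OF 3, of "v 2" "v 3" 0] triangle_param_pieces(3) by simp
  next
    case 4
    hence u: "t rmod (3 * L) = t" using a_eq L_pos by (intro rmod_period) auto
    hence "edge_direction w t = (1 / side) *\<^sub>R (v 1 - v 3)" using 4 a_eq L_pos
      by (simp add: edge_direction_def L_def[symmetric])
    thus ?thesis using piece[OF 4, of "v 3" "v 1" "-1"] triangle_param_pieces(4) by simp
  qed
qed

end

text \<open>\<open>f\<close> is continuous only on the gasket, so its measurability is taken on the
  Borel space restricted to the gasket, where the parameterization has its values.\<close>

lemma continuous_comp_param_measurable:
  fixes f :: "real^2 \<Rightarrow> complex"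
  assumes f: "continuous_on (SG v) f" and w: "w \<in> words n"
  shows "(\<lambda>t. f (triangle_param v w t)) \<in> borel_measurable borel"
proof (rule measurable_compose[of "triangle_param v w" borel "restrict_space borel (SG v)"])
  show "triangle_param v w \<in> borel \<rightarrow>\<^sub>M restrict_space borel (SG v)"
    by (rule measurable_restrict_space2) (use triangle_param_in_SG[OF w] in auto)
  show "f \<in> borel_measurable (restrict_space borel (SG v))"
    using f by (rule borel_measurable_continuous_on_restrict)
qed

end

end

text \<open>Continuity in \<open>x\<close> is claimed for each fixed direction \<open>h\<close>,
  since it makes the derivative in that direction bounded on compact sets and only three directions
  occur.\<close>

lemma real_polynomial_function_derivative:
  fixes p :: "'a::real_normed_vector \<Rightarrow> real"
  assumes "real_polynomial_function p"
  shows "\<exists>D. (\<forall>x. (p has_derivative D x) (at x)) \<and> (\<forall>h. continuous_on UNIV (\<lambda>x. D x h))"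
  using assms
proof (induction rule: real_polynomial_function.induct)
  case (linear p)
  thus ?case by (intro exI[of _ "\<lambda>x. p"]) (auto simp: bounded_linear_imp_has_derivative)
next
  case (const c)
  show ?case by (intro exI[of _ "\<lambda>x h. 0"]) auto
next
  case (add p q)
  then obtain D E where "\<And>x. (p has_derivative D x) (at x)" "\<And>h. continuous_on UNIV (\<lambda>x. D x h)"
    "\<And>x. (q has_derivative E x) (at x)" "\<And>h. continuous_on UNIV (\<lambda>x. E x h)" by blast
  thus ?case by (intro exI[of _ "\<lambda>x h. D x h + E x h"]) (auto intro!: derivative_intros continuous_intros)
next
  case (mult p q)
  then obtain D E where DE: "\<And>x. (p has_derivative D x) (at x)" "\<And>h. continuous_on UNIV (\<lambda>x. D x h)"
    "\<And>x. (q has_derivative E x) (at x)" "\<And>h. continuous_on UNIV (\<lambda>x. E x h)" by blast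
  have "continuous_on UNIV p" "continuous_on UNIV q"
    using has_derivative_continuous[OF DE(1)] has_derivative_continuous[OF DE(3)]
    by (auto simp: continuous_on_eq_continuous_at)
  thus ?case using DE
    by (intro exI[of _ "\<lambda>x h. p x * E x h + D x h * q x"]) (auto intro!: has_derivative_mult continuous_intros)
qed

lemma polynomial_function_derivative:
  fixes p :: "'a::real_normed_vector \<Rightarrow> complex"
  assumes "polynomial_function p"
  obtains D where "\<And>x. (p has_derivative D x) (at x)" "\<And>h. continuous_on UNIV (\<lambda>x. D x h)"
proof -
  have "real_polynomial_function (Re \<circ> p)" "real_polynomial_function (Im \<circ> p)"
    using assms bounded_linear_Re bounded_linear_Im by (auto simp: polynomial_function_def)
  then obtain D E where DE: "\<And>x. ((Re \<circ> p) has_derivative D x) (at x)" "\<And>h. continuous_on UNIV (\<lambda>x. D x h)"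
    "\<And>x. ((Im \<circ> p) has_derivative E x) (at x)" "\<And>h. continuous_on UNIV (\<lambda>x. E x h)"
    using real_polynomial_function_derivative by metis
  have "p = (\<lambda>x. complex_of_real ((Re \<circ> p) x) + \<i> * complex_of_real ((Im \<circ> p) x))"
    by (simp add: fun_eq_iff complex_eq_iff)
  moreover have "((\<lambda>x. complex_of_real ((Re \<circ> p) x) + \<i> * complex_of_real ((Im \<circ> p) x)) has_derivative
      (\<lambda>h. complex_of_real (D x h) + \<i> * complex_of_real (E x h))) (at x)" for x
    by (intro has_derivative_add has_derivative_mult_right has_derivative_of_real DE)
  ultimately have der: "(p has_derivative (\<lambda>h. complex_of_real (D x h) + \<i> * complex_of_real (E x h))) (at x)" for x
    by simp
  have "continuous_on UNIV (\<lambda>x. complex_of_real (D x h) + \<i> * complex_of_real (E x h))" for h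
    by (intro continuous_intros DE)
  thus ?thesis by (rule that[OF der])
qed

section \<open>The direct sum over all triangles\<close>

text \<open>The constant \<open>C\<close> common to all summands keeps the image square summable;
  boundedness of each summand separately would not suffice.\<close>

lemma (in direct_sum_of_hilbert_spaces) bounded_op_componentwise:
  assumes T: "\<And>i. i \<in> I \<Longrightarrow> bounded_op (H i) (T i)"
    and le: "\<And>i x. \<lbrakk>i \<in> I; x \<in> carrier (H i)\<rbrakk> \<Longrightarrow> hnorm (H i) (T i x) \<le> C * hnorm (H i) x" and C: "C \<ge> 0"
  shows "bounded_op S (\<lambda>x. \<lambda>i\<in>I. T i (x i))"
proof -
  have T_in: "T i x \<in> carrier (H i)" if "i \<in> I" "x \<in> carrier (H i)" for i x
    using T[OF that(1)] that(2) by (auto simp: bounded_op_def)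
  have T_add: "T i (x \<oplus>\<^bsub>H i\<^esub> y) = T i x \<oplus>\<^bsub>H i\<^esub> T i y" if "i \<in> I" "x \<in> carrier (H i)" "y \<in> carrier (H i)" for i x y
    using T[OF that(1)] that(2,3) by (simp add: bounded_op_def)
  have T_smult: "T i (c \<odot>\<^bsub>H i\<^esub> x) = c \<odot>\<^bsub>H i\<^esub> T i x" if "i \<in> I" "x \<in> carrier (H i)" for i c x
    using T[OF that(1)] that(2) by (simp add: bounded_op_def)
  have in_S: "(\<lambda>i\<in>I. T i (x i)) \<in> carrier S" if "x \<in> carrier S" for x
    by (rule bounded_image_in[OF that, of _ C]) (use that comp_in T_in le in auto)
  have "hnorm S (\<lambda>i\<in>I. T i (x i)) \<le> C * hnorm S x" if "x \<in> carrier S" for x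
    by (rule hnorm_le_of_comp_le[OF that in_S[OF that] C]) (use that comp_in le in auto)
  moreover have "(\<lambda>i\<in>I. T i ((x \<oplus>\<^bsub>S\<^esub> y) i)) = (\<lambda>i\<in>I. T i (x i)) \<oplus>\<^bsub>S\<^esub> (\<lambda>i\<in>I. T i (y i))"
    if "x \<in> carrier S" "y \<in> carrier S" for x y
    unfolding ops by (rule restrict_ext) (use that comp_in T_add in auto)
  moreover have "(\<lambda>i\<in>I. T i ((c \<odot>\<^bsub>S\<^esub> x) i)) = c \<odot>\<^bsub>S\<^esub> (\<lambda>i\<in>I. T i (x i))" if "x \<in> carrier S" for c x
    unfolding ops by (rule restrict_ext) (use that comp_in T_smult in auto)
  ultimately show ?thesis unfolding bounded_op_def by (intro conjI ballI allI Pi_I exI[of _ C] in_S)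
qed

locale gasket_triple = gasket +
  fixes \<nu> :: "nat \<Rightarrow> nat \<Rightarrow> nat list"
  assumes numbering: "triangle_numbering \<nu>"
begin

definition I :: "(nat \<times> nat) set" where "I = (SIGMA n:UNIV. {1..3 ^ n})"

definition word :: "nat \<times> nat \<Rightarrow> nat list" where "word = (\<lambda>(n, i). \<nu> n i)"

text \<open>The length of the word, as in \<open>ST_triangle\<close>, so that the direct sum unfolds
  for arbitrary pairs; on \<open>I\<close> it coincides with \<open>fst p\<close>.\<close>

abbreviation lev :: "nat \<times> nat \<Rightarrow> nat" where "lev p \<equiv> length (word p)"

abbreviation param :: "nat \<times> nat \<Rightarrow> real \<Rightarrow> real^2" where "param p \<equiv> triangle_param v (word p)"

abbreviation "H \<equiv> \<lambda>p. L2 (circle_measure (lev p))"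

abbreviation "dirac \<equiv> direct_sum_op I H (\<lambda>p. circle_dirac (lev p))"

definition rep :: "(real^2 \<Rightarrow> complex) \<Rightarrow> (nat \<times> nat \<Rightarrow> (real \<Rightarrow> complex) set) \<Rightarrow> nat \<times> nat \<Rightarrow> (real \<Rightarrow> complex) set" where
  "rep a x = (\<lambda>p\<in>I. mult_op (circle_measure (lev p)) (\<lambda>t. a (param p t)) (x p))"

lemma ST_SG_simps: "fspace (ST_SG v \<nu>) = direct_sum_space I H" "frep (ST_SG v \<nu>) = rep" "fdirac (ST_SG v \<nu>) = dirac"
proof -
  have "(\<lambda>(n, i). ST_triangle v (\<nu> n i)) = (\<lambda>p. ST_triangle v (word p))"
    by (simp add: word_def case_prod_unfold)
  hence "ST_SG v \<nu> = direct_sum I (\<lambda>p. ST_triangle v (word p))"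
    unfolding ST_SG_def I_def by (rule arg_cong)
  thus "fspace (ST_SG v \<nu>) = direct_sum_space I H" "frep (ST_SG v \<nu>) = rep" "fdirac (ST_SG v \<nu>) = dirac"
    by (simp_all add: direct_sum_def ST_triangle_def Let_def rep_def[abs_def] mult_op_def[abs_def])
qed

lemma word_in: "p \<in> I \<Longrightarrow> word p \<in> words (fst p)"
proof -
  assume "p \<in> I"
  hence "snd p \<in> {1..3 ^ fst p}" "word p = \<nu> (fst p) (snd p)" by (auto simp: I_def word_def)
  thus "word p \<in> words (fst p)" using numbering by (metis triangle_numbering_def bij_betwE)
qed

lemma lev_eq: "p \<in> I \<Longrightarrow> lev p = fst p"
  using word_in by (simp add: words_def)

lemma word_surj:
  assumes "w \<in> words n"
  shows "\<exists>p\<in>I. word p = w"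
proof -
  have "\<nu> n ` {1..3 ^ n} = words n" using numbering by (simp add: triangle_numbering_def bij_betw_def)
  then obtain i where "i \<in> {1..3 ^ n}" "\<nu> n i = w" using assms by (metis imageE)
  thus ?thesis by (intro bexI[of _ "(n, i)"]) (simp_all add: I_def word_def)
qed

lemma param_in_SG: "p \<in> I \<Longrightarrow> param p t \<in> SG v"
  using triangle_param_in_SG[OF word_in] .

sublocale ds: direct_sum_of_diagonal_operators I H "\<lambda>p. UNIV" "\<lambda>p. circle_basis (lev p)" "\<lambda>p. circle_dirac (lev p)"
  "\<lambda>p k. 2 ^ lev p * (of_int k + 1 / 2)"
  by (rule direct_sum_of_diagonal_operators.intro) (rule diagonal_operator_circle_dirac)

sublocale dirac: diagonal_operator "direct_sum_space I H" "Sigma I (\<lambda>p. UNIV)" ds.sum_basis dirac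
  "\<lambda>(p, k). 2 ^ lev p * (of_int k + 1 / 2)"
  by (rule ds.diagonal_operator_S)

lemma rep_symbol:
  assumes a: "a \<in> carrier (C_alg (SG v))" and p: "p \<in> I"
  shows "(\<lambda>t. a (param p t)) \<in> borel_measurable (circle_measure (lev p))"
    and "\<And>t. cmod (a (param p t)) \<le> anorm (C_alg (SG v)) a"
proof -
  have "continuous_on (SG v) a" using a by (simp add: C_alg_simps)
  thus "(\<lambda>t. a (param p t)) \<in> borel_measurable (circle_measure (lev p))"
    unfolding measurable_circle by (rule continuous_comp_param_measurable[OF _ word_in[OF p]])
  show "cmod (a (param p t)) \<le> anorm (C_alg (SG v)) a" for t
    by (rule anorm_upper[OF compact_SG SG_nonempty a param_in_SG[OF p]])
qed

lemma bounded_op_rep: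
  assumes a: "a \<in> carrier (C_alg (SG v))"
  shows "bounded_op ds.S (rep a)"
proof -
  have "bounded_op ds.S (\<lambda>x. \<lambda>p\<in>I. mult_op (circle_measure (lev p)) (\<lambda>t. a (param p t)) (x p))"
    by (rule ds.bounded_op_componentwise[OF bounded_op_mult_op[OF rep_symbol[OF a]] hnorm_mult_op[OF rep_symbol[OF a]]
          anorm_C_alg_nonneg[OF compact_SG SG_nonempty a]])
  thus ?thesis by (simp add: rep_def[abs_def])
qed

lemma rep_in: "\<lbrakk>a \<in> carrier (C_alg (SG v)); x \<in> carrier ds.S\<rbrakk> \<Longrightarrow> rep a x \<in> carrier ds.S"
  by (rule funcset_mem[OF conjunct1[OF bounded_op_rep[unfolded bounded_op_def]]])

lemma unital_representation_rep: "unital_representation (C_alg (SG v)) ds.S rep"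
  unfolding unital_representation_def
proof (intro conjI ballI allI)
  fix a assume a: "a \<in> carrier (C_alg (SG v))"
  show "bounded_op ds.S (rep a)" by (rule bounded_op_rep[OF a])
  fix x assume x: "x \<in> carrier ds.S"
  show "rep (c \<odot>\<^bsub>C_alg (SG v)\<^esub> a) x = c \<odot>\<^bsub>ds.S\<^esub> rep a x" for c
    unfolding ds.ops rep_def
  proof (rule restrict_ext)
    fix p assume p: "p \<in> I"
    have "mult_op (circle_measure (lev p)) (\<lambda>t. (c \<odot>\<^bsub>C_alg (SG v)\<^esub> a) (param p t)) (x p)
      = mult_op (circle_measure (lev p)) (\<lambda>t. c * a (param p t)) (x p)"
      using param_in_SG[OF p] by (intro mult_op_cong) (simp add: C_alg_simps)
    also have "\<dots> = c \<odot>\<^bsub>H p\<^esub> mult_op (circle_measure (lev p)) (\<lambda>t. a (param p t)) (x p)"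
      by (rule mult_op_cmult[OF rep_symbol[OF a p] ds.comp_in[OF x p]])
    finally show "mult_op (circle_measure (lev p)) (\<lambda>t. (c \<odot>\<^bsub>C_alg (SG v)\<^esub> a) (param p t)) (x p)
      = c \<odot>\<^bsub>H p\<^esub> (\<lambda>p\<in>I. mult_op (circle_measure (lev p)) (\<lambda>t. a (param p t)) (x p)) p" using p by simp
  qed
  show "ip ds.S (rep a x) y = ip ds.S x (rep (star (C_alg (SG v)) a) y)" if y: "y \<in> carrier ds.S" for y
    unfolding ds.ops
  proof (rule infsum_cong)
    fix p assume p: "p \<in> I"
    have "ip (H p) (rep a x p) (y p) = ip (H p) (x p) (mult_op (circle_measure (lev p)) (\<lambda>t. cnj (a (param p t))) (y p))"
      using mult_op_adjoint[OF rep_symbol[OF a p] ds.comp_in[OF x p] ds.comp_in[OF y p]] p by (simp add: rep_def)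
    also have "mult_op (circle_measure (lev p)) (\<lambda>t. cnj (a (param p t))) (y p) = rep (star (C_alg (SG v)) a) y p"
      using param_in_SG[OF p] p by (simp add: rep_def C_alg_simps)
    finally show "ip (H p) (rep a x p) (y p) = ip (H p) (x p) (rep (star (C_alg (SG v)) a) y p)" .
  qed
  fix b assume b: "b \<in> carrier (C_alg (SG v))"
  show "rep (a \<oplus>\<^bsub>C_alg (SG v)\<^esub> b) x = rep a x \<oplus>\<^bsub>ds.S\<^esub> rep b x"
    unfolding ds.ops rep_def
  proof (rule restrict_ext)
    fix p assume p: "p \<in> I"
    have "mult_op (circle_measure (lev p)) (\<lambda>t. (a \<oplus>\<^bsub>C_alg (SG v)\<^esub> b) (param p t)) (x p)
      = mult_op (circle_measure (lev p)) (\<lambda>t. a (param p t) + b (param p t)) (x p)"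
      using param_in_SG[OF p] by (intro mult_op_cong) (simp add: C_alg_simps)
    also have "\<dots> = mult_op (circle_measure (lev p)) (\<lambda>t. a (param p t)) (x p)
        \<oplus>\<^bsub>H p\<^esub> mult_op (circle_measure (lev p)) (\<lambda>t. b (param p t)) (x p)"
      by (rule mult_op_sum[OF rep_symbol[OF a p] rep_symbol[OF b p] ds.comp_in[OF x p]])
    finally show "mult_op (circle_measure (lev p)) (\<lambda>t. (a \<oplus>\<^bsub>C_alg (SG v)\<^esub> b) (param p t)) (x p)
      = (\<lambda>p\<in>I. mult_op (circle_measure (lev p)) (\<lambda>t. a (param p t)) (x p)) p
        \<oplus>\<^bsub>H p\<^esub> (\<lambda>p\<in>I. mult_op (circle_measure (lev p)) (\<lambda>t. b (param p t)) (x p)) p" using p by simp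
  qed
  show "rep (a \<otimes>\<^bsub>C_alg (SG v)\<^esub> b) x = rep a (rep b x)"
    unfolding rep_def
  proof (rule restrict_ext)
    fix p assume p: "p \<in> I"
    have "mult_op (circle_measure (lev p)) (\<lambda>t. (a \<otimes>\<^bsub>C_alg (SG v)\<^esub> b) (param p t)) (x p)
      = mult_op (circle_measure (lev p)) (\<lambda>t. a (param p t) * b (param p t)) (x p)"
      using param_in_SG[OF p] by (intro mult_op_cong) (simp add: C_alg_simps)
    also have "\<dots> = mult_op (circle_measure (lev p)) (\<lambda>t. a (param p t))
        (mult_op (circle_measure (lev p)) (\<lambda>t. b (param p t)) (x p))"
      by (rule mult_op_product[OF rep_symbol[OF b p] ds.comp_in[OF x p]])
    finally show "mult_op (circle_measure (lev p)) (\<lambda>t. (a \<otimes>\<^bsub>C_alg (SG v)\<^esub> b) (param p t)) (x p)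
      = mult_op (circle_measure (lev p)) (\<lambda>t. a (param p t))
        ((\<lambda>p\<in>I. mult_op (circle_measure (lev p)) (\<lambda>t. b (param p t)) (x p)) p)" using p by simp
  qed
next
  fix x assume x: "x \<in> carrier ds.S"
  have "mult_op (circle_measure (lev p)) (\<lambda>t. \<one>\<^bsub>C_alg (SG v)\<^esub> (param p t)) (x p) = x p" if p: "p \<in> I" for p
  proof -
    have "mult_op (circle_measure (lev p)) (\<lambda>t. \<one>\<^bsub>C_alg (SG v)\<^esub> (param p t)) (x p) = mult_op (circle_measure (lev p)) (\<lambda>t. 1) (x p)"
      using param_in_SG[OF p] by (intro mult_op_cong) (simp add: C_alg_simps)
    thus ?thesis using mult_op_one[OF ds.comp_in[OF x p]] by simp
  qed
  hence "rep \<one>\<^bsub>C_alg (SG v)\<^esub> x p = x p" for p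
    using ds.comp_undefined[OF x, of p] by (cases "p \<in> I") (simp_all add: rep_def)
  thus "rep \<one>\<^bsub>C_alg (SG v)\<^esub> x = x" by (rule ext)
qed

subsection \<open>Commutators with polynomials\<close>

lemma edge_direction_cases:
  "edge_direction w t \<in> {(1 / side) *\<^sub>R (v 3 - v 2), (1 / side) *\<^sub>R (v 1 - v 3), (1 / side) *\<^sub>R (v 2 - v 1)}"
  by (simp add: edge_direction_def Let_def del: One_nat_def)

text \<open>The Leibniz rule is asserted on the whole domain of \<open>dirac\<close>, so that the
  commutator has no smaller domain. \<open>B\<close> consists of multiplications by -i times the
  derivative of \<open>q\<close> along the triangles, which have a common bound.\<close>

lemma polynomial_commutator:
  fixes q :: "real^2 \<Rightarrow> complex"
  assumes q: "polynomial_function q"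
  shows "\<exists>B. bounded_op ds.S B \<and> (\<forall>x\<in>dom dirac. rep (restrict q (SG v)) x \<in> dom dirac \<and>
      the (dirac (rep (restrict q (SG v)) x)) = rep (restrict q (SG v)) (the (dirac x)) \<oplus>\<^bsub>ds.S\<^esub> B x)"
proof -
  obtain Dq where Dq: "\<And>x. (q has_derivative Dq x) (at x)" "\<And>h. continuous_on UNIV (\<lambda>x. Dq x h)"
    using polynomial_function_derivative[OF q] by blast
  have q_cont: "continuous_on A q" for A by (rule continuous_on_polymonial_function[OF q])
  let ?a = "restrict q (SG v)"
  have a: "?a \<in> carrier (C_alg (SG v))" by (rule restrict_in_C_alg[OF q_cont])
  define g where "g = (\<lambda>p t. q (param p t))"
  define g' where "g' = (\<lambda>p t. Dq (param p t) (edge_direction (word p) t))"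
  have g_eq: "(\<lambda>t. ?a (param p t)) = g p" if "p \<in> I" for p
    using param_in_SG[OF that] by (simp add: g_def)
  have "\<exists>C. \<forall>x\<in>SG v. cmod (Dq x h) \<le> C" for h
  proof -
    have "bounded ((\<lambda>x. Dq x h) ` SG v)"
      by (rule compact_imp_bounded[OF compact_continuous_image[OF continuous_on_subset[OF Dq(2)] compact_SG]]) simp
    thus ?thesis by (auto simp: bounded_iff)
  qed
  then obtain c where c: "\<And>h x. x \<in> SG v \<Longrightarrow> cmod (Dq x h) \<le> c h" by metis
  have c0: "0 \<le> c h" for h using c SG_nonempty norm_ge_zero order_trans by (metis ex_in_conv)
  \<comment> \<open>Each of the three directional derivatives of \<open>q\<close> is bounded on the
    compact gasket; the sum of the three bounds serves for all triangles and all parameters.\<close>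
  define C where "C = c ((1 / side) *\<^sub>R (v 3 - v 2)) + c ((1 / side) *\<^sub>R (v 1 - v 3)) + c ((1 / side) *\<^sub>R (v 2 - v 1))"
  have C0: "0 \<le> C" using c0 by (simp add: C_def add_nonneg_nonneg)
  have c_le: "c (edge_direction w t) \<le> C" for w t
  proof -
    have "c d \<le> C" if "d \<in> {(1 / side) *\<^sub>R (v 3 - v 2), (1 / side) *\<^sub>R (v 1 - v 3), (1 / side) *\<^sub>R (v 2 - v 1)}" for d
      using that c0 by (auto simp: C_def add_increasing add_increasing2)
    thus ?thesis using edge_direction_cases .
  qed
  have g'_bd: "cmod (g' p t) \<le> C" if "p \<in> I" for p t
    unfolding g'_def by (rule order_trans[OF c[OF param_in_SG[OF that]] c_le])
  have g_meas: "g p \<in> borel_measurable borel" for p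
    unfolding g_def by (rule measurable_compose[OF triangle_param_measurable borel_measurable_continuous_onI[OF q_cont]])
  have g'_meas: "g' p \<in> borel_measurable borel" for p
  proof -
    have [measurable]: "(\<lambda>t. Dq (param p t) h) \<in> borel_measurable borel" for h
      by (rule measurable_compose[OF triangle_param_measurable borel_measurable_continuous_onI[OF Dq(2)]])
    \<comment> \<open>Written out by cases, the direction is constant in each branch, and each
      branch is a continuous function composed with the parameterization.\<close>
    let ?L = "side / 2 ^ lev p"
    have "g' p = (\<lambda>t. if t rmod (3 * ?L) \<le> ?L then Dq (param p t) ((1 / side) *\<^sub>R (v 3 - v 2))
      else if t rmod (3 * ?L) \<le> 2 * ?L then Dq (param p t) ((1 / side) *\<^sub>R (v 1 - v 3))
      else Dq (param p t) ((1 / side) *\<^sub>R (v 2 - v 1)))"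
      by (simp add: g'_def edge_direction_def Let_def fun_eq_iff)
    thus ?thesis by simp
  qed
  have g_bd: "cmod (g p t) \<le> anorm (C_alg (SG v)) ?a" if "p \<in> I" for p t
    using rep_symbol(2)[OF a that, of t] param_in_SG[OF that] by (simp add: g_def)
  have g_deriv: "(g p has_vector_derivative g' p t) (at t)"
    if "t \<in> {- (pi / 2 ^ lev p)<..<pi / 2 ^ lev p} - {- (side / 2 ^ lev p), 0, side / 2 ^ lev p}" for p t
  proof -
    have "(param p has_derivative (\<lambda>s. s *\<^sub>R edge_direction (word p) t)) (at t)"
      using triangle_param_derivative[OF that] by (simp add: has_vector_derivative_def)
    from has_derivative_compose[OF this Dq(1)]
    have "(g p has_derivative (\<lambda>s. Dq (param p t) (s *\<^sub>R edge_direction (word p) t))) (at t)"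
      by (simp add: g_def)
    moreover have "Dq (param p t) (s *\<^sub>R h) = s *\<^sub>R Dq (param p t) h" for s h
      using has_derivative_linear[OF Dq(1)] by (rule linear_scale)
    ultimately show ?thesis by (simp add: has_vector_derivative_def g'_def)
  qed
  have g_cont: "continuous_on {- (pi / 2 ^ lev p)..pi / 2 ^ lev p} (g p)" for p
    unfolding g_def by (rule continuous_on_compose2[OF q_cont[of UNIV] continuous_triangle_param]) simp
  have g_per: "g p (- (pi / 2 ^ lev p)) = g p (pi / 2 ^ lev p)" for p
    by (simp add: g_def triangle_param_ends)
  have mg': "(\<lambda>t. - \<i> * g' p t) \<in> borel_measurable (circle_measure (lev p))" "\<And>t. cmod (- \<i> * g' p t) \<le> C" if "p \<in> I" for p
    using g'_meas g'_bd[OF that] by (auto simp: norm_mult)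
  define B where "B = (\<lambda>x. \<lambda>p\<in>I. mult_op (circle_measure (lev p)) (\<lambda>t. - \<i> * g' p t) (x p))"
  have B: "bounded_op ds.S B"
    unfolding B_def by (rule ds.bounded_op_componentwise[OF bounded_op_mult_op[OF mg'] hnorm_mult_op[OF mg'] C0])
  have key: "rep ?a x \<in> dom dirac \<and> the (dirac (rep ?a x)) = rep ?a (the (dirac x)) \<oplus>\<^bsub>ds.S\<^esub> B x" if x: "x \<in> dom dirac" for x
  proof -
    have x': "x \<in> carrier ds.S" "\<And>p. p \<in> I \<Longrightarrow> x p \<in> dom (circle_dirac (lev p))"
      "the (dirac x) = (\<lambda>p\<in>I. the (circle_dirac (lev p) (x p)))"
      using x by (auto simp: direct_sum_op_def domIff split: if_splits)
    have y: "rep ?a (the (dirac x)) \<oplus>\<^bsub>ds.S\<^esub> B x \<in> carrier ds.S"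
      using ds.add_in[OF rep_in[OF a dirac.D_in[OF x]]] B x'(1) by (auto simp: bounded_op_def)
    have comm: "rep ?a x p \<in> dom (circle_dirac (lev p)) \<and> the (circle_dirac (lev p) (rep ?a x p)) = (rep ?a (the (dirac x)) \<oplus>\<^bsub>ds.S\<^esub> B x) p"
      if p: "p \<in> I" for p
    proof -
      have r: "rep ?a z p = mult_op (circle_measure (lev p)) (g p) (z p)" for z
        using p by (simp only: rep_def restrict_apply' g_eq)
      have s: "(rep ?a (the (dirac x)) \<oplus>\<^bsub>ds.S\<^esub> B x) p = mult_op (circle_measure (lev p)) (g p) (the (circle_dirac (lev p) (x p)))
          \<oplus>\<^bsub>H p\<^esub> mult_op (circle_measure (lev p)) (\<lambda>t. - \<i> * g' p t) (x p)"
        using p unfolding ds.ops restrict_apply'[OF p] r x'(3) by (simp add: B_def)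
      have fin: "finite {- (side / 2 ^ lev p), 0, side / 2 ^ lev p}" by simp
      show ?thesis unfolding r s
        by (rule conjI; rule circle_dirac_commutator[OF g_cont g_per fin g_deriv g_meas g'_meas g_bd[OF p] g'_bd[OF p] x'(2)[OF p]])
    qed
    have eq: "(\<lambda>p\<in>I. the (circle_dirac (lev p) (rep ?a x p))) = rep ?a (the (dirac x)) \<oplus>\<^bsub>ds.S\<^esub> B x"
    proof (rule ext)
      fix p show "(\<lambda>p\<in>I. the (circle_dirac (lev p) (rep ?a x p))) p = (rep ?a (the (dirac x)) \<oplus>\<^bsub>ds.S\<^esub> B x) p"
        using comm[of p] ds.comp_undefined[OF y, of p] by (cases "p \<in> I") simp_all
    qed
    have "dirac z = Some y" if "z \<in> carrier ds.S" "\<And>p. p \<in> I \<Longrightarrow> z p \<in> dom (circle_dirac (lev p))"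
      "(\<lambda>p\<in>I. the (circle_dirac (lev p) (z p))) = y" "y \<in> carrier ds.S" for y z
      using that by (auto simp: direct_sum_op_def)
    hence "dirac (rep ?a x) = Some (rep ?a (the (dirac x)) \<oplus>\<^bsub>ds.S\<^esub> B x)"
      by this (rule rep_in[OF a x'(1)], erule comm[THEN conjunct1], rule eq, rule y)
    thus ?thesis by (simp add: domI)
  qed
  show ?thesis by (rule exI[of _ B], rule conjI[OF B], rule ballI, rule key)
qed

lemma bounded_commutators_dense:
  "atop (C_alg (SG v)) closure_of {a \<in> carrier (C_alg (SG v)). densely_defined ds.S (commutator_op ds.S dirac (rep a)) \<and>
     extends_to_bounded ds.S (commutator_op ds.S dirac (rep a))} = carrier (C_alg (SG v))"
proof (rule atop_dense[OF compact_SG SG_nonempty])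
  let ?A = "{a \<in> carrier (C_alg (SG v)). densely_defined ds.S (commutator_op ds.S dirac (rep a)) \<and>
     extends_to_bounded ds.S (commutator_op ds.S dirac (rep a))}"
  have poly: "restrict q (SG v) \<in> ?A" if q: "polynomial_function q" for q :: "real^2 \<Rightarrow> complex"
  proof -
    let ?a = "restrict q (SG v)"
    have a: "?a \<in> carrier (C_alg (SG v))" by (rule restrict_in_C_alg[OF continuous_on_polymonial_function[OF q]])
    obtain B where *: "bounded_op ds.S B \<and> (\<forall>x\<in>dom dirac. rep ?a x \<in> dom dirac \<and>
        the (dirac (rep ?a x)) = rep ?a (the (dirac x)) \<oplus>\<^bsub>ds.S\<^esub> B x)"
      using polynomial_commutator[OF q] ..
    note B = conjunct1[OF *] bspec[OF conjunct2[OF *]]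
    have val: "commutator_op ds.S dirac (rep ?a) x = Some (B x)" if x: "x \<in> dom dirac" for x
    proof -
      have "B x \<in> carrier ds.S" using B(1) dirac.dom_in[OF x] by (auto simp: bounded_op_def)
      moreover have "rep ?a (the (dirac x)) \<in> carrier ds.S" by (rule rep_in[OF a dirac.D_in[OF x]])
      ultimately have "(rep ?a (the (dirac x)) \<oplus>\<^bsub>ds.S\<^esub> B x) \<ominus>\<^bsub>ds.S\<^esub> rep ?a (the (dirac x)) = B x"
        using ds.pre.add_minus_cancel[of "B x" "rep ?a (the (dirac x))"] by (simp add: ds.pre.a_comm)
      thus ?thesis using B(2)[OF x] x by (simp add: commutator_op_def)
    qed
    \<comment> \<open>With equality of the domains, the commutator is densely defined because
      \<open>dirac\<close> is.\<close>
    have "dom (commutator_op ds.S dirac (rep ?a)) = dom dirac"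
      using val by (auto simp: commutator_op_def domIff split: if_splits)
    thus ?thesis
      using a dirac.densely_defined_D B(1) val by (auto simp: densely_defined_def extends_to_bounded_def)
  qed
  show "?A \<subseteq> carrier (C_alg (SG v))" by blast
  fix f :: "real^2 \<Rightarrow> complex" and \<epsilon> :: real assume f: "f \<in> carrier (C_alg (SG v))" and \<epsilon>: "\<epsilon> > 0"
  have "continuous_on (SG v) f" using f by (simp add: C_alg_simps)
  from Stone_Weierstrass_polynomial_function[OF compact_SG this \<epsilon>]
  obtain q where q: "polynomial_function q" "\<And>x. x \<in> SG v \<Longrightarrow> norm (f x - q x) < \<epsilon>" by blast
  show "\<exists>g\<in>?A. \<forall>x\<in>SG v. cmod (f x - g x) \<le> \<epsilon>"
  proof (rule bexI[OF _ poly[OF q(1)]], rule ballI)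
    fix x assume x: "x \<in> SG v"
    show "cmod (f x - restrict q (SG v) x) \<le> \<epsilon>" using less_imp_le[OF q(2)[OF x]] x by simp
  qed
qed

subsection \<open>Faithfulness\<close>

lemma rep_faithful:
  assumes a: "a \<in> carrier (C_alg (SG v))" and zero: "\<And>x. x \<in> carrier ds.S \<Longrightarrow> rep a x = \<zero>\<^bsub>ds.S\<^esub>"
  shows "a = \<zero>\<^bsub>C_alg (SG v)\<^esub>"
proof -
  have cont: "continuous_on (SG v) a" using a by (simp add: C_alg_simps)
  have zero_in_triangle: "\<exists>t. a (param p t) = 0" if p: "p \<in> I" for p
  proof -
    \<comment> \<open>The test vector is the constant function 1 on the triangle \<open>p\<close>,
      the exponential with \<open>k = 0\<close>, and zero in the other summands. Its image is
      \<open>a\<close> along the triangle, so \<open>a\<close> vanishes almost everywhere there,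
      hence somewhere, as the measure has mass 1.\<close>
    let ?M = "circle_measure (lev p)" and ?f = "\<lambda>t. a (param p t) * fourier (lev p) 0 t"
    have e: "circle_basis (lev p) 0 \<in> carrier (H p)"
      using orthonormal_basis.e_in[OF orthonormal_basis_circle] by simp
    have "mult_op ?M (\<lambda>t. a (param p t)) (circle_basis (lev p) 0) = rep a (ds.single p (circle_basis (lev p) 0)) p"
      using p by (simp add: rep_def ds.single_def)
    also have "\<dots> = L2_class ?M (\<lambda>t. 0)"
      using p zero[OF ds.single_in[OF p e]] by (simp add: ds.ops L2_zero)
    finally have "L2_class ?M ?f = L2_class ?M (\<lambda>t. 0)"
      unfolding circle_basis_fourier mult_op_class[OF fourier_sq_integrable] .
    moreover have "?f \<in> sq_integrable ?M"
      by (rule sq_integrable_mult[OF fourier_sq_integrable rep_symbol[OF a p]])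
    ultimately have "?f \<in> L2_class ?M (\<lambda>t. 0)" by (auto simp: L2_class_def)
    hence ae: "AE t in ?M. a (param p t) = 0" by (simp add: L2_class_def)
    show ?thesis
    proof (rule ccontr)
      assume "\<not> ?thesis"
      hence "AE t in ?M. False" using ae by simp
      thus False using prob_space_circle[of "lev p"] by (simp add: eventually_False ae_filter_eq_bot_iff)
    qed
  qed
  have "a x = 0" if x: "x \<in> SG v" for x
  proof (rule ccontr)
    assume "a x \<noteq> 0"
    then obtain \<delta> where \<delta>: "\<delta> > 0" "\<And>y. \<lbrakk>y \<in> SG v; dist y x < \<delta>\<rbrakk> \<Longrightarrow> dist (a y) (a x) < cmod (a x)"
      using cont x unfolding continuous_on_iff by (metis zero_less_norm_iff)
    \<comment> \<open>Both \<open>x\<close> and the zero found on the triangle of \<open>w\<close>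
      lie within side / 2^n of the corner, so their distance will be below
      \<open>\<delta>\<close>.\<close>
    obtain n where n: "2 * side / \<delta> < 2 ^ n" using real_arch_pow[of 2 "2 * side / \<delta>"] by auto
    obtain w where w: "w \<in> words n" "x \<in> cball (corner w) (side / 2 ^ n)" using SG_subset_balls x by blast
    obtain p where p: "p \<in> I" "word p = w" using word_surj[OF w(1)] by blast
    obtain t where t: "a (param p t) = 0" using zero_in_triangle[OF p(1)] by blast
    obtain y where y: "y \<in> SG0 v" "param p t = word_map v w y"
      using triangle_param_in[of w t] p by (auto simp: triangle_def)
    have "dist (corner w) (param p t) \<le> side / 2 ^ n"
      using dist_word_map[of v w "v 1" y] SG0_in_ball y w(1)
      by (auto simp: corner_def words_def divide_right_mono simp del: One_nat_def)
    hence "dist (param p t) x \<le> side / 2 ^ n + side / 2 ^ n"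
      using w(2) dist_triangle3[of "param p t" x "corner w"] unfolding mem_cball by linarith
    also have "\<dots> < \<delta>" using n \<delta>(1) by (simp add: field_simps)
    finally have "dist (a (param p t)) (a x) < cmod (a x)" by (rule \<delta>(2)[OF param_in_SG[OF p(1)]])
    thus False using t by simp
  qed
  thus ?thesis by (intro C_alg_ext[OF a]) (auto simp: C_alg_simps intro!: continuous_intros)
qed

subsection \<open>Summability\<close>

text \<open>The shift by 1/2 keeps |k + 1/2| at or above 1/2, so eigenvalues of level
  \<open>n\<close> are at least 2^n / 2 in absolute value, and a bound on them bounds
  \<open>n\<close>. Without the shift every triangle would contribute the eigenvalue 0, and the
  resolvent would not be compact.\<close>

lemma finite_dirac_eigenvalues:
  "finite {q \<in> Sigma I (\<lambda>p. UNIV). \<bar>case q of (p, k) \<Rightarrow> 2 ^ lev p * (real_of_int k + 1 / 2)\<bar> \<le> R}"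
proof -
  obtain N where N: "2 * R < 2 ^ N" using real_arch_pow[of 2 "2 * R"] by auto
  have "{q \<in> Sigma I (\<lambda>p. UNIV). \<bar>case q of (p, k) \<Rightarrow> 2 ^ lev p * (real_of_int k + 1 / 2)\<bar> \<le> R}
    \<subseteq> (SIGMA n:{..N}. {1..3 ^ n}) \<times> {- \<lceil>R + 1\<rceil>..\<lceil>R + 1\<rceil>}"
  proof
    fix q assume q: "q \<in> {q \<in> Sigma I (\<lambda>p. UNIV). \<bar>case q of (p, k) \<Rightarrow> 2 ^ lev p * (real_of_int k + 1 / 2)\<bar> \<le> R}"
    obtain p k where pk: "q = (p, k)" by (cases q)
    have p: "p \<in> I" and le: "2 ^ fst p * \<bar>real_of_int k + 1 / 2\<bar> \<le> R"
      using q lev_eq[of p] by (simp_all add: pk abs_mult)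
    have "1 / 2 \<le> \<bar>real_of_int k + 1 / 2\<bar>"
    proof (cases "k \<ge> 0")
      case False
      hence "real_of_int k \<le> -1" by linarith
      thus ?thesis by linarith
    qed simp
    hence "2 ^ fst p * (1 / 2) \<le> 2 ^ fst p * \<bar>real_of_int k + 1 / 2\<bar>" by (rule mult_left_mono) simp
    hence "(2::real) ^ fst p < 2 ^ N" using le N by linarith
    hence n: "fst p < N" by (simp add: power_strict_increasing_iff)
    have "1 * \<bar>real_of_int k + 1 / 2\<bar> \<le> 2 ^ fst p * \<bar>real_of_int k + 1 / 2\<bar>" by (rule mult_right_mono) simp_all
    hence "\<bar>real_of_int k + 1 / 2\<bar> \<le> R" using le unfolding mult_1 by (rule order_trans)
    hence "- \<lceil>R + 1\<rceil> \<le> k" "k \<le> \<lceil>R + 1\<rceil>" by linarith+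
    thus "q \<in> (SIGMA n:{..N}. {1..3 ^ n}) \<times> {- \<lceil>R + 1\<rceil>..\<lceil>R + 1\<rceil>}"
      using n p by (auto simp: pk I_def)
  qed
  thus ?thesis by (rule finite_subset) (intro finite_cartesian_product finite_SigmaI; simp)
qed

lemma nonneg_summable_on_I_iff:
  fixes f :: "nat \<Rightarrow> real"
  assumes "\<And>n. f n \<ge> 0"
  shows "(\<lambda>p. f (fst p)) summable_on I \<longleftrightarrow> summable (\<lambda>n. 3 ^ n * f n)"
proof -
  have "(\<lambda>p. f (fst p)) summable_on I \<longleftrightarrow> (\<lambda>p. norm (f (fst p))) summable_on I"
    using assms by simp
  also have "\<dots> \<longleftrightarrow> (\<forall>n\<in>UNIV. (\<lambda>i. norm (f (fst (n, i)))) summable_on {1..3 ^ n :: nat}) \<and>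
      (\<lambda>n. norm (\<Sum>\<^sub>\<infinity>i\<in>{1..3 ^ n :: nat}. norm (f (fst (n, i))))) summable_on UNIV"
    unfolding I_def by (rule Infinite_Sum.abs_summable_on_Sigma_iff)
  also have "\<dots> \<longleftrightarrow> (\<lambda>n. 3 ^ n * f n) summable_on UNIV"
    using assms by simp
  also have "\<dots> \<longleftrightarrow> summable (\<lambda>n. 3 ^ n * f n)"
    by (rule summable_on_UNIV_nonneg_real_iff) (use assms in simp)
  finally show ?thesis .
qed

text \<open>For necessity the eigenvalues with \<open>k = 0\<close> suffice: their terms, 3^n on
  each level, do not tend to 0 if 2^s \<le> 3. For sufficiency the summand 1 in 1 + \<mu>^2 is
  dropped; the majorant then factors into (2^(-s))^n and |k + 1/2|^(-s), and both sums can be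
  treated separately.\<close>

lemma dirac_summable_iff:
  assumes s: "s > 0"
  shows "(\<lambda>q. (1 + (case q of (p, k) \<Rightarrow> 2 ^ lev p * (real_of_int k + 1 / 2))\<^sup>2) powr (- s / 2)) summable_on Sigma I (\<lambda>p. UNIV)
    \<longleftrightarrow> s > ln 3 / ln 2" (is "?f summable_on ?Q \<longleftrightarrow> _")
proof
  assume "?f summable_on ?Q"
  hence "?f summable_on (\<lambda>p. (p, 0)) ` I" by (rule summable_on_subset_banach) auto
  hence "(?f \<circ> (\<lambda>p. (p, 0))) summable_on I" by (subst (asm) summable_on_reindex) (auto simp: inj_on_def)
  hence "(\<lambda>p. (1 + (2 ^ fst p / 2)\<^sup>2) powr (- s / 2)) summable_on I"
    by (rule summable_on_cong[THEN iffD1, rotated]) (simp add: lev_eq)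
  hence "summable (\<lambda>n. 3 ^ n * (1 + (2 ^ n / 2)\<^sup>2) powr (- s / 2))"
    by (subst (asm) nonneg_summable_on_I_iff) auto
  hence lim: "(\<lambda>n. 3 ^ n * (1 + (2 ^ n / 2)\<^sup>2) powr (- s / 2) :: real) \<longlonglongrightarrow> 0" by (rule summable_LIMSEQ_zero)
  \<comment> \<open>The comparison 1 + 4^n / 4 \<le> 2 * 4^n produces the factor 2^(-s/2); what is
    left is (3 / 2^s)^n, which is at least 1, also at the critical exponent.\<close>
  have lower: "2 powr (- s / 2) \<le> 3 ^ n * (1 + (2 ^ n / 2)\<^sup>2) powr (- s / 2)" if le: "s \<le> ln 3 / ln 2" for n
  proof -
    have "s * ln 2 \<le> ln 3" using le by (simp add: field_simps)
    hence "exp (s * ln 2) \<le> exp (ln 3)" by (simp only: exp_le_cancel_iff)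
    hence "2 powr s \<le> 3" by (simp add: powr_def)
    hence "(2 powr s) ^ n \<le> 3 ^ n" by (rule power_mono) simp
    hence "1 \<le> 3 ^ n * inverse ((2 powr s) ^ n)" by (simp add: field_simps)
    also have "inverse ((2 powr s) ^ n) = (2 powr (2 * real n)) powr (- s / 2)"
    proof -
      have "(2 powr s) ^ n = 2 powr (s * real n)" by (simp add: powr_powr flip: powr_realpow)
      thus ?thesis by (simp add: powr_powr mult.commute flip: powr_minus)
    qed
    also have "2 powr (2 * real n) = (2 ^ n)\<^sup>2"
      using powr_realpow[of 2 "2 * n"] by (simp add: power_even_eq)
    finally have "1 \<le> 3 ^ n * ((2 ^ n)\<^sup>2) powr (- s / 2)" .
    hence "2 powr (- s / 2) * 1 \<le> 2 powr (- s / 2) * (3 ^ n * ((2 ^ n)\<^sup>2) powr (- s / 2))"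
      by (rule mult_left_mono) simp
    also have "\<dots> = 3 ^ n * (2 * (2 ^ n)\<^sup>2) powr (- s / 2)" by (simp add: powr_mult)
    also have "\<dots> \<le> 3 ^ n * (1 + (2 ^ n / 2)\<^sup>2) powr (- s / 2)"
    proof -
      have "(1::real) \<le> (2 ^ n)\<^sup>2" by simp
      moreover have "((2::real) ^ n / 2)\<^sup>2 = (2 ^ n)\<^sup>2 / 4" by (simp add: power_divide)
      ultimately have "1 + (2 ^ n / 2)\<^sup>2 \<le> 2 * ((2::real) ^ n)\<^sup>2" by linarith
      moreover have "0 < 1 + ((2::real) ^ n / 2)\<^sup>2" by (simp add: add_pos_nonneg)
      ultimately show ?thesis using s by (intro mult_left_mono powr_mono2') auto
    qed
    finally show ?thesis by simp
  qed
  show "s > ln 3 / ln 2"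
  proof (rule ccontr)
    assume "\<not> s > ln 3 / ln 2"
    hence "2 powr (- s / 2) \<le> (0::real)" by (intro LIMSEQ_le_const[OF lim] exI[of _ 0] allI impI lower) simp
    thus False by simp
  qed
next
  assume gt: "s > ln 3 / ln 2"
  have "(1::real) \<le> ln 3 / ln 2" by simp
  hence s1: "s > 1" using gt by linarith
  have half: "(\<lambda>n. (real n + 1 / 2) powr (- s)) summable_on UNIV"
  proof -
    have "summable (\<lambda>n. real (Suc n) powr (- s))"
      using s1 by (subst summable_Suc_iff) (simp add: summable_real_powr_iff)
    hence "summable (\<lambda>n. 2 powr s * real (Suc n) powr (- s))" by (rule summable_mult)
    hence "summable (\<lambda>n. (real n + 1 / 2) powr (- s))"
    proof (rule summable_comparison_test'[of _ 0])
      fix n :: nat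
      \<comment> \<open>n + 1/2 \<ge> (n + 1)/2 gives comparison with the series of the (n +
        1)^(-s), which converges for s > 1.\<close>
      have "(real n + 1 / 2) powr (- s) \<le> (real (Suc n) / 2) powr (- s)"
        using s by (intro powr_mono2') auto
      also have "\<dots> = 2 powr s * real (Suc n) powr (- s)"
        by (simp add: powr_divide powr_minus field_simps)
      finally show "norm ((real n + 1 / 2) powr (- s)) \<le> 2 powr s * real (Suc n) powr (- s)" by simp
    qed
    thus ?thesis by (subst summable_on_UNIV_nonneg_real_iff) auto
  qed
  \<comment> \<open>The reflection taking k to -1 - k preserves |k + 1/2|, so the nonnegative and
    the negative integers give the same series over \<open>nat\<close>.\<close>
  have "(\<lambda>k. \<bar>real_of_int k + 1 / 2\<bar> powr (- s)) summable_on (range int \<union> range (\<lambda>n. - 1 - int n))"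
  proof (rule summable_on_Un_disjoint)
    have "((\<lambda>k. \<bar>real_of_int k + 1 / 2\<bar> powr (- s)) \<circ> int) summable_on UNIV"
      by (rule summable_on_cong[THEN iffD1, OF _ half]) simp
    thus "(\<lambda>k. \<bar>real_of_int k + 1 / 2\<bar> powr (- s)) summable_on range int"
      by (subst summable_on_reindex) auto
    have "((\<lambda>k. \<bar>real_of_int k + 1 / 2\<bar> powr (- s)) \<circ> (\<lambda>n. - 1 - int n)) summable_on UNIV"
    proof (rule summable_on_cong[THEN iffD1, OF _ half])
      fix n :: nat
      have "\<bar>real_of_int (- 1 - int n) + 1 / 2\<bar> = real n + 1 / 2" by simp
      thus "(real n + 1 / 2) powr (- s) = ((\<lambda>k. \<bar>real_of_int k + 1 / 2\<bar> powr (- s)) \<circ> (\<lambda>n. - 1 - int n)) n"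
        by (simp only: comp_def)
    qed
    thus "(\<lambda>k. \<bar>real_of_int k + 1 / 2\<bar> powr (- s)) summable_on range (\<lambda>n. - 1 - int n)"
      by (subst summable_on_reindex) (auto simp: inj_on_def)
  qed auto
  also have "range int \<union> range (\<lambda>n. - 1 - int n) = UNIV"
  proof -
    have "k \<in> range int \<union> range (\<lambda>n. - 1 - int n)" for k
      using image_eqI[of k int "nat k"] image_eqI[of k "\<lambda>n. - 1 - int n" "nat (- 1 - k)"] by (cases "k \<ge> 0") auto
    thus ?thesis by blast
  qed
  finally have g: "(\<lambda>k. norm (\<bar>real_of_int k + 1 / 2\<bar> powr (- s))) summable_on UNIV" by simp
  have "summable (\<lambda>n. (3 * 2 powr (- s)) ^ n)"
  proof (rule summable_geometric)
    have "ln 3 < s * ln 2" using gt by (simp add: field_simps)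
    hence "exp (ln 3) < exp (s * ln 2)" by (rule exp_less_mono)
    thus "norm (3 * 2 powr (- s)) < 1" by (simp add: powr_def exp_minus field_simps)
  qed
  hence "summable (\<lambda>n. 3 ^ n * (2 powr (- s)) ^ n)" by (simp add: power_mult_distrib)
  hence "(\<lambda>p. norm ((2 powr (- s)) ^ fst p)) summable_on I"
    using nonneg_summable_on_I_iff[of "\<lambda>n. norm ((2 powr (- s)) ^ n)"] by (simp add: norm_power)
  note f = this
  have "(\<lambda>q. norm ((\<lambda>(p, k). (2 powr (- s)) ^ fst p * \<bar>real_of_int k + 1 / 2\<bar> powr (- s)) q)) summable_on ?Q"
  proof (rule Infinite_Sum.abs_summable_on_Sigma_iff[THEN iffD2], intro conjI ballI)
    show "(\<lambda>k. norm ((\<lambda>(p, k). (2 powr (- s)) ^ fst p * \<bar>real_of_int k + 1 / 2\<bar> powr (- s)) (p, k))) summable_on UNIV" for p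
      using summable_on_cmult_right[OF g, of "norm ((2 powr (- s)) ^ fst p)"] by (simp add: norm_mult)
    show "(\<lambda>p. norm (\<Sum>\<^sub>\<infinity>k. norm ((\<lambda>(p, k). (2 powr (- s)) ^ fst p * \<bar>real_of_int k + 1 / 2\<bar> powr (- s)) (p, k)))) summable_on I"
      using summable_on_cmult_left[OF f, of "norm (\<Sum>\<^sub>\<infinity>k. \<bar>real_of_int k + 1 / 2\<bar> powr (- s))"]
      by (simp add: norm_mult abs_mult infsum_cmult_right')
  qed
  thus "?f summable_on ?Q"
  proof (rule summable_on_comparison_test)
    fix q assume "q \<in> ?Q"
    then obtain p k where pk: "q = (p, k)" "p \<in> I" by auto
    let ?m = "2 ^ fst p * \<bar>real_of_int k + 1 / 2\<bar>"
    have m: "?m > 0"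
    proof -
      have "real_of_int (2 * k + 1) \<noteq> 0" unfolding of_int_eq_0_iff by presburger
      hence "real_of_int k + 1 / 2 \<noteq> 0" by (simp add: field_simps)
      thus ?thesis by simp
    qed
    have "(1 + ?m\<^sup>2) powr (- s / 2) \<le> (?m\<^sup>2) powr (- s / 2)"
      using s m by (intro powr_mono2') auto
    also have "(?m\<^sup>2) powr (- s / 2) = ?m powr (- s)"
    proof -
      have "?m\<^sup>2 = ?m powr 2" using m by (simp add: powr_numeral)
      thus ?thesis by (simp only: powr_powr) simp
    qed
    also have "\<dots> = (2 powr (- s)) ^ fst p * \<bar>real_of_int k + 1 / 2\<bar> powr (- s)"
    proof -
      have "((2::real) ^ fst p) powr (- s) = (2 powr (- s)) ^ fst p"
        by (simp add: powr_powr mult.commute flip: powr_realpow)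
      thus ?thesis by (simp add: powr_mult)
    qed
    finally have "(1 + ?m\<^sup>2) powr (- s / 2) \<le> (2 powr (- s)) ^ fst p * \<bar>real_of_int k + 1 / 2\<bar> powr (- s)" .
    thus "?f q \<le> norm ((\<lambda>(p, k). (2 powr (- s)) ^ fst p * \<bar>real_of_int k + 1 / 2\<bar> powr (- s)) q)"
      using lev_eq[OF pk(2)] by (simp add: pk(1) power_mult_distrib)
  qed auto
qed

lemma summable_module_iff:
  assumes "s > 0"
  shows "summable_module (ST_SG v \<nu>) s \<longleftrightarrow> s > ln 3 / ln 2"
  unfolding summable_module_def ST_SG_simps dirac.trace_power_resolvent_finite_iff[OF assms]
  by (rule dirac_summable_iff[OF assms])

lemma spectral_triple_ST_SG: "spectral_triple (C_alg (SG v)) (ST_SG v \<nu>)"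
  unfolding spectral_triple_def unbounded_fredholm_module_def Let_def ST_SG_simps
proof (intro conjI ballI impI)
  show "unital_cstar_algebra (C_alg (SG v))" by (rule unital_cstar_algebra_C_alg[OF compact_SG SG_nonempty])
  show "hilbert_space ds.S" by (rule ds.hilbert_space_S)
  show "unital_representation (C_alg (SG v)) ds.S rep" by (rule unital_representation_rep)
  show "self_adjoint ds.S dirac" by (rule dirac.self_adjoint_D)
  show "compact_op ds.S (resolvent_op ds.S dirac)" by (rule dirac.compact_resolvent[OF finite_dirac_eigenvalues])
qed (use bounded_commutators_dense rep_faithful in blast)+

lemma metric_dimension_ST_SG: "metric_dimension (ST_SG v \<nu>) = ereal (ln 3 / ln 2)"
proof -
  have "{s. s > 0 \<and> summable_module (ST_SG v \<nu>) s} = {s. s > 0 \<and> s > ln 3 / ln 2}"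
    using summable_module_iff by blast
  thus ?thesis using INF_ereal_greaterThan[of "ln 3 / ln 2"] by (simp add: metric_dimension_def)
qed

end

theorem theorem8p2:
  fixes v :: "nat \<Rightarrow> real^2" and \<nu> :: "nat \<Rightarrow> nat \<Rightarrow> nat list"
  assumes "gasket_vertices v" and "triangle_numbering \<nu>"
  shows "spectral_triple (C_alg (SG v)) (ST_SG v \<nu>) \<and>
    (\<forall>s>0. summable_module (ST_SG v \<nu>) s \<longleftrightarrow> s > ln 3 / ln 2) \<and>
    metric_dimension (ST_SG v \<nu>) = ereal (ln 3 / ln 2) \<and>
    has_minkowski_dimension (SG v) (ln 3 / ln 2) \<and>
    hausdorff_dimension (SG v) = ereal (ln 3 / ln 2)"
proof -
  interpret gasket_triple v \<nu> using assms by unfold_locales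
  show ?thesis
    using spectral_triple_ST_SG summable_module_iff metric_dimension_ST_SG
      minkowski_dimension_SG hausdorff_dimension_SG by blast
qed

end
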